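(* Let $0\le\varrho\le1$, $a(x,\xi)\in L^\infty S^m_\varrho$ on $\mathbf{R}^n\times\mathbf{R}^n$, and let the phase $\varphi(x,\xi)\in\Phi^2$ be strongly non-degenerate. Then the Fourier integral operator $$T_{a,\varphi}u(x)=\frac1{(2\pi)^n}\int a(x,\xi)e^{i\varphi(x,\xi)}\widehat u(\xi)\,d\xi$$ is a bounded operator from $L^2(\mathbf{R}^n)$ to itself provided $m<\frac n2(\varrho-1)$. The bound on $m$ is sharp: for every $\varrho\in[0,1]$ there exist $a\in L^\infty S^{\frac n2(\varrho-1)}_\varrho$ and a strongly non-degenerate $\varphi\in\Phi^2$ such that $T_{a,\varphi}$ is not bounded on $L^2$.
   Context: Notation: $\langle\xi\rangle=(1+|\xi|^2)^{1/2}$; $\widehat u(\xi)=\int e^{-i\langle x,\xi\rangle}u(x)\,dx$. Bounded on $L^2$ means $\|T_{a,\varphi}u\|_{L^2}\le C\|u\|_{L^2}$ for all $u\in\mathscr{S}(\mathbf{R}^n)$. Class $L^\infty S^m_\varrho$: functions $a(x,\xi)$, smooth in $\xi$ and bounded measurable in $x$, such that for every multi-index $\alpha$, $\sup_{\xi}\langle\xi\rangle^{-m+\varrho|\alpha|}\|\partial_\xi^\alpha a(\cdot,\xi)\|_{L^\infty(\mathbf{R}^n)}<\infty$. Class $\Phi^k$: real-valued $\varphi\in C^\infty(\mathbf{R}^n\times(\mathbf{R}^n\setminus0))$, positively homogeneous of degree $1$ in $\xi$, such that for all multi-indices with $|\alpha|+|\beta|\ge k$, $\sup_{x\in\mathbf{R}^n,\,\xi\ne0}|\xi|^{-1+|\alpha|}|\partial_\xi^\alpha\partial_x^\beta\varphi(x,\xi)|<\infty$.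 Strong non-degeneracy: there is $c>0$ with $|\det(\partial^2\varphi(x,\xi)/\partial x_j\partial\xi_k)|\ge c$ for all $x\in\mathbf{R}^n$, $\xi\in\mathbf{R}^n\setminus0$. *)

theory Defs
  imports "HOL-Analysis.Analysis" "HOL-Probability.Essential_Supremum"
begin

section \<open>Smooth functions and multi-index derivatives\<close>

text \<open>Meant for open \<open>S\<close>. The index set \<open>Basis\<close> also covers product spaces, where it consists of
  the coordinate directions of both factors.\<close>

primrec Ck_on :: "nat \<Rightarrow> 'a::euclidean_space set \<Rightarrow> ('a \<Rightarrow> 'b::real_normed_vector) \<Rightarrow> bool" where
  "Ck_on 0 S f \<longleftrightarrow> continuous_on S f"
| "Ck_on (Suc k) S f \<longleftrightarrow>
     (\<forall>x\<in>S. f differentiable (at x)) \<and>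
     (\<forall>b\<in>Basis. Ck_on k S (\<lambda>x. frechet_derivative f (at x) b))"

definition smooth_on :: "'a::euclidean_space set \<Rightarrow> ('a \<Rightarrow> 'b::real_normed_vector) \<Rightarrow> bool" where
  "smooth_on S f \<longleftrightarrow> (\<forall>k. Ck_on k S f)"

definition pderiv_at :: "'n::finite \<Rightarrow> (real^'n \<Rightarrow> 'b::real_normed_vector) \<Rightarrow> real^'n \<Rightarrow> 'b" where
  "pderiv_at i f x = frechet_derivative f (at x) (axis i 1)"

type_synonym 'n multi_index = "'n \<Rightarrow> nat"

definition mi_order :: "'n::finite multi_index \<Rightarrow> nat" where
  "mi_order \<alpha> = (\<Sum>i\<in>UNIV. \<alpha> i)"

text \<open>The index type carries no order, so some enumeration of the coordinates is fixed in which the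
  partial derivatives are taken; for smooth functions the choice does not matter.\<close>

definition coords :: "'n::finite list" where
  "coords = map (from_nat_into UNIV) [0..<CARD('n)]"

lemma set_coords: "set (coords :: 'n::finite list) = UNIV"
  and distinct_coords: "distinct (coords :: 'n::finite list)"
proof -
  have bij: "bij_betw (from_nat_into (UNIV :: 'n set)) {..<CARD('n)} UNIV"
    by (rule bij_betw_from_nat_into_finite) simp
  then show "set (coords :: 'n list) = UNIV"
    by (simp add: coords_def bij_betw_def atLeast0LessThan)
  from bij show "distinct (coords :: 'n list)"
    by (simp add: coords_def distinct_map bij_betw_def atLeast0LessThan)
qed

definition mderiv ::
    "'n::finite multi_index \<Rightarrow> (real^'n \<Rightarrow> 'b::real_normed_vector) \<Rightarrow> real^'n \<Rightarrow> 'b" where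
  "mderiv \<alpha> f = foldr (\<lambda>i g. (pderiv_at i ^^ \<alpha> i) g) coords f"

definition mpower :: "real^'n \<Rightarrow> 'n::finite multi_index \<Rightarrow> real" where
  "mpower x \<alpha> = (\<Prod>i\<in>UNIV. (x $ i) ^ \<alpha> i)"


section \<open>Symbols and phases\<close>

definition jbracket :: "real^'n \<Rightarrow> real" where
  "jbracket \<xi> = sqrt (1 + (norm \<xi>)\<^sup>2)"

definition Linf_symbol :: "real \<Rightarrow> real \<Rightarrow> (real^'n \<Rightarrow> real^'n \<Rightarrow> complex) set" where
  "Linf_symbol m \<rho> = {a.
     (\<forall>x. smooth_on UNIV (a x)) \<and>
     (\<forall>\<xi>. (\<lambda>x. a x \<xi>) \<in> borel_measurable lebesgue) \<and>
     (\<forall>\<alpha>. (SUP \<xi>. ereal (jbracket \<xi> powr (- m + \<rho> * real (mi_order \<alpha>))) *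
                esssup lebesgue (\<lambda>x. ereal (norm (mderiv \<alpha> (a x) \<xi>)))) < \<infinity>)}"

text \<open>Phases are total functions, but nothing is required of their values at frequency \<open>0\<close>.\<close>

definition phase_class :: "nat \<Rightarrow> (real^'n \<Rightarrow> real^'n \<Rightarrow> real) set" where
  "phase_class k = {\<phi>.
     smooth_on (UNIV \<times> - {0}) (\<lambda>(x, \<xi>). \<phi> x \<xi>) \<and>
     (\<forall>x \<xi> t. \<xi> \<noteq> 0 \<and> t > 0 \<longrightarrow> \<phi> x (t *\<^sub>R \<xi>) = t * \<phi> x \<xi>) \<and>
     (\<forall>\<alpha> \<beta>. mi_order \<alpha> + mi_order \<beta> \<ge> k \<longrightarrow>
        bdd_above ((\<lambda>(x, \<xi>). norm \<xi> powr (- 1 + real (mi_order \<alpha>)) *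
                      \<bar>mderiv \<alpha> (\<lambda>\<eta>. mderiv \<beta> (\<lambda>y. \<phi> y \<eta>) x) \<xi>\<bar>) ` (UNIV \<times> - {0})))}"

definition mixed_hessian :: "(real^'n \<Rightarrow> real^'n \<Rightarrow> real) \<Rightarrow> real^'n \<Rightarrow> real^'n \<Rightarrow> real^'n^'n" where
  "mixed_hessian \<phi> x \<xi> = (\<chi> j k. pderiv_at j (\<lambda>y. pderiv_at k (\<phi> y) \<xi>) x)"

definition strongly_nondegenerate :: "(real^'n \<Rightarrow> real^'n \<Rightarrow> real) \<Rightarrow> bool" where
  "strongly_nondegenerate \<phi> \<longleftrightarrow>
     (\<exists>c>0. \<forall>x \<xi>. \<xi> \<noteq> 0 \<longrightarrow> \<bar>det (mixed_hessian \<phi> x \<xi>)\<bar> \<ge> c)"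


section \<open>Fourier integral operators and boundedness on $L^2$\<close>

definition schwartz :: "(real^'n \<Rightarrow> complex) set" where
  "schwartz = {u. smooth_on UNIV u \<and>
     (\<forall>\<alpha> \<beta>. bdd_above (range (\<lambda>x. \<bar>mpower x \<alpha>\<bar> * norm (mderiv \<beta> u x))))}"

definition fourier_transform :: "(real^'n \<Rightarrow> complex) \<Rightarrow> real^'n \<Rightarrow> complex" where
  "fourier_transform u \<xi> = (LINT x|lebesgue. exp (- \<i> * complex_of_real (x \<bullet> \<xi>)) * u x)"

definition FIO :: "(real^'n \<Rightarrow> real^'n \<Rightarrow> complex) \<Rightarrow> (real^'n \<Rightarrow> real^'n \<Rightarrow> real)
    \<Rightarrow> (real^'n \<Rightarrow> complex) \<Rightarrow> real^'n \<Rightarrow> complex" where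
  "FIO a \<phi> u x = complex_of_real (1 / (2 * pi) ^ CARD('n)) *
     (LINT \<xi>|lebesgue. a x \<xi> * exp (\<i> * complex_of_real (\<phi> x \<xi>)) * fourier_transform u \<xi>)"

definition in_L2 :: "(real^'n \<Rightarrow> complex) \<Rightarrow> bool" where
  "in_L2 f \<longleftrightarrow> f \<in> borel_measurable lebesgue \<and> integrable lebesgue (\<lambda>x. (norm (f x))\<^sup>2)"

definition L2_norm :: "(real^'n \<Rightarrow> complex) \<Rightarrow> real" where
  "L2_norm f = sqrt (LINT x|lebesgue. (norm (f x))\<^sup>2)"

text \<open>Membership in $L^2$ has to be required explicitly: the Bochner integral of a non-integrable
  function is \<open>0\<close>, so the inequality alone would hold trivially when \<open>T u\<close> is not
  square-integrable.\<close>

definition L2_bounded :: "((real^'n \<Rightarrow> complex) \<Rightarrow> real^'n \<Rightarrow> complex) \<Rightarrow> bool" where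
  "L2_bounded T \<longleftrightarrow> (\<exists>C. \<forall>u\<in>schwartz. in_L2 (T u) \<and> L2_norm (T u) \<le> C * L2_norm u)"

end

theory Submission
  imports Defs "HOL-Probability.Probability"
begin

text \<open>
  Upper bound: the frequency space is cut into dyadic shells, and each shell of radius \<open>R\<close> into small
  cubes. On one piece, non-stationary phase bounds the kernel of \<open>T T*\<close> by a multiple of
  \<open>R^(2m + n) (1 + R^\<rho> |x - y|)^(-2n)\<close>, because the map from \<open>x\<close> to the frequency gradient of the phase
  expands distances: strong non-degeneracy gives this locally, and a covering argument globally.
  Schur's test then bounds the squared norm of the piece by a multiple of \<open>R^(2m + n - n\<rho>)\<close>, which
  decays geometrically along the shells. Close to frequency zero the phase is replaced by its
  linearization.

  Sharpness: take the phase \<open>x \<bullet> \<xi>\<close> and, around each point \<open>p\<close> of a lattice of spacing \<open>R^\<rho>\<close> in the shell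
  of radius \<open>R = 4^j\<close>, let the symbol be \<open>R^m exp(-i x \<bullet> p)\<close> times a bump of width \<open>R^\<rho>\<close>. The waves
  \<open>R^m exp(i x \<bullet> p)\<close>, multiplied by a very wide Gaussian, are nearly orthogonal, but the operator
  removes their oscillation and lets them add up coherently. So boundedness would bound the sum of
  \<open>R^(2m)\<close> over all lattice points, whereas each shell contributes a fixed positive amount.
\<close>

section \<open>Global expansion from local expansion\<close>

text \<open>The symbol is merely measurable in x, so nothing can be integrated by parts in x; the
  kernel of T T* is an integral over \<xi>, where the symbol is smooth. Phases have no bound on
  their first derivatives, so only differences in x of the frequency gradient are controlled, and
  they must be bounded below for all pairs x, y, not just for close ones. One partial derivative of
  the phase difference has to stay large on a whole piece; this forces the cubes, whose number per
  shell does not depend on R by homogeneity. The decay exponent 2n makes the kernel comparable with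
  a product of n integrable weights of one variable. For small R the same estimate gives a bound
  without decay, so the shells would not sum; after subtracting the symbol frozen at frequency zero
  with the linearized phase, a remainder of size R is left, and the subtracted part is treated on
  all low shells at once. At the critical order a shell has about R^(n - n\<rho>) lattice points,
  each of weight R^(2m) = R^(n\<rho> - n): this is the fixed amount contributed by every
  shell.\<close>

lemma uniformly_local_expansion_ball_image:
  fixes F :: "'a::euclidean_space \<Rightarrow> 'a"
  assumes cont: "continuous_on UNIV F" and c: "c > 0"
    and loc: "\<And>x y. dist x y \<le> r \<Longrightarrow> c * dist x y \<le> dist (F x) (F y)"
    and s: "0 < s" "2 * s \<le> r"
  shows "ball (F x) (c * s) \<subseteq> F ` ball x s"
proof -
  let ?B = "ball (F x) (c * s)"
  let ?S = "?B \<inter> F ` ball x s"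
  have inj: "inj_on F (cball x s)"
  proof (rule inj_onI)
    fix u v assume uv: "u \<in> cball x s" "v \<in> cball x s" "F u = F v"
    have "dist u v \<le> r"
      using dist_triangle2[of u v x] uv s by (simp add: dist_commute)
    from loc[OF this] uv c show "u = v" by (simp add: mult_le_0_iff)
  qed
  \<comment> \<open>The covered part of the target ball is shown to be open and closed in that
    connected ball. Openness is invariance of domain, available because two points of the closed
    ball of radius s are within r of each other, where F is injective.\<close>
  have "open (F ` ball x s)"
    by (rule invariance_of_domain)
       (use cont inj in \<open>auto intro: continuous_on_subset inj_on_subset[OF _ ball_subset_cball]\<close>)
  hence op: "openin (top_of_set ?B) ?S" by (simp add: openin_open_Int)
  have "compact (F ` cball x s)"
    by (intro compact_continuous_image continuous_on_subset[OF cont]) auto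
  hence cl: "closed (F ` cball x s)" by (rule compact_imp_closed)
  have eq: "?S = ?B \<inter> F ` cball x s"
  proof -
    \<comment> \<open>A point on the sphere of radius s is moved by at least c * s, so its image
      misses the open target ball; hence the compact closed ball covers no more of it than the open
      one.\<close>
    have "z \<in> ball x s" if "z \<in> cball x s" "F z \<in> ?B" for z
    proof (rule ccontr)
      assume "z \<notin> ball x s"
      with that have "dist x z = s" by auto
      with loc[of x z] s that show False by auto
    qed
    thus ?thesis by fastforce
  qed
  have "closedin (top_of_set ?B) ?S"
    unfolding eq by (simp add: cl closedin_closed_Int)
  with op have "?S = {} \<or> ?S = ?B"
    using connected_clopen[of ?B] by (metis connected_ball)
  moreover have "F x \<in> ?S" using c s by auto
  ultimately show ?thesis by blast
qed

text \<open>The segment from u to v is cut into N equal pieces shorter than r. Since the lengths of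
  collinear pieces add up exactly, the local constant L survives.\<close>

lemma uniformly_local_Lipschitz_imp_Lipschitz:
  fixes g :: "'a::real_normed_vector \<Rightarrow> 'b::metric_space"
  assumes r: "r > 0" and loc: "\<And>u v. dist u v < r \<Longrightarrow> dist (g u) (g v) \<le> L * dist u v"
  shows "dist (g u) (g v) \<le> L * dist u v"
proof -
  obtain N :: nat where N: "dist u v / r < real N" using reals_Archimedean2 by blast
  have N0: "N > 0" using N r by (metis divide_nonneg_pos gr0I of_nat_0 not_less zero_le_dist)
  define w where "w i = u + (real i / real N) *\<^sub>R (v - u)" for i
  have d: "dist (w i) (w (Suc i)) = dist u v / real N" for i
  proof -
    have "w (Suc i) - w i = (1 / real N) *\<^sub>R (v - u)"
      by (simp add: w_def scaleR_left_diff_distrib[symmetric] diff_divide_distrib[symmetric])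
    then have "dist (w i) (w (Suc i)) = norm ((1 / real N) *\<^sub>R (v - u))"
      by (metis dist_commute dist_norm)
    then show ?thesis
      by (simp add: dist_norm norm_minus_commute)
  qed
  have small: "dist u v / real N < r"
    using N N0 r by (simp add: field_simps)
  have "dist (g (w 0)) (g (w k)) \<le> real k * (L * (dist u v / real N))" for k
  proof (induction k)
    case (Suc k)
    have "dist (g (w k)) (g (w (Suc k))) \<le> L * (dist u v / real N)"
      using loc[of "w k" "w (Suc k)"] d small by simp
    with Suc dist_triangle[of "g (w 0)" "g (w (Suc k))" "g (w k)"] show ?case
      unfolding of_nat_Suc distrib_right by simp
  qed simp
  from this[of N] N0 show ?thesis by (simp add: w_def)
qed

text \<open>Hadamard's global inverse function theorem in quantitative form: the map is a covering of the
  simply connected space by itself, hence has a global inverse.\<close>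

lemma uniformly_local_expansion_imp_expansion:
  fixes F :: "'a::euclidean_space \<Rightarrow> 'a"
  assumes cont: "continuous_on UNIV F" and c: "c > 0" and r: "r > 0"
    and loc: "\<And>x y. dist x y \<le> r \<Longrightarrow> c * dist x y \<le> dist (F x) (F y)"
  shows "c * dist x y \<le> dist (F x) (F y)"
proof -
  have ball_image: "ball (F x) (c * s) \<subseteq> F ` ball x s" if "0 < s" "2 * s \<le> r" for x s
    using uniformly_local_expansion_ball_image[of F c r s x] cont c loc that by blast
  \<comment> \<open>Every image point has a ball of the same radius c * (r/2) inside the range, so
    the range is both open and closed.\<close>
  have surj: "range F = UNIV"
  proof -
    have "closed (range F)"
    proof (rule closed_limpt[THEN iffD2], intro allI impI)
      fix y assume "y islimpt range F"
      then obtain x where "dist (F x) y < c * (r/2)"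
        using c r unfolding islimpt_approachable by (metis half_gt_zero mult_pos_pos rangeE)
      then have "y \<in> ball (F x) (c * (r/2))" by simp
      then show "y \<in> range F"
        using ball_image[where s="r/2" and x="x"] r by auto
    qed
    moreover have "open (range F)"
    proof (rule openI)
      fix y assume "y \<in> range F"
      then obtain x where "y = F x" by blast
      then have "ball y (c * (r/2)) \<subseteq> range F" using ball_image[where s="r/2" and x="x"] r by auto
      then show "\<exists>e>0. ball y e \<subseteq> range F" using c r by (intro exI[of _ "c * (r/2)"]) auto
    qed
    ultimately show ?thesis using clopen[of "range F"] by blast
  qed
  \<comment> \<open>Small enough that two preimages of one point whose balls of radius s meet are
    within distance r, and therefore equal.\<close>
  define s where "s = r / 4"
  have s: "s > 0" "2 * s \<le> r" using r by (auto simp: s_def)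
  have same: "x = x'" if "F x = F x'" "dist x x' \<le> r" for x x'
    using loc[OF that(2)] that c by (simp add: mult_le_0_iff)
  have cov: "covering_space UNIV F UNIV"
  proof
    fix y :: 'a
    let ?T = "ball y (c * s)"
    \<comment> \<open>The sheets over a small ball around y are the parts above it of the balls
      around the preimages of y.\<close>
    let ?v = "{ball x s \<inter> F -` ?T | x. F x = y}"
    have "\<Union>?v = UNIV \<inter> F -` ?T"
    proof -
      have "\<exists>x. F x = y \<and> z \<in> ball x s" if "F z \<in> ?T" for z
      proof -
        have "y \<in> ball (F z) (c * s)" using that by (simp add: dist_commute)
        then have "y \<in> F ` ball z s" using ball_image[OF s] by blast
        then show ?thesis by (auto simp: dist_commute)
      qed
      then show ?thesis by blast
    qed
    moreover have op: "open (ball x s \<inter> F -` ?T)" for x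
      using cont by (intro open_Int open_vimage) auto
    moreover have "pairwise disjnt ?v"
    proof (rule pairwiseI)
      fix a b assume "a \<in> ?v" "b \<in> ?v" "a \<noteq> b"
      then obtain x x' where xx: "a = ball x s \<inter> F -` ?T" "b = ball x' s \<inter> F -` ?T"
        "F x = y" "F x' = y" "x \<noteq> x'" by blast
      show "disjnt a b"
      proof (rule ccontr)
        assume "\<not> disjnt a b"
        then obtain z where "z \<in> ball x s" "z \<in> ball x' s" using xx unfolding disjnt_def by blast
        then have "dist x x' \<le> r" using dist_triangle2[of x x' z] s by (simp add: dist_commute)
        with same[of x x'] xx show False by auto
      qed
    qed
    moreover have "\<exists>q. homeomorphism (ball x s \<inter> F -` ?T) ?T F q" if "F x = y" for x
    proof -
      have "inj_on F (ball x s \<inter> F -` ?T)"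
      proof (rule inj_onI)
        fix u v assume "u \<in> ball x s \<inter> F -` ?T" "v \<in> ball x s \<inter> F -` ?T" "F u = F v"
        then show "u = v" using same dist_triangle2[of u v x] s by (force simp: dist_commute)
      qed
      then obtain q where "homeomorphism (ball x s \<inter> F -` ?T) (F ` (ball x s \<inter> F -` ?T)) F q"
        using invariance_of_domain_homeomorphism[of "ball x s \<inter> F -` ?T" F] op
          continuous_on_subset[OF cont] by blast
      moreover have "F ` (ball x s \<inter> F -` ?T) = ?T" using ball_image[OF s, of x] that by blast
      ultimately show ?thesis by auto
    qed
    ultimately show "\<exists>T. y \<in> T \<and> openin (top_of_set UNIV) T \<and>
              (\<exists>v. \<Union> v = UNIV \<inter> F -` T \<and> (\<forall>u\<in>v. openin (top_of_set UNIV) u) \<and>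
                   pairwise disjnt v \<and> (\<forall>u\<in>v. \<exists>q. homeomorphism u T F q))"
      using c s by (intro exI[of _ ?T] conjI exI[of _ ?v]) auto
  qed (use cont surj in auto)
  obtain g where g: "continuous_on UNIV g" "g (F 0) = 0" "\<And>y. F (g y) = y"
    using covering_space_lift_strong[OF cov, of 0 "F 0" UNIV id]
    by (auto simp: convex_imp_simply_connected convex_imp_locally_path_connected)
  \<comment> \<open>Both g composed with F and the identity lift F through F, and they agree at 0;
    uniqueness of lifts makes g a left inverse as well.\<close>
  have gF: "g (F x) = x" for x
  proof (rule covering_space_lift_unique[OF cov, of "\<lambda>x. g (F x)" 0 "\<lambda>x. x" UNIV F x])
    show "continuous_on UNIV (\<lambda>x. g (F x))"
      using continuous_on_compose2[OF g(1) cont] by simp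
  qed (use g cont in \<open>simp_all add: convex_connected\<close>)
  \<comment> \<open>A point v near u has a preimage near g u, which must be g v; the local expansion
    of F then reads as a local Lipschitz bound for g.\<close>
  have lip: "dist (g u) (g v) \<le> (1/c) * dist u v" if uv: "dist u v < c * (r/2)" for u v
  proof -
    have "v \<in> ball (F (g u)) (c * (r/2))" using uv by (simp add: g)
    then have "v \<in> F ` ball (g u) (r/2)" using ball_image[where s="r/2" and x="g u"] r by auto
    then have "dist (g u) (g v) \<le> r" using gF r by auto
    from loc[OF this] c show ?thesis by (simp add: g field_simps)
  qed
  have "dist (g (F x)) (g (F y)) \<le> (1/c) * dist (F x) (F y)"
    by (rule uniformly_local_Lipschitz_imp_Lipschitz[where r="c * (r/2)"]) (use lip c r in auto)
  then show ?thesis using c by (simp add: gF field_simps)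
qed

section \<open>Iterated directional derivatives\<close>

text \<open>The head of the list is the direction differentiated last. Lists of directions allow the
  order of differentiation to be changed by comparing multisets.\<close>

primrec dirderivs :: "'a::euclidean_space list \<Rightarrow> ('a \<Rightarrow> 'b::real_normed_vector) \<Rightarrow> 'a \<Rightarrow> 'b" where
  "dirderivs [] f = f"
| "dirderivs (v # vs) f = (\<lambda>x. frechet_derivative (dirderivs vs f) (at x) v)"

lemma dirderivs_append: "dirderivs (us @ vs) f = dirderivs us (dirderivs vs f)"
  by (induction us) auto

lemma smooth_on_differentiable: "smooth_on S f \<Longrightarrow> x \<in> S \<Longrightarrow> f differentiable (at x)"
  unfolding smooth_on_def by (metis Ck_on.simps(2))

lemma smooth_on_continuous_on: "smooth_on S f \<Longrightarrow> continuous_on S f"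
  unfolding smooth_on_def by (metis Ck_on.simps(1))

lemma smooth_on_frechet_derivative:
  "smooth_on S f \<Longrightarrow> b \<in> Basis \<Longrightarrow> smooth_on S (\<lambda>x. frechet_derivative f (at x) b)"
  unfolding smooth_on_def by (metis Ck_on.simps(2))

lemma smooth_on_dirderivs:
  "smooth_on S f \<Longrightarrow> set vs \<subseteq> Basis \<Longrightarrow> smooth_on S (dirderivs vs f)"
  by (induction vs) (auto intro: smooth_on_frechet_derivative)

lemma dirderivs_cong_open:
  assumes "open S" "\<And>x. x \<in> S \<Longrightarrow> f x = g x" "x \<in> S"
  shows "dirderivs vs f x = dirderivs vs g x"
  using assms(3)
proof (induction vs arbitrary: x)
  case (Cons v vs)
  have "frechet_derivative (dirderivs vs f) (at x) = frechet_derivative (dirderivs vs g) (at x)"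
  proof (cases "dirderivs vs f differentiable at x")
    case True
    then show ?thesis
      by (rule frechet_derivative_transform_within_open[OF _ assms(1) Cons.prems]) (use Cons.IH in auto)
  next
    case False
    \<comment> \<open>Without differentiability \<open>frechet_derivative\<close> is an arbitrary
      choice, but it is the same choice for two functions that have the same derivatives D at x,
      that is, none.\<close>
    have "(dirderivs vs f has_derivative D) (at x) \<longleftrightarrow> (dirderivs vs g has_derivative D) (at x)" for D
      using Cons.IH has_derivative_transform_within_open[OF _ assms(1) Cons.prems]
      by metis
    then show ?thesis unfolding frechet_derivative_def by simp
  qed
  then show ?case by simp
qed (use assms in auto)

lemma smooth_on_has_derivative_line:
  fixes f :: "'a::euclidean_space \<Rightarrow> 'b::real_normed_vector"
  assumes "smooth_on S f" "x + t *\<^sub>R v \<in> S"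
  shows "((\<lambda>t. f (x + t *\<^sub>R v)) has_vector_derivative frechet_derivative f (at (x + t *\<^sub>R v)) v) (at t)"
proof -
  have "(f has_derivative frechet_derivative f (at (x + t *\<^sub>R v))) (at (x + t *\<^sub>R v))"
    using smooth_on_differentiable[OF assms] frechet_derivative_works by blast
  moreover have "((\<lambda>t. x + t *\<^sub>R v) has_derivative (\<lambda>h. h *\<^sub>R v)) (at t)"
    by (auto intro!: derivative_eq_intros)
  ultimately have "((\<lambda>t. f (x + t *\<^sub>R v)) has_derivative
      (\<lambda>h. frechet_derivative f (at (x + t *\<^sub>R v)) (h *\<^sub>R v))) (at t)"
    using has_derivative_compose by blast
  moreover have "frechet_derivative f (at (x + t *\<^sub>R v)) (h *\<^sub>R v) =
      h *\<^sub>R frechet_derivative f (at (x + t *\<^sub>R v)) v" for h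
    using smooth_on_differentiable[OF assms] linear_frechet_derivative linear_scale by blast
  ultimately show ?thesis by (simp add: has_vector_derivative_def)
qed

text \<open>Two applications of the mean value theorem to the second difference quotient.\<close>

lemma second_difference_mvt:
  fixes f :: "'a::euclidean_space \<Rightarrow> real"
  assumes sm: "smooth_on S f" and uv: "u \<in> Basis" "v \<in> Basis" and h: "h > 0"
    and sub: "\<And>s t. 0 \<le> s \<Longrightarrow> s \<le> h \<Longrightarrow> 0 \<le> t \<Longrightarrow> t \<le> h \<Longrightarrow> x + s *\<^sub>R u + t *\<^sub>R v \<in> S"
  obtains s t where "0 < s" "s < h" "0 < t" "t < h"
    "f (x + h *\<^sub>R u + h *\<^sub>R v) - f (x + h *\<^sub>R u) - f (x + h *\<^sub>R v) + f x
       = h\<^sup>2 * dirderivs [v, u] f (x + s *\<^sub>R u + t *\<^sub>R v)"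
proof -
  let ?D = "\<lambda>y. frechet_derivative f (at y) u"
  let ?A = "\<lambda>s. f (x + s *\<^sub>R u + h *\<^sub>R v) - f (x + s *\<^sub>R u)"
  have d1: "((\<lambda>s. f (x + s *\<^sub>R u + t *\<^sub>R v)) has_real_derivative ?D (x + s *\<^sub>R u + t *\<^sub>R v)) (at s)"
    if "0 \<le> s" "s \<le> h" "0 \<le> t" "t \<le> h" for s t
    using smooth_on_has_derivative_line[OF sm, of "x + t *\<^sub>R v" s u] sub[OF that]
    by (simp add: has_real_derivative_iff_has_vector_derivative algebra_simps)
  have "(?A has_real_derivative ?D (x + s *\<^sub>R u + h *\<^sub>R v) - ?D (x + s *\<^sub>R u)) (at s)"
    if "0 \<le> s" "s \<le> h" for s
    using d1[OF that, of h] d1[OF that, of 0] h by (auto intro!: derivative_intros)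
  from MVT2[of 0 h ?A, OF h this]
  obtain s where s: "0 < s" "s < h"
    "?A h - ?A 0 = h * (?D (x + s *\<^sub>R u + h *\<^sub>R v) - ?D (x + s *\<^sub>R u))" by auto
  have smD: "smooth_on S ?D" using smooth_on_frechet_derivative[OF sm] uv by blast
  have "((\<lambda>t. ?D (x + s *\<^sub>R u + t *\<^sub>R v)) has_real_derivative
      frechet_derivative ?D (at (x + s *\<^sub>R u + t *\<^sub>R v)) v) (at t)" if "0 \<le> t" "t \<le> h" for t
    using smooth_on_has_derivative_line[OF smD, of "x + s *\<^sub>R u" t v] sub[of s t] that s
    by (simp add: has_real_derivative_iff_has_vector_derivative)
  from MVT2[of 0 h "\<lambda>t. ?D (x + s *\<^sub>R u + t *\<^sub>R v)", OF h this]
  obtain t where t: "0 < t" "t < h" "?D (x + s *\<^sub>R u + h *\<^sub>R v) - ?D (x + s *\<^sub>R u) =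
      h * frechet_derivative ?D (at (x + s *\<^sub>R u + t *\<^sub>R v)) v" by auto
  show ?thesis
  proof (rule that[OF s(1,2) t(1,2)])
    have "f (x + h *\<^sub>R u + h *\<^sub>R v) - f (x + h *\<^sub>R u) - f (x + h *\<^sub>R v) + f x = ?A h - ?A 0" by simp
    also have "\<dots> = h * (h * dirderivs [v, u] f (x + s *\<^sub>R u + t *\<^sub>R v))"
      unfolding s(3) t(3) by simp
    finally show "f (x + h *\<^sub>R u + h *\<^sub>R v) - f (x + h *\<^sub>R u) - f (x + h *\<^sub>R v) + f x
       = h\<^sup>2 * dirderivs [v, u] f (x + s *\<^sub>R u + t *\<^sub>R v)" by (simp add: power2_eq_square)
  qed
qed

text \<open>The second difference over a small square is symmetric in u and v, so it equals h^2
  times either mixed derivative at some point of the square. Letting the square shrink and using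
  continuity identifies the two at x.\<close>

lemma mixed_derivatives_commute:
  fixes f :: "'a::euclidean_space \<Rightarrow> real"
  assumes sm: "smooth_on S f" and S: "open S" and x: "x \<in> S" and uv: "u \<in> Basis" "v \<in> Basis"
  shows "dirderivs [v, u] f x = dirderivs [u, v] f x"
proof -
  obtain e where e: "e > 0" "ball x e \<subseteq> S" using S x openE by blast
  have small: "x + s *\<^sub>R u + t *\<^sub>R v \<in> ball x d"
    if "0 \<le> s" "s < d/2" "0 \<le> t" "t < d/2" for s t d
  proof -
    have "norm (s *\<^sub>R u + t *\<^sub>R v) \<le> s + t"
      using norm_triangle_ineq[of "s *\<^sub>R u" "t *\<^sub>R v"] uv that by simp
    moreover have "dist x (x + s *\<^sub>R u + t *\<^sub>R v) = norm (s *\<^sub>R u + t *\<^sub>R v)"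
      by (metis add.assoc add_diff_cancel_left' dist_commute dist_norm)
    ultimately show ?thesis using that by simp
  qed
  have "\<bar>dirderivs [v, u] f x - dirderivs [u, v] f x\<bar> \<le> 2 * \<epsilon>" if "\<epsilon> > 0" for \<epsilon>
  proof -
    have cont: "continuous_on S (dirderivs ws f)" if "set ws \<subseteq> Basis" for ws
      using smooth_on_continuous_on smooth_on_dirderivs sm that by blast
    have near: "\<exists>d>0. \<forall>y\<in>ball x d. \<bar>dirderivs ws f y - dirderivs ws f x\<bar> < \<epsilon>"
      if "set ws \<subseteq> Basis" for ws
    proof -
      have "isCont (dirderivs ws f) x" using cont[OF that] S x continuous_on_eq_continuous_at by blast
      then show ?thesis using \<open>\<epsilon> > 0\<close>
        unfolding continuous_at_eps_delta by (simp add: dist_real_def dist_commute[of x] Ball_def) 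
    qed
    obtain d1 where d1: "d1 > 0" "\<And>y. y\<in>ball x d1 \<Longrightarrow> \<bar>dirderivs [v,u] f y - dirderivs [v,u] f x\<bar> < \<epsilon>"
      using near[of "[v,u]"] uv by auto
    obtain d2 where d2: "d2 > 0" "\<And>y. y\<in>ball x d2 \<Longrightarrow> \<bar>dirderivs [u,v] f y - dirderivs [u,v] f x\<bar> < \<epsilon>"
      using near[of "[u,v]"] uv by auto
    define d where "d = min e (min d1 d2)"
    define h where "h = d / 4"
    have d: "d > 0" "d \<le> e" "d \<le> d1" "d \<le> d2" using e d1 d2 by (auto simp: d_def)
    have h: "h > 0" "h < d / 2" using d by (auto simp: h_def)
    have inS: "x + s *\<^sub>R u + t *\<^sub>R v \<in> S" "x + s *\<^sub>R v + t *\<^sub>R u \<in> S"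
      if "0 \<le> s" "s \<le> h" "0 \<le> t" "t \<le> h" for s t
      using small[of s d t] small[of t d s] that h d e by (auto simp: subset_iff algebra_simps)
    obtain s t where st: "0 < s" "s < h" "0 < t" "t < h"
      "f (x + h *\<^sub>R u + h *\<^sub>R v) - f (x + h *\<^sub>R u) - f (x + h *\<^sub>R v) + f x
       = h\<^sup>2 * dirderivs [v, u] f (x + s *\<^sub>R u + t *\<^sub>R v)"
      using second_difference_mvt[OF sm uv h(1) inS(1)] by auto
    obtain s' t' where st': "0 < s'" "s' < h" "0 < t'" "t' < h"
      "f (x + h *\<^sub>R v + h *\<^sub>R u) - f (x + h *\<^sub>R v) - f (x + h *\<^sub>R u) + f x
       = h\<^sup>2 * dirderivs [u, v] f (x + s' *\<^sub>R v + t' *\<^sub>R u)"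
      using second_difference_mvt[OF sm uv(2,1) h(1) inS(2)] by auto
    have comm: "x + h *\<^sub>R v + h *\<^sub>R u = x + h *\<^sub>R u + h *\<^sub>R v" by (simp add: algebra_simps)
    have "h\<^sup>2 * dirderivs [v, u] f (x + s *\<^sub>R u + t *\<^sub>R v)
        = h\<^sup>2 * dirderivs [u, v] f (x + s' *\<^sub>R v + t' *\<^sub>R u)"
      using st(5) st'(5) unfolding comm by linarith
    then have "dirderivs [v, u] f (x + s *\<^sub>R u + t *\<^sub>R v)
        = dirderivs [u, v] f (x + s' *\<^sub>R v + t' *\<^sub>R u)" using h by simp
    moreover have "x + s *\<^sub>R u + t *\<^sub>R v \<in> ball x d" using small st h by auto
    moreover have "x + s' *\<^sub>R v + t' *\<^sub>R u \<in> ball x d"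
      using small[of t' d s'] st' h by (auto simp: algebra_simps)
    moreover have "y \<in> ball x d1 \<and> y \<in> ball x d2" if "y \<in> ball x d" for y using that d by auto
    ultimately have "\<bar>dirderivs [v, u] f (x + s *\<^sub>R u + t *\<^sub>R v) - dirderivs [v, u] f x\<bar> < \<epsilon>"
      "\<bar>dirderivs [v, u] f (x + s *\<^sub>R u + t *\<^sub>R v) - dirderivs [u, v] f x\<bar> < \<epsilon>"
      using d1(2) d2(2) by metis+
    then show ?thesis by arith
  qed
  from this[of "\<epsilon>/2" for \<epsilon>]
  have "\<bar>dirderivs [v, u] f x - dirderivs [u, v] f x\<bar> \<le> 0 + \<epsilon>" if "\<epsilon> > 0" for \<epsilon>
    using that by simp
  then have "\<bar>dirderivs [v, u] f x - dirderivs [u, v] f x\<bar> \<le> 0" by (rule field_le_epsilon)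
  then show ?thesis by simp
qed

text \<open>The direction v is exchanged with its left neighbours one at a time. Openness of S
  enters because an identity has to hold on a neighbourhood before it can be differentiated
  further.\<close>

lemma dirderivs_move_front:
  fixes f :: "'a::euclidean_space \<Rightarrow> real"
  assumes sm: "smooth_on S f" and S: "open S" and "set (us @ v # vs) \<subseteq> Basis" and "x \<in> S"
  shows "dirderivs (us @ v # vs) f x = dirderivs (v # us @ vs) f x"
  using assms(3,4)
proof (induction us arbitrary: x)
  case (Cons u us)
  have "dirderivs (u # us @ v # vs) f x = dirderivs [u] (dirderivs (us @ v # vs) f) x" by simp
  also have "\<dots> = dirderivs [u] (dirderivs (v # us @ vs) f) x"
    using Cons by (intro dirderivs_cong_open[OF S]) auto
  also have "\<dots> = dirderivs [u, v] (dirderivs (us @ vs) f) x" by simp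
  also have "\<dots> = dirderivs [v, u] (dirderivs (us @ vs) f) x"
    using Cons by (intro mixed_derivatives_commute[OF _ S]) (auto intro!: smooth_on_dirderivs sm)
  finally show ?case by simp
qed simp

lemma dirderivs_perm:
  fixes f :: "'a::euclidean_space \<Rightarrow> real"
  assumes sm: "smooth_on S f" and S: "open S" and "set vs \<subseteq> Basis" "mset vs = mset ws" "x \<in> S"
  shows "dirderivs vs f x = dirderivs ws f x"
  using assms(3-5)
proof (induction vs arbitrary: ws x)
  case (Cons v vs)
  then have "v \<in> set ws" by (metis list.set_intros(1) mset_eq_setD)
  then obtain us1 us2 where ws: "ws = us1 @ v # us2" by (meson split_list)
  have sub: "set ws \<subseteq> Basis" using Cons.prems by (metis mset_eq_setD)
  have "dirderivs ws f x = dirderivs (v # us1 @ us2) f x"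
    unfolding ws using sub ws Cons.prems by (intro dirderivs_move_front[OF sm S]) auto
  also have "\<dots> = dirderivs [v] (dirderivs (us1 @ us2) f) x" by simp
  also have "\<dots> = dirderivs [v] (dirderivs vs f) x"
    using Cons.prems by (intro dirderivs_cong_open[OF S] Cons.IH[symmetric]) (auto simp: ws)
  finally show ?case by simp
qed simp

text \<open>The multi-index written out as a list in the order fixed by \<open>coords\<close>, which
  turns \<open>mderiv\<close> into an instance of \<open>dirderivs\<close>.\<close>

definition mi_list :: "'n::finite multi_index \<Rightarrow> 'n list" where
  "mi_list \<alpha> = concat (map (\<lambda>i. replicate (\<alpha> i) i) coords)"

lemma pderiv_at_funpow: "(pderiv_at i ^^ k) f = dirderivs (replicate k (axis i 1)) f"
  by (induction k) (simp_all add: pderiv_at_def[abs_def])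

lemma mderiv_dirderivs: "mderiv \<alpha> f = dirderivs (map (\<lambda>i. axis i 1) (mi_list \<alpha>)) f"
proof -
  have "foldr (\<lambda>i g. (pderiv_at i ^^ \<alpha> i) g) cs f =
      dirderivs (map (\<lambda>i. axis i 1) (concat (map (\<lambda>i. replicate (\<alpha> i) i) cs))) f" for cs
    by (induction cs) (auto simp: pderiv_at_funpow dirderivs_append)
  then show ?thesis by (simp add: mderiv_def mi_list_def)
qed

text \<open>Any list of coordinates is a permutation of the list of its own counting multi-index. In
  this way bounds for multi-indices become bounds for arbitrary orders of differentiation.\<close>

lemma mset_mi_list_count: "mset (mi_list (count_list is)) = mset (is :: 'n::finite list)"
proof -
  have "count (mset (concat (map (\<lambda>i. replicate (f i) i) cs))) j = (if j \<in> set cs then f j else 0)"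
    if "distinct cs" for f :: "'n \<Rightarrow> nat" and cs j
    using that by (induction cs) auto
  from this[OF distinct_coords] show ?thesis
    unfolding mi_list_def by (intro multiset_eqI) (simp add: set_coords count_mset)
qed

lemma mi_order_count_list: "mi_order (count_list is) = length (is :: 'n::finite list)"
proof -
  have "(\<Sum>i\<in>UNIV. count_list is i) = (\<Sum>i\<in>set is. count_list is i)"
    by (intro sum.mono_neutral_right) (auto simp: count_list_0_iff)
  then show ?thesis by (simp add: mi_order_def sum_count_set)
qed

lemma length_mi_list: "length (mi_list \<alpha>) = mi_order (\<alpha> :: 'n::finite multi_index)"
proof -
  have "length (mi_list \<alpha>) = (\<Sum>i\<leftarrow>coords. \<alpha> i)"
    by (simp add: mi_list_def length_concat comp_def)
  also have "\<dots> = (\<Sum>i\<in>set coords. \<alpha> i)" by (rule sum_list_distinct_conv_sum_set[OF distinct_coords])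
  finally show ?thesis by (simp add: mi_order_def set_coords)
qed

text \<open>Integration by parts repeats a single coordinate direction; this extracts such
  derivatives from the multi-index bounds of the symbol class.\<close>

lemma mderiv_single:
  "mderiv (\<lambda>j. if j = i then k else 0) f = (pderiv_at i ^^ k) (f :: real^'n \<Rightarrow> 'b::real_normed_vector)"
proof -
  have "concat (map (\<lambda>j. replicate (if j = i then k else 0) j) cs) = (if i \<in> set cs then replicate k i else [])"
    if "distinct cs" for cs :: "'n list"
    using that by (induction cs) auto
  from this[OF distinct_coords] have "mi_list (\<lambda>j. if j = i then k else 0) = replicate k i"
    by (simp add: mi_list_def set_coords)
  then show ?thesis by (simp add: mderiv_dirderivs pderiv_at_funpow)
qed

lemma mi_order_single: "mi_order (\<lambda>j. if j = (i::'n::finite) then k else 0) = k"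
  by (simp add: mi_order_def)

text \<open>The phase class differentiates first in x at fixed frequency and then in the frequency,
  whereas smoothness is joint. Derivatives of sections are rewritten as derivatives of the joint
  function, where they commute.\<close>

lemma dirderivs_slice:
  fixes G :: "'a::euclidean_space \<times> 'b::euclidean_space \<Rightarrow> 'c::real_normed_vector"
  assumes sm: "smooth_on S G" and S: "open S"
  shows dirderivs_slice_fst:
      "set vs \<subseteq> Basis \<Longrightarrow> (x, \<eta>) \<in> S \<Longrightarrow> dirderivs vs (\<lambda>y. G (y, \<eta>)) x = dirderivs (map (\<lambda>v. (v, 0)) vs) G (x, \<eta>)"
    and dirderivs_slice_snd:
      "set ws \<subseteq> Basis \<Longrightarrow> (x, \<eta>) \<in> S \<Longrightarrow> dirderivs ws (\<lambda>\<xi>. G (x, \<xi>)) \<eta> = dirderivs (map (\<lambda>v. (0, v)) ws) G (x, \<eta>)"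
proof -
  have op1: "open {y. (y, \<eta>) \<in> S}"
    using open_vimage[OF S, of "\<lambda>y. (y, \<eta>)"] by (simp add: continuous_on_Pair vimage_def)
  have op2: "open {\<xi>. (x, \<xi>) \<in> S}"
    using open_vimage[OF S, of "\<lambda>\<xi>. (x, \<xi>)"] by (simp add: continuous_on_Pair vimage_def)
  have diff: "(H has_derivative frechet_derivative H (at p)) (at p)" if "smooth_on S H" "p \<in> S" for H :: "'a \<times> 'b \<Rightarrow> 'c" and p
    using smooth_on_differentiable[OF that] frechet_derivative_works by blast
  show "dirderivs vs (\<lambda>y. G (y, \<eta>)) x = dirderivs (map (\<lambda>v. (v, 0)) vs) G (x, \<eta>)"
    if "set vs \<subseteq> Basis" "(x, \<eta>) \<in> S" using that
  proof (induction vs arbitrary: x)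
    case (Cons v vs)
    let ?H = "dirderivs (map (\<lambda>v. (v, 0)) vs) G"
    have "set (map (\<lambda>v. (v, 0)) vs) \<subseteq> (Basis :: ('a\<times>'b) set)" using Cons.prems by (auto simp: Basis_prod_def)
    then have sH: "smooth_on S ?H" using smooth_on_dirderivs sm by blast
    have pr: "((\<lambda>y. (y, \<eta>)) has_derivative (\<lambda>h. (h, 0))) (at x)"
      by (auto intro!: derivative_eq_intros)
    have "((\<lambda>y. ?H (y, \<eta>)) has_derivative (\<lambda>h. frechet_derivative ?H (at (x, \<eta>)) (h, 0))) (at x)"
      using has_derivative_compose[OF pr diff[OF sH Cons.prems(2)]] by (simp add: o_def)
    then have "(dirderivs vs (\<lambda>y. G (y, \<eta>)) has_derivative (\<lambda>h. frechet_derivative ?H (at (x, \<eta>)) (h, 0))) (at x)"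
      by (rule has_derivative_transform_within_open[OF _ op1]) (use Cons in auto)
    from frechet_derivative_at[OF this, symmetric] show ?case by simp
  qed simp
  show "dirderivs ws (\<lambda>\<xi>. G (x, \<xi>)) \<eta> = dirderivs (map (\<lambda>v. (0, v)) ws) G (x, \<eta>)"
    if "set ws \<subseteq> Basis" "(x, \<eta>) \<in> S" using that
  proof (induction ws arbitrary: \<eta>)
    case (Cons v vs)
    let ?H = "dirderivs (map (\<lambda>v. (0, v)) vs) G"
    have "set (map (\<lambda>v. (0, v)) vs) \<subseteq> (Basis :: ('a\<times>'b) set)" using Cons.prems by (auto simp: Basis_prod_def)
    then have sH: "smooth_on S ?H" using smooth_on_dirderivs sm by blast
    have pr: "((\<lambda>\<xi>. (x, \<xi>)) has_derivative (\<lambda>h. (0, h))) (at \<eta>)"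
      by (auto intro!: derivative_eq_intros)
    have "((\<lambda>\<xi>. ?H (x, \<xi>)) has_derivative (\<lambda>h. frechet_derivative ?H (at (x, \<eta>)) (0, h))) (at \<eta>)"
      using has_derivative_compose[OF pr diff[OF sH Cons.prems(2)]] by (simp add: o_def)
    then have "(dirderivs vs (\<lambda>\<xi>. G (x, \<xi>)) has_derivative (\<lambda>h. frechet_derivative ?H (at (x, \<eta>)) (0, h))) (at \<eta>)"
      by (rule has_derivative_transform_within_open[OF _ op2]) (use Cons in auto)
    from frechet_derivative_at[OF this, symmetric] show ?case by simp
  qed simp
qed

section \<open>Product integrals, the Schur weight and Gaussian integrals\<close>

lemma sigma_finite_lebesgue: "sigma_finite_measure (lebesgue :: 'a::euclidean_space measure)"
proof
  obtain A :: "'a set set" where A: "countable A" "A \<subseteq> sets lborel" "\<Union>A = space lborel" "\<forall>a\<in>A. emeasure lborel a \<noteq> \<infinity>"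
    using lborel.sigma_finite_countable by blast
  have "A \<subseteq> sets lebesgue" using A(2) by auto
  moreover have "\<forall>a\<in>A. emeasure lebesgue a \<noteq> \<infinity>" using A(2,4) by (auto simp: subset_iff)
  ultimately show "\<exists>A. countable A \<and> A \<subseteq> sets lebesgue \<and> \<Union> A = space (lebesgue :: 'a measure) \<and> (\<forall>a\<in>A. emeasure lebesgue a \<noteq> \<infinity>)"
    using A(1,3) by (intro exI[of _ A]) simp
qed

lemma lborel_integral_prod:
  fixes f :: "'a::euclidean_space \<Rightarrow> real \<Rightarrow> complex"
  assumes int: "\<And>b. b \<in> Basis \<Longrightarrow> integrable lborel (f b)"
  shows "integrable lborel (\<lambda>x::'a. \<Prod>b\<in>Basis. f b (x \<bullet> b))"
    and "(LINT x|lborel. (\<Prod>b\<in>Basis. f b ((x::'a) \<bullet> b))) = (\<Prod>b\<in>Basis. (LINT t|lborel. f b t))"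
proof -
  interpret product_sigma_finite "\<lambda>_::'a. lborel :: real measure" ..
  have m: "f b \<in> borel_measurable borel" if "b \<in> Basis" for b
    using borel_measurable_integrable[OF int[OF that]] by simp
  have m1: "(\<lambda>x::'a. \<Prod>b\<in>Basis. f b (x \<bullet> b)) \<in> borel_measurable borel"
    using m by (intro borel_measurable_prod measurable_compose[OF _ m]) auto
  have m2: "(\<lambda>f. \<Sum>b\<in>Basis. f b *\<^sub>R b) \<in> measurable (\<Pi>\<^sub>M b\<in>(Basis::'a set). lborel) borel"
    by measurable
  have eq: "(\<Prod>b\<in>Basis. f b ((\<Sum>b\<in>Basis. y b *\<^sub>R b) \<bullet> b)) = (\<Prod>b\<in>Basis. f b (y b))" for y :: "'a \<Rightarrow> real"
    by (intro prod.cong) auto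
  show "integrable lborel (\<lambda>x::'a. \<Prod>b\<in>Basis. f b (x \<bullet> b))"
    unfolding lborel_eq[where ?'a='a]
    by (subst integrable_distr_eq[OF m2 m1], subst eq, rule product_integrable_prod) (use int in auto)
  show "(LINT x|lborel. (\<Prod>b\<in>Basis. f b ((x::'a) \<bullet> b))) = (\<Prod>b\<in>Basis. (LINT t|lborel. f b t))"
    unfolding lborel_eq[where ?'a='a]
    by (subst integral_distr[OF m2 m1], subst eq, rule product_integral_prod) (use int in auto)
qed

lemma prod_Basis_vec:
  fixes g :: "real^'n \<Rightarrow> 'b::comm_monoid_mult"
  shows "(\<Prod>b\<in>Basis. g b) = (\<Prod>i\<in>UNIV. g (axis i 1))"
proof -
  have B: "(Basis :: (real^'n) set) = range (\<lambda>i. axis i 1)"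
    by (auto simp: Basis_vec_def)
  have inj: "inj (\<lambda>i::'n. axis i (1::real))" by (auto intro!: injI simp: axis_eq_axis)
  show ?thesis unfolding B by (subst prod.reindex[OF inj]) simp
qed

lemma lborel_vec_integral_prod:
  fixes f :: "'n::finite \<Rightarrow> real \<Rightarrow> complex"
  assumes int: "\<And>i. integrable lborel (f i)"
  shows "integrable lborel (\<lambda>x::real^'n. \<Prod>i\<in>UNIV. f i (x $ i))"
    and "(LINT x|lborel. (\<Prod>i\<in>UNIV. f i ((x::real^'n) $ i))) = (\<Prod>i\<in>UNIV. (LINT t|lborel. f i t))"
proof -
  \<comment> \<open>Re-indexes the factors from coordinates to basis vectors; the choice is unique
    because distinct coordinates give distinct axes.\<close>
  define g :: "real^'n \<Rightarrow> real \<Rightarrow> complex" where "g b = f (SOME i. b = axis i 1)" for b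
  have g: "g (axis i 1) = f i" for i
    by (simp add: g_def axis_eq_axis)
  have "\<And>b. b \<in> Basis \<Longrightarrow> integrable lborel (g b)" using int by (simp add: g_def)
  note P = lborel_integral_prod[of g, OF this]
  from P show "integrable lborel (\<lambda>x::real^'n. \<Prod>i\<in>UNIV. f i (x $ i))"
    and "(LINT x|lborel. (\<Prod>i\<in>UNIV. f i ((x::real^'n) $ i))) = (\<Prod>i\<in>UNIV. (LINT t|lborel. f i t))"
    by (simp_all add: prod_Basis_vec g cart_eq_inner_axis)
qed

lemma lborel_vec_nn_integral_prod:
  fixes f :: "real \<Rightarrow> real" and c :: "real^'n"
  assumes [measurable]: "f \<in> borel_measurable borel" and nn: "\<And>t. 0 \<le> f t"
  shows "(\<integral>\<^sup>+x. ennreal (\<Prod>i\<in>UNIV. f (c $ i - x $ i)) \<partial>lborel) = (\<integral>\<^sup>+t. ennreal (f t) \<partial>lborel) ^ CARD('n)"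
proof -
  have 1: "(\<integral>\<^sup>+t. ennreal (f (s - t)) \<partial>lborel) = (\<integral>\<^sup>+t. ennreal (f t) \<partial>lborel)" for s
    using nn_integral_real_affine[of "\<lambda>t. ennreal (f t)" "-1" s] by simp
  have "(\<integral>\<^sup>+(x::real^'n). (\<Prod>b\<in>Basis. ennreal (f (c \<bullet> b - x \<bullet> b))) \<partial>lborel)
      = (\<Prod>b\<in>(Basis::(real^'n) set). (\<integral>\<^sup>+t. ennreal (f (c \<bullet> b - t)) \<partial>lborel))"
    by (rule nn_integral_lborel_prod[where f="\<lambda>b t. ennreal (f (c \<bullet> b - t))"]) auto
  then show ?thesis
    by (simp add: prod_Basis_vec 1 nn prod_ennreal cart_eq_inner_axis)
qed

lemma nn_integral_inverse_one_plus_square: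
  "(\<integral>\<^sup>+t. ennreal (2 / (1 + t\<^sup>2)) \<partial>lborel) = ennreal (2 * pi)"
proof -
  have "einterval (-\<infinity>) \<infinity> = UNIV" by (auto simp: einterval_def)
  then have i: "integrable lborel (\<lambda>t::real. inverse (1 + t\<^sup>2))" "(LINT t|lborel. inverse (1 + (t::real)\<^sup>2)) = pi"
    using integrable_inverse_1_plus_square LBINT_inverse_1_plus_square
    by (simp_all add: set_integrable_def interval_lebesgue_integral_def set_lebesgue_integral_def)
  have "(\<integral>\<^sup>+t. ennreal (2 / (1 + t\<^sup>2)) \<partial>lborel) = (\<integral>\<^sup>+t. ennreal (2 * inverse (1 + t\<^sup>2)) \<partial>lborel)"
    by (simp add: field_simps)
  also have "\<dots> = ennreal (LINT t|lborel. 2 * inverse (1 + (t::real)\<^sup>2))"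
    using i(1) by (intro nn_integral_eq_integral) (auto intro!: AE_I2)
  finally show ?thesis using i(2) by simp
qed

text \<open>A product of Cauchy densities of width \<nu>, up to normalization: its integral is
  explicit, and the numerator 2 makes every factor at least 1 where |z| is at most \<nu>.\<close>

definition schur_weight :: "real \<Rightarrow> real^'n \<Rightarrow> real" where
  "schur_weight \<nu> z = (\<Prod>i\<in>UNIV. 2 / (1 + (z $ i / \<nu>)\<^sup>2))"

lemma schur_weight_nonneg: "0 \<le> schur_weight \<nu> z"
  unfolding schur_weight_def by (intro prod_nonneg) auto

lemma schur_weight_minus: "schur_weight \<nu> (x - y) = schur_weight \<nu> (y - x)"
proof -
  have "((x - y) $ i / \<nu>)\<^sup>2 = ((y - x) $ i / \<nu>)\<^sup>2" for i
    by (simp add: power_divide power2_commute)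
  then show ?thesis unfolding schur_weight_def by simp
qed

lemma schur_weight_measurable [measurable]: "schur_weight \<nu> \<in> borel_measurable borel"
  unfolding schur_weight_def[abs_def] by measurable

lemma nn_integral_schur_weight:
  fixes x :: "real^'n"
  assumes "\<nu> > 0"
  shows "(\<integral>\<^sup>+y. ennreal (schur_weight \<nu> (x - y)) \<partial>lborel) = ennreal ((2 * pi * \<nu>) ^ CARD('n))"
proof -
  have "(\<integral>\<^sup>+t. ennreal (2 / (1 + (t / \<nu>)\<^sup>2)) \<partial>lborel) = ennreal (2 * pi * \<nu>)"
    using nn_integral_real_affine[of "\<lambda>t. ennreal (2 / (1 + (t / \<nu>)\<^sup>2))" \<nu> 0] assms
    by (simp add: nn_integral_inverse_one_plus_square ennreal_mult' [symmetric] mult.commute)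
  then show ?thesis
    using lborel_vec_nn_integral_prod[of "\<lambda>t. 2 / (1 + (t / \<nu>)\<^sup>2)" x] assms
    by (simp add: schur_weight_def ennreal_power)
qed

text \<open>Decay of order 2n pays a factor (\<nu> / |z|)^2 for each of the n coordinates: if \<nu>
  < |z|, then \<nu>^2 plus the square of a coordinate is at most 2 |z|^2, so each such factor is
  below the corresponding factor of the weight.\<close>

lemma decay_le_schur_weight:
  fixes z :: "real^'n"
  assumes \<nu>: "\<nu> > 0" and A: "A \<ge> 0" and a1: "a \<le> A" and a2: "z \<noteq> 0 \<Longrightarrow> a \<le> A * (\<nu> / norm z) ^ (2 * CARD('n))"
  shows "a \<le> A * schur_weight \<nu> z"
proof (cases "norm z \<le> \<nu>")
  case True
  have "1 \<le> schur_weight \<nu> z" unfolding schur_weight_def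
  proof (rule prod_ge_1)
    fix i
    have "\<bar>z $ i / \<nu>\<bar> \<le> 1" using component_le_norm_cart[of z i] True \<nu> by simp
    then have "(z $ i / \<nu>)\<^sup>2 \<le> 1" by (simp add: abs_square_le_1)
    moreover have "0 < 1 + (z $ i / \<nu>)\<^sup>2" by (simp add: add_pos_nonneg)
    ultimately show "1 \<le> 2 / (1 + (z $ i / \<nu>)\<^sup>2)" by (simp add: le_divide_eq)
  qed
  then have "A * 1 \<le> A * schur_weight \<nu> z" using A by (intro mult_left_mono)
  then show ?thesis using a1 by simp
next
  case False
  have "(\<nu> / norm z) ^ (2 * CARD('n)) = (\<Prod>i\<in>(UNIV::'n set). (\<nu> / norm z)\<^sup>2)"
    by (simp add: power_mult)
  also have "\<dots> \<le> schur_weight \<nu> z" unfolding schur_weight_def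
  proof (rule prod_mono)
    fix i :: 'n
    have p: "0 < 1 + (z $ i / \<nu>)\<^sup>2" by (simp add: add_pos_nonneg)
    have "(z $ i)\<^sup>2 \<le> (norm z)\<^sup>2" using component_le_norm_cart[of z i] by (metis abs_le_square_iff abs_norm_cancel)
    moreover have "\<nu>\<^sup>2 \<le> (norm z)\<^sup>2" using False \<nu> by (intro power_mono) auto
    ultimately have "\<nu>\<^sup>2 * (1 + (z $ i / \<nu>)\<^sup>2) \<le> 2 * (norm z)\<^sup>2"
      using \<nu> by (simp add: power_divide distrib_left del: power_mono_iff)
    then have "(\<nu> / norm z)\<^sup>2 * (1 + (z $ i / \<nu>)\<^sup>2) \<le> 2" using False \<nu>
      by (simp add: power_divide divide_le_eq)
    then show "0 \<le> (\<nu> / norm z)\<^sup>2 \<and> (\<nu> / norm z)\<^sup>2 \<le> 2 / (1 + (z $ i / \<nu>)\<^sup>2)"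
      using p by (simp add: le_divide_eq)
  qed
  finally have "A * (\<nu> / norm z) ^ (2 * CARD('n)) \<le> A * schur_weight \<nu> z"
    using A by (intro mult_left_mono)
  moreover have "z \<noteq> 0" using False \<nu> by auto
  ultimately show ?thesis using a2 by simp
qed

text \<open>The characteristic function of the standard normal distribution, rescaled by sqrt
  s.\<close>

lemma gaussian_fourier_real:
  assumes s: "s > 0"
  shows "integrable lborel (\<lambda>x. iexp (z * x) * complex_of_real (exp (- s * x\<^sup>2 / 2)))"
    and "(LINT x|lborel. iexp (z * x) * complex_of_real (exp (- s * x\<^sup>2 / 2))) =
      complex_of_real (sqrt (2 * pi / s) * exp (- z\<^sup>2 / (2 * s)))"
proof -
  let ?r = "sqrt s"
  have r: "?r > 0" "?r\<^sup>2 = s" using s by auto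
  have std: "(LINT x|lborel. iexp (t * x) * complex_of_real (std_normal_density x)) = complex_of_real (exp (- t\<^sup>2 / 2))" for t
  proof -
    have "char std_normal_distribution t = (LINT x|lborel. std_normal_density x *\<^sub>R iexp (t * x))"
      unfolding char_def by (subst integral_density) auto
    then show ?thesis
      by (simp add: char_std_normal_distribution scaleR_conv_of_real mult.commute)
  qed
  have istd: "integrable lborel (\<lambda>x. iexp (t * x) * complex_of_real (std_normal_density x))" for t
  proof (rule Bochner_Integration.integrable_bound[of _ std_normal_density])
    show "(\<lambda>x. iexp (t * x) * complex_of_real (std_normal_density x)) \<in> borel_measurable lborel" by measurable
  qed (auto simp: norm_mult)
  have conv: "iexp (z * x) * complex_of_real (exp (- s * x\<^sup>2 / 2)) =
    complex_of_real (sqrt (2 * pi)) * (iexp (z / ?r * (0 + ?r * x)) * complex_of_real (std_normal_density (0 + ?r * x)))" for x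
    using r by (simp add: std_normal_density_def power_mult_distrib)
  have i2: "integrable lborel (\<lambda>x. iexp (z / ?r * (0 + ?r * x)) * complex_of_real (std_normal_density (0 + ?r * x)))"
    using lborel_integrable_real_affine[OF istd[of "z / ?r"], of ?r 0] r by simp
  show "integrable lborel (\<lambda>x. iexp (z * x) * complex_of_real (exp (- s * x\<^sup>2 / 2)))"
    unfolding conv using i2 by (rule integrable_mult_right)
  have "complex_of_real (exp (- (z / ?r)\<^sup>2 / 2)) = \<bar>?r\<bar> *\<^sub>R (LINT x|lborel. iexp (z / ?r * (0 + ?r * x)) * complex_of_real (std_normal_density (0 + ?r * x)))"
    unfolding std[symmetric] using r by (intro lborel_integral_real_affine) auto
  then have "(LINT x|lborel. iexp (z / ?r * (0 + ?r * x)) * complex_of_real (std_normal_density (0 + ?r * x))) = complex_of_real (exp (- (z / ?r)\<^sup>2 / 2) / ?r)"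
    using r by (simp add: scaleR_conv_of_real field_simps)
  then have "(LINT x|lborel. iexp (z * x) * complex_of_real (exp (- s * x\<^sup>2 / 2))) =
     complex_of_real (sqrt (2 * pi)) * complex_of_real (exp (- (z / ?r)\<^sup>2 / 2) / ?r)"
    unfolding conv by (subst Bochner_Integration.integral_mult_right[OF i2]) simp
  also have "\<dots> = complex_of_real (sqrt (2 * pi / s) * exp (- z\<^sup>2 / (2 * s)))"
    using r s by (simp add: power_divide real_sqrt_divide)
  finally show "(LINT x|lborel. iexp (z * x) * complex_of_real (exp (- s * x\<^sup>2 / 2))) =
      complex_of_real (sqrt (2 * pi / s) * exp (- z\<^sup>2 / (2 * s)))" .
qed

lemma norm_vec_power2: "(norm (x::real^'n))\<^sup>2 = (\<Sum>i\<in>UNIV. (x $ i)\<^sup>2)"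
  unfolding power2_norm_eq_inner by (simp add: inner_vec_def power2_eq_square)

lemma gaussian_fourier:
  fixes z :: "real^'n"
  assumes s: "s > 0"
  shows "integrable lborel (\<lambda>x. iexp (z \<bullet> x) * complex_of_real (exp (- s * (norm x)\<^sup>2 / 2)))"
    and "(LINT x|lborel. iexp (z \<bullet> x) * complex_of_real (exp (- s * (norm x)\<^sup>2 / 2))) =
      complex_of_real (sqrt (2 * pi / s) ^ CARD('n) * exp (- (norm z)\<^sup>2 / (2 * s)))"
proof -
  have e: "iexp (z \<bullet> x) * complex_of_real (exp (- s * (norm x)\<^sup>2 / 2)) =
      (\<Prod>i\<in>UNIV. iexp (z $ i * x $ i) * complex_of_real (exp (- s * (x $ i)\<^sup>2 / 2)))" for x
    by (simp add: prod.distrib norm_vec_power2 inner_vec_def exp_sum[symmetric] sum_distrib_left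
        sum_divide_distrib sum_negf of_real_prod[symmetric] del: of_real_prod)
  note g = lborel_vec_integral_prod[where f="\<lambda>i t. iexp (z $ i * t) * complex_of_real (exp (- s * t\<^sup>2 / 2))",
      OF gaussian_fourier_real(1)[OF s]]
  show "integrable lborel (\<lambda>x. iexp (z \<bullet> x) * complex_of_real (exp (- s * (norm x)\<^sup>2 / 2)))"
    unfolding e by (rule g(1))
  have "(\<Prod>i\<in>UNIV. exp (- (z $ i)\<^sup>2 / (2 * s))) = exp (- (norm z)\<^sup>2 / (2 * s))"
    by (simp add: exp_sum[symmetric] norm_vec_power2 sum_divide_distrib sum_negf)
  then show "(LINT x|lborel. iexp (z \<bullet> x) * complex_of_real (exp (- s * (norm x)\<^sup>2 / 2))) =
      complex_of_real (sqrt (2 * pi / s) ^ CARD('n) * exp (- (norm z)\<^sup>2 / (2 * s)))"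
    unfolding e g(2) gaussian_fourier_real(2)[OF s]
    by (simp add: prod.distrib of_real_prod[symmetric] del: of_real_prod of_real_mult of_real_power)
qed

section \<open>Schur's test\<close>

abbreviation L2_mass :: "'a measure \<Rightarrow> ('a \<Rightarrow> complex) \<Rightarrow> ennreal" where
  "L2_mass M f \<equiv> \<integral>\<^sup>+x. ennreal ((norm (f x))\<^sup>2) \<partial>M"

lemma borel_measurable_cnj [measurable]: "cnj \<in> borel_measurable borel"
  by (intro borel_measurable_continuous_onI continuous_intros)

text \<open>A non-integrable function has Bochner integral 0, so both cases are covered.\<close>

lemma norm_integral_le_nn_integral:
  fixes f :: "'a \<Rightarrow> 'b::{banach, second_countable_topology}"
  shows "ennreal (norm (integral\<^sup>L M f)) \<le> (\<integral>\<^sup>+x. ennreal (norm (f x)) \<partial>M)"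
  by (cases "integrable M f") (auto simp: integral_norm_bound_ennreal not_integrable_integral_eq)

text \<open>The product w x * w y is at most half the sum of the squares. By symmetry of H the two
  halves have the same integral, in which H is integrated over the variable that w does not
  see.\<close>

lemma schur_bilinear_bound:
  fixes w :: "'a \<Rightarrow> real"
  assumes "sigma_finite_measure M" and [measurable]: "w \<in> borel_measurable M"
    and w: "\<And>x. 0 \<le> w x"
    and H: "case_prod H \<in> borel_measurable (M \<Otimes>\<^sub>M M)" "\<And>x y. 0 \<le> H x y" "\<And>x y. H x y = H y x"
    and B: "\<And>x. x \<in> space M \<Longrightarrow> (\<integral>\<^sup>+y. ennreal (H x y) \<partial>M) \<le> B"
  shows "(\<integral>\<^sup>+x. (\<integral>\<^sup>+y. ennreal (w x * w y * H x y) \<partial>M) \<partial>M) \<le> B * (\<integral>\<^sup>+x. ennreal ((w x)\<^sup>2) \<partial>M)"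
proof -
  interpret sigma_finite_measure M by fact
  interpret pair_sigma_finite M M ..
  note [measurable] = H(1)
  have Hx [measurable]: "H x \<in> borel_measurable M" if "x \<in> space M" for x
    using measurable_compose_Pair1[OF that H(1)] by simp
  have am: "w x * w y * H x y \<le> (w x)\<^sup>2 / 2 * H x y + (w y)\<^sup>2 / 2 * H x y" for x y
  proof -
    have "w x * w y \<le> (w x)\<^sup>2 / 2 + (w y)\<^sup>2 / 2" using sum_squares_bound[of "w x" "w y"] by simp
    from mult_right_mono[OF this H(2)] show ?thesis by (simp add: distrib_right)
  qed
  define I where "I = (\<integral>\<^sup>+x. (\<integral>\<^sup>+y. ennreal ((w x)\<^sup>2 / 2 * H x y) \<partial>M) \<partial>M)"
  have swap: "(\<integral>\<^sup>+x. (\<integral>\<^sup>+y. ennreal ((w y)\<^sup>2 / 2 * H x y) \<partial>M) \<partial>M) = I"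
  proof -
    have "(\<integral>\<^sup>+x. (\<integral>\<^sup>+y. ennreal ((w y)\<^sup>2 / 2 * H x y) \<partial>M) \<partial>M) = (\<integral>\<^sup>+y. (\<integral>\<^sup>+x. ennreal ((w y)\<^sup>2 / 2 * H x y) \<partial>M) \<partial>M)"
      by (rule Fubini') measurable
    also have "\<dots> = I" unfolding I_def by (intro nn_integral_cong) (metis H(3))
    finally show ?thesis .
  qed
  have "(\<integral>\<^sup>+x. (\<integral>\<^sup>+y. ennreal (w x * w y * H x y) \<partial>M) \<partial>M) \<le>
     (\<integral>\<^sup>+x. (\<integral>\<^sup>+y. ennreal ((w x)\<^sup>2 / 2 * H x y) + ennreal ((w y)\<^sup>2 / 2 * H x y) \<partial>M) \<partial>M)"
    using am H(2) by (intro nn_integral_mono) (auto simp: ennreal_plus[symmetric] simp del: ennreal_plus intro!: ennreal_leI)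
  also have "\<dots> = (\<integral>\<^sup>+x. (\<integral>\<^sup>+y. ennreal ((w x)\<^sup>2 / 2 * H x y) \<partial>M) + (\<integral>\<^sup>+y. ennreal ((w y)\<^sup>2 / 2 * H x y) \<partial>M) \<partial>M)"
    by (intro nn_integral_cong nn_integral_add) auto
  also have "\<dots> = (\<integral>\<^sup>+x. (\<integral>\<^sup>+y. ennreal ((w x)\<^sup>2 / 2 * H x y) \<partial>M) \<partial>M) + (\<integral>\<^sup>+x. (\<integral>\<^sup>+y. ennreal ((w y)\<^sup>2 / 2 * H x y) \<partial>M) \<partial>M)"
    by (rule nn_integral_add) measurable
  also have "\<dots> = I + I" unfolding swap by (simp only: I_def)
  also have "I \<le> (\<integral>\<^sup>+x. ennreal ((w x)\<^sup>2 / 2) * B \<partial>M)"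
    unfolding I_def
  proof (rule nn_integral_mono)
    fix x assume x: "x \<in> space M"
    have "(\<integral>\<^sup>+y. ennreal ((w x)\<^sup>2 / 2 * H x y) \<partial>M) = ennreal ((w x)\<^sup>2 / 2) * (\<integral>\<^sup>+y. ennreal (H x y) \<partial>M)"
      using x H(2) by (subst nn_integral_cmult[symmetric]) (auto simp: ennreal_mult'[symmetric] mult.commute)
    also have "\<dots> \<le> ennreal ((w x)\<^sup>2 / 2) * B" using B[OF x] by (rule mult_left_mono) simp
    finally show "(\<integral>\<^sup>+y. ennreal ((w x)\<^sup>2 / 2 * H x y) \<partial>M) \<le> ennreal ((w x)\<^sup>2 / 2) * B" .
  qed
  also have "\<dots> = B * (\<integral>\<^sup>+x. ennreal ((w x)\<^sup>2 / 2) \<partial>M)"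
    by (subst nn_integral_multc) (auto simp: mult.commute)
  finally have "(\<integral>\<^sup>+x. (\<integral>\<^sup>+y. ennreal (w x * w y * H x y) \<partial>M) \<partial>M) \<le>
     B * ((\<integral>\<^sup>+x. ennreal ((w x)\<^sup>2 / 2) \<partial>M) + (\<integral>\<^sup>+x. ennreal ((w x)\<^sup>2 / 2) \<partial>M))"
    by (simp add: distrib_left add_mono)
  also have "(\<integral>\<^sup>+x. ennreal ((w x)\<^sup>2 / 2) \<partial>M) + (\<integral>\<^sup>+x. ennreal ((w x)\<^sup>2 / 2) \<partial>M) = (\<integral>\<^sup>+x. ennreal ((w x)\<^sup>2) \<partial>M)"
    by (subst nn_integral_add[symmetric]) (auto simp: ennreal_plus[symmetric] simp del: ennreal_plus)
  finally show ?thesis .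
qed

text \<open>Here k is the kernel of an operator from functions on N to functions on M, and H
  majorizes the kernel of this operator composed with its adjoint. The majorant
  \<open>\<kappa>\<close> serves to justify exchanges of integrals; the constant B comes from H
  alone.\<close>

locale schur_kernel =
  fixes M :: "'a measure" and N :: "'b measure" and k :: "'a \<Rightarrow> 'b \<Rightarrow> complex"
    and \<kappa> :: "'b \<Rightarrow> real" and H :: "'a \<Rightarrow> 'a \<Rightarrow> real" and B :: real
  assumes M: "sigma_finite_measure M" and N: "sigma_finite_measure N"
    and k_meas [measurable]: "case_prod k \<in> borel_measurable (M \<Otimes>\<^sub>M N)"
    and \<kappa>_meas [measurable]: "\<kappa> \<in> borel_measurable N"
    and k_le: "\<And>x \<xi>. x \<in> space M \<Longrightarrow> \<xi> \<in> space N \<Longrightarrow> norm (k x \<xi>) \<le> \<kappa> \<xi>"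
    and \<kappa>_L2: "integrable N (\<lambda>\<xi>. (\<kappa> \<xi>)\<^sup>2)"
    and H_meas [measurable]: "case_prod H \<in> borel_measurable (M \<Otimes>\<^sub>M M)"
    and H_nonneg: "\<And>x y. 0 \<le> H x y" and H_sym: "\<And>x y. H x y = H y x"
    and B_pos: "B > 0" and B: "\<And>x. x \<in> space M \<Longrightarrow> (\<integral>\<^sup>+y. ennreal (H x y) \<partial>M) \<le> ennreal B"
    and kernel: "\<And>x y. x \<in> space M \<Longrightarrow> y \<in> space M \<Longrightarrow> norm (LINT \<xi>|N. k x \<xi> * cnj (k y \<xi>)) \<le> H x y"
begin

sublocale M: sigma_finite_measure M by (rule M)
sublocale N: sigma_finite_measure N by (rule N)
sublocale MN: pair_sigma_finite M N ..

lemma \<kappa>_nonneg: "x \<in> space M \<Longrightarrow> \<xi> \<in> space N \<Longrightarrow> 0 \<le> \<kappa> \<xi>"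
  using k_le norm_ge_zero order_trans by blast

lemma k_meas1 [measurable]: "x \<in> space M \<Longrightarrow> k x \<in> borel_measurable N"
  using measurable_compose_Pair1[OF _ k_meas] by simp

lemma integrable_product_bound:
  assumes u: "integrable M (u :: 'a \<Rightarrow> real)" and v: "integrable N v" and f: "case_prod f \<in> borel_measurable (M \<Otimes>\<^sub>M N)"
    and le: "\<And>x \<xi>. x \<in> space M \<Longrightarrow> \<xi> \<in> space N \<Longrightarrow> norm (f x \<xi> :: complex) \<le> norm (u x) * norm (v \<xi> :: real)"
  shows "integrable (M \<Otimes>\<^sub>M N) (case_prod f)"
proof (rule integrableI_bounded[OF f])
  have [measurable]: "u \<in> borel_measurable M" "v \<in> borel_measurable N" using u v by auto
  have "(\<integral>\<^sup>+p. ennreal (norm (case_prod f p)) \<partial>(M \<Otimes>\<^sub>M N)) \<le> (\<integral>\<^sup>+p. ennreal (norm (u (fst p))) * ennreal (norm (v (snd p))) \<partial>(M \<Otimes>\<^sub>M N))"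
    using le by (intro nn_integral_mono) (auto simp: space_pair_measure ennreal_mult[symmetric] intro!: ennreal_leI)
  also have "\<dots> = (\<integral>\<^sup>+x. (\<integral>\<^sup>+y. ennreal (norm (u x)) * ennreal (norm (v y)) \<partial>N) \<partial>M)"
    by (subst N.nn_integral_fst[symmetric]) auto
  also have "\<dots> = (\<integral>\<^sup>+x. ennreal (norm (u x)) \<partial>M) * (\<integral>\<^sup>+y. ennreal (norm (v y)) \<partial>N)"
    by (simp add: nn_integral_cmult nn_integral_multc)
  also have "\<dots> < \<infinity>" using u v by (simp add: integrable_iff_bounded ennreal_mult_less_top)
  finally show "(\<integral>\<^sup>+p. ennreal (norm (case_prod f p)) \<partial>(M \<Otimes>\<^sub>M N)) < \<infinity>" .
qed

text \<open>Expanding the squared norm of the transposed operator and exchanging integrals produces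
  a double integral over M of w x * cnj (w y) against the composed kernel, to which the bilinear
  Schur bound applies. Integrability of w is what Fubini requires.\<close>

lemma dual_bound:
  assumes w: "integrable M (w :: 'a \<Rightarrow> complex)"
  shows "L2_mass N (\<lambda>\<xi>. LINT x|M. w x * k x \<xi>) \<le> ennreal B * L2_mass M w"
    and "integrable N (\<lambda>\<xi>. (norm (LINT x|M. w x * k x \<xi>))\<^sup>2)"
proof -
  have [measurable]: "w \<in> borel_measurable M" using w by auto
  define W where "W \<xi> = (LINT x|M. w x * k x \<xi>)" for \<xi>
  define L where "L = (LINT x|M. norm (w x))"
  interpret NM: pair_sigma_finite N M ..
  have Wm [measurable]: "W \<in> borel_measurable N"
    unfolding W_def by (rule M.borel_measurable_lebesgue_integral) measurable
  have L: "L \<ge> 0" unfolding L_def by simp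
  have W_le: "norm (W \<xi>) \<le> L * \<kappa> \<xi>" if \<xi>: "\<xi> \<in> space N" for \<xi>
  proof -
    have "norm (W \<xi>) \<le> (LINT x|M. norm (w x * k x \<xi>))" unfolding W_def by (rule integral_norm_bound)
    also have "\<dots> \<le> (LINT x|M. norm (w x) * \<kappa> \<xi>)"
      using w k_le[OF _ \<xi>] by (intro integral_mono') (auto simp: norm_mult intro!: mult_left_mono mult_nonneg_nonneg \<kappa>_nonneg \<xi>)
    finally show ?thesis by (simp add: L_def mult.commute)
  qed
  have W2: "(norm (W \<xi>))\<^sup>2 \<le> L\<^sup>2 * (\<kappa> \<xi>)\<^sup>2" if "\<xi> \<in> space N" for \<xi>
    using power_mono[OF W_le[OF that], of 2] by (simp add: power_mult_distrib)
  show int: "integrable N (\<lambda>\<xi>. (norm (LINT x|M. w x * k x \<xi>))\<^sup>2)"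
    unfolding W_def[symmetric]
    by (rule Bochner_Integration.integrable_bound[OF integrable_mult_right[OF \<kappa>_L2, of "L\<^sup>2"]])
       (auto simp: W2)
  have i1: "integrable (M \<Otimes>\<^sub>M N) (\<lambda>(x, \<xi>). w x * k x \<xi> * cnj (W \<xi>))"
  proof (rule integrable_product_bound[of "\<lambda>x. norm (w x)" "\<lambda>\<xi>. L * (\<kappa> \<xi>)\<^sup>2"])
    fix x \<xi> assume s: "x \<in> space M" "\<xi> \<in> space N"
    have "norm (k x \<xi>) * norm (W \<xi>) \<le> \<kappa> \<xi> * (L * \<kappa> \<xi>)"
      using k_le[OF s] W_le[OF s(2)] by (intro mult_mono) (auto simp: \<kappa>_nonneg[OF s])
    then have "norm (w x) * (norm (k x \<xi>) * norm (W \<xi>)) \<le> norm (w x) * (\<kappa> \<xi> * (L * \<kappa> \<xi>))"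
      by (rule mult_left_mono) simp
    then show "norm (w x * k x \<xi> * cnj (W \<xi>)) \<le> norm (norm (w x)) * norm (L * (\<kappa> \<xi>)\<^sup>2)"
      using L by (simp add: norm_mult power2_eq_square mult_ac)
  next
    show "(\<lambda>(x, \<xi>). w x * k x \<xi> * cnj (W \<xi>)) \<in> borel_measurable (M \<Otimes>\<^sub>M N)"
      by measurable
  qed (use w \<kappa>_L2 in auto)
  have i2: "integrable (M \<Otimes>\<^sub>M N) (\<lambda>(y, \<xi>). cnj (w y) * (k x \<xi> * cnj (k y \<xi>)))" if x: "x \<in> space M" for x
  proof (rule integrable_product_bound[of "\<lambda>x. norm (w x)" "\<lambda>\<xi>. (\<kappa> \<xi>)\<^sup>2"])
    show "(\<lambda>(y, \<xi>). cnj (w y) * (k x \<xi> * cnj (k y \<xi>))) \<in> borel_measurable (M \<Otimes>\<^sub>M N)"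
      using k_meas1[OF x] by measurable
    fix y \<xi> assume s: "y \<in> space M" "\<xi> \<in> space N"
    have "norm (k x \<xi>) * norm (k y \<xi>) \<le> \<kappa> \<xi> * \<kappa> \<xi>"
      using k_le[OF s] k_le[OF x s(2)] by (intro mult_mono) (auto simp: \<kappa>_nonneg[OF s])
    then have "norm (w y) * (norm (k x \<xi>) * norm (k y \<xi>)) \<le> norm (w y) * (\<kappa> \<xi> * \<kappa> \<xi>)"
      by (rule mult_left_mono) simp
    then show "norm (cnj (w y) * (k x \<xi> * cnj (k y \<xi>))) \<le> norm (norm (w y)) * norm ((\<kappa> \<xi>)\<^sup>2)"
      by (simp add: norm_mult power2_eq_square)
  qed (use w \<kappa>_L2 in auto)
  have "complex_of_real (LINT \<xi>|N. (norm (W \<xi>))\<^sup>2) = (LINT \<xi>|N. W \<xi> * cnj (W \<xi>))"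
    by (simp add: complex_norm_square[symmetric] del: of_real_power)
  also have "\<dots> = (LINT \<xi>|N. (LINT x|M. w x * k x \<xi> * cnj (W \<xi>)))"
    by (simp add: W_def)
  also have "\<dots> = (LINT x|M. (LINT \<xi>|N. w x * k x \<xi> * cnj (W \<xi>)))"
    by (rule MN.Fubini_integral[OF i1])
  also have "\<dots> = (LINT x|M. w x * (LINT y|M. cnj (w y) * (LINT \<xi>|N. k x \<xi> * cnj (k y \<xi>))))"
  proof (rule Bochner_Integration.integral_cong[OF refl])
    fix x assume x: "x \<in> space M"
    have "(LINT \<xi>|N. w x * k x \<xi> * cnj (W \<xi>)) = w x * (LINT \<xi>|N. k x \<xi> * cnj (W \<xi>))"
      by (simp add: mult.assoc)
    also have "(LINT \<xi>|N. k x \<xi> * cnj (W \<xi>)) = (LINT \<xi>|N. (LINT y|M. cnj (w y) * (k x \<xi> * cnj (k y \<xi>))))"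
    proof (rule Bochner_Integration.integral_cong[OF refl])
      fix \<xi>
      have "cnj (W \<xi>) = (LINT y|M. cnj (w y * k y \<xi>))" 
        unfolding W_def by (rule Bochner_Integration.integral_cnj[symmetric])
      then have "k x \<xi> * cnj (W \<xi>) = (LINT y|M. k x \<xi> * cnj (w y * k y \<xi>))" by simp
      then show "k x \<xi> * cnj (W \<xi>) = (LINT y|M. cnj (w y) * (k x \<xi> * cnj (k y \<xi>)))"
        by (simp add: mult_ac)
    qed
    also have "\<dots> = (LINT y|M. (LINT \<xi>|N. cnj (w y) * (k x \<xi> * cnj (k y \<xi>))))"
      by (rule MN.Fubini_integral[OF i2[OF x]])
    finally show "(LINT \<xi>|N. w x * k x \<xi> * cnj (W \<xi>)) =
        w x * (LINT y|M. cnj (w y) * (LINT \<xi>|N. k x \<xi> * cnj (k y \<xi>)))" by simp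
  qed
  finally have eq: "complex_of_real (LINT \<xi>|N. (norm (W \<xi>))\<^sup>2) = \<dots>" .
  have "L2_mass N W = ennreal (LINT \<xi>|N. (norm (W \<xi>))\<^sup>2)"
    using int by (intro nn_integral_eq_integral) (auto simp: W_def)
  also have "\<dots> = ennreal (norm (complex_of_real (LINT \<xi>|N. (norm (W \<xi>))\<^sup>2)))"
    by simp
  also have "\<dots> \<le> (\<integral>\<^sup>+x. ennreal (norm (w x * (LINT y|M. cnj (w y) * (LINT \<xi>|N. k x \<xi> * cnj (k y \<xi>))))) \<partial>M)"
    unfolding eq by (rule norm_integral_le_nn_integral)
  also have "\<dots> \<le> (\<integral>\<^sup>+x. (\<integral>\<^sup>+y. ennreal (norm (w x) * norm (w y) * H x y) \<partial>M) \<partial>M)"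
  proof (rule nn_integral_mono)
    fix x assume x: "x \<in> space M"
    have [measurable]: "H x \<in> borel_measurable M" using measurable_compose_Pair1[OF x H_meas] by simp
    have "ennreal (norm (w x * (LINT y|M. cnj (w y) * (LINT \<xi>|N. k x \<xi> * cnj (k y \<xi>)))))
       = ennreal (norm (w x)) * ennreal (norm (LINT y|M. cnj (w y) * (LINT \<xi>|N. k x \<xi> * cnj (k y \<xi>))))"
      by (simp add: norm_mult ennreal_mult)
    also have "\<dots> \<le> ennreal (norm (w x)) * (\<integral>\<^sup>+y. ennreal (norm (cnj (w y) * (LINT \<xi>|N. k x \<xi> * cnj (k y \<xi>)))) \<partial>M)"
      by (intro mult_left_mono norm_integral_le_nn_integral) simp
    also have "\<dots> \<le> ennreal (norm (w x)) * (\<integral>\<^sup>+y. ennreal (norm (w y) * H x y) \<partial>M)"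
      using kernel[OF x] by (intro mult_left_mono nn_integral_mono ennreal_leI) (auto simp: norm_mult intro!: mult_left_mono)
    also have "\<dots> = (\<integral>\<^sup>+y. ennreal (norm (w x)) * ennreal (norm (w y) * H x y) \<partial>M)"
      by (subst nn_integral_cmult) auto
    finally show "ennreal (norm (w x * (LINT y|M. cnj (w y) * (LINT \<xi>|N. k x \<xi> * cnj (k y \<xi>)))))
        \<le> (\<integral>\<^sup>+y. ennreal (norm (w x) * norm (w y) * H x y) \<partial>M)"
      using H_nonneg by (simp add: ennreal_mult'[symmetric] mult.assoc)
  qed
  also have "\<dots> \<le> ennreal B * L2_mass M w"
    using B H_nonneg H_sym by (intro schur_bilinear_bound M) auto
  finally show "L2_mass N (\<lambda>\<xi>. LINT x|M. w x * k x \<xi>) \<le> ennreal B * L2_mass M w"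
    by (simp add: W_def)
qed

text \<open>The adjoint bound is applied to the truncation of the conjugate of the image of \<open>g\<close>.\<close>

lemma bound:
  assumes [measurable]: "g \<in> borel_measurable N" and g: "integrable N (\<lambda>\<xi>. (norm (g \<xi> :: complex))\<^sup>2)"
  shows "L2_mass M (\<lambda>x. LINT \<xi>|N. k x \<xi> * g \<xi>) \<le> ennreal B * L2_mass N g"
proof -
  define S where "S x = (LINT \<xi>|N. k x \<xi> * g \<xi>)" for x
  define G where "G = (LINT \<xi>|N. (norm (g \<xi>))\<^sup>2)"
  have [measurable]: "S \<in> borel_measurable M"
    unfolding S_def by (rule N.borel_measurable_lebesgue_integral) measurable
  have kg: "integrable N (\<lambda>\<xi>. \<kappa> \<xi> * norm (g \<xi>))"
  proof (rule Bochner_Integration.integrable_bound[of N "\<lambda>\<xi>. (\<kappa> \<xi>)\<^sup>2 + (norm (g \<xi>))\<^sup>2"])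
    show "AE \<xi> in N. norm (\<kappa> \<xi> * norm (g \<xi>)) \<le> norm ((\<kappa> \<xi>)\<^sup>2 + (norm (g \<xi>))\<^sup>2)"
    proof (intro AE_I2)
      fix \<xi>
      have "2 * (\<bar>\<kappa> \<xi>\<bar> * norm (g \<xi>)) \<le> (\<kappa> \<xi>)\<^sup>2 + (norm (g \<xi>))\<^sup>2" "0 \<le> \<bar>\<kappa> \<xi>\<bar> * norm (g \<xi>)"
        using sum_squares_bound[of "\<bar>\<kappa> \<xi>\<bar>" "norm (g \<xi>)"] by auto
      then have "\<bar>\<kappa> \<xi>\<bar> * norm (g \<xi>) \<le> (\<kappa> \<xi>)\<^sup>2 + (norm (g \<xi>))\<^sup>2" by linarith
      then show "norm (\<kappa> \<xi> * norm (g \<xi>)) \<le> norm ((\<kappa> \<xi>)\<^sup>2 + (norm (g \<xi>))\<^sup>2)"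
        by (simp add: abs_mult)
    qed
  qed (use g \<kappa>_L2 in auto)
  define L where "L = (LINT \<xi>|N. \<kappa> \<xi> * norm (g \<xi>))"
  \<comment> \<open>Since \<open>\<kappa>\<close> and g are square integrable, S is bounded; its
    truncation to a set of finite measure is therefore integrable, as \<open>dual_bound\<close>
    demands.\<close>
  have S_le: "norm (S x) \<le> L" if x: "x \<in> space M" for x
  proof -
    have "norm (S x) \<le> (LINT \<xi>|N. norm (k x \<xi> * g \<xi>))" unfolding S_def by (rule integral_norm_bound)
    also have "\<dots> \<le> L" unfolding L_def
      using kg k_le[OF x] by (intro integral_mono') (auto simp: norm_mult intro!: mult_right_mono mult_nonneg_nonneg \<kappa>_nonneg[OF x])
    finally show ?thesis .
  qed
  have trunc: "(\<integral>\<^sup>+x. ennreal ((norm (S x))\<^sup>2) * indicator A x \<partial>M) \<le> ennreal (B * G)"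
    if A [measurable]: "A \<in> sets M" and fin: "emeasure M A < \<infinity>" for A
  proof -
    \<comment> \<open>With this w the integral of w * S is P, the mass of S on A; Fubini turns it
      into the pairing of W with g.\<close>
    define w where "w x = complex_of_real (indicator A x) * cnj (S x)" for x
    have [measurable]: "w \<in> borel_measurable M" unfolding w_def by measurable
    have iA: "integrable M (\<lambda>x. c * indicator A x :: real)" for c
      using fin A by (intro integrable_mult_right integrable_real_indicator) auto
    have w: "integrable M w"
      by (rule Bochner_Integration.integrable_bound[OF iA[of L]])
         (auto simp: w_def norm_mult intro!: AE_I2 order_trans[OF S_le abs_ge_self] split: split_indicator)
    have w2: "(norm (w x))\<^sup>2 = (norm (S x))\<^sup>2 * indicator A x" for x
      by (auto simp: w_def norm_mult indicator_def)
    have intS: "integrable M (\<lambda>x. (norm (w x))\<^sup>2)"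
      by (rule Bochner_Integration.integrable_bound[OF iA[of "L\<^sup>2"]])
         (auto simp: w2 intro!: AE_I2 power_mono S_le split: split_indicator)
    define P where "P = (LINT x|M. (norm (w x))\<^sup>2)"
    define W where "W \<xi> = (LINT x|M. w x * k x \<xi>)" for \<xi>
    have Wm [measurable]: "W \<in> borel_measurable N"
    proof -
      have [measurable]: "w \<in> borel_measurable M" using w by auto
      interpret NM: pair_sigma_finite N M ..
      show ?thesis unfolding W_def by (rule M.borel_measurable_lebesgue_integral) measurable
    qed
    have intW: "integrable N (\<lambda>\<xi>. (norm (W \<xi>))\<^sup>2)" unfolding W_def by (rule dual_bound(2)[OF w])
    have WP: "(LINT \<xi>|N. (norm (W \<xi>))\<^sup>2) \<le> B * P"
    proof -
      have "ennreal (LINT \<xi>|N. (norm (W \<xi>))\<^sup>2) \<le> ennreal B * L2_mass M w"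
        using dual_bound(1)[OF w] intW by (simp add: nn_integral_eq_integral W_def)
      also have "\<dots> = ennreal (B * P)"
        using intS B_pos by (simp add: nn_integral_eq_integral P_def ennreal_mult)
      finally show ?thesis using B_pos by (simp add: P_def)
    qed
    have fub: "integrable (M \<Otimes>\<^sub>M N) (\<lambda>(x, \<xi>). w x * k x \<xi> * g \<xi>)"
    proof (rule integrable_product_bound[of "\<lambda>x. norm (w x)" "\<lambda>\<xi>. \<kappa> \<xi> * norm (g \<xi>)"])
      show "(\<lambda>(x, \<xi>). w x * k x \<xi> * g \<xi>) \<in> borel_measurable (M \<Otimes>\<^sub>M N)"
        by measurable
      fix x \<xi> assume s: "x \<in> space M" "\<xi> \<in> space N"
      have "norm (w x) * norm (k x \<xi>) * norm (g \<xi>) \<le> norm (w x) * \<kappa> \<xi> * norm (g \<xi>)"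
        using k_le[OF s] by (intro mult_right_mono mult_left_mono) auto
      then show "norm (w x * k x \<xi> * g \<xi>) \<le> norm (norm (w x)) * norm (\<kappa> \<xi> * norm (g \<xi>))"
        using \<kappa>_nonneg[OF s] by (simp add: norm_mult abs_mult mult.assoc)
    qed (use w kg in auto)
    have "complex_of_real P = (LINT x|M. w x * S x)"
      unfolding P_def integral_complex_of_real[symmetric]
      by (intro Bochner_Integration.integral_cong)
         (auto simp: w_def w2 indicator_def complex_norm_square mult.commute simp del: of_real_power)
    also have "\<dots> = (LINT x|M. (LINT \<xi>|N. w x * k x \<xi> * g \<xi>))"
      by (simp add: S_def mult.assoc)
    also have "\<dots> = (LINT \<xi>|N. (LINT x|M. w x * k x \<xi> * g \<xi>))"
      by (rule MN.Fubini_integral[OF fub, symmetric])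
    also have "\<dots> = (LINT \<xi>|N. W \<xi> * g \<xi>)" by (simp add: W_def)
    finally have cP: "complex_of_real P = (LINT \<xi>|N. W \<xi> * g \<xi>)" .
    have "P \<ge> 0" unfolding P_def by (intro Bochner_Integration.integral_nonneg) simp
    then have "P = norm (complex_of_real P)" by simp
    also have "\<dots> = norm (LINT \<xi>|N. W \<xi> * g \<xi>)" by (simp only: cP)
    also have "\<dots> \<le> (LINT \<xi>|N. norm (W \<xi> * g \<xi>))" by (rule integral_norm_bound)
    \<comment> \<open>Arithmetic-geometric mean inequality with weight B: by the dual bound the
      first term integrates to at most P / 2, which is absorbed on the left.\<close>
    also have "\<dots> \<le> (LINT \<xi>|N. (norm (W \<xi>))\<^sup>2 / (2 * B) + B / 2 * (norm (g \<xi>))\<^sup>2)"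
    proof (rule integral_mono')
      fix \<xi>
      have "2 * B * (norm (W \<xi>) * norm (g \<xi>)) \<le> (norm (W \<xi>))\<^sup>2 + (B * norm (g \<xi>))\<^sup>2"
        using sum_squares_bound[of "norm (W \<xi>)" "B * norm (g \<xi>)"] by (simp add: mult_ac)
      also have "\<dots> = 2 * B * ((norm (W \<xi>))\<^sup>2 / (2 * B) + B / 2 * (norm (g \<xi>))\<^sup>2)"
        using B_pos by (simp add: field_simps power2_eq_square)
      finally show "norm (W \<xi> * g \<xi>) \<le> (norm (W \<xi>))\<^sup>2 / (2 * B) + B / 2 * (norm (g \<xi>))\<^sup>2"
        using B_pos by (simp add: norm_mult)
    qed (use intW g B_pos in auto)
    also have "\<dots> = (LINT \<xi>|N. (norm (W \<xi>))\<^sup>2) / (2 * B) + B / 2 * G"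
      using intW g by (simp add: G_def)
    also have "\<dots> \<le> P / 2 + B / 2 * G" using WP B_pos by (simp add: field_simps)
    finally have "P \<le> B * G" by simp
    moreover have "(\<integral>\<^sup>+x. ennreal ((norm (S x))\<^sup>2) * indicator A x \<partial>M) = ennreal P"
      unfolding P_def by (subst nn_integral_eq_integral[symmetric, OF intS]) (auto simp: w2 ennreal_mult' ennreal_indicator)
    ultimately show ?thesis by (simp add: ennreal_leI)
  qed
  obtain A where A: "range A \<subseteq> sets M" "(\<Union>i. A i) = space M" "\<And>i::nat. emeasure M (A i) \<noteq> \<infinity>" "incseq A"
    using M.sigma_finite_incseq by metis
  have "L2_mass M S = (\<integral>\<^sup>+x. (SUP i. ennreal ((norm (S x))\<^sup>2) * indicator (A i) x) \<partial>M)"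
  proof (rule nn_integral_cong)
    fix x assume "x \<in> space M"
    then obtain i where i: "x \<in> A i" using A(2) by blast
    show "ennreal ((norm (S x))\<^sup>2) = (SUP i. ennreal ((norm (S x))\<^sup>2) * indicator (A i) x)"
    proof (rule antisym)
      show "ennreal ((norm (S x))\<^sup>2) \<le> (SUP i. ennreal ((norm (S x))\<^sup>2) * indicator (A i) x)"
        by (rule SUP_upper2[of i]) (use i in auto)
    qed (auto intro!: SUP_least simp: indicator_def)
  qed
  also have "\<dots> = (SUP i. (\<integral>\<^sup>+x. ennreal ((norm (S x))\<^sup>2) * indicator (A i) x \<partial>M))"
  proof (rule nn_integral_monotone_convergence_SUP)
    show "incseq (\<lambda>i x. ennreal ((norm (S x))\<^sup>2) * indicator (A i) x)"
      using A(4) by (auto simp: incseq_def le_fun_def indicator_def)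
  qed (use A in auto)
  also have "\<dots> \<le> ennreal (B * G)"
  proof (rule SUP_least)
    fix i show "(\<integral>\<^sup>+x. ennreal ((norm (S x))\<^sup>2) * indicator (A i) x \<partial>M) \<le> ennreal (B * G)"
      by (rule trunc) (use A in \<open>auto simp: less_top\<close>)
  qed
  also have "\<dots> = ennreal B * L2_mass N g"
    using g B_pos by (simp add: G_def nn_integral_eq_integral ennreal_mult)
  finally show ?thesis by (simp add: S_def)
qed

end

section \<open>Plancherel's inequality\<close>

lemma borel_measurable_vec_nth_compose [measurable (raw)]:
  "f \<in> borel_measurable M \<Longrightarrow> (\<lambda>x. (f x :: real^'n) $ i) \<in> borel_measurable M"
  by (rule measurable_compose[of f M borel "\<lambda>x. x $ i"])
     (auto intro!: borel_measurable_continuous_onI continuous_intros)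

text \<open>The oscillating exponential has no square integrable majorant in \<xi>. A Gaussian
  factor provides one, and the composed kernel becomes a Gaussian in x - y whose integral is (2
  pi)^n for every \<epsilon>; so Schur's test gives the sharp constant and Fatou's lemma removes the
  factor.\<close>

lemma plancherel_le:
  fixes u :: "real^'n \<Rightarrow> complex"
  assumes u: "integrable lborel u" and \<sigma>: "\<bar>\<sigma>\<bar> = 1"
  shows "L2_mass lborel (\<lambda>\<xi>. LINT x|lborel. u x * iexp (\<sigma> * (x \<bullet> \<xi>)))
    \<le> ennreal ((2 * pi) ^ CARD('n)) * L2_mass lborel u"
proof -
  have [measurable]: "u \<in> borel_measurable borel" using u by auto
  define F where "F \<xi> = (LINT x|lborel. u x * iexp (\<sigma> * (x \<bullet> \<xi>)))" for \<xi> :: "real^'n"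
  define Q where "Q = ennreal ((2 * pi) ^ CARD('n)) * L2_mass lborel u"
  have [measurable]: "F \<in> borel_measurable borel"
  proof -
    have "F \<in> borel_measurable lborel" unfolding F_def
      by (rule lborel.borel_measurable_lebesgue_integral) measurable
    then show ?thesis by simp
  qed
  have reg: "L2_mass lborel (\<lambda>\<xi>. F \<xi> * complex_of_real (exp (- \<epsilon> * (norm \<xi>)\<^sup>2 / 2))) \<le> Q"
    if \<epsilon>: "\<epsilon> > 0" for \<epsilon>
  proof -
    define k where "k x \<xi> = iexp (\<sigma> * (x \<bullet> \<xi>)) * complex_of_real (exp (- \<epsilon> * (norm \<xi>)\<^sup>2 / 2))" for x \<xi> :: "real^'n"
    \<comment> \<open>One-dimensional factor of the Fourier transform of exp(-\<epsilon> |\<xi>|^2),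
      the square of the regularizing factor.\<close>
    define h where "h t = sqrt (pi / \<epsilon>) * exp (- t\<^sup>2 / (4 * \<epsilon>))" for t :: real
    define H where "H x y = (\<Prod>i\<in>UNIV. h (x $ i - y $ i))" for x y :: "real^'n"
    have [measurable]: "h \<in> borel_measurable borel" unfolding h_def[abs_def] by measurable
    have h0: "h t \<ge> 0" for t using \<epsilon> by (simp add: h_def)
    have hs: "h (s - t) = h (t - s)" for s t by (simp add: h_def power2_commute)
    have H: "H x y = sqrt (pi / \<epsilon>) ^ CARD('n) * exp (- (norm (x - y))\<^sup>2 / (4 * \<epsilon>))" for x y
      by (simp add: H_def h_def prod.distrib exp_sum[symmetric] norm_vec_power2 sum_divide_distrib sum_negf)
    have hi: "(\<integral>\<^sup>+t. ennreal (h t) \<partial>lborel) = ennreal (2 * pi)"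
    proof -
      have i: "integrable lborel (\<lambda>t. complex_of_real (exp (- t\<^sup>2 / (4 * \<epsilon>))))"
        "(LINT t|lborel. complex_of_real (exp (- t\<^sup>2 / (4 * \<epsilon>)))) = complex_of_real (sqrt (4 * pi * \<epsilon>))"
      proof -
        define s where "s = 1 / (2 * \<epsilon>)"
        have s: "s > 0" "- s * t\<^sup>2 / 2 = - t\<^sup>2 / (4 * \<epsilon>)" "2 * pi / s = 4 * pi * \<epsilon>" for t
          using \<epsilon> by (simp_all add: s_def)
        have e1: "iexp (0 * t) * complex_of_real (exp (- s * t\<^sup>2 / 2)) = complex_of_real (exp (- t\<^sup>2 / (4 * \<epsilon>)))" for t
          unfolding s(2) by simp
        have e2: "sqrt (2 * pi / s) * exp (- 0\<^sup>2 / (2 * s)) = sqrt (4 * pi * \<epsilon>)" unfolding s(3) by simp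
        note G = gaussian_fourier_real[of s 0, OF s(1)]
        show "integrable lborel (\<lambda>t. complex_of_real (exp (- t\<^sup>2 / (4 * \<epsilon>))))"
          "(LINT t|lborel. complex_of_real (exp (- t\<^sup>2 / (4 * \<epsilon>)))) = complex_of_real (sqrt (4 * pi * \<epsilon>))"
          using G unfolding e1 e2 by blast+
      qed
      then have j: "integrable lborel (\<lambda>t. exp (- t\<^sup>2 / (4 * \<epsilon>)))"
        using complex_of_real_integrable_eq by blast
      have j2: "(LINT t|lborel. exp (- t\<^sup>2 / (4 * \<epsilon>))) = sqrt (4 * pi * \<epsilon>)"
        using i(2) by (simp only: integral_complex_of_real of_real_eq_iff)
      have "(\<integral>\<^sup>+t. ennreal (h t) \<partial>lborel) = ennreal (LINT t|lborel. h t)"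
        using j h0 by (intro nn_integral_eq_integral) (auto simp: h_def)
      also have "(LINT t|lborel. h t) = sqrt (pi / \<epsilon>) * sqrt (4 * pi * \<epsilon>)"
        unfolding h_def by (simp only: Bochner_Integration.integral_mult_right_zero j2)
      also have "\<dots> = sqrt ((2 * pi)\<^sup>2)"
        using \<epsilon> by (simp add: real_sqrt_mult[symmetric] power2_eq_square)
      also have "\<dots> = 2 * pi" by (rule real_sqrt_unique) simp_all
      finally show ?thesis .
    qed
    interpret schur_kernel lborel lborel k "\<lambda>\<xi>. exp (- \<epsilon> * (norm \<xi>)\<^sup>2 / 2)" H "(2 * pi) ^ CARD('n)"
    proof
      show "case_prod k \<in> borel_measurable (lborel \<Otimes>\<^sub>M lborel)"
        unfolding k_def by measurable
      show "case_prod H \<in> borel_measurable (lborel \<Otimes>\<^sub>M lborel)"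
        unfolding H_def by measurable
      have "integrable lborel (\<lambda>\<xi>::real^'n. complex_of_real (exp (- (2 * \<epsilon>) * (norm \<xi>)\<^sup>2 / 2)))"
        using gaussian_fourier(1)[of "2 * \<epsilon>" "0 :: real^'n"] \<epsilon> by (simp only: inner_zero_left) simp
      then have "integrable lborel (\<lambda>\<xi>::real^'n. exp (- (2 * \<epsilon>) * (norm \<xi>)\<^sup>2 / 2))"
        using complex_of_real_integrable_eq by blast
      then show "integrable lborel (\<lambda>\<xi>::real^'n. (exp (- \<epsilon> * (norm \<xi>)\<^sup>2 / 2))\<^sup>2)"
        by (simp add: exp_double[symmetric])
      show "(\<integral>\<^sup>+y. ennreal (H x y) \<partial>lborel) \<le> ennreal ((2 * pi) ^ CARD('n))" for x
        unfolding H_def using lborel_vec_nn_integral_prod[of h x] h0 by (simp add: hi ennreal_power)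
      fix x y :: "real^'n"
      have "k x \<xi> * cnj (k y \<xi>) = iexp ((\<sigma> *\<^sub>R (x - y)) \<bullet> \<xi>) * complex_of_real (exp (- (2 * \<epsilon>) * (norm \<xi>)\<^sup>2 / 2))" for \<xi>
      proof -
        have a: "exp (- (2 * \<epsilon>) * (norm \<xi>)\<^sup>2 / 2) = exp (- \<epsilon> * (norm \<xi>)\<^sup>2 / 2) * exp (- \<epsilon> * (norm \<xi>)\<^sup>2 / 2)"
          by (simp add: exp_add[symmetric])
        have b: "iexp ((\<sigma> *\<^sub>R (x - y)) \<bullet> \<xi>) = iexp (\<sigma> * (x \<bullet> \<xi>)) * cnj (iexp (\<sigma> * (y \<bullet> \<xi>)))"
          by (simp add: exp_cnj exp_add[symmetric] inner_diff_left algebra_simps)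
        show ?thesis unfolding k_def a b of_real_mult complex_cnj_mult complex_cnj_complex_of_real by (simp only: mult_ac)
      qed
      then have "(LINT \<xi>|lborel. k x \<xi> * cnj (k y \<xi>)) = complex_of_real (H x y)"
        using gaussian_fourier(2)[of "2 * \<epsilon>" "\<sigma> *\<^sub>R (x - y)"] \<epsilon> \<sigma> by (simp add: H)
      then show "norm (LINT \<xi>|lborel. k x \<xi> * cnj (k y \<xi>)) \<le> H x y"
        using h0 by (simp add: H_def prod_nonneg abs_of_nonneg del: of_real_prod)
    qed (use h0 hs in \<open>auto simp: H_def k_def norm_mult prod_nonneg lborel.sigma_finite_measure_axioms intro!: prod.cong\<close>)
    have "(LINT x|lborel. u x * k x \<xi>) = F \<xi> * complex_of_real (exp (- \<epsilon> * (norm \<xi>)\<^sup>2 / 2))" for \<xi>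
      by (simp add: k_def F_def mult.assoc[symmetric])
    then show ?thesis using dual_bound(1)[OF u] by (simp add: Q_def)
  qed
  have "L2_mass lborel F = (\<integral>\<^sup>+\<xi>. liminf (\<lambda>m. ennreal ((norm (F \<xi> * complex_of_real (exp (- (1 / real (Suc m)) * (norm \<xi>)\<^sup>2 / 2))))\<^sup>2)) \<partial>lborel)"
  proof (intro nn_integral_cong)
    fix \<xi> :: "real^'n"
    have "(\<lambda>m. (norm (F \<xi> * complex_of_real (exp (- (1 / real (Suc m)) * (norm \<xi>)\<^sup>2 / 2))))\<^sup>2) \<longlonglongrightarrow> (norm (F \<xi> * complex_of_real (exp (- 0 * (norm \<xi>)\<^sup>2 / 2))))\<^sup>2"
      by (intro tendsto_intros lim_1_over_n[THEN LIMSEQ_Suc]) auto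
    then have "(\<lambda>m. ennreal ((norm (F \<xi> * complex_of_real (exp (- (1 / real (Suc m)) * (norm \<xi>)\<^sup>2 / 2))))\<^sup>2)) \<longlonglongrightarrow> ennreal ((norm (F \<xi>))\<^sup>2)"
      by (intro tendsto_ennrealI) simp
    then show "ennreal ((norm (F \<xi>))\<^sup>2) = liminf (\<lambda>m. ennreal ((norm (F \<xi> * complex_of_real (exp (- (1 / real (Suc m)) * (norm \<xi>)\<^sup>2 / 2))))\<^sup>2))"
      by (rule lim_imp_Liminf[symmetric, rotated]) simp
  qed
  also have "\<dots> \<le> liminf (\<lambda>m. L2_mass lborel (\<lambda>\<xi>. F \<xi> * complex_of_real (exp (- (1 / real (Suc m)) * (norm \<xi>)\<^sup>2 / 2))))"
    by (intro nn_integral_liminf) measurable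
  also have "\<dots> \<le> liminf (\<lambda>m::nat. Q)"
    by (intro Liminf_mono always_eventually allI reg) simp
  finally show ?thesis by (simp add: F_def Q_def Liminf_const)
qed

section \<open>Iterated derivatives in one direction\<close>

text \<open>\<open>dbounds e \<nu> U k B f\<close>: the first \<open>k\<close> derivatives of \<open>f\<close> in direction \<open>e\<close> exist on \<open>U\<close>, the
  \<open>l\<close>-th one being bounded by \<open>B * \<nu> ^ l\<close>.\<close>

primrec dbounds :: "'a::real_normed_vector \<Rightarrow> real \<Rightarrow> 'a set \<Rightarrow> nat \<Rightarrow> real \<Rightarrow> ('a \<Rightarrow> complex) \<Rightarrow> bool" where
  "dbounds e \<nu> U 0 B f \<longleftrightarrow> (\<forall>x\<in>U. norm (f x) \<le> B)"
| "dbounds e \<nu> U (Suc k) B f \<longleftrightarrow> (\<forall>x\<in>U. norm (f x) \<le> B) \<and>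
     (\<exists>f'. (\<forall>x\<in>U. ((\<lambda>t. f (x + t *\<^sub>R e)) has_vector_derivative f' x) (at 0)) \<and> dbounds e \<nu> U k (\<nu> * B) f')"

lemma dbounds_norm: "dbounds e \<nu> U k B f \<Longrightarrow> x \<in> U \<Longrightarrow> norm (f x) \<le> B"
  by (cases k) auto

lemma dbounds_mono: "dbounds e \<nu> U k B f \<Longrightarrow> 0 \<le> \<nu> \<Longrightarrow> \<nu> \<le> \<nu>' \<Longrightarrow> 0 \<le> B \<Longrightarrow> B \<le> B' \<Longrightarrow> dbounds e \<nu>' U k B' f"
proof (induction k arbitrary: B B' f)
  case (Suc k)
  from Suc.prems obtain f' where f': "\<forall>x\<in>U. norm (f x) \<le> B" "\<forall>x\<in>U. ((\<lambda>t. f (x + t *\<^sub>R e)) has_vector_derivative f' x) (at 0)"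
    "dbounds e \<nu> U k (\<nu> * B) f'" by auto
  have "dbounds e \<nu>' U k (\<nu>' * B') f'"
    by (rule Suc.IH[OF f'(3)]) (use Suc.prems in \<open>auto intro: mult_mono mult_nonneg_nonneg\<close>)
  then show ?case using f' Suc.prems by (auto intro!: exI[of _ f'] order_trans[OF _ Suc.prems(5)])
qed auto

lemma dbounds_Suc: "dbounds e \<nu> U (Suc k) B f \<Longrightarrow> dbounds e \<nu> U k B f"
proof (induction k arbitrary: B f)
  case (Suc k)
  from Suc.prems obtain f' where f': "\<forall>x\<in>U. norm (f x) \<le> B" "\<forall>x\<in>U. ((\<lambda>t. f (x + t *\<^sub>R e)) has_vector_derivative f' x) (at 0)"
    "dbounds e \<nu> U (Suc k) (\<nu> * B) f'" unfolding dbounds.simps(2)[of e \<nu> U "Suc k"] by blast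
  show ?case using f'(1,2) Suc.IH[OF f'(3)] by auto
qed auto

lemma dbounds_subset: "dbounds e \<nu> U k B f \<Longrightarrow> U' \<subseteq> U \<Longrightarrow> dbounds e \<nu> U' k B f"
proof (induction k arbitrary: B f)
  case (Suc k)
  from Suc.prems obtain f' where f': "\<forall>x\<in>U. norm (f x) \<le> B" "\<forall>x\<in>U. ((\<lambda>t. f (x + t *\<^sub>R e)) has_vector_derivative f' x) (at 0)"
    "dbounds e \<nu> U k (\<nu> * B) f'" by auto
  show ?case using f'(1,2) Suc.IH[OF f'(3)] Suc.prems(2) by (auto intro!: exI[of _ f'])
qed auto

lemma dbounds_add:
  "dbounds e \<nu> U k B f \<Longrightarrow> dbounds e \<nu> U k C g \<Longrightarrow> dbounds e \<nu> U k (B + C) (\<lambda>x. f x + g x)"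
proof (induction k arbitrary: B C f g)
  case (Suc k)
  from Suc.prems(1) obtain f' where f': "\<forall>x\<in>U. norm (f x) \<le> B" "\<forall>x\<in>U. ((\<lambda>t. f (x + t *\<^sub>R e)) has_vector_derivative f' x) (at 0)"
    "dbounds e \<nu> U k (\<nu> * B) f'" by auto
  from Suc.prems(2) obtain g' where g': "\<forall>x\<in>U. norm (g x) \<le> C" "\<forall>x\<in>U. ((\<lambda>t. g (x + t *\<^sub>R e)) has_vector_derivative g' x) (at 0)"
    "dbounds e \<nu> U k (\<nu> * C) g'" by auto
  have "norm (f x + g x) \<le> B + C" if "x \<in> U" for x
    using f'(1) g'(1) that by (intro norm_triangle_le add_mono) auto
  then show ?case
    using f'(1,2) g'(1,2) Suc.IH[OF f'(3) g'(3)]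
    by (auto intro!: exI[of _ "\<lambda>x. f' x + g' x"] has_vector_derivative_add simp: distrib_left)
qed (auto intro: order_trans[OF norm_triangle_ineq] add_mono)

text \<open>Every differentiation doubles the number of Leibniz terms, hence 2^k; because both
  factors have the same scale \<nu>, all terms of one order obey the same bound.\<close>

lemma dbounds_mult:
  "dbounds e \<nu> U k B f \<Longrightarrow> dbounds e \<nu> U k C g \<Longrightarrow> 0 \<le> \<nu> \<Longrightarrow> 0 \<le> B \<Longrightarrow> 0 \<le> C \<Longrightarrow>
    dbounds e \<nu> U k (2 ^ k * B * C) (\<lambda>x. f x * g x)"
proof (induction k arbitrary: B C f g)
  case 0
  then show ?case by (auto simp: norm_mult intro!: mult_mono)
next
  case (Suc k)
  from Suc.prems(1) obtain f' where f': "\<forall>x\<in>U. norm (f x) \<le> B" "\<forall>x\<in>U. ((\<lambda>t. f (x + t *\<^sub>R e)) has_vector_derivative f' x) (at 0)"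
    "dbounds e \<nu> U k (\<nu> * B) f'" by auto
  from Suc.prems(2) obtain g' where g': "\<forall>x\<in>U. norm (g x) \<le> C" "\<forall>x\<in>U. ((\<lambda>t. g (x + t *\<^sub>R e)) has_vector_derivative g' x) (at 0)"
    "dbounds e \<nu> U k (\<nu> * C) g'" by auto
  let ?h = "\<lambda>x. f' x * g x + f x * g' x"
  have "norm (f x * g x) \<le> 2 ^ Suc k * B * C" if "x \<in> U" for x
  proof -
    have "norm (f x * g x) \<le> B * C" using f'(1) g'(1) that Suc.prems by (simp add: norm_mult mult_mono)
    also have "1 * (B * C) \<le> 2 ^ Suc k * (B * C)" using Suc.prems by (intro mult_right_mono mult_nonneg_nonneg) (auto simp: one_le_power simp del: power_Suc)
    finally show ?thesis by (simp add: mult.assoc)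
  qed
  moreover have "((\<lambda>t. f (x + t *\<^sub>R e) * g (x + t *\<^sub>R e)) has_vector_derivative ?h x) (at 0)" if "x \<in> U" for x
    using has_vector_derivative_mult[OF f'(2)[rule_format, OF that] g'(2)[rule_format, OF that]]
    by (simp add: add.commute)
  moreover have "dbounds e \<nu> U k (\<nu> * (2 ^ Suc k * B * C)) ?h"
  proof -
    have "dbounds e \<nu> U k (2 ^ k * (\<nu> * B) * C + 2 ^ k * B * (\<nu> * C)) ?h"
      using Suc.prems f'(3) g'(3) Suc.prems(1,2)[THEN dbounds_Suc]
      by (intro dbounds_add Suc.IH mult_nonneg_nonneg) auto
    then show ?thesis by (simp add: algebra_simps)
  qed
  ultimately show ?case by (auto intro!: exI[of _ ?h])
qed

lemma dbounds_const: "0 \<le> \<nu> \<Longrightarrow> norm c \<le> B \<Longrightarrow> dbounds e \<nu> U k B (\<lambda>x. c)"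
proof (induction k arbitrary: B c)
  case (Suc k)
  have "dbounds e \<nu> U k (\<nu> * B) (\<lambda>x. 0)"
    using Suc.prems norm_ge_zero[of c] by (intro Suc.IH) (auto simp del: norm_ge_zero)
  then show ?case using Suc.prems by (auto intro!: exI[of _ "\<lambda>x. 0"])
qed auto

lemma dbounds_cmult:
  "dbounds e \<nu> U k B f \<Longrightarrow> dbounds e \<nu> U k (norm c * B) (\<lambda>x. c * f x)"
proof (induction k arbitrary: B f)
  case (Suc k)
  from Suc.prems(1) obtain f' where f': "\<forall>x\<in>U. norm (f x) \<le> B" "\<forall>x\<in>U. ((\<lambda>t. f (x + t *\<^sub>R e)) has_vector_derivative f' x) (at 0)"
    "dbounds e \<nu> U k (\<nu> * B) f'" by auto
  have "norm (c * f x) \<le> norm c * B" if "x \<in> U" for x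
    using f'(1) that by (simp add: norm_mult mult_left_mono)
  moreover have "dbounds e \<nu> U k (\<nu> * (norm c * B)) (\<lambda>x. c * f' x)"
    using Suc.IH[OF f'(3)] by (simp add: mult_ac)
  ultimately show ?case using f'(2)
    by (auto intro!: exI[of _ "\<lambda>x. c * f' x"] has_vector_derivative_mult_right)
qed (auto simp: norm_mult mult_left_mono)

lemma dbounds_cnj: "dbounds e \<nu> U k B f \<Longrightarrow> dbounds e \<nu> U k B (\<lambda>x. cnj (f x))"
proof (induction k arbitrary: B f)
  case (Suc k)
  from Suc.prems(1) obtain f' where f': "\<forall>x\<in>U. norm (f x) \<le> B" "\<forall>x\<in>U. ((\<lambda>t. f (x + t *\<^sub>R e)) has_vector_derivative f' x) (at 0)"
    "dbounds e \<nu> U k (\<nu> * B) f'" by auto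
  show ?case using f'(1,2) Suc.IH[OF f'(3)]
    by (auto intro!: exI[of _ "\<lambda>x. cnj (f' x)"] has_vector_derivative_cnj)
qed auto

text \<open>The constant depends on k, c and A only, so that it is uniform over pieces, scales and
  directions. The derivative of 1/q is -q' / q^2, a product to which the bound of one order less
  applies.\<close>

lemma dbounds_inverse:
  assumes c: "c > 0" and A: "A \<ge> 0"
  shows "\<exists>R\<ge>0. \<forall>e \<nu> (U :: 'a::real_normed_vector set) q. 0 \<le> \<nu> \<and> dbounds e \<nu> U k A q \<and> (\<forall>\<xi>\<in>U. c \<le> norm (q \<xi>)) \<longrightarrow>
    dbounds e \<nu> U k R (\<lambda>\<xi>. inverse (q \<xi>))"
proof (induction k)
  case 0
  have "norm (inverse z) \<le> 1 / c" if "c \<le> norm z" for z :: complex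
    using le_imp_inverse_le[OF that c] by (simp add: norm_inverse inverse_eq_divide norm_divide)
  then show ?case using c by (intro exI[of _ "1 / c"]) auto
next
  case (Suc k)
  then obtain R where R0: "R \<ge> 0" and R1: "\<forall>e \<nu> (U :: 'a set) q. 0 \<le> \<nu> \<and> dbounds e \<nu> U k A q \<and> (\<forall>\<xi>\<in>U. c \<le> norm (q \<xi>)) \<longrightarrow>
    dbounds e \<nu> U k R (\<lambda>\<xi>. inverse (q \<xi>))" by (elim exE conjE) (rule that; assumption)
  define R' where "R' = max (1 / c) (2 ^ k * (2 ^ k * A * R) * R)"
  have R': "1 / c \<le> R'" "2 ^ k * (2 ^ k * A * R) * R \<le> R'" by (auto simp: R'_def)
  show ?case
  proof (intro exI[of _ R'] conjI allI impI)
    show "0 \<le> R'" using R' c by (meson divide_pos_pos less_imp_le order_trans zero_less_one)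
    fix e \<nu> q and U :: "'a set" assume h: "0 \<le> \<nu> \<and> dbounds e \<nu> U (Suc k) A q \<and> (\<forall>\<xi>\<in>U. c \<le> norm (q \<xi>))"
    then obtain q' where q': "\<forall>\<xi>\<in>U. ((\<lambda>t. q (\<xi> + t *\<^sub>R e)) has_vector_derivative q' \<xi>) (at 0)"
      "dbounds e \<nu> U k (\<nu> * A) q'" by auto
    have r: "dbounds e \<nu> U k R (\<lambda>\<xi>. inverse (q \<xi>))" 
      by (rule R1[THEN spec, THEN spec, THEN spec, THEN spec, THEN mp]) (use h dbounds_Suc[of e \<nu> U k A q] in blast)
    let ?h = "\<lambda>\<xi>. - 1 * (q' \<xi> * inverse (q \<xi>) * inverse (q \<xi>))"
    have 1: "norm (inverse (q \<xi>)) \<le> R'" if "\<xi> \<in> U" for \<xi>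
    proof -
      have "c \<le> norm (q \<xi>)" using h that by blast
      then have "inverse (norm (q \<xi>)) \<le> 1 / c" using le_imp_inverse_le c by (simp add: inverse_eq_divide frac_le)
      then show ?thesis using R'(1) by (simp add: norm_inverse)
    qed
    have 2: "((\<lambda>t. inverse (q (\<xi> + t *\<^sub>R e))) has_vector_derivative ?h \<xi>) (at 0)" if "\<xi> \<in> U" for \<xi>
    proof -
      have "(q has_vector_derivative q') (at t) \<Longrightarrow> q t \<noteq> 0 \<Longrightarrow> ((\<lambda>t. inverse (q t)) has_vector_derivative - 1 * (q' * inverse (q t) * inverse (q t))) (at t)"
        for q :: "real \<Rightarrow> complex" and q' t
      proof -
        assume a: "(q has_vector_derivative q') (at t)" "q t \<noteq> 0"
        have "((\<lambda>t. inverse (q t)) has_derivative (\<lambda>h. - (inverse (q t) * (h *\<^sub>R q') * inverse (q t)))) (at t)"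
          using Deriv.has_derivative_inverse[where f=q and x=t and f'="\<lambda>h. h *\<^sub>R q'" and S=UNIV] a
          by (simp add: has_vector_derivative_def)
        then show ?thesis unfolding has_vector_derivative_def
          by (rule has_derivative_eq_rhs) (auto simp: fun_eq_iff scaleR_conv_of_real mult_ac)
      qed
      from this[OF q'(1)[rule_format, OF that]] show ?thesis using h that c by force
    qed
    have "dbounds e \<nu> U k (norm (- 1 :: complex) * (2 ^ k * (2 ^ k * (\<nu> * A) * R) * R)) ?h"
      using h q'(2) r R0 A by (intro dbounds_cmult dbounds_mult mult_nonneg_nonneg) auto
    moreover have "norm (- 1 :: complex) * (2 ^ k * (2 ^ k * (\<nu> * A) * R) * R) \<le> \<nu> * R'"
      using mult_left_mono[OF R'(2), of \<nu>] h by (simp add: mult_ac)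
    ultimately have "dbounds e \<nu> U k (\<nu> * R') ?h"
      using h A R0 by (meson dbounds_mono mult_nonneg_nonneg norm_ge_zero order_refl zero_le_numeral zero_le_power)
    with 1 2 show "dbounds e \<nu> U (Suc k) R' (\<lambda>\<xi>. inverse (q \<xi>))" by (auto intro!: exI[of _ ?h])
  qed
qed

text \<open>The derivative of exp(i \<psi>) is i \<psi>' exp(i \<psi>), again a product with an
  exponential of one order less; the constant is uniform in everything but k and A.\<close>

lemma dbounds_iexp:
  assumes A: "A \<ge> 0"
  shows "\<exists>E\<ge>0. \<forall>e \<nu> (U :: 'a::real_normed_vector set) \<psi>. 0 \<le> \<nu> \<and> dbounds e \<nu> U k A (\<lambda>x. complex_of_real (\<psi> x)) \<longrightarrow>
    dbounds e \<nu> U k E (\<lambda>x. iexp (\<psi> x))"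
proof (induction k)
  case 0
  show ?case by (intro exI[of _ 1]) auto
next
  case (Suc k)
  then obtain E where E0: "E \<ge> 0" and E1: "\<forall>e \<nu> (U :: 'a set) \<psi>. 0 \<le> \<nu> \<and> dbounds e \<nu> U k A (\<lambda>x. complex_of_real (\<psi> x)) \<longrightarrow>
    dbounds e \<nu> U k E (\<lambda>x. iexp (\<psi> x))" by (elim exE conjE) (rule that; assumption)
  define E' where "E' = max 1 (2 ^ k * A * E)"
  show ?case
  proof (intro exI[of _ E'] conjI allI impI)
    show "0 \<le> E'" by (simp add: E'_def)
    fix e \<nu> \<psi> and U :: "'a set" assume h: "0 \<le> \<nu> \<and> dbounds e \<nu> U (Suc k) A (\<lambda>x. complex_of_real (\<psi> x))"
    then obtain q' where q': "\<forall>x\<in>U. ((\<lambda>t. complex_of_real (\<psi> (x + t *\<^sub>R e))) has_vector_derivative q' x) (at 0)"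
      "dbounds e \<nu> U k (\<nu> * A) q'" by auto
    have r: "dbounds e \<nu> U k E (\<lambda>x. iexp (\<psi> x))"
      by (rule E1[THEN spec, THEN spec, THEN spec, THEN spec, THEN mp]) (use h dbounds_Suc[of e \<nu> U k A] in blast)
    let ?h = "\<lambda>x. \<i> * (q' x * iexp (\<psi> x))"
    have 2: "((\<lambda>t. iexp (\<psi> (x + t *\<^sub>R e))) has_vector_derivative ?h x) (at 0)" if "x \<in> U" for x
    proof -
      have "((\<lambda>t. \<i> * complex_of_real (\<psi> (x + t *\<^sub>R e))) has_vector_derivative \<i> * q' x) (at 0)"
        using q'(1) that by (intro has_vector_derivative_mult_right) auto
      from field_vector_diff_chain_at[OF this, of exp "exp (\<i> * complex_of_real (\<psi> (x + 0 *\<^sub>R e)))"]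
      show ?thesis by (simp add: o_def DERIV_exp mult_ac)
    qed
    have a: "dbounds e \<nu> U k (norm \<i> * (2 ^ k * (\<nu> * A) * E)) ?h"
      using h q'(2) r E0 A by (intro dbounds_cmult dbounds_mult mult_nonneg_nonneg) auto
    have b: "norm \<i> * (2 ^ k * (\<nu> * A) * E) \<le> \<nu> * E'"
    proof -
      have "\<nu> * (2 ^ k * A * E) \<le> \<nu> * E'" using h by (intro mult_left_mono) (auto simp: E'_def)
      then show ?thesis by (simp add: mult_ac)
    qed
    have "dbounds e \<nu> U k (\<nu> * E') ?h"
      by (rule dbounds_mono[OF a _ _ _ b]) (use h A E0 in auto)
    with 2 show "dbounds e \<nu> U (Suc k) E' (\<lambda>x. iexp (\<psi> x))"
      by (auto intro!: exI[of _ ?h] simp: E'_def)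
  qed
qed

text \<open>A function that vanishes off a closed set V has derivative 0 along every line near
  points outside V, so bounds on a neighbourhood of V hold everywhere. This is what translation over
  the whole space requires.\<close>

lemma dbounds_vanishing_extend:
  assumes U: "open U" and V: "closed V" "V \<subseteq> U" and \<nu>: "0 \<le> \<nu>"
  shows "dbounds e \<nu> U k B f \<Longrightarrow> (\<And>x. x \<notin> V \<Longrightarrow> f x = 0) \<Longrightarrow> 0 \<le> B \<Longrightarrow> dbounds e \<nu> UNIV k B f"
proof (induction k arbitrary: B f)
  case 0
  then show ?case using V by (metis UNIV_I dbounds.simps(1) norm_zero subsetD)
next
  case (Suc k)
  then obtain f' where f': "\<forall>x\<in>U. norm (f x) \<le> B" "\<forall>x\<in>U. ((\<lambda>t. f (x + t *\<^sub>R e)) has_vector_derivative f' x) (at 0)"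
    "dbounds e \<nu> U k (\<nu> * B) f'" by auto
  have 0: "((\<lambda>t. f (x + t *\<^sub>R e)) has_vector_derivative 0) (at 0)" if "x \<notin> V" for x
  proof (rule has_vector_derivative_transform_within_open[where f="\<lambda>_. 0" and S="(\<lambda>t. x + t *\<^sub>R e) -` (- V)"])
    show "open ((\<lambda>t. x + t *\<^sub>R e) -` (- V))" using V(1) by (intro open_vimage) (auto intro!: continuous_intros)
  qed (use that Suc.prems(2) in auto)
  have f'0: "f' x = 0" if "x \<in> U" "x \<notin> V" for x
    using vector_derivative_unique_at[OF f'(2)[rule_format, OF that(1)] 0[OF that(2)]] .
  \<comment> \<open>The derivative f' is meaningful on U only. Its extension by 0 agrees with it on
    all of U, since f' vanishes on U outside V.\<close>
  define g where "g x = (if x \<in> V then f' x else 0)" for x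
  have gf: "g x = f' x" if "x \<in> U" for x using f'0 that by (auto simp: g_def)
  have cong: "dbounds e \<nu> U k C g \<longleftrightarrow> dbounds e \<nu> U k C f'" for C
  proof -
    have *: "((\<lambda>t. g (x + t *\<^sub>R e)) has_vector_derivative d) (at 0) \<longleftrightarrow> ((\<lambda>t. f' (x + t *\<^sub>R e)) has_vector_derivative d) (at 0)" if "x \<in> U" for x d
    proof -
      have op: "open ((\<lambda>t. x + t *\<^sub>R e) -` U)" using U by (intro open_vimage) (auto intro!: continuous_intros)
      show ?thesis
        using that gf by (auto intro: has_vector_derivative_transform_within_open[OF _ op])
    qed
    show ?thesis by (cases k) (auto simp: gf *)
  qed
  have "dbounds e \<nu> UNIV k (\<nu> * B) g"
    by (rule Suc.IH) (use cong f'(3) Suc.prems(3) \<nu> in \<open>simp_all, simp add: g_def\<close>)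
  moreover have "((\<lambda>t. f (x + t *\<^sub>R e)) has_vector_derivative g x) (at 0)" for x
  proof (cases "x \<in> V")
    case True
    then show ?thesis using f'(2) V(2) by (auto simp: g_def)
  qed (use 0 in \<open>auto simp: g_def\<close>)
  moreover have "norm (f x) \<le> B" for x
    using f'(1) V Suc.prems(2)[of x] Suc.prems(3) by (cases "x \<in> V") auto
  ultimately show ?case by auto
qed

text \<open>A small factor s in the phase survives in exp(i \<psi>) - 1: for the value because
  |exp(i t) - 1| is at most |t|, and for the derivatives because each contains a derivative of
  \<psi> as a factor.\<close>

lemma dbounds_iexp_minus_one:
  assumes A: "A \<ge> 0"
  shows "\<exists>E\<ge>0. \<forall>e \<nu> (U :: 'a::real_normed_vector set) \<psi> s. 0 \<le> \<nu> \<and> 0 \<le> s \<and> s \<le> 1 \<and>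
      dbounds e \<nu> U k (s * A) (\<lambda>x. complex_of_real (\<psi> x)) \<longrightarrow>
    dbounds e \<nu> U k (s * E) (\<lambda>x. iexp (\<psi> x) - 1)"
proof -
  obtain E where E0: "E \<ge> 0" and E1: "\<forall>e \<nu> (U :: 'a set) \<psi>. 0 \<le> \<nu> \<and> dbounds e \<nu> U k A (\<lambda>x. complex_of_real (\<psi> x)) \<longrightarrow>
    dbounds e \<nu> U k E (\<lambda>x. iexp (\<psi> x))" using dbounds_iexp[OF A, of k] by (elim exE conjE) (rule that; assumption)
  define E' where "E' = max A (2 ^ k * A * E)"
  have le: "norm (iexp t - 1) \<le> \<bar>t\<bar>" for t using iexp_approx1[of t 0] by simp
  show ?thesis
  proof (intro exI[of _ E'] conjI allI impI)
    show "0 \<le> E'" using A by (simp add: E'_def)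
    fix e \<nu> \<psi> s and U :: "'a set"
    assume h: "0 \<le> \<nu> \<and> 0 \<le> s \<and> s \<le> 1 \<and> dbounds e \<nu> U k (s * A) (\<lambda>x. complex_of_real (\<psi> x))"
    have b: "norm (iexp (\<psi> x) - 1) \<le> s * E'" if "x \<in> U" for x
    proof -
      have "\<bar>\<psi> x\<bar> \<le> s * A" using dbounds_norm[OF conjunct2[OF conjunct2[OF conjunct2[OF h]]] that] by simp
      also have "\<dots> \<le> s * E'" using h by (intro mult_left_mono) (auto simp: E'_def)
      finally show ?thesis using le[of "\<psi> x"] by linarith
    qed
    have mono: "dbounds e \<nu> U k A (\<lambda>x. complex_of_real (\<psi> x))"
      by (rule dbounds_mono[of e \<nu> U k "s * A"]) (use h A in \<open>auto simp: mult_left_le_one_le\<close>)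
    have r: "dbounds e \<nu> U k E (\<lambda>x. iexp (\<psi> x))"
      by (rule E1[THEN spec, THEN spec, THEN spec, THEN spec, THEN mp]) (use h mono in blast)
    show "dbounds e \<nu> U k (s * E') (\<lambda>x. iexp (\<psi> x) - 1)"
    proof (cases k)
      case (Suc l)
      obtain q' where q': "\<forall>x\<in>U. ((\<lambda>t. complex_of_real (\<psi> (x + t *\<^sub>R e))) has_vector_derivative q' x) (at 0)"
        "dbounds e \<nu> U l (\<nu> * (s * A)) q'" using h unfolding Suc by auto
      let ?h = "\<lambda>x. \<i> * (q' x * iexp (\<psi> x))"
      have 2: "((\<lambda>t. iexp (\<psi> (x + t *\<^sub>R e)) - 1) has_vector_derivative ?h x) (at 0)" if "x \<in> U" for x
      proof -
        have "((\<lambda>t. \<i> * complex_of_real (\<psi> (x + t *\<^sub>R e))) has_vector_derivative \<i> * q' x) (at 0)"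
          using q'(1) that by (intro has_vector_derivative_mult_right) auto
        from field_vector_diff_chain_at[OF this, of exp "exp (\<i> * complex_of_real (\<psi> (x + 0 *\<^sub>R e)))"]
        have "((\<lambda>t. iexp (\<psi> (x + t *\<^sub>R e))) has_vector_derivative ?h x) (at 0)" by (simp add: o_def DERIV_exp mult_ac)
        then show ?thesis using has_vector_derivative_diff[OF _ has_vector_derivative_const[of 1]] by fastforce
      qed
      have a: "dbounds e \<nu> U l (norm \<i> * (2 ^ l * (\<nu> * (s * A)) * E)) ?h"
        using h q'(2) dbounds_Suc[OF r[unfolded Suc]] E0 A by (intro dbounds_cmult dbounds_mult mult_nonneg_nonneg) auto
      have c: "norm \<i> * (2 ^ l * (\<nu> * (s * A)) * E) \<le> \<nu> * (s * E')"
      proof -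
        have "(2::real) ^ l * A * E \<le> 2 ^ k * A * E" using A E0 Suc by (intro mult_right_mono) auto
        then have "\<nu> * (s * (2 ^ l * A * E)) \<le> \<nu> * (s * E')" using h by (intro mult_left_mono) (auto simp: E'_def)
        then show ?thesis by (simp add: mult_ac)
      qed
      have "dbounds e \<nu> U l (\<nu> * (s * E')) ?h"
        by (rule dbounds_mono[OF a _ _ _ c]) (use h A E0 in auto)
      with 2 b show ?thesis unfolding Suc by (auto intro!: exI[of _ ?h])
    qed (use b in auto)
  qed
qed

section \<open>Non-stationary phase\<close>

lemma lborel_integral_shift:
  fixes f :: "'a::euclidean_space \<Rightarrow> complex"
  assumes [measurable]: "f \<in> borel_measurable borel"
  shows "(LINT x|lborel. f (x + c)) = (LINT x|lborel. f x)"
proof -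
  have "(LINT x|lborel. f x) = (LINT x|distr lborel borel ((+) c). f x)" by (simp add: lborel_distr_plus)
  also have "\<dots> = (LINT x|lborel. f (c + x))" by (subst integral_distr) auto
  finally show ?thesis by (simp add: add.commute)
qed

lemma has_vector_derivative_line_shift:
  fixes f :: "'a::real_normed_vector \<Rightarrow> 'b::real_normed_vector"
  assumes "\<And>x. ((\<lambda>t. f (x + t *\<^sub>R e)) has_vector_derivative f' x) (at 0)"
  shows "((\<lambda>t. f (x + t *\<^sub>R e)) has_vector_derivative f' (x + s *\<^sub>R e)) (at s within S)"
proof -
  have "((\<lambda>t. t - s) has_vector_derivative 1) (at s)"
    by (auto intro!: derivative_eq_intros)
  from vector_diff_chain_at[OF this, of "\<lambda>t. f (x + s *\<^sub>R e + t *\<^sub>R e)" "f' (x + s *\<^sub>R e)"]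
  have "((\<lambda>t. f (x + s *\<^sub>R e + (t - s) *\<^sub>R e)) has_vector_derivative f' (x + s *\<^sub>R e)) (at s)"
    using assms[of "x + s *\<^sub>R e"] by (simp add: o_def)
  moreover have "(\<lambda>t. f (x + s *\<^sub>R e + (t - s) *\<^sub>R e)) = (\<lambda>t. f (x + t *\<^sub>R e))"
  proof
    fix t
    have "x + s *\<^sub>R e + (t - s) *\<^sub>R e = x + t *\<^sub>R e" by (simp add: algebra_simps)
    then show "f (x + s *\<^sub>R e + (t - s) *\<^sub>R e) = f (x + t *\<^sub>R e)" by (simp only:)
  qed
  ultimately show ?thesis by (simp only: has_vector_derivative_at_within)
qed

text \<open>Difference quotients with step 1/(m + 1) provide the measurability of the derivative
  and, in the next lemma, a sequence for dominated convergence.\<close>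

lemma borel_measurable_directional_derivative:
  fixes f :: "'a::euclidean_space \<Rightarrow> complex"
  assumes [measurable]: "f \<in> borel_measurable borel"
    and d: "\<And>x. ((\<lambda>t. f (x + t *\<^sub>R e)) has_vector_derivative f' x) (at 0)"
  shows "f' \<in> borel_measurable borel"
    and "(\<lambda>m. real (Suc m) *\<^sub>R (f (x + (1 / real (Suc m)) *\<^sub>R e) - f x)) \<longlonglongrightarrow> f' x"
proof -
  show lim: "(\<lambda>m. real (Suc m) *\<^sub>R (f (x + (1 / real (Suc m)) *\<^sub>R e) - f x)) \<longlonglongrightarrow> f' x" for x
  proof -
    have "((\<lambda>h. norm (f (x + h *\<^sub>R e) - f x - h *\<^sub>R f' x) / norm h) \<longlongrightarrow> 0) (at 0)"
      using d[of x] unfolding has_vector_derivative_def has_derivative_at by simp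
    moreover have eq: "norm (f (x + h *\<^sub>R e) - f x - h *\<^sub>R f' x) / norm h = norm ((f (x + h *\<^sub>R e) - f x) /\<^sub>R h - f' x)"
      if "h \<noteq> 0" for h
    proof -
      have "(f (x + h *\<^sub>R e) - f x) /\<^sub>R h - f' x = (f (x + h *\<^sub>R e) - f x - h *\<^sub>R f' x) /\<^sub>R h"
        using that by (simp add: scaleR_diff_right)
      then show ?thesis by (simp add: divide_inverse mult.commute)
    qed
    ultimately have "((\<lambda>h. norm ((f (x + h *\<^sub>R e) - f x) /\<^sub>R h - f' x)) \<longlongrightarrow> 0) (at 0)"
      by (rule Lim_transform_eventually[OF _ eventually_at_filter[THEN iffD2, OF always_eventually], rule_format])
    then have "((\<lambda>h. (f (x + h *\<^sub>R e) - f x) /\<^sub>R h) \<longlongrightarrow> f' x) (at 0)"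
      by (rule LIM_zero_cancel[OF tendsto_norm_zero_cancel])
    moreover have "filterlim (\<lambda>m. 1 / real (Suc m)) (at 0) sequentially"
      using lim_1_over_n[THEN LIMSEQ_Suc] by (auto simp: filterlim_at)
    ultimately have "((\<lambda>m. (f (x + (1 / real (Suc m)) *\<^sub>R e) - f x) /\<^sub>R (1 / real (Suc m))) \<longlongrightarrow> f' x) sequentially"
      by (rule filterlim_compose)
    then show ?thesis by simp
  qed
  show "f' \<in> borel_measurable borel"
    by (rule borel_measurable_LIMSEQ_metric[OF _ lim]) measurable
qed

text \<open>Translation invariance of the integral, differentiated.\<close>

lemma integral_directional_derivative_eq_0:
  fixes f :: "'a::euclidean_space \<Rightarrow> complex"
  assumes f [measurable]: "f \<in> borel_measurable borel"
    and d: "\<And>x. ((\<lambda>t. f (x + t *\<^sub>R e)) has_vector_derivative f' x) (at 0)"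
    and L: "\<And>x. norm (f' x) \<le> L" and V: "bounded V" "\<And>x. x \<notin> V \<Longrightarrow> f x = 0" and B: "\<And>x. norm (f x) \<le> B"
  shows "(LINT x|lborel. f' x) = 0"
proof -
  define g where "g m x = real (Suc m) *\<^sub>R (f (x + (1 / real (Suc m)) *\<^sub>R e) - f x)" for m x
  obtain r where r: "\<And>x. x \<in> V \<Longrightarrow> norm x \<le> r" using V(1) by (auto simp: bounded_iff)
  \<comment> \<open>The steps are at most |e|, so all difference quotients vanish outside this
    enlarged ball.\<close>
  let ?K = "cball 0 (r + norm e) :: 'a set"
  have L0: "0 \<le> L" using L[of 0] norm_ge_zero order_trans by blast
  have gL: "norm (g m x) \<le> L * indicator ?K x" for m x
  proof (cases "x \<in> ?K")
    case True
    have "norm (f (x + (1 / real (Suc m)) *\<^sub>R e) - f (x + 0 *\<^sub>R e)) \<le> L * norm (1 / real (Suc m) - 0)"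
    proof (rule differentiable_bound[of UNIV "\<lambda>t. f (x + t *\<^sub>R e)" "\<lambda>t h. h *\<^sub>R f' (x + t *\<^sub>R e)"])
      show "((\<lambda>t. f (x + t *\<^sub>R e)) has_derivative (\<lambda>h. h *\<^sub>R f' (x + t *\<^sub>R e))) (at t within UNIV)" for t
        using has_vector_derivative_line_shift[of f e f', OF d] by (simp add: has_vector_derivative_def)
      show "onorm (\<lambda>h. h *\<^sub>R f' (x + t *\<^sub>R e)) \<le> L" for t
        by (rule onorm_le) (use L in \<open>auto simp: mult.commute[of L] intro: mult_left_mono\<close>)
    qed auto
    then have "norm (f (x + (1 / real (Suc m)) *\<^sub>R e) - f x) \<le> L / real (Suc m)" by simp
    then have "real (Suc m) * norm (f (x + (1 / real (Suc m)) *\<^sub>R e) - f x) \<le> L"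
      by (simp only: pos_le_divide_eq[OF of_nat_0_less_iff[THEN iffD2, OF zero_less_Suc]] mult.commute)
    then show ?thesis using True by (simp add: g_def del: of_nat_Suc)
  next
    case False
    have "x + (1 / real (Suc m)) *\<^sub>R e \<notin> V"
    proof
      assume "x + (1 / real (Suc m)) *\<^sub>R e \<in> V"
      from r[OF this] have "norm x \<le> r + norm ((1 / real (Suc m)) *\<^sub>R e)"
        using norm_triangle_ineq4[of "x + (1 / real (Suc m)) *\<^sub>R e" "(1 / real (Suc m)) *\<^sub>R e"] by simp
      also have "norm ((1 / real (Suc m)) *\<^sub>R e) \<le> norm e"
        by (simp add: divide_le_eq distrib_left)
      finally show False using False by simp
    qed
    moreover have "x \<notin> V" using False r[of x] norm_ge_zero[of e] by (auto simp del: norm_ge_zero)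
    ultimately show ?thesis using V(2) False by (simp add: g_def)
  qed
  have fi: "integrable lborel f"
  proof (rule Bochner_Integration.integrable_bound[of lborel "\<lambda>x. B * indicator (cball 0 r) x"])
    show "integrable lborel (\<lambda>x::'a. B * indicator (cball 0 r) x)"
      by (intro integrable_mult_right integrable_real_indicator) (auto simp: emeasure_compact_finite[OF compact_cball, simplified])
    show "AE x in lborel. norm (f x) \<le> norm (B * indicator (cball 0 r) x)"
      using B V(2) r by (intro AE_I2) (auto simp: indicator_def intro: order_trans[OF B abs_ge_self])
  qed auto
  have g0: "(LINT x|lborel. g m x) = 0" for m
  proof -
    have "integrable lborel (\<lambda>x. f (x + c))" for c
      using fi integrable_distr_eq[of "(+) c" lborel borel f] by (simp add: lborel_distr_plus add.commute)
    then show ?thesis unfolding g_def using fi by (simp add: lborel_integral_shift)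
  qed
  have "(\<lambda>m. LINT x|lborel. g m x) \<longlonglongrightarrow> (LINT x|lborel. f' x)"
  proof (rule integral_dominated_convergence[where w="\<lambda>x. L * indicator ?K x"])
    show "integrable lborel (\<lambda>x::'a. L * indicator ?K x)"
      by (intro integrable_mult_right integrable_real_indicator) (auto simp: emeasure_compact_finite[OF compact_cball, simplified])
    show "f' \<in> borel_measurable lborel" using borel_measurable_directional_derivative(1)[OF f d] by simp
    show "AE x in lborel. (\<lambda>m. g m x) \<longlonglongrightarrow> f' x"
      unfolding g_def using borel_measurable_directional_derivative(2)[OF f d] by simp
    show "g m \<in> borel_measurable lborel" for m unfolding g_def by measurable
  qed (use gL in auto)
  then show ?thesis using g0 by (simp add: LIMSEQ_const_iff)
qed

text \<open>\<open>D * q\<close> is the derivative of the phase \<open>\<theta>\<close> in direction \<open>e\<close>, with \<open>D\<close> large and \<open>q\<close> of size one.\<close>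

abbreviation nonstationary ::
    "real \<Rightarrow> nat \<Rightarrow> 'a::euclidean_space \<Rightarrow> real \<Rightarrow> real \<Rightarrow> ('a \<Rightarrow> real) \<Rightarrow> ('a \<Rightarrow> real) \<Rightarrow> ('a \<Rightarrow> complex) \<Rightarrow> 'a set \<Rightarrow> 'a set \<Rightarrow> real \<Rightarrow> bool" where
  "nonstationary R k e \<nu> D \<theta> q f U V B \<equiv> 0 \<le> \<nu> \<and> 0 < D \<and> 0 \<le> B \<and> open U \<and> compact V \<and> V \<subseteq> U \<and>
     (\<forall>x\<in>U. ((\<lambda>t. \<theta> (x + t *\<^sub>R e)) has_real_derivative D * q x) (at 0)) \<and> (\<forall>x\<in>U. q x \<noteq> 0) \<and>
     dbounds e \<nu> U k R (\<lambda>x. inverse (complex_of_real (q x))) \<and>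
     \<theta> \<in> borel_measurable borel \<and> q \<in> borel_measurable borel \<and> (\<exists>Q. \<forall>x\<in>U. \<bar>q x\<bar> \<le> Q) \<and> f \<in> borel_measurable borel \<and>
     dbounds e \<nu> U k B f \<and> (\<forall>x. x \<notin> V \<longrightarrow> f x = 0)"

text \<open>Integration by parts \<open>k\<close> times.\<close>

lemma nonstationary_phase_reciprocal:
  assumes R: "R \<ge> 0"
  shows "\<exists>C\<ge>0. \<forall>(e :: 'a::euclidean_space) \<nu> D \<theta> q f U V B.
     nonstationary R k e \<nu> D \<theta> q f U V B \<longrightarrow>
     norm (LINT x|lborel. iexp (\<theta> x) * f x) \<le> C * measure lborel V * B * (\<nu> / D) ^ k"
proof (induction k)
  case 0
  show ?case
  proof (intro exI[of _ 1] conjI allI impI)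
    fix e :: 'a and \<nu> D \<theta> q and f :: "'a \<Rightarrow> complex" and U V B
    assume h: "nonstationary R 0 e \<nu> D \<theta> q f U V B"
    have V [measurable]: "V \<in> sets borel" using h by (auto intro: borel_compact)
    have fin: "emeasure lborel V < \<infinity>" using h emeasure_compact_finite by blast
    have "norm (LINT x|lborel. iexp (\<theta> x) * f x) \<le> (LINT x|lborel. norm (iexp (\<theta> x) * f x))"
      by (rule integral_norm_bound)
    also have "\<dots> \<le> (LINT x|lborel. B * indicator V x)"
    proof (rule integral_mono')
      show "integrable lborel (\<lambda>x. B * indicator V x)"
        using fin by (intro integrable_mult_right integrable_real_indicator) auto
      show "norm (iexp (\<theta> x) * f x) \<le> B * indicator V x" for x
        using h by (cases "x \<in> V") (auto simp: norm_mult)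
      show "0 \<le> B * indicator V x" for x using h by auto
    qed
    also have "\<dots> = measure lborel V * B" by (simp add: mult.commute)
    finally show "norm (LINT x|lborel. iexp (\<theta> x) * f x) \<le> 1 * measure lborel V * B * (\<nu> / D) ^ 0" by simp
  qed simp
next
  case (Suc k)
  obtain C where C0: "C \<ge> 0" and C1: "\<forall>(e::'a) \<nu> D \<theta> q f U V B. nonstationary R k e \<nu> D \<theta> q f U V B \<longrightarrow>
     norm (LINT x|lborel. iexp (\<theta> x) * f x) \<le> C * measure lborel V * B * (\<nu> / D) ^ k"
    using Suc.IH by (elim exE conjE) (rule that; assumption)
  show ?case
  proof (intro exI[of _ "C * (2 ^ Suc k * R)"] conjI allI impI)
    show "0 \<le> C * (2 ^ Suc k * R)" using C0 R by simp
    fix e :: 'a and \<nu> D \<theta> q and f :: "'a \<Rightarrow> complex" and U V B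
    assume "nonstationary R (Suc k) e \<nu> D \<theta> q f U V B"
    then have h: "0 \<le> \<nu>" "0 < D" "0 \<le> B" "open U" "compact V" "V \<subseteq> U"
      "\<And>x. x\<in>U \<Longrightarrow> ((\<lambda>t. \<theta> (x + t *\<^sub>R e)) has_real_derivative D * q x) (at 0)"
      "\<And>x. x\<in>U \<Longrightarrow> q x \<noteq> 0" and r: "dbounds e \<nu> U (Suc k) R (\<lambda>x. inverse (complex_of_real (q x)))"
      and [measurable]: "\<theta> \<in> borel_measurable borel" "q \<in> borel_measurable borel" "f \<in> borel_measurable borel"
      and Qex: "\<exists>Q. \<forall>x\<in>U. \<bar>q x\<bar> \<le> Q" and fb: "dbounds e \<nu> U (Suc k) B f" and f0: "\<And>x. x \<notin> V \<Longrightarrow> f x = 0"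
      by blast+
    \<comment> \<open>The exponential has derivative i D q exp(i \<theta>); only q is divided into
      the amplitude, while D stays a number. Each round trades a derivative of g, costing \<nu>, for
      a factor 1/D.\<close>
    define g where "g x = f x * inverse (complex_of_real (q x))" for x
    have [measurable]: "g \<in> borel_measurable borel" unfolding g_def by measurable
    have g0: "g x = 0" if "x \<notin> V" for x using f0[OF that] by (simp add: g_def)
    define B' where "B' = 2 ^ Suc k * B * R"
    have B': "B' \<ge> 0" using h R by (simp add: B'_def)
    have "dbounds e \<nu> U (Suc k) B' g"
      unfolding g_def B'_def using h R by (intro dbounds_mult fb r)
    then have gb: "dbounds e \<nu> UNIV (Suc k) B' g"
      using h g0 B' by (intro dbounds_vanishing_extend[of U V] compact_imp_closed)
    then obtain g' where g': "\<And>x. ((\<lambda>t. g (x + t *\<^sub>R e)) has_vector_derivative g' x) (at 0)"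
      "dbounds e \<nu> UNIV k (\<nu> * B') g'" by auto
    have [measurable]: "g' \<in> borel_measurable borel"
      by (rule borel_measurable_directional_derivative(1)[OF _ g'(1)]) measurable
    have g'0: "g' x = 0" if "x \<notin> V" for x
    proof -
      have "((\<lambda>t. g (x + t *\<^sub>R e)) has_vector_derivative 0) (at 0)"
      proof (rule has_vector_derivative_transform_within_open[where f="\<lambda>_. 0" and S="(\<lambda>t. x + t *\<^sub>R e) -` (- V)"])
        show "open ((\<lambda>t. x + t *\<^sub>R e) -` (- V))"
          using h by (intro open_vimage open_Compl compact_imp_closed) (auto intro!: continuous_intros)
      qed (use that g0 in auto)
      then show ?thesis using vector_derivative_unique_at[OF g'(1)] by blast
    qed
    \<comment> \<open>That the derivative of F integrates to 0 is the integration by parts identity.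
      Inside U the factor q cancels against the one in g; outside V everything vanishes.\<close>
    define F where "F x = iexp (\<theta> x) * g x" for x
    define F' where "F' x = \<i> * D * (iexp (\<theta> x) * f x) + iexp (\<theta> x) * g' x" for x
    have FF: "((\<lambda>t. F (x + t *\<^sub>R e)) has_vector_derivative F' x) (at 0)" for x
    proof (cases "x \<in> U")
      case True
      have "((\<lambda>t. \<i> * complex_of_real (\<theta> (x + t *\<^sub>R e))) has_vector_derivative \<i> * complex_of_real (D * q x)) (at 0)"
        using h(7)[OF True] by (intro has_vector_derivative_mult_right has_vector_derivative_of_real)
          (simp add: has_real_derivative_iff_has_vector_derivative)
      from field_vector_diff_chain_at[OF this, of exp "exp (\<i> * complex_of_real (\<theta> (x + 0 *\<^sub>R e)))"]
      have "((\<lambda>t. iexp (\<theta> (x + t *\<^sub>R e))) has_vector_derivative \<i> * complex_of_real (D * q x) * iexp (\<theta> x)) (at 0)"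
        by (simp add: o_def DERIV_exp)
      from has_vector_derivative_mult[OF this g'(1)[of x]]
      have "((\<lambda>t. F (x + t *\<^sub>R e)) has_vector_derivative
          iexp (\<theta> x) * g' x + \<i> * complex_of_real (D * q x) * iexp (\<theta> x) * g x) (at 0)"
        by (simp add: F_def)
      moreover have "complex_of_real (q x) * g x = f x" using h(8)[OF True] by (simp add: g_def)
      moreover have "\<i> * complex_of_real (D * q x) * iexp (\<theta> x) * g x =
          \<i> * complex_of_real D * (iexp (\<theta> x) * (complex_of_real (q x) * g x))" by (simp add: mult_ac)
      ultimately show ?thesis by (simp only: F'_def add.commute)
    next
      case False
      then have x: "x \<notin> V" using h by blast
      have "((\<lambda>t. F (x + t *\<^sub>R e)) has_vector_derivative 0) (at 0)"
      proof (rule has_vector_derivative_transform_within_open[where f="\<lambda>_. 0" and S="(\<lambda>t. x + t *\<^sub>R e) -` (- V)"])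
        show "open ((\<lambda>t. x + t *\<^sub>R e) -` (- V))"
          using h by (intro open_vimage open_Compl compact_imp_closed) (auto intro!: continuous_intros)
      qed (use x g0 in \<open>auto simp: F_def\<close>)
      then show ?thesis using x f0 g'0 by (simp add: F'_def)
    qed
    have fB: "norm (f x) \<le> B" for x using dbounds_norm[OF fb, of x] f0[of x] h(3,6) by (cases "x \<in> V") auto
    have F0: "(LINT x|lborel. F' x) = 0"
    proof (rule integral_directional_derivative_eq_0[OF _ FF])
      show "F \<in> borel_measurable borel" unfolding F_def by measurable
      show "bounded V" using h compact_imp_bounded by blast
      show "norm (F' x) \<le> D * B + \<nu> * B'" for x
      proof -
        have "norm (F' x) \<le> norm (\<i> * D * (iexp (\<theta> x) * f x)) + norm (iexp (\<theta> x) * g' x)"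
          unfolding F'_def by (rule norm_triangle_ineq)
        also have "\<dots> \<le> D * B + \<nu> * B'"
          using h(2) fB dbounds_norm[OF g'(2)] by (intro add_mono) (auto simp: norm_mult intro: mult_left_mono)
        finally show ?thesis .
      qed
      show "norm (F x) \<le> B'" for x using dbounds_norm[OF gb] by (simp add: F_def norm_mult)
    qed (use g0 in \<open>auto simp: F_def\<close>)
    have V [measurable]: "V \<in> sets borel" using h by (auto intro: borel_compact)
    have fin: "emeasure lborel V < \<infinity>" using h emeasure_compact_finite by blast
    have int: "integrable lborel (\<lambda>x. iexp (\<theta> x) * w x)"
      if [measurable]: "w \<in> borel_measurable borel" and "\<And>x. norm (w x) \<le> c" "\<And>x. x \<notin> V \<Longrightarrow> w x = 0" for w c
    proof (rule Bochner_Integration.integrable_bound[of lborel "\<lambda>x. c * indicator V x"])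
      show "integrable lborel (\<lambda>x. c * indicator V x)"
        using fin by (intro integrable_mult_right integrable_real_indicator) auto
      show "AE x in lborel. norm (iexp (\<theta> x) * w x) \<le> norm (c * indicator V x)"
        using that by (intro AE_I2) (auto simp: norm_mult indicator_def intro: order_trans[OF _ abs_ge_self])
    qed measurable
    have i1: "integrable lborel (\<lambda>x. iexp (\<theta> x) * f x)" using int[of f B] fB f0 by auto
    have i2: "integrable lborel (\<lambda>x. iexp (\<theta> x) * g' x)"
      using int[of g' "\<nu> * B'"] dbounds_norm[OF g'(2)] g'0 by auto
    have "0 = \<i> * D * (LINT x|lborel. iexp (\<theta> x) * f x) + (LINT x|lborel. iexp (\<theta> x) * g' x)"
      using F0 i1 i2 by (simp add: F'_def)
    then have "\<i> * D * (LINT x|lborel. iexp (\<theta> x) * f x) = - (LINT x|lborel. iexp (\<theta> x) * g' x)"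
      by (simp add: eq_neg_iff_add_eq_0)
    then have "norm (\<i> * D * (LINT x|lborel. iexp (\<theta> x) * f x)) = norm (LINT x|lborel. iexp (\<theta> x) * g' x)"
      by simp
    then have "D * norm (LINT x|lborel. iexp (\<theta> x) * f x) = norm (LINT x|lborel. iexp (\<theta> x) * g' x)"
      using h by (simp add: norm_mult)
    also have "\<dots> \<le> C * measure lborel V * (\<nu> * B') * (\<nu> / D) ^ k"
    proof (rule C1[THEN spec, THEN spec, THEN spec, THEN spec, THEN spec, THEN spec, THEN spec, THEN spec, THEN spec, THEN mp])
      show "nonstationary R k e \<nu> D \<theta> q g' U V (\<nu> * B')"
        using h r[THEN dbounds_Suc] Qex g'(2)[THEN dbounds_subset[OF _ subset_UNIV]] g'0 B' by auto
    qed
    finally have "norm (LINT x|lborel. iexp (\<theta> x) * f x) \<le> C * measure lborel V * (\<nu> * B') * (\<nu> / D) ^ k / D"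
      using h by (simp add: field_simps)
    also have "\<dots> = C * (2 ^ Suc k * R) * measure lborel V * B * (\<nu> / D) ^ Suc k"
      using h by (simp add: B'_def)
    finally show "norm (LINT x|lborel. iexp (\<theta> x) * f x) \<le> C * (2 ^ Suc k * R) * measure lborel V * B * (\<nu> / D) ^ Suc k" .
  qed
qed

section \<open>Phase functions\<close>

lemma has_derivative_vec_norm_bound:
  fixes g' :: "real^'n \<Rightarrow> real"
  assumes lin: "bounded_linear g'" and C: "\<And>j. \<bar>g' (axis j 1)\<bar> \<le> C"
  shows "\<bar>g' h\<bar> \<le> (real CARD('n) * C) * norm h"
proof -
  interpret bounded_linear g' by fact
  have "h = (\<Sum>j\<in>UNIV. h $ j *\<^sub>R axis j 1)"
    by (metis (no_types) basis_expansion scalar_mult_eq_scaleR)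
  then have "g' h = g' (\<Sum>j\<in>UNIV. h $ j *\<^sub>R axis j 1)" by (rule arg_cong)
  also have "\<dots> = (\<Sum>j\<in>UNIV. h $ j * g' (axis j 1))"
    by (simp add: sum scaleR)
  also have "\<bar>\<dots>\<bar> \<le> (\<Sum>j\<in>(UNIV::'n set). \<bar>h $ j * g' (axis j 1)\<bar>)" by (rule sum_abs)
  also have "\<dots> \<le> (\<Sum>j\<in>(UNIV::'n set). norm h * C)"
    using C component_le_norm_cart[of h] by (intro sum_mono) (auto simp: abs_mult intro!: mult_mono)
  finally show ?thesis by (simp add: mult_ac)
qed

lemma Lipschitz_of_partials:
  fixes g :: "real^'n \<Rightarrow> real"
  assumes X: "convex X" and d: "\<And>x. x \<in> X \<Longrightarrow> (g has_derivative g' x) (at x)"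
    and C: "\<And>x j. x \<in> X \<Longrightarrow> \<bar>g' x (axis j 1)\<bar> \<le> C" and xy: "x \<in> X" "y \<in> X"
  shows "\<bar>g x - g y\<bar> \<le> (real CARD('n) * C) * norm (x - y)"
proof -
  have "norm (g x - g y) \<le> (real CARD('n) * C) * norm (x - y)"
  proof (rule differentiable_bound[OF X _ _ xy])
    show "(g has_derivative g' z) (at z within X)" if "z \<in> X" for z
      using d[OF that] by (rule has_derivative_at_withinI)
    show "onorm (g' z) \<le> real CARD('n) * C" if "z \<in> X" for z
      by (rule onorm_le) (use has_derivative_vec_norm_bound[OF has_derivative_bounded_linear[OF d[OF that]] C[OF that]] in simp)
  qed
  then show ?thesis by simp
qed

lemma norm_le_card_component:
  fixes v :: "real^'n"
  assumes "\<And>i. \<bar>v $ i\<bar> \<le> C"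
  shows "norm v \<le> real CARD('n) * C"
proof -
  have "norm v \<le> (\<Sum>i\<in>UNIV. \<bar>v $ i\<bar>)" by (rule norm_le_l1_cart)
  also have "\<dots> \<le> (\<Sum>i\<in>(UNIV::'n set). C)" using assms by (intro sum_mono)
  finally show ?thesis by simp
qed

text \<open>Matrices with bounded entries and determinant bounded away from 0, paired with unit
  vectors, form a compact set on which |M v| is continuous and nonzero; its minimum is
  \<mu>.\<close>

lemma matrix_lower_bound:
  assumes c: "c > 0"
  shows "\<exists>\<mu>>0. \<forall>M :: real^'n^'n. (\<forall>i j. \<bar>M $ i $ j\<bar> \<le> C) \<and> \<bar>det M\<bar> \<ge> c \<longrightarrow> (\<forall>v. \<mu> * norm v \<le> norm (M *v v))"
proof (cases "\<exists>M :: real^'n^'n. (\<forall>i j. \<bar>M $ i $ j\<bar> \<le> C) \<and> \<bar>det M\<bar> \<ge> c")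
  case False
  then show ?thesis by (intro exI[of _ 1]) auto
next
  case True
  let ?K = "{M :: real^'n^'n. (\<forall>i j. \<bar>M $ i $ j\<bar> \<le> C) \<and> \<bar>det M\<bar> \<ge> c} \<times> sphere (0 :: real^'n) 1"
  have contdet: "continuous_on UNIV (\<lambda>M :: real^'n^'n. \<bar>det M\<bar>)"
    unfolding det_def by (intro continuous_intros)
  have "closed {M :: real^'n^'n. (\<forall>i j. \<bar>M $ i $ j\<bar> \<le> C) \<and> \<bar>det M\<bar> \<ge> c}"
    by (intro closed_Collect_conj closed_Collect_all closed_Collect_le contdet continuous_intros)
  moreover have "bounded {M :: real^'n^'n. (\<forall>i j. \<bar>M $ i $ j\<bar> \<le> C) \<and> \<bar>det M\<bar> \<ge> c}"
  proof (rule boundedI)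
    fix M :: "real^'n^'n" assume "M \<in> {M. (\<forall>i j. \<bar>M $ i $ j\<bar> \<le> C) \<and> \<bar>det M\<bar> \<ge> c}"
    then have "norm (M $ i) \<le> real CARD('n) * C" for i by (intro norm_le_card_component) auto
    then have "(\<Sum>i\<in>UNIV. norm (M $ i)) \<le> (\<Sum>i\<in>(UNIV::'n set). real CARD('n) * C)" by (intro sum_mono)
    moreover have "norm M \<le> (\<Sum>i\<in>UNIV. norm (M $ i))" unfolding norm_vec_def by (rule L2_set_le_sum) simp
    ultimately show "norm M \<le> real CARD('n) * (real CARD('n) * C)" by simp
  qed
  ultimately have K: "compact ?K" by (intro compact_Times) (auto simp: compact_eq_bounded_closed)
  have contf: "continuous_on ?K (\<lambda>(M, v). norm (M *v v))"
  proof -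
    have "continuous_on ?K (\<lambda>p. norm (fst p *v snd p))"
      unfolding matrix_vector_mult_def by (intro continuous_intros)
    then show ?thesis by (simp add: case_prod_unfold)
  qed
  have ne: "?K \<noteq> {}"
  proof -
    have "axis undefined 1 \<in> sphere (0 :: real^'n) 1" by simp
    then show ?thesis using True by blast
  qed
  obtain M0 v0 where m: "(M0, v0) \<in> ?K" "\<And>M v. (M, v) \<in> ?K \<Longrightarrow> norm (M0 *v v0) \<le> norm (M *v v)"
    using continuous_attains_inf[OF K ne contf] by auto
  have pos: "norm (M0 *v v0) > 0"
  proof -
    have "det M0 \<noteq> 0" "v0 \<noteq> 0" using m(1) c by auto
    then have "M0 *v v0 \<noteq> 0" by (metis invertible_det_nz invertible_left_inverse matrix_left_invertible_ker)
    then show ?thesis by simp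
  qed
  show ?thesis
  proof (intro exI[of _ "norm (M0 *v v0)"] conjI pos allI impI)
    fix M :: "real^'n^'n" and v :: "real^'n"
    assume M: "(\<forall>i j. \<bar>M $ i $ j\<bar> \<le> C) \<and> \<bar>det M\<bar> \<ge> c"
    show "norm (M0 *v v0) * norm v \<le> norm (M *v v)"
    proof (cases "v = 0")
      case False
      have "(M, v /\<^sub>R norm v) \<in> ?K" using M False by simp
      from m(2)[OF this] have "norm (M0 *v v0) \<le> norm (M *v v) / norm v"
        by (simp add: matrix_vector_mult_scaleR divide_inverse mult.commute)
      then show ?thesis using False by (simp add: pos_le_divide_eq)
    qed simp
  qed
qed

text \<open>Packs an explicit sequence of derivatives into the nested existential quantifiers of
  \<open>dbounds\<close>.\<close>

lemma dbounds_seq: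
  assumes "\<And>l x. l \<le> k \<Longrightarrow> x \<in> U \<Longrightarrow> norm (f l x) \<le> B * \<nu> ^ l"
    and "\<And>l x. l < k \<Longrightarrow> x \<in> U \<Longrightarrow> ((\<lambda>t. f l (x + t *\<^sub>R e)) has_vector_derivative f (Suc l) x) (at 0)"
  shows "dbounds e \<nu> U k B (f 0)"
  using assms
proof (induction k arbitrary: f B)
  case (Suc k)
  have "dbounds e \<nu> U k (\<nu> * B) (f (Suc 0))"
    by (rule Suc.IH[of "\<lambda>l. f (Suc l)"]) (use Suc.prems(1)[of "Suc _"] Suc.prems(2)[of "Suc _"] in \<open>auto simp: mult_ac\<close>)
  then show ?case using Suc.prems(1)[of 0] Suc.prems(2)[of 0] by (auto intro!: exI[of _ "f (Suc 0)"])
qed force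

abbreviation xdir :: "'n::finite \<Rightarrow> (real^'n) \<times> (real^'n)" where "xdir j \<equiv> (axis j 1, 0)"
abbreviation \<xi>dir :: "'n::finite \<Rightarrow> (real^'n) \<times> (real^'n)" where "\<xi>dir i \<equiv> (0, axis i 1)"

lemma xdir_Basis [simp]: "xdir j \<in> Basis" and \<xi>dir_Basis [simp]: "\<xi>dir i \<in> Basis"
  by (auto simp: Basis_prod_def)

locale phase =
  fixes \<phi> :: "real^'n \<Rightarrow> real^'n \<Rightarrow> real"
  assumes \<phi>: "\<phi> \<in> phase_class 2" and nondeg: "strongly_nondegenerate \<phi>"
begin

text \<open>All mixed derivatives of the phase as derivatives of one function on the product space,
  so that the order of differentiation can be changed freely away from frequency 0.\<close>

definition P :: "((real^'n) \<times> (real^'n)) list \<Rightarrow> real^'n \<Rightarrow> real^'n \<Rightarrow> real" where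
  "P vs x \<xi> = dirderivs vs (\<lambda>(x, \<xi>). \<phi> x \<xi>) (x, \<xi>)"

abbreviation "phdom \<equiv> UNIV \<times> (- {0}) :: ((real^'n) \<times> (real^'n)) set"

lemma open_phdom: "open phdom" by (intro open_Times) auto

lemma smooth_\<Phi>: "smooth_on phdom (\<lambda>(x, \<xi>). \<phi> x \<xi>)"
  using \<phi> unfolding phase_class_def by blast

lemma homog: "\<xi> \<noteq> 0 \<Longrightarrow> t > 0 \<Longrightarrow> \<phi> x (t *\<^sub>R \<xi>) = t * \<phi> x \<xi>"
  using \<phi> unfolding phase_class_def by blast

lemma P_Nil: "P [] x \<xi> = \<phi> x \<xi>" by (simp add: P_def)

lemma P_perm: "set vs \<subseteq> Basis \<Longrightarrow> mset vs = mset ws \<Longrightarrow> \<xi> \<noteq> 0 \<Longrightarrow> P vs x \<xi> = P ws x \<xi>"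
  unfolding P_def by (rule dirderivs_perm[OF smooth_\<Phi> open_phdom]) auto

lemma P_has_derivative:
  assumes "set vs \<subseteq> Basis" "\<xi> \<noteq> 0"
  shows "(dirderivs vs (\<lambda>(x, \<xi>). \<phi> x \<xi>) has_derivative frechet_derivative (dirderivs vs (\<lambda>(x, \<xi>). \<phi> x \<xi>)) (at (x, \<xi>))) (at (x, \<xi>))"
  using smooth_on_differentiable[OF smooth_on_dirderivs[OF smooth_\<Phi> assms(1)], of "(x, \<xi>)"] assms(2)
    frechet_derivative_works by auto

lemma P_has_derivative_x:
  assumes "set vs \<subseteq> Basis" "\<xi> \<noteq> 0"
  obtains D where "((\<lambda>x. P vs x \<xi>) has_derivative D) (at x)" "\<And>j. D (axis j 1) = P (xdir j # vs) x \<xi>"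
proof
  have "((\<lambda>x. (x, \<xi>)) has_derivative (\<lambda>h. (h, 0))) (at x)" by (auto intro!: derivative_eq_intros)
  from has_derivative_compose[OF this P_has_derivative[OF assms]]
  show "((\<lambda>x. P vs x \<xi>) has_derivative (\<lambda>h. frechet_derivative (dirderivs vs (\<lambda>(x, \<xi>). \<phi> x \<xi>)) (at (x, \<xi>)) (h, 0))) (at x)"
    by (simp add: P_def)
qed (simp add: P_def)

lemma P_has_derivative_\<xi>:
  assumes "set vs \<subseteq> Basis" "\<xi> \<noteq> 0"
  obtains D where "((\<lambda>\<xi>. P vs x \<xi>) has_derivative D) (at \<xi>)" "\<And>j. D (axis j 1) = P (\<xi>dir j # vs) x \<xi>"
proof
  have "((\<lambda>\<xi>. (x, \<xi>)) has_derivative (\<lambda>h. (0, h))) (at \<xi>)" by (auto intro!: derivative_eq_intros)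
  from has_derivative_compose[OF this P_has_derivative[OF assms]]
  show "((\<lambda>\<xi>. P vs x \<xi>) has_derivative (\<lambda>h. frechet_derivative (dirderivs vs (\<lambda>(x, \<xi>). \<phi> x \<xi>)) (at (x, \<xi>)) (0, h))) (at \<xi>)"
    by (simp add: P_def)
qed (simp add: P_def)

lemma P_line:
  assumes "set vs \<subseteq> Basis" "\<xi> \<noteq> 0"
  shows "((\<lambda>t. P vs x (\<xi> + t *\<^sub>R axis i 1)) has_real_derivative P (\<xi>dir i # vs) x \<xi>) (at 0)"
  using smooth_on_has_derivative_line[OF smooth_on_dirderivs[OF smooth_\<Phi> assms(1)], of "(x, \<xi>)" 0 "\<xi>dir i"] assms(2)
  by (simp add: P_def has_real_derivative_iff_has_vector_derivative)

lemma mderiv_P: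
  assumes "\<xi> \<noteq> 0"
  shows "mderiv \<alpha> (\<lambda>\<eta>. mderiv \<beta> (\<lambda>y. \<phi> y \<eta>) x) \<xi> = P (map \<xi>dir (mi_list \<alpha>) @ map xdir (mi_list \<beta>)) x \<xi>"
proof -
  let ?\<Phi> = "\<lambda>(x, \<xi>). \<phi> x \<xi>"
  let ?G = "dirderivs (map xdir (mi_list \<beta>)) ?\<Phi>"
  have B: "set (map (\<lambda>i. axis i 1) (mi_list \<gamma>)) \<subseteq> (Basis :: (real^'n) set)" for \<gamma> :: "'n multi_index"
    by auto
  have B2: "set (map xdir (mi_list \<beta>)) \<subseteq> Basis" by auto
  have 1: "mderiv \<beta> (\<lambda>y. \<phi> y \<eta>) x = ?G (x, \<eta>)" if "\<eta> \<in> - {0}" for \<eta>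
    using dirderivs_slice_fst[OF smooth_\<Phi> open_phdom B, of x \<eta>] that by (simp add: mderiv_dirderivs comp_def)
  have "mderiv \<alpha> (\<lambda>\<eta>. mderiv \<beta> (\<lambda>y. \<phi> y \<eta>) x) \<xi> = mderiv \<alpha> (\<lambda>\<eta>. ?G (x, \<eta>)) \<xi>"
    unfolding mderiv_dirderivs[of \<alpha>] by (rule dirderivs_cong_open[of "- {0}"]) (use 1 assms in auto)
  also have "\<dots> = dirderivs (map \<xi>dir (mi_list \<alpha>)) ?G (x, \<xi>)"
    unfolding mderiv_dirderivs[of \<alpha>]
    using dirderivs_slice_snd[OF smooth_on_dirderivs[OF smooth_\<Phi> B2] open_phdom B, of x \<xi>] assms by (simp add: comp_def)
  finally show ?thesis by (simp add: P_def dirderivs_append)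
qed

text \<open>The class bounds derivatives in the order prescribed by multi-indices; by symmetry the
  bound passes to every arrangement vs of the same directions.\<close>

lemma P_bound:
  assumes "length is + length js \<ge> 2"
  shows "\<exists>C\<ge>0. \<forall>vs x \<xi>. mset vs = mset (map \<xi>dir is @ map xdir js) \<and> \<xi> \<noteq> 0 \<longrightarrow>
    \<bar>P vs x \<xi>\<bar> \<le> C * norm \<xi> powr (1 - real (length is))"
proof -
  let ?\<alpha> = "count_list is" and ?\<beta> = "count_list js"
  have "bdd_above ((\<lambda>(x, \<xi>). norm \<xi> powr (- 1 + real (mi_order ?\<alpha>)) *
      \<bar>mderiv ?\<alpha> (\<lambda>\<eta>. mderiv ?\<beta> (\<lambda>y. \<phi> y \<eta>) x) \<xi>\<bar>) ` phdom)"
  proof -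
    have "\<forall>\<alpha> \<beta>. mi_order \<alpha> + mi_order \<beta> \<ge> 2 \<longrightarrow>
        bdd_above ((\<lambda>(x, \<xi>). norm \<xi> powr (- 1 + real (mi_order \<alpha>)) *
                      \<bar>mderiv \<alpha> (\<lambda>\<eta>. mderiv \<beta> (\<lambda>y. \<phi> y \<eta>) x) \<xi>\<bar>) ` phdom)"
      using \<phi> unfolding phase_class_def mem_Collect_eq by (elim conjE)
    from this[rule_format, of ?\<alpha> ?\<beta>] show ?thesis using assms by (simp only: mi_order_count_list)
  qed
  then obtain C where C: "\<And>x \<xi>. \<xi> \<noteq> 0 \<Longrightarrow> norm \<xi> powr (- 1 + real (length is)) *
      \<bar>P (map \<xi>dir (mi_list ?\<alpha>) @ map xdir (mi_list ?\<beta>)) x \<xi>\<bar> \<le> C"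
    unfolding bdd_above_def by (force simp: mi_order_count_list mderiv_P)
  show ?thesis
  proof (intro exI[of _ "max C 0"] conjI allI impI)
    fix vs and x \<xi> :: "real^'n" assume h: "mset vs = mset (map \<xi>dir is @ map xdir js) \<and> \<xi> \<noteq> 0"
    then have "P vs x \<xi> = P (map \<xi>dir (mi_list ?\<alpha>) @ map xdir (mi_list ?\<beta>)) x \<xi>"
    proof (intro P_perm)
      have "set vs = set (map \<xi>dir is @ map xdir js)" using h by (metis mset_eq_setD)
      then show "set vs \<subseteq> Basis" by auto
      show "mset vs = mset (map \<xi>dir (mi_list ?\<alpha>) @ map xdir (mi_list ?\<beta>))"
        using h by (simp add: mset_mi_list_count)
    qed auto
    with C[of \<xi> x] h have 1: "norm \<xi> powr (- 1 + real (length is)) * \<bar>P vs x \<xi>\<bar> \<le> max C 0" by simp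
    have "norm \<xi> powr (1 - real (length is)) * norm \<xi> powr (- 1 + real (length is)) = 1"
      using h by (simp add: powr_add[symmetric])
    then have "\<bar>P vs x \<xi>\<bar> = norm \<xi> powr (1 - real (length is)) * (norm \<xi> powr (- 1 + real (length is)) * \<bar>P vs x \<xi>\<bar>)"
      by (simp only: mult.assoc[symmetric] mult_1)
    also have "\<dots> \<le> norm \<xi> powr (1 - real (length is)) * max C 0" using 1 by (rule mult_left_mono) simp
    finally show "\<bar>P vs x \<xi>\<bar> \<le> max C 0 * norm \<xi> powr (1 - real (length is))" by (simp only: mult.commute)
  qed simp
qed

text \<open>There are finitely many lists of given lengths, so the sum of their constants serves
  them all.\<close>

lemma P_bound_uniform:
  assumes "N + M \<ge> 2"
  shows "\<exists>C\<ge>0. \<forall>is js vs x \<xi>. length is = N \<and> length js = M \<and> mset vs = mset (map \<xi>dir is @ map xdir js) \<and> \<xi> \<noteq> 0 \<longrightarrow>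
    \<bar>P vs x \<xi>\<bar> \<le> C * norm \<xi> powr (1 - real N)"
proof -
  let ?L = "{p :: 'n list \<times> 'n list. length (fst p) = N \<and> length (snd p) = M}"
  have "finite ({is :: 'n list. set is \<subseteq> UNIV \<and> length is = N} \<times> {js :: 'n list. set js \<subseteq> UNIV \<and> length js = M})"
    by (intro finite_cartesian_product finite_lists_length_eq) auto
  then have fin: "finite ?L" by (rule finite_subset[rotated]) auto
  have ex: "\<forall>p\<in>?L. \<exists>C. C \<ge> 0 \<and> (\<forall>vs x \<xi>. mset vs = mset (map \<xi>dir (fst p) @ map xdir (snd p)) \<and> \<xi> \<noteq> 0 \<longrightarrow>
    \<bar>P vs x \<xi>\<bar> \<le> C * norm \<xi> powr (1 - real N))"
  proof
    fix p assume "p \<in> ?L"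
    then have len: "length (fst p) = N" "length (fst p) + length (snd p) \<ge> 2" using assms by auto
    show "\<exists>C. C \<ge> 0 \<and> (\<forall>vs x \<xi>. mset vs = mset (map \<xi>dir (fst p) @ map xdir (snd p)) \<and> \<xi> \<noteq> 0 \<longrightarrow>
      \<bar>P vs x \<xi>\<bar> \<le> C * norm \<xi> powr (1 - real N))"
      by (rule P_bound[OF len(2), unfolded len(1)])
  qed
  from bchoice[OF ex] obtain C where C: "\<forall>p\<in>?L. C p \<ge> 0 \<and> (\<forall>vs x \<xi>. mset vs = mset (map \<xi>dir (fst p) @ map xdir (snd p)) \<and> \<xi> \<noteq> 0 \<longrightarrow>
    \<bar>P vs x \<xi>\<bar> \<le> C p * norm \<xi> powr (1 - real N))" by (elim exE) (rule that)
  show ?thesis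
  proof (intro exI[of _ "\<Sum>p\<in>?L. C p"] conjI allI impI)
    show "0 \<le> (\<Sum>p\<in>?L. C p)" using C by (intro sum_nonneg) blast
    fix "is" js :: "'n list" and vs and x \<xi> :: "real^'n" assume h: "length is = N \<and> length js = M \<and> mset vs = mset (map \<xi>dir is @ map xdir js) \<and> \<xi> \<noteq> 0"
    then have p: "(is, js) \<in> ?L" by simp
    have "C (is, js) \<le> (\<Sum>p\<in>?L. C p)" using p C by (intro member_le_sum fin) blast+
    then have "C (is, js) * norm \<xi> powr (1 - real N) \<le> (\<Sum>p\<in>?L. C p) * norm \<xi> powr (1 - real N)"
      by (rule mult_right_mono) simp
    moreover have "\<bar>P vs x \<xi>\<bar> \<le> C (is, js) * norm \<xi> powr (1 - real N)" 
      using C[rule_format, OF p, THEN conjunct2, rule_format, of vs \<xi> x] h by simp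
    ultimately show "\<bar>P vs x \<xi>\<bar> \<le> (\<Sum>p\<in>?L. C p) * norm \<xi> powr (1 - real N)" by linarith
  qed
qed

definition grad :: "real^'n \<Rightarrow> real^'n \<Rightarrow> real^'n" where
  "grad x \<xi> = (\<chi> i. P [\<xi>dir i] x \<xi>)"

lemma mixed_hessian_P: "\<xi> \<noteq> 0 \<Longrightarrow> mixed_hessian \<phi> x \<xi> $ j $ k = P [xdir j, \<xi>dir k] x \<xi>"
proof -
  assume \<xi>: "\<xi> \<noteq> 0"
  have "dirderivs [axis k 1] (\<phi> y) \<xi> = dirderivs [\<xi>dir k] (\<lambda>(x, \<xi>). \<phi> x \<xi>) (y, \<xi>)" for y
    using dirderivs_slice_snd[OF smooth_\<Phi> open_phdom, of "[axis k 1]" y \<xi>] \<xi> by simp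
  then have "mixed_hessian \<phi> x \<xi> $ j $ k = dirderivs [axis j 1] (\<lambda>y. dirderivs [\<xi>dir k] (\<lambda>(x, \<xi>). \<phi> x \<xi>) (y, \<xi>)) x"
    by (simp add: mixed_hessian_def pderiv_at_def)
  also have "\<dots> = P [xdir j, \<xi>dir k] x \<xi>"
    using dirderivs_slice_fst[OF smooth_on_dirderivs[OF smooth_\<Phi>] open_phdom, of "[\<xi>dir k]" "[axis j 1]" x \<xi>] \<xi>
    by (simp add: P_def)
  finally show ?thesis .
qed

text \<open>The derivative in x of the frequency gradient has homogeneity 0 in \<xi>, so all
  constants are uniform in \<xi>. The transposed mixed Hessian is bounded below by compactness, the
  Taylor remainder is controlled by one more derivative in x, and the resulting local expansion is
  globalized.\<close>

lemma grad_expansion: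
  obtains c where "c > 0" "\<And>x y \<xi>. \<xi> \<noteq> 0 \<Longrightarrow> c * norm (x - y) \<le> norm (grad x \<xi> - grad y \<xi>)"
proof -
  let ?n = "real CARD('n)"
  obtain C1 where C1: "C1 \<ge> 0" "\<And>i j x \<xi>. \<xi> \<noteq> 0 \<Longrightarrow> \<bar>P [xdir j, \<xi>dir i] x \<xi>\<bar> \<le> C1"
  proof -
    obtain C where C: "C \<ge> 0" and Cb: "\<forall>is js vs x \<xi>. length is = 1 \<and> length js = 1 \<and> mset vs = mset (map \<xi>dir is @ map xdir js) \<and> \<xi> \<noteq> 0 \<longrightarrow>
      \<bar>P vs x \<xi>\<bar> \<le> C * norm \<xi> powr (1 - real 1)" using P_bound_uniform[of 1 1] by auto
    have "\<bar>P [xdir j, \<xi>dir i] x \<xi>\<bar> \<le> C" if "\<xi> \<noteq> 0" for i j x \<xi>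
      using Cb[rule_format, of "[i]" "[j]" "[xdir j, \<xi>dir i]" \<xi> x] that by simp
    then show ?thesis using C that by blast
  qed
  obtain C2 where C2: "C2 \<ge> 0" "\<And>i j k x \<xi>. \<xi> \<noteq> 0 \<Longrightarrow> \<bar>P [xdir k, xdir j, \<xi>dir i] x \<xi>\<bar> \<le> C2"
  proof -
    obtain C where C: "C \<ge> 0" and Cb: "\<forall>is js vs x \<xi>. length is = 1 \<and> length js = 2 \<and> mset vs = mset (map \<xi>dir is @ map xdir js) \<and> \<xi> \<noteq> 0 \<longrightarrow>
      \<bar>P vs x \<xi>\<bar> \<le> C * norm \<xi> powr (1 - real 1)" using P_bound_uniform[of 1 2] by auto
    have "\<bar>P [xdir k, xdir j, \<xi>dir i] x \<xi>\<bar> \<le> C" if "\<xi> \<noteq> 0" for i j k x \<xi>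
      using Cb[rule_format, of "[i]" "[j, k]" "[xdir k, xdir j, \<xi>dir i]" \<xi> x] that by simp
    then show ?thesis using C that by blast
  qed
  obtain c0 where c0: "c0 > 0" "\<And>x \<xi>. \<xi> \<noteq> 0 \<Longrightarrow> \<bar>det (mixed_hessian \<phi> x \<xi>)\<bar> \<ge> c0"
    using nondeg unfolding strongly_nondegenerate_def by blast
  obtain \<mu> where \<mu>: "\<mu> > 0" and \<mu>b: "\<And>M v. (\<forall>i j. \<bar>M $ i $ j\<bar> \<le> C1) \<and> \<bar>det M\<bar> \<ge> c0 \<Longrightarrow> \<mu> * norm v \<le> norm (M *v v :: real^'n)"
    using matrix_lower_bound[OF c0(1), of C1] by blast
  \<comment> \<open>The Taylor remainder of the gradient map is at most n^3 C2 |x - y|^2, hence at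
    most half of \<mu> |x - y| up to this radius; the summand 1 keeps the denominator
    positive.\<close>
  define r where "r = \<mu> / (2 * (?n * (?n * (?n * C2)) + 1))"
  have den: "?n * (?n * (?n * C2)) + 1 > 0" using C2 by (simp add: add_nonneg_pos)
  have r: "r > 0" using \<mu> den by (simp add: r_def)
  have loc: "\<mu> / 2 * dist x y \<le> dist (grad x \<xi>) (grad y \<xi>)" if \<xi>: "\<xi> \<noteq> 0" and d: "dist x y \<le> r" for x y \<xi>
  proof -
    \<comment> \<open>The rows of \<open>mixed_hessian\<close> belong to x, so its transpose is the
      Jacobian at y of the map from x to the frequency gradient.\<close>
    define M where "M = transpose (mixed_hessian \<phi> y \<xi>)"
    have Mij: "M $ i $ j = P [xdir j, \<xi>dir i] y \<xi>" for i j
      using mixed_hessian_P[OF \<xi>] by (simp add: M_def transpose_def)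
    have low: "\<mu> * norm (x - y) \<le> norm (M *v (x - y))"
      using c0(2)[OF \<xi>, of y] C1(2)[OF \<xi>] Mij by (intro \<mu>b) (auto simp: M_def det_transpose)
    have comp: "\<bar>(grad x \<xi> - grad y \<xi> - M *v (x - y)) $ i\<bar> \<le> (?n * (?n * C2)) * norm (x - y) * norm (x - y)" for i
    proof -
      \<comment> \<open>One component of the gradient map minus its linear part at y. Its partial
        derivatives vanish at y and by C2 grow at most linearly in the distance from y.\<close>
      let ?g = "\<lambda>z. P [\<xi>dir i] z \<xi> - (\<Sum>j\<in>UNIV. M $ i $ j * z $ j)"
      have ex: "\<forall>z. \<exists>D. (?g has_derivative D) (at z) \<and> (\<forall>j. D (axis j 1) = P [xdir j, \<xi>dir i] z \<xi> - M $ i $ j)"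
      proof
        fix z
        obtain D where D: "((\<lambda>x. P [\<xi>dir i] x \<xi>) has_derivative D) (at z)" "\<And>j. D (axis j 1) = P [xdir j, \<xi>dir i] z \<xi>"
          using P_has_derivative_x[of "[\<xi>dir i]" \<xi> z] \<xi> by auto
        have "(?g has_derivative (\<lambda>h. D h - (\<Sum>j\<in>UNIV. M $ i $ j * h $ j))) (at z)"
          by (intro has_derivative_diff D(1) has_derivative_sum has_derivative_mult_right bounded_linear.has_derivative[OF bounded_linear_vec_nth] has_derivative_ident)
        moreover have "(\<Sum>j\<in>UNIV. M $ i $ j * axis k 1 $ j) = M $ i $ k" for k
          by (simp add: axis_def if_distrib cong: if_cong)
        ultimately show "\<exists>D. (?g has_derivative D) (at z) \<and> (\<forall>j. D (axis j 1) = P [xdir j, \<xi>dir i] z \<xi> - M $ i $ j)"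
          using D(2) by (intro exI[of _ "\<lambda>h. D h - (\<Sum>j\<in>UNIV. M $ i $ j * h $ j)"]) simp
      qed
      from choice[OF ex] obtain D where "\<forall>z. (?g has_derivative D z) (at z) \<and> (\<forall>j. D z (axis j 1) = P [xdir j, \<xi>dir i] z \<xi> - M $ i $ j)"
        by (elim exE) (rule that)
      then have D: "\<And>z. (?g has_derivative D z) (at z)" "\<And>z j. D z (axis j 1) = P [xdir j, \<xi>dir i] z \<xi> - M $ i $ j"
        by blast+
      have P2: "\<bar>P [xdir j, \<xi>dir i] z \<xi> - P [xdir j, \<xi>dir i] y \<xi>\<bar> \<le> (?n * C2) * norm (z - y)" for z j
      proof -
        have ex: "\<forall>x. \<exists>E. ((\<lambda>x. P [xdir j, \<xi>dir i] x \<xi>) has_derivative E) (at x) \<and> (\<forall>k. E (axis k 1) = P [xdir k, xdir j, \<xi>dir i] x \<xi>)"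
        proof
          fix x show "\<exists>E. ((\<lambda>x. P [xdir j, \<xi>dir i] x \<xi>) has_derivative E) (at x) \<and> (\<forall>k. E (axis k 1) = P [xdir k, xdir j, \<xi>dir i] x \<xi>)"
          by (rule P_has_derivative_x[of "[xdir j, \<xi>dir i]" \<xi> x]) (use \<xi> in \<open>simp, simp, blast\<close>)
        qed
        from choice[OF ex] obtain E where "\<forall>x. ((\<lambda>x. P [xdir j, \<xi>dir i] x \<xi>) has_derivative E x) (at x) \<and> (\<forall>k. E x (axis k 1) = P [xdir k, xdir j, \<xi>dir i] x \<xi>)"
          by (elim exE) (rule that)
        then have E: "\<And>x. ((\<lambda>x. P [xdir j, \<xi>dir i] x \<xi>) has_derivative E x) (at x)" "\<And>x k. E x (axis k 1) = P [xdir k, xdir j, \<xi>dir i] x \<xi>"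
          by blast+
        show ?thesis by (rule Lipschitz_of_partials[of UNIV _ E]) (use E C2(2)[OF \<xi>] in auto)
      qed
      have "\<bar>?g x - ?g y\<bar> \<le> (?n * ((?n * C2) * norm (x - y))) * norm (x - y)"
      proof (rule Lipschitz_of_partials[of "cball y (norm (x - y))" _ D])
        fix z j assume z: "z \<in> cball y (norm (x - y))"
        have "\<bar>D z (axis j 1)\<bar> \<le> (?n * C2) * norm (z - y)" using P2[of j z] by (simp add: D Mij)
        also have "\<dots> \<le> (?n * C2) * norm (x - y)"
          using z C2(1) by (intro mult_left_mono) (auto simp: dist_norm norm_minus_commute)
        finally show "\<bar>D z (axis j 1)\<bar> \<le> (?n * C2) * norm (x - y)" .
      qed (use D in \<open>auto simp: dist_norm norm_minus_commute\<close>)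
      moreover have "?g x - ?g y = (grad x \<xi> - grad y \<xi> - M *v (x - y)) $ i"
        by (simp add: grad_def matrix_vector_mult_def right_diff_distrib sum_subtractf)
      ultimately show ?thesis by (simp add: mult_ac)
    qed
    have "norm (grad x \<xi> - grad y \<xi> - M *v (x - y)) \<le> ?n * ((?n * (?n * C2)) * norm (x - y) * norm (x - y))"
      using comp by (rule norm_le_card_component)
    also have "\<dots> = (?n * (?n * (?n * C2))) * norm (x - y) * norm (x - y)" by simp
    also have "\<dots> \<le> \<mu> / 2 * norm (x - y)"
    proof (rule mult_right_mono)
      have "(?n * (?n * (?n * C2))) * norm (x - y) \<le> (?n * (?n * (?n * C2)) + 1) * r"
        using d C2 den by (intro mult_mono) (auto simp: dist_norm)
      also have "\<dots> = \<mu> / 2"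
      proof -
        have "a > 0 \<Longrightarrow> a * (\<mu> / (2 * a)) = \<mu> / 2" for a :: real by simp
        from this[OF den] show ?thesis by (simp only: r_def)
      qed
      finally show "(?n * (?n * (?n * C2))) * norm (x - y) \<le> \<mu> / 2" .
    qed simp
    finally have "norm (grad x \<xi> - grad y \<xi> - M *v (x - y)) \<le> \<mu> / 2 * norm (x - y)" .
    moreover have "norm (M *v (x - y)) \<le> norm (grad x \<xi> - grad y \<xi>) + norm (grad x \<xi> - grad y \<xi> - M *v (x - y))"
      using norm_triangle_ineq4[of "grad x \<xi> - grad y \<xi>" "grad x \<xi> - grad y \<xi> - M *v (x - y)"] by simp
    ultimately show ?thesis using low by (simp add: dist_norm)
  qed
  have cont: "continuous_on UNIV (\<lambda>x. grad x \<xi>)" if \<xi>: "\<xi> \<noteq> 0" for \<xi>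
  proof -
    have "isCont (\<lambda>x. P [\<xi>dir i] x \<xi>) x" for i x
      by (rule P_has_derivative_x[of "[\<xi>dir i]" \<xi> x]) (use \<xi> in \<open>simp, simp, blast intro: has_derivative_continuous\<close>)
    then show ?thesis unfolding grad_def by (intro continuous_on_vec_lambda) (simp add: continuous_at_imp_continuous_on)
  qed
  have "\<mu> / 2 * dist x y \<le> dist (grad x \<xi>) (grad y \<xi>)" if "\<xi> \<noteq> 0" for x y \<xi>
    by (rule uniformly_local_expansion_imp_expansion[OF cont[OF that] _ r]) (use \<mu> loc[OF that] in auto)
  then show ?thesis using \<mu> that[of "\<mu> / 2"] by (simp add: dist_norm)
qed

text \<open>One constant for the derivatives used below: pure repeated frequency derivatives, the
  same with one derivative in x, and the two kinds that control how the gradient varies with \<xi>.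
  It is a sum over the finitely many pairs of orders.\<close>

lemma P_bound_replicate:
  obtains C where "C \<ge> 0" "\<And>l i x \<xi>. l \<le> k \<Longrightarrow> \<xi> \<noteq> 0 \<Longrightarrow> \<bar>P (replicate (Suc (Suc l)) (\<xi>dir i)) x \<xi>\<bar> \<le> C * norm \<xi> powr (- 1 - real l)"
    "\<And>l i j x \<xi>. l \<le> k \<Longrightarrow> \<xi> \<noteq> 0 \<Longrightarrow> \<bar>P (xdir j # replicate (Suc l) (\<xi>dir i)) x \<xi>\<bar> \<le> C * norm \<xi> powr (- real l)"
    "\<And>i j x \<xi>. \<xi> \<noteq> 0 \<Longrightarrow> \<bar>P [\<xi>dir j, \<xi>dir i] x \<xi>\<bar> \<le> C * norm \<xi> powr (- 1)"
    "\<And>i j m x \<xi>. \<xi> \<noteq> 0 \<Longrightarrow> \<bar>P [xdir m, \<xi>dir j, \<xi>dir i] x \<xi>\<bar> \<le> C * norm \<xi> powr (- 1)"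
proof -
  have ex: "\<forall>p\<in>{..k + 2} \<times> {0, 1::nat}. \<exists>C. fst p + snd p \<ge> 2 \<longrightarrow> C \<ge> 0 \<and> (\<forall>is js vs x \<xi>. length is = fst p \<and> length js = snd p \<and> mset vs = mset (map \<xi>dir is @ map xdir js) \<and> \<xi> \<noteq> 0 \<longrightarrow>
    \<bar>P vs x \<xi>\<bar> \<le> C * norm \<xi> powr (1 - real (fst p)))"
    using P_bound_uniform by auto
  from bchoice[OF ex] obtain C where C: "\<forall>p\<in>{..k + 2} \<times> {0, 1::nat}. fst p + snd p \<ge> 2 \<longrightarrow> C p \<ge> 0 \<and> (\<forall>is js vs x \<xi>. length is = fst p \<and> length js = snd p \<and> mset vs = mset (map \<xi>dir is @ map xdir js) \<and> \<xi> \<noteq> 0 \<longrightarrow>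
    \<bar>P vs x \<xi>\<bar> \<le> C p * norm \<xi> powr (1 - real (fst p)))" by (elim exE) (rule that)
  define A where "A = (\<Sum>p\<in>{..k + 2} \<times> {0, 1::nat}. \<bar>C p\<bar>)"
  have main: "\<bar>P vs x \<xi>\<bar> \<le> A * norm \<xi> powr (1 - real (length is))"
    if "length is \<le> k + 2" "length js \<le> 1" "length is + length js \<ge> 2" "mset vs = mset (map \<xi>dir is @ map xdir js)" "\<xi> \<noteq> 0"
    for "is" js :: "'n list" and vs x \<xi>
  proof -
    let ?p = "(length is, length js)"
    have "length js \<in> {0, 1}" using that(2) by (cases js) auto
    then have p: "?p \<in> {..k + 2} \<times> {0, 1::nat}" using that(1) by simp
    have "C ?p \<le> A" unfolding A_def
      using member_le_sum[of ?p "{..k + 2} \<times> {0, 1::nat}" "\<lambda>p. \<bar>C p\<bar>"] p abs_ge_self[of "C ?p"] by (simp add: finite_cartesian_product)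
    then have "C ?p * norm \<xi> powr (1 - real (length is)) \<le> A * norm \<xi> powr (1 - real (length is))"
      by (rule mult_right_mono) simp
    moreover have "\<bar>P vs x \<xi>\<bar> \<le> C ?p * norm \<xi> powr (1 - real (length is))"
      using C[rule_format, OF p, THEN conjunct2, rule_format, of "is" js vs \<xi> x] that by simp
    ultimately show ?thesis by linarith
  qed
  show ?thesis
  proof (rule that[of A])
    show "A \<ge> 0" by (auto simp: A_def intro!: sum_nonneg)
    show "\<bar>P (replicate (Suc (Suc l)) (\<xi>dir i)) x \<xi>\<bar> \<le> A * norm \<xi> powr (- 1 - real l)" if "l \<le> k" "\<xi> \<noteq> 0" for l i x \<xi>
      using main[of "replicate (Suc (Suc l)) i" "[]" "replicate (Suc (Suc l)) (\<xi>dir i)" \<xi> x] that by simp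
    show "\<bar>P (xdir j # replicate (Suc l) (\<xi>dir i)) x \<xi>\<bar> \<le> A * norm \<xi> powr (- real l)" if "l \<le> k" "\<xi> \<noteq> 0" for l i j x \<xi>
      using main[of "replicate (Suc l) i" "[j]" "xdir j # replicate (Suc l) (\<xi>dir i)" \<xi> x] that by simp
    show "\<bar>P [\<xi>dir j, \<xi>dir i] x \<xi>\<bar> \<le> A * norm \<xi> powr (- 1)" if "\<xi> \<noteq> 0" for i j x \<xi>
      using main[of "[j, i]" "[]" "[\<xi>dir j, \<xi>dir i]" \<xi> x] that by simp
    show "\<bar>P [xdir m, \<xi>dir j, \<xi>dir i] x \<xi>\<bar> \<le> A * norm \<xi> powr (- 1)" if "\<xi> \<noteq> 0" for i j m x \<xi>
      using main[of "[j, i]" "[m]" "[xdir m, \<xi>dir j, \<xi>dir i]" \<xi> x] that by simp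
  qed
qed

lemma P_Lipschitz_x:
  assumes vs: "set vs \<subseteq> Basis" and \<xi>: "\<xi> \<noteq> 0" and C: "\<And>j x. \<bar>P (xdir j # vs) x \<xi>\<bar> \<le> C"
  shows "\<bar>P vs x \<xi> - P vs y \<xi>\<bar> \<le> (real CARD('n) * C) * norm (x - y)"
proof -
  have ex: "\<forall>x. \<exists>E. ((\<lambda>x. P vs x \<xi>) has_derivative E) (at x) \<and> (\<forall>k. E (axis k 1) = P (xdir k # vs) x \<xi>)"
  proof
    fix x show "\<exists>E. ((\<lambda>x. P vs x \<xi>) has_derivative E) (at x) \<and> (\<forall>k. E (axis k 1) = P (xdir k # vs) x \<xi>)"
      by (rule P_has_derivative_x[OF vs \<xi>, of x]) blast
  qed
  from choice[OF ex] obtain E where E: "\<forall>x. ((\<lambda>x. P vs x \<xi>) has_derivative E x) (at x) \<and> (\<forall>k. E x (axis k 1) = P (xdir k # vs) x \<xi>)"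
    by (elim exE) (rule that)
  show ?thesis by (rule Lipschitz_of_partials[of UNIV _ E]) (use E C in auto)
qed

lemma norm_powr_neg_le:
  assumes "R / 2 < norm (x :: real^'n)" "R > 0" "s \<ge> 0"
  shows "norm x powr (- s) \<le> 2 powr s * R powr (- s)"
proof -
  have "norm x powr (- s) \<le> (R / 2) powr (- s)" using assms by (intro powr_mono2') auto
  also have "\<dots> = 2 powr s * R powr (- s)" using assms by (simp add: powr_divide powr_minus_divide)
  finally show ?thesis .
qed

text \<open>The mean value theorem in x produces the factor |x - y| that is divided out; after that
  every frequency derivative gains 1/|\<xi>|, which is at most 2/R. This gives the scale
  1/R.\<close>

lemma phase_difference_dbounds:
  obtains A where "A \<ge> 0" "\<And>i x y R U. R > 0 \<Longrightarrow> x \<noteq> y \<Longrightarrow> (\<And>\<xi>. \<xi> \<in> U \<Longrightarrow> R / 2 < norm \<xi>) \<Longrightarrow>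
    dbounds (axis i 1) (1 / R) U k A (\<lambda>\<xi>. complex_of_real ((P [\<xi>dir i] x \<xi> - P [\<xi>dir i] y \<xi>) / norm (x - y)))"
proof -
  let ?n = "real CARD('n)"
  obtain C where C: "C \<ge> 0" "\<And>l i j x \<xi>. l \<le> k \<Longrightarrow> \<xi> \<noteq> 0 \<Longrightarrow> \<bar>P (xdir j # replicate (Suc l) (\<xi>dir i)) x \<xi>\<bar> \<le> C * norm \<xi> powr (- real l)"
    by (rule P_bound_replicate[of k], rule that, assumption+)
  show ?thesis
  proof (rule that[of "?n * C * 2 ^ k"])
    fix i and x y :: "real^'n" and R :: real and U :: "(real^'n) set" assume R: "R > 0" and xy: "x \<noteq> y" and U: "\<And>\<xi>. \<xi> \<in> U \<Longrightarrow> R / 2 < norm \<xi>"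
    have nz: "\<xi> \<noteq> 0" if "\<xi> \<in> U" for \<xi> using U[OF that] R by auto
    define f where "f l \<xi> = complex_of_real ((P (replicate (Suc l) (\<xi>dir i)) x \<xi> - P (replicate (Suc l) (\<xi>dir i)) y \<xi>) / norm (x - y))" for l \<xi>
    have "dbounds (axis i 1) (1 / R) U k (?n * C * 2 ^ k) (f 0)"
    proof (rule dbounds_seq)
      fix l \<xi> assume l: "l \<le> k" and \<xi>: "\<xi> \<in> U"
      have "\<bar>P (replicate (Suc l) (\<xi>dir i)) x \<xi> - P (replicate (Suc l) (\<xi>dir i)) y \<xi>\<bar> \<le> (?n * (C * norm \<xi> powr (- real l))) * norm (x - y)"
        by (rule P_Lipschitz_x) (use C(2)[OF l nz[OF \<xi>]] nz[OF \<xi>] in auto)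
      then have "norm (f l \<xi>) \<le> ?n * C * norm \<xi> powr (- real l)"
        using xy by (simp add: f_def norm_divide divide_le_eq mult.assoc del: of_real_diff)
      also have "\<dots> \<le> ?n * C * (2 powr real l * R powr (- real l))"
        using norm_powr_neg_le[OF U[OF \<xi>] R, of "real l"] C(1) by (intro mult_left_mono) auto
      also have "\<dots> = ?n * C * 2 ^ l * (1 / R) ^ l"
        using R by (simp add: powr_realpow powr_minus power_divide divide_inverse power_inverse)
      also have "\<dots> \<le> ?n * C * 2 ^ k * (1 / R) ^ l"
        using C(1) l R by (intro mult_right_mono mult_left_mono) auto
      finally show "norm (f l \<xi>) \<le> ?n * C * 2 ^ k * (1 / R) ^ l" .
    next
      fix l \<xi> assume l: "l < k" and \<xi>: "\<xi> \<in> U"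
      have B: "set (replicate (Suc l) (\<xi>dir i)) \<subseteq> Basis" by auto
      have "((\<lambda>t. (P (replicate (Suc l) (\<xi>dir i)) x (\<xi> + t *\<^sub>R axis i 1) - P (replicate (Suc l) (\<xi>dir i)) y (\<xi> + t *\<^sub>R axis i 1)) / norm (x - y))
        has_real_derivative (P (\<xi>dir i # replicate (Suc l) (\<xi>dir i)) x \<xi> - P (\<xi>dir i # replicate (Suc l) (\<xi>dir i)) y \<xi>) / norm (x - y)) (at 0)"
        by (intro DERIV_cdivide DERIV_diff P_line[OF B nz[OF \<xi>]])
      then show "((\<lambda>t. f l (\<xi> + t *\<^sub>R axis i 1)) has_vector_derivative f (Suc l) \<xi>) (at 0)"
        unfolding f_def by (intro has_vector_derivative_of_real) simp
    qed
    moreover have "f 0 = (\<lambda>\<xi>. complex_of_real ((P [\<xi>dir i] x \<xi> - P [\<xi>dir i] y \<xi>) / norm (x - y)))"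
      by (rule ext) (simp add: f_def)
    ultimately show "dbounds (axis i 1) (1 / R) U k (?n * C * 2 ^ k) (\<lambda>\<xi>. complex_of_real ((P [\<xi>dir i] x \<xi> - P [\<xi>dir i] y \<xi>) / norm (x - y)))"
      by (simp only:)
  qed (use C in simp)
qed

text \<open>At the centre \<zeta> the largest component of the gradient difference is at least c0 /
  n times |x - y|; which one it is depends on x and y. The neighbourhood is so small that this
  component stays large on all of U.\<close>

lemma phase_difference_lower:
  obtains c \<delta> where "c > 0" "0 < \<delta>" "\<delta> \<le> 1"
    "\<And>x y R \<zeta> U. R > 0 \<Longrightarrow> convex U \<Longrightarrow> (\<And>\<xi>. \<xi> \<in> U \<Longrightarrow> R / 2 < norm \<xi> \<and> norm (\<xi> - \<zeta>) \<le> \<delta> * R) \<Longrightarrow> \<zeta> \<in> U \<Longrightarrow>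
      \<exists>i. \<forall>\<xi>\<in>U. c * norm (x - y) \<le> \<bar>P [\<xi>dir i] x \<xi> - P [\<xi>dir i] y \<xi>\<bar>"
proof -
  let ?n = "real CARD('n)"
  obtain c0 where c0: "c0 > 0" "\<And>x y \<xi>. \<xi> \<noteq> 0 \<Longrightarrow> c0 * norm (x - y) \<le> norm (grad x \<xi> - grad y \<xi>)"
    using grad_expansion by metis
  obtain C where C: "C \<ge> 0" "\<And>i j m x \<xi>. \<xi> \<noteq> 0 \<Longrightarrow> \<bar>P [xdir m, \<xi>dir j, \<xi>dir i] x \<xi>\<bar> \<le> C * norm \<xi> powr (- 1)"
    by (rule P_bound_replicate[of 0], rule that, assumption+)
  define c where "c = c0 / ?n"
  define K where "K = ?n * (?n * (2 * C)) + 1"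
  \<comment> \<open>Within \<delta> R of \<zeta> the chosen component changes by at most K \<delta>
    |x - y|, the R of the distance cancelling the 1/R of the derivative; this is at most half of c
    |x - y|.\<close>
  define \<delta> where "\<delta> = min 1 (c / (2 * K))"
  have K: "K > 0" using C by (auto simp: K_def intro!: add_nonneg_pos)
  have c: "c > 0" using c0 by (simp add: c_def)
  have \<delta>: "\<delta> > 0" "\<delta> \<le> 1" "K * \<delta> \<le> c / 2" 
  proof -
    show "\<delta> > 0" "\<delta> \<le> 1" using c K by (auto simp: \<delta>_def)
    have "K * \<delta> \<le> K * (c / (2 * K))" using K by (intro mult_left_mono) (auto simp: \<delta>_def)
    then show "K * \<delta> \<le> c / 2" using K by simp
  qed
  show ?thesis
  proof (rule that[of "c / 2" \<delta>])
    fix x y \<zeta> :: "real^'n" and R :: real and U assume R: "R > 0" and cv: "convex U" and U: "\<And>\<xi>. \<xi> \<in> U \<Longrightarrow> R / 2 < norm \<xi> \<and> norm (\<xi> - \<zeta>) \<le> \<delta> * R" and \<zeta>: "\<zeta> \<in> U"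
    have nz: "\<xi> \<noteq> 0" if "\<xi> \<in> U" for \<xi> using U[OF that] R by auto
    have "\<exists>i. c * norm (x - y) \<le> \<bar>(grad x \<zeta> - grad y \<zeta>) $ i\<bar>"
    proof (rule ccontr)
      assume "\<nexists>i. c * norm (x - y) \<le> \<bar>(grad x \<zeta> - grad y \<zeta>) $ i\<bar>"
      then have lt: "\<And>i. \<bar>(grad x \<zeta> - grad y \<zeta>) $ i\<bar> < c * norm (x - y)" by (meson not_le)
      have "norm (grad x \<zeta> - grad y \<zeta>) \<le> (\<Sum>i\<in>UNIV. \<bar>(grad x \<zeta> - grad y \<zeta>) $ i\<bar>)" by (rule norm_le_l1_cart)
      also have "\<dots> < (\<Sum>i\<in>(UNIV::'n set). c * norm (x - y))" using lt by (intro sum_strict_mono) auto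
      also have "\<dots> = c0 * norm (x - y)" by (simp add: c_def)
      finally show False using c0(2)[OF nz[OF \<zeta>], of x y] by simp
    qed
    then obtain i where i: "c * norm (x - y) \<le> \<bar>P [\<xi>dir i] x \<zeta> - P [\<xi>dir i] y \<zeta>\<bar>"
      by (auto simp: grad_def)
    have "c / 2 * norm (x - y) \<le> \<bar>P [\<xi>dir i] x \<xi> - P [\<xi>dir i] y \<xi>\<bar>" if \<xi>: "\<xi> \<in> U" for \<xi>
    proof -
      let ?g = "\<lambda>\<xi>. P [\<xi>dir i] x \<xi> - P [\<xi>dir i] y \<xi>"
      have ex: "\<forall>\<eta>\<in>U. \<exists>E. (?g has_derivative E) (at \<eta>) \<and> (\<forall>j. E (axis j 1) = P [\<xi>dir j, \<xi>dir i] x \<eta> - P [\<xi>dir j, \<xi>dir i] y \<eta>)"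
      proof
        fix \<eta> assume "\<eta> \<in> U"
        then have \<eta>: "\<eta> \<noteq> 0" using nz by blast
        obtain D1 where D1: "((\<lambda>\<xi>. P [\<xi>dir i] x \<xi>) has_derivative D1) (at \<eta>)" "\<And>j. D1 (axis j 1) = P [\<xi>dir j, \<xi>dir i] x \<eta>"
          using P_has_derivative_\<xi>[of "[\<xi>dir i]" \<eta> x] \<eta> by auto
        obtain D2 where D2: "((\<lambda>\<xi>. P [\<xi>dir i] y \<xi>) has_derivative D2) (at \<eta>)" "\<And>j. D2 (axis j 1) = P [\<xi>dir j, \<xi>dir i] y \<eta>"
          using P_has_derivative_\<xi>[of "[\<xi>dir i]" \<eta> y] \<eta> by auto
        show "\<exists>E. (?g has_derivative E) (at \<eta>) \<and> (\<forall>j. E (axis j 1) = P [\<xi>dir j, \<xi>dir i] x \<eta> - P [\<xi>dir j, \<xi>dir i] y \<eta>)"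
          using has_derivative_diff[OF D1(1) D2(1)] D1(2) D2(2) by (intro exI[of _ "\<lambda>h. D1 h - D2 h"]) simp
      qed
      from bchoice[OF ex] obtain E where E: "\<forall>\<eta>\<in>U. (?g has_derivative E \<eta>) (at \<eta>) \<and> (\<forall>j. E \<eta> (axis j 1) = P [\<xi>dir j, \<xi>dir i] x \<eta> - P [\<xi>dir j, \<xi>dir i] y \<eta>)"
        by (elim exE) (rule that)
      have "\<bar>?g \<xi> - ?g \<zeta>\<bar> \<le> (?n * ((?n * (2 * C / R)) * norm (x - y))) * norm (\<xi> - \<zeta>)"
      proof (rule Lipschitz_of_partials[OF cv _ _ \<xi> \<zeta>])
        fix \<eta> j assume \<eta>: "\<eta> \<in> U"
        have b: "\<bar>P [xdir m, \<xi>dir j, \<xi>dir i] z \<eta>\<bar> \<le> 2 * C / R" for m z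
        proof -
          have "\<bar>P [xdir m, \<xi>dir j, \<xi>dir i] z \<eta>\<bar> \<le> C * norm \<eta> powr (- 1)" using C(2) nz[OF \<eta>] by blast
          also have "\<dots> \<le> C * (2 powr 1 * R powr (- 1))"
            using norm_powr_neg_le[of R \<eta> 1] U[OF \<eta>] R C(1) by (intro mult_left_mono) auto
          finally show ?thesis using R by (simp add: powr_minus divide_inverse mult_ac)
        qed
        have "\<bar>P [\<xi>dir j, \<xi>dir i] x \<eta> - P [\<xi>dir j, \<xi>dir i] y \<eta>\<bar> \<le> (?n * (2 * C / R)) * norm (x - y)"
          by (rule P_Lipschitz_x) (use nz[OF \<eta>] b in auto)
        then show "\<bar>E \<eta> (axis j 1)\<bar> \<le> (?n * (2 * C / R)) * norm (x - y)" using E \<eta> by simp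
      qed (use E in auto)
      also have "\<dots> \<le> (?n * ((?n * (2 * C / R)) * norm (x - y))) * (\<delta> * R)"
        using U[OF \<xi>] C(1) R by (intro mult_left_mono) auto
      also have "\<dots> = (?n * (?n * (2 * C))) * \<delta> * norm (x - y)" using R by simp
      also have "\<dots> \<le> (c / 2) * norm (x - y)"
      proof (rule mult_right_mono)
        have "(?n * (?n * (2 * C))) * \<delta> \<le> K * \<delta>" using \<delta> by (intro mult_right_mono) (auto simp: K_def)
        then show "(?n * (?n * (2 * C))) * \<delta> \<le> c / 2" using \<delta>(3) by linarith
      qed simp
      finally show ?thesis using i by linarith
    qed
    then show "\<exists>i. \<forall>\<xi>\<in>U. c / 2 * norm (x - y) \<le> \<bar>P [\<xi>dir i] x \<xi> - P [\<xi>dir i] y \<xi>\<bar>" by blast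
  qed (use c \<delta> in auto)
qed

lemma grad_has_derivative:
  assumes \<xi>: "\<xi> \<noteq> 0"
  shows "((\<lambda>\<xi>. \<phi> x \<xi>) has_derivative (\<lambda>h. grad x \<xi> \<bullet> h)) (at \<xi>)"
proof -
  obtain D where D: "((\<lambda>\<xi>. P [] x \<xi>) has_derivative D) (at \<xi>)" "\<And>j. D (axis j 1) = P [\<xi>dir j] x \<xi>"
    using P_has_derivative_\<xi>[of "[]" \<xi> x] \<xi> by auto
  have "D h = grad x \<xi> \<bullet> h" for h
  proof -
    have lin: "linear D" using has_derivative_linear[OF D(1)] .
    have "D h = D (\<Sum>j\<in>UNIV. h $ j *\<^sub>R axis j 1)" by (metis (no_types) basis_expansion scalar_mult_eq_scaleR)
    also have "\<dots> = (\<Sum>j\<in>UNIV. h $ j * D (axis j 1))" using lin by (simp add: linear_sum linear_scale)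
    finally show ?thesis by (simp add: D(2) grad_def inner_vec_def mult.commute)
  qed
  then have "D = (\<lambda>h. grad x \<xi> \<bullet> h)" by blast
  with D(1) show ?thesis by (simp add: P_Nil)
qed

text \<open>By this identity the linear function with coefficients grad x \<zeta> agrees with the
  phase at \<zeta> without an additive constant.\<close>

lemma Euler: "\<xi> \<noteq> 0 \<Longrightarrow> grad x \<xi> \<bullet> \<xi> = \<phi> x \<xi>"
proof -
  assume \<xi>: "\<xi> \<noteq> 0"
  have "((\<lambda>t. t *\<^sub>R \<xi>) has_derivative (\<lambda>h. h *\<^sub>R \<xi>)) (at 1)" by (auto intro!: derivative_eq_intros)
  from has_derivative_compose[OF this, of "\<phi> x" "\<lambda>h. grad x \<xi> \<bullet> h"] grad_has_derivative[OF \<xi>, of x]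
  have "((\<lambda>t. \<phi> x (t *\<^sub>R \<xi>)) has_derivative (\<lambda>h. h * (grad x \<xi> \<bullet> \<xi>))) (at 1)" by simp
  then have "((\<lambda>t. \<phi> x (t *\<^sub>R \<xi>)) has_real_derivative (grad x \<xi> \<bullet> \<xi>)) (at 1)"
    by (simp add: has_field_derivative_def mult.commute[of _ "grad x \<xi> \<bullet> \<xi>"])
  then have "((\<lambda>t. t * \<phi> x \<xi>) has_real_derivative (grad x \<xi> \<bullet> \<xi>)) (at 1)"
    by (rule has_field_derivative_transform_within_open[of _ _ _ "{0<..}"]) (use homog \<xi> in auto)
  moreover have "((\<lambda>t. t * \<phi> x \<xi>) has_real_derivative \<phi> x \<xi>) (at 1)"
    by (auto intro!: derivative_eq_intros)
  ultimately show ?thesis by (rule DERIV_unique)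
qed

text \<open>The gradient is constant along rays, so the linearization at R z is the one at z and
  does not depend on the shell.\<close>

lemma grad_scale: "\<xi> \<noteq> 0 \<Longrightarrow> t > 0 \<Longrightarrow> grad x (t *\<^sub>R \<xi>) = grad x \<xi>"
proof -
  assume \<xi>: "\<xi> \<noteq> 0" and t: "t > 0"
  have "((\<lambda>\<xi>. t *\<^sub>R \<xi>) has_derivative (\<lambda>h. t *\<^sub>R h)) (at \<xi>)" by (auto intro!: derivative_eq_intros)
  from has_derivative_compose[OF this, of "\<phi> x" "\<lambda>h. grad x (t *\<^sub>R \<xi>) \<bullet> h"] grad_has_derivative[of "t *\<^sub>R \<xi>" x] \<xi> t
  have "((\<lambda>\<xi>. \<phi> x (t *\<^sub>R \<xi>)) has_derivative (\<lambda>h. t * (grad x (t *\<^sub>R \<xi>) \<bullet> h))) (at \<xi>)" by simp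
  then have 1: "((\<lambda>\<xi>. t * \<phi> x \<xi>) has_derivative (\<lambda>h. t * (grad x (t *\<^sub>R \<xi>) \<bullet> h))) (at \<xi>)"
    by (rule has_derivative_transform_within_open[OF _ open_Compl[OF closed_singleton[of 0]]]) (use homog \<xi> t in auto)
  have 2: "((\<lambda>\<xi>. t * \<phi> x \<xi>) has_derivative (\<lambda>h. t * (grad x \<xi> \<bullet> h))) (at \<xi>)"
    by (intro has_derivative_mult_right grad_has_derivative \<xi>)
  have "t * (grad x (t *\<^sub>R \<xi>) \<bullet> h) = t * (grad x \<xi> \<bullet> h)" for h
    using has_derivative_unique[OF 1 2] by (rule fun_cong)
  then have "grad x (t *\<^sub>R \<xi>) \<bullet> h = grad x \<xi> \<bullet> h" for h using t by simp
  then show ?thesis by (metis inner_commute vector_eq_ldot)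
qed

text \<open>The error vanishes to first order at \<zeta> and has second derivatives of size 1/R, so
  near \<zeta> it is of size R and its gradient of size 1. All orders fit the scale 1/R with the
  common factor R.\<close>

lemma phase_linearization_dbounds:
  obtains A where "A \<ge> 0" "\<And>i x \<zeta> R U. R > 0 \<Longrightarrow> convex U \<Longrightarrow> (\<And>\<xi>. \<xi> \<in> U \<Longrightarrow> R / 2 < norm \<xi> \<and> norm (\<xi> - \<zeta>) \<le> R) \<Longrightarrow> \<zeta> \<in> U \<Longrightarrow>
    dbounds (axis i 1) (1 / R) U k (R * A) (\<lambda>\<xi>. complex_of_real (\<phi> x \<xi> - grad x \<zeta> \<bullet> \<xi>))"
proof -
  let ?n = "real CARD('n)"
  obtain C where C: "C \<ge> 0" "\<And>l i x \<xi>. l \<le> k \<Longrightarrow> \<xi> \<noteq> 0 \<Longrightarrow> \<bar>P (replicate (Suc (Suc l)) (\<xi>dir i)) x \<xi>\<bar> \<le> C * norm \<xi> powr (- 1 - real l)"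
    "\<And>i j x \<xi>. \<xi> \<noteq> 0 \<Longrightarrow> \<bar>P [\<xi>dir j, \<xi>dir i] x \<xi>\<bar> \<le> C * norm \<xi> powr (- 1)"
    by (rule P_bound_replicate[of k], rule that, assumption+)
  define A1 where "A1 = ?n * (2 * C)"
  define A where "A = ?n * A1 + A1 + C * 2 ^ (k + 1)"
  have A1: "A1 \<ge> 0" using C by (simp add: A1_def)
  have A: "?n * A1 \<le> A" "A1 \<le> A" "C * 2 ^ (k + 1) \<le> A" "0 \<le> A" using C A1 by (auto simp: A_def)
  show ?thesis
  proof (rule that[of A])
    fix i :: 'n and x \<zeta> :: "real^'n" and R :: real and U assume R: "R > 0" and cv: "convex U"
      and U: "\<And>\<xi>. \<xi> \<in> U \<Longrightarrow> R / 2 < norm \<xi> \<and> norm (\<xi> - \<zeta>) \<le> R" and \<zeta>: "\<zeta> \<in> U"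
    have nz: "\<xi> \<noteq> 0" if "\<xi> \<in> U" for \<xi> using U[OF that] R by auto
    have g1: "\<bar>P [\<xi>dir j] x \<xi> - P [\<xi>dir j] x \<zeta>\<bar> \<le> A1" if \<xi>: "\<xi> \<in> U" for j \<xi>
    proof -
      have ex: "\<forall>\<eta>\<in>U. \<exists>E. ((\<lambda>\<xi>. P [\<xi>dir j] x \<xi>) has_derivative E) (at \<eta>) \<and> (\<forall>m. E (axis m 1) = P [\<xi>dir m, \<xi>dir j] x \<eta>)"
      proof
        fix \<eta> assume "\<eta> \<in> U"
        then have \<eta>: "\<eta> \<noteq> 0" using nz by blast
        show "\<exists>E. ((\<lambda>\<xi>. P [\<xi>dir j] x \<xi>) has_derivative E) (at \<eta>) \<and> (\<forall>m. E (axis m 1) = P [\<xi>dir m, \<xi>dir j] x \<eta>)"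
          by (rule P_has_derivative_\<xi>[of "[\<xi>dir j]" \<eta> x]) (use \<eta> in \<open>simp, simp, blast\<close>)
      qed
      from bchoice[OF ex] obtain E where E: "\<forall>\<eta>\<in>U. ((\<lambda>\<xi>. P [\<xi>dir j] x \<xi>) has_derivative E \<eta>) (at \<eta>) \<and> (\<forall>m. E \<eta> (axis m 1) = P [\<xi>dir m, \<xi>dir j] x \<eta>)"
        by (elim exE) (rule that)
      have "\<bar>P [\<xi>dir j] x \<xi> - P [\<xi>dir j] x \<zeta>\<bar> \<le> (?n * (2 * C / R)) * norm (\<xi> - \<zeta>)"
      proof (rule Lipschitz_of_partials[OF cv _ _ \<xi> \<zeta>])
        fix \<eta> m assume \<eta>: "\<eta> \<in> U"
        have "\<bar>P [\<xi>dir m, \<xi>dir j] x \<eta>\<bar> \<le> C * norm \<eta> powr (- 1)" using C(3) nz[OF \<eta>] by blast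
        also have "\<dots> \<le> C * (2 powr 1 * R powr (- 1))"
          using norm_powr_neg_le[of R \<eta> 1] U[OF \<eta>] R C(1) by (intro mult_left_mono) auto
        finally show "\<bar>E \<eta> (axis m 1)\<bar> \<le> 2 * C / R" using R E \<eta> by (simp add: powr_minus divide_inverse mult_ac)
      qed (use E in auto)
      also have "\<dots> \<le> (?n * (2 * C / R)) * R" using U[OF \<xi>] C(1) R by (intro mult_left_mono) auto
      finally show ?thesis using R by (simp add: A1_def)
    qed
    have psi: "\<bar>\<phi> x \<xi> - grad x \<zeta> \<bullet> \<xi>\<bar> \<le> R * A" if \<xi>: "\<xi> \<in> U" for \<xi>
    proof -
      have "\<bar>(\<phi> x \<xi> - grad x \<zeta> \<bullet> \<xi>) - (\<phi> x \<zeta> - grad x \<zeta> \<bullet> \<zeta>)\<bar> \<le> (?n * A1) * norm (\<xi> - \<zeta>)"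
      proof (rule Lipschitz_of_partials[OF cv _ _ \<xi> \<zeta>])
        show "((\<lambda>\<xi>. \<phi> x \<xi> - grad x \<zeta> \<bullet> \<xi>) has_derivative (\<lambda>h. grad x \<eta> \<bullet> h - grad x \<zeta> \<bullet> h)) (at \<eta>)" if "\<eta> \<in> U" for \<eta>
          by (intro has_derivative_diff grad_has_derivative nz that has_derivative_inner_right has_derivative_ident)
        show "\<bar>grad x \<eta> \<bullet> axis j 1 - grad x \<zeta> \<bullet> axis j 1\<bar> \<le> A1" if "\<eta> \<in> U" for \<eta> j
          using g1[OF that] by (simp add: grad_def inner_axis)
      qed
      also have "\<dots> \<le> (?n * A1) * R" using U[OF \<xi>] A1 by (intro mult_left_mono) auto
      also have "\<dots> \<le> A * R" using A R by (intro mult_right_mono) auto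
      finally show ?thesis using Euler[OF nz[OF \<zeta>], of x] by (simp add: mult.commute)
    qed
    \<comment> \<open>The successive derivatives of the error: the linear part contributes to orders
      0 and 1 only.\<close>
    define f where "f l \<xi> = complex_of_real (case l of 0 \<Rightarrow> \<phi> x \<xi> - grad x \<zeta> \<bullet> \<xi> | Suc 0 \<Rightarrow> P [\<xi>dir i] x \<xi> - P [\<xi>dir i] x \<zeta>
       | Suc (Suc m) \<Rightarrow> P (replicate (Suc (Suc m)) (\<xi>dir i)) x \<xi>)" for l \<xi>
    have "dbounds (axis i 1) (1 / R) U k (R * A) (f 0)"
    proof (rule dbounds_seq)
      fix l \<xi> assume l: "l \<le> k" and \<xi>: "\<xi> \<in> U"
      consider "l = 0" | "l = Suc 0" | m where "l = Suc (Suc m)" by (metis not0_implies_Suc)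
      then show "norm (f l \<xi>) \<le> R * A * (1 / R) ^ l"
      proof cases
        case 1 then show ?thesis using psi[OF \<xi>] by (simp add: f_def del: of_real_diff)
      next
        case 2 then show ?thesis using g1[OF \<xi>, of i] A R by (simp add: f_def del: of_real_diff)
      next
        case 3
        have "norm (f l \<xi>) = \<bar>P (replicate (Suc (Suc m)) (\<xi>dir i)) x \<xi>\<bar>" using 3 by (simp add: f_def)
        also have "\<dots> \<le> C * norm \<xi> powr (- (real (m + 1)))"
          using C(2)[of m \<xi> i x] l 3 nz[OF \<xi>] by (simp add: add.commute)
        also have "\<dots> \<le> C * (2 powr real (m + 1) * R powr (- real (m + 1)))"
          using norm_powr_neg_le[of R \<xi> "real (m + 1)"] U[OF \<xi>] R C(1) by (intro mult_left_mono) auto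
        also have "\<dots> = C * 2 ^ (m + 1) * (1 / R) ^ (m + 1)"
          using R by (simp only: powr_minus powr_realpow zero_less_numeral power_divide divide_inverse power_one mult_1 power_inverse mult.assoc)
        also have "\<dots> \<le> C * 2 ^ (k + 1) * (1 / R) ^ (m + 1)"
          using C(1) l R 3 by (intro mult_right_mono mult_left_mono power_increasing) auto
        also have "\<dots> \<le> A * (1 / R) ^ (m + 1)" using A R by (intro mult_right_mono) auto
        also have "\<dots> = R * A * (1 / R) ^ l" using R 3 by simp
        finally show ?thesis .
      qed
    next
      fix l \<xi> assume l: "l < k" and \<xi>: "\<xi> \<in> U"
      consider "l = 0" | "l = Suc 0" | m where "l = Suc (Suc m)" by (metis not0_implies_Suc)
      then have "((\<lambda>t. case l of 0 \<Rightarrow> \<phi> x (\<xi> + t *\<^sub>R axis i 1) - grad x \<zeta> \<bullet> (\<xi> + t *\<^sub>R axis i 1) | Suc 0 \<Rightarrow> P [\<xi>dir i] x (\<xi> + t *\<^sub>R axis i 1) - P [\<xi>dir i] x \<zeta>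
       | Suc (Suc m) \<Rightarrow> P (replicate (Suc (Suc m)) (\<xi>dir i)) x (\<xi> + t *\<^sub>R axis i 1)) has_real_derivative 
        (case Suc l of 0 \<Rightarrow> \<phi> x \<xi> - grad x \<zeta> \<bullet> \<xi> | Suc 0 \<Rightarrow> P [\<xi>dir i] x \<xi> - P [\<xi>dir i] x \<zeta>
       | Suc (Suc m) \<Rightarrow> P (replicate (Suc (Suc m)) (\<xi>dir i)) x \<xi>)) (at 0)"
      proof cases
        case 1
        have "((\<lambda>t. grad x \<zeta> \<bullet> (\<xi> + t *\<^sub>R axis i 1)) has_real_derivative P [\<xi>dir i] x \<zeta>) (at 0)"
          by (auto intro!: derivative_eq_intros simp: inner_add_right grad_def inner_axis)
        from DERIV_diff[OF P_line[of "[]" \<xi> x i, OF _ nz[OF \<xi>], unfolded P_Nil] this] 1 show ?thesis by simp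
      next
        case 2
        from DERIV_diff[OF P_line[of "[\<xi>dir i]" \<xi> x i, OF _ nz[OF \<xi>]] DERIV_const] 2 show ?thesis by simp
      next
        case 3
        have "set (replicate (Suc (Suc m)) (\<xi>dir i)) \<subseteq> Basis" by auto
        from P_line[OF this nz[OF \<xi>], of x i] 3 show ?thesis by simp
      qed
      then show "((\<lambda>t. f l (\<xi> + t *\<^sub>R axis i 1)) has_vector_derivative f (Suc l) \<xi>) (at 0)"
        unfolding f_def by (rule has_vector_derivative_of_real)
    qed
    moreover have "f 0 = (\<lambda>\<xi>. complex_of_real (\<phi> x \<xi> - grad x \<zeta> \<bullet> \<xi>))"
      by (rule ext) (simp add: f_def)
    ultimately show "dbounds (axis i 1) (1 / R) U k (R * A) (\<lambda>\<xi>. complex_of_real (\<phi> x \<xi> - grad x \<zeta> \<bullet> \<xi>))"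
      by (simp only:)
  qed (use A in simp)
qed

end

section \<open>A smooth bump function\<close>

text \<open>The flat function exp(-1/t) with polynomial factors in 1/t. The family is closed under
  differentiation, so smoothness becomes an induction over polynomials.\<close>

definition flat :: "real poly \<Rightarrow> real \<Rightarrow> real" where
  "flat p t = (if t > 0 then poly p (1 / t) * exp (- (1 / t)) else 0)"

text \<open>The derivative of p(1/t) exp(-1/t) is t^(-2) (p - p')(1/t) exp(-1/t); the polynomial
  \<open>[:0, 0, 1:]\<close> is the factor t^(-2) in the variable 1/t.\<close>

definition flat_deriv :: "real poly \<Rightarrow> real poly" where
  "flat_deriv p = [:0, 0, 1:] * (p - pderiv p)"

lemma poly_mult_exp_minus_tendsto_0: "((\<lambda>s. poly p s * exp (- s)) \<longlongrightarrow> 0) (at_top :: real filter)"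
proof -
  have "((\<lambda>s. \<Sum>i\<le>degree p. coeff p i * (s ^ i / exp s)) \<longlongrightarrow> (\<Sum>i\<le>degree p. coeff p i * 0)) at_top"
    by (intro tendsto_intros tendsto_power_div_exp_0)
  then show ?thesis by (simp add: poly_altdef sum_distrib_right exp_minus divide_inverse mult.assoc)
qed

lemma flat_has_derivative: "(flat p has_real_derivative flat (flat_deriv p) t) (at t)"
proof -
  consider "t > 0" | "t < 0" | "t = 0" by linarith
  then show ?thesis
  proof cases
    case 1
    have "((\<lambda>t. poly p (1 / t) * exp (- (1 / t))) has_real_derivative
        flat (flat_deriv p) t) (at t)"
      using 1 by (auto intro!: derivative_eq_intros DERIV_chain'[OF _ poly_DERIV] simp: flat_def flat_deriv_def field_simps power2_eq_square)
    then show ?thesis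
      by (rule has_field_derivative_transform_within_open[of _ _ _ "{0<..}"]) (use 1 in \<open>auto simp: flat_def\<close>)
  next
    case 2
    have "((\<lambda>t. 0) has_real_derivative flat (flat_deriv p) t) (at t)" using 2 by (simp add: flat_def)
    then show ?thesis
      by (rule has_field_derivative_transform_within_open[of _ _ _ "{..<0}"]) (use 2 in \<open>auto simp: flat_def\<close>)
  next
    case 3
    have inv: "filterlim (\<lambda>h::real. 1 / h) at_top (at_right 0)"
      using filterlim_inverse_at_top_right by (simp add: inverse_eq_divide)
    \<comment> \<open>In s = 1/h the difference quotient at 0 is s p(s) exp(-s); the extra factor
      \<open>[:0, 1:]\<close> is the division by h.\<close>
    have "((\<lambda>h. poly ([:0, 1:] * p) (1 / h) * exp (- (1 / h))) \<longlongrightarrow> 0) (at_right 0)"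
      by (rule filterlim_compose[OF poly_mult_exp_minus_tendsto_0 inv])
    then have r: "((\<lambda>h. flat p h / h) \<longlongrightarrow> 0) (at_right 0)"
      by (rule Lim_transform_eventually) (auto simp: flat_def eventually_at_filter)
    have "((\<lambda>h. 0) \<longlongrightarrow> (0::real)) (at_left 0)" by simp
    then have l: "((\<lambda>h. flat p h / h) \<longlongrightarrow> 0) (at_left 0)"
      by (rule Lim_transform_eventually) (auto simp: flat_def eventually_at_filter)
    have "((\<lambda>h. flat p h / h) \<longlongrightarrow> 0) (at 0)" using l r by (rule filterlim_split_at)
    then show ?thesis using 3 by (simp add: has_field_derivative_iff flat_def)
  qed
qed

primrec cdiff :: "nat \<Rightarrow> (real \<Rightarrow> real) \<Rightarrow> bool" where
  "cdiff 0 f \<longleftrightarrow> True"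
| "cdiff (Suc n) f \<longleftrightarrow> (\<exists>f'. (\<forall>t. (f has_real_derivative f' t) (at t)) \<and> cdiff n f')"

lemma cdiff_Suc: "cdiff (Suc n) f \<Longrightarrow> cdiff n f"
  by (induction n arbitrary: f) auto

lemma cdiff_add: "cdiff n f \<Longrightarrow> cdiff n g \<Longrightarrow> cdiff n (\<lambda>t. f t + g t)"
proof (induction n arbitrary: f g)
  case (Suc n)
  then obtain f' g' where "\<forall>t. (f has_real_derivative f' t) (at t)" "cdiff n f'"
    "\<forall>t. (g has_real_derivative g' t) (at t)" "cdiff n g'" by auto
  then show ?case using Suc.IH[of f' g'] by (auto intro!: exI[of _ "\<lambda>t. f' t + g' t"] DERIV_add)
qed simp

lemma cdiff_mult: "cdiff n f \<Longrightarrow> cdiff n g \<Longrightarrow> cdiff n (\<lambda>t. f t * g t)"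
proof (induction n arbitrary: f g)
  case (Suc n)
  then obtain f' g' where d: "\<forall>t. (f has_real_derivative f' t) (at t)" "cdiff n f'"
    "\<forall>t. (g has_real_derivative g' t) (at t)" "cdiff n g'" by auto
  have "cdiff n (\<lambda>t. f' t * g t + f t * g' t)"
    using d Suc.prems[THEN cdiff_Suc] by (intro cdiff_add Suc.IH)
  then show ?case using d by (auto intro!: exI[of _ "\<lambda>t. f' t * g t + f t * g' t"] derivative_eq_intros simp: mult.commute)
qed simp

lemma cdiff_affine: "cdiff n f \<Longrightarrow> cdiff n (\<lambda>t. f (a + b * t))"
proof (induction n arbitrary: f)
  case (Suc n)
  then obtain f' where d: "\<forall>t. (f has_real_derivative f' t) (at t)" "cdiff n f'" by auto
  have "((\<lambda>t. f (a + b * t)) has_real_derivative b * f' (a + b * t)) (at t)" for t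
  proof -
    have "((\<lambda>t. a + b * t) has_real_derivative b) (at t)" by (auto intro!: derivative_eq_intros)
    from DERIV_chain'[OF this d(1)[rule_format]] show ?thesis by (simp add: mult.commute)
  qed
  moreover have "cdiff n (\<lambda>t. b)" for b by (induction n arbitrary: b) (auto intro!: exI[of _ "\<lambda>t. 0"])
  ultimately show ?case using Suc.IH[OF d(2)] by (auto intro!: exI[of _ "\<lambda>t. b * f' (a + b * t)"] cdiff_mult)
qed simp

lemma cdiff_flat: "cdiff n (flat p)"
  by (induction n arbitrary: p) (auto intro!: exI[of _ "flat (flat_deriv _)"] flat_has_derivative)

text \<open>Passes from existential chains of derivatives to the canonical sequence of iterated
  \<open>deriv\<close>, in terms of which \<open>bump\<close> is defined.\<close>

lemma cdiff_deriv_funpow: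
  assumes "\<And>n. cdiff n f"
  shows "((deriv ^^ n) f has_real_derivative (deriv ^^ Suc n) f t) (at t)"
proof -
  have "cdiff k ((deriv ^^ n) f)" for k
  proof (induction n arbitrary: k)
    case (Suc n)
    from Suc[of "Suc k"] obtain f' where f': "\<forall>t. ((deriv ^^ n) f has_real_derivative f' t) (at t)" "cdiff k f'" by auto
    then have "deriv ((deriv ^^ n) f) = f'" by (auto simp: DERIV_imp_deriv)
    with f'(2) show ?case by simp
  qed (use assms in simp)
  from this[of "Suc 0"] obtain f' where "((deriv ^^ n) f has_real_derivative f' t) (at t)" by auto
  then show ?thesis by (simp add: DERIV_imp_deriv)
qed

text \<open>One fixed function supported in [-1, 1] together with all its derivatives, the index
  being the order.\<close>

definition bump :: "nat \<Rightarrow> real \<Rightarrow> real" where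
  "bump l = (deriv ^^ l) (\<lambda>t. flat 1 (1 + t) * flat 1 (1 - t))"

lemma bump_has_derivative: "(bump l has_real_derivative bump (Suc l) t) (at t)"
proof -
  have "cdiff n (\<lambda>t. flat 1 (1 + t) * flat 1 (1 - t))" for n
    using cdiff_mult[OF cdiff_affine[OF cdiff_flat[of n 1], of 1 1] cdiff_affine[OF cdiff_flat[of n 1], of 1 "-1"]] by simp
  from cdiff_deriv_funpow[OF this] show ?thesis by (simp add: bump_def)
qed

lemma bump_0: "bump 0 t = flat 1 (1 + t) * flat 1 (1 - t)" by (simp add: bump_def)

lemma bump_0_nonneg: "0 \<le> bump 0 t" and bump_0_pos: "\<bar>t\<bar> < 1 \<Longrightarrow> 0 < bump 0 t" and bump_0_le: "bump 0 t \<le> 1"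
proof -
  have "0 \<le> flat 1 t" "flat 1 t \<le> 1" for t by (auto simp: flat_def)
  then show "0 \<le> bump 0 t" "bump 0 t \<le> 1" by (auto simp: bump_0 intro!: mult_le_one)
  show "\<bar>t\<bar> < 1 \<Longrightarrow> 0 < bump 0 t" by (auto simp: bump_0 flat_def)
qed

lemma bump_continuous: "continuous_on UNIV (bump l)"
  using bump_has_derivative DERIV_isCont by (intro continuous_at_imp_continuous_on) blast

lemma bump_measurable [measurable]: "bump l \<in> borel_measurable borel"
  using bump_continuous by (rule borel_measurable_continuous_onI)

lemma bump_eq_0: "\<bar>t\<bar> \<ge> 1 \<Longrightarrow> bump l t = 0"
proof -
  have out: "bump l t = 0" if "\<bar>t\<bar> > 1" for t l using that
  proof (induction l arbitrary: t)
    case 0 then show ?case by (auto simp: bump_0 flat_def)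
  next
    case (Suc l)
    have "((\<lambda>t. 0) has_real_derivative 0) (at t)" by simp
    then have "(bump l has_real_derivative 0) (at t)"
      by (rule has_field_derivative_transform_within_open[of _ _ _ "{t. \<bar>t\<bar> > 1}"])
         (use Suc in \<open>auto intro!: open_Collect_less continuous_intros\<close>)
    then show ?case using DERIV_unique bump_has_derivative by blast
  qed
  assume t: "\<bar>t\<bar> \<ge> 1"
  show "bump l t = 0"
  proof (rule ccontr)
    assume nz: "bump l t \<noteq> 0"
    have "isCont (bump l) t" using bump_has_derivative DERIV_isCont by blast
    then obtain d where d: "d > 0" "\<And>s. \<bar>s - t\<bar> < d \<Longrightarrow> bump l s \<noteq> 0"
      using continuous_at_avoid[of t "bump l" 0] nz by (auto simp: dist_real_def abs_minus_commute)
    \<comment> \<open>A small step outward from an end point enters the region where the function is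
      already known to vanish, contradicting continuity there.\<close>
    have "bump l (t + sgn t * (d / 2)) = 0" using t d(1) by (intro out) (auto simp: sgn_if)
    then show False using d(2)[of "t + sgn t * (d / 2)"] d(1) t by (auto simp: sgn_if split: if_splits)
  qed
qed

lemma bump_bounded: obtains C where "C \<ge> 0" "\<And>l t. l \<le> k \<Longrightarrow> \<bar>bump l t\<bar> \<le> C"
proof -
  have "\<exists>C. \<forall>t. \<bar>bump l t\<bar> \<le> C" for l
  proof -
    have "compact (bump l ` {-1..1})" by (intro compact_continuous_image continuous_on_subset[OF bump_continuous]) auto
    then obtain C where C: "\<And>t. t \<in> {-1..1} \<Longrightarrow> \<bar>bump l t\<bar> \<le> C" using compact_imp_bounded by (force simp: bounded_iff)
    have "\<bar>bump l t\<bar> \<le> max C 0" for t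
    proof (cases "\<bar>t\<bar> \<le> 1")
      case True
      then have "t \<in> {-1..1}" by auto
      from C[OF this] show ?thesis by simp
    qed (use bump_eq_0[of t l] in auto)
    then show ?thesis by blast
  qed
  then obtain C where C: "\<And>l t. \<bar>bump l t\<bar> \<le> C l" by metis
  show ?thesis
  proof (rule that[of "\<Sum>l\<le>k. \<bar>C l\<bar>"])
    fix l t assume "l \<le> k"
    then have "\<bar>C l\<bar> \<le> (\<Sum>l\<le>k. \<bar>C l\<bar>)" by (intro member_le_sum) auto
    then show "\<bar>bump l t\<bar> \<le> (\<Sum>l\<le>k. \<bar>C l\<bar>)" using C[where l=l and t=t] by linarith
  qed (auto intro: sum_nonneg)
qed

definition cube_bump :: "real^'n \<Rightarrow> real \<Rightarrow> real^'n \<Rightarrow> real" where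
  "cube_bump \<zeta> r x = (\<Prod>i\<in>UNIV. bump 0 ((x $ i - \<zeta> $ i) / r))"

lemma cube_bump_measurable [measurable]: "cube_bump \<zeta> r \<in> borel_measurable borel"
  unfolding cube_bump_def[abs_def] by measurable

lemma cube_bump_eq_0: "r > 0 \<Longrightarrow> r \<le> \<bar>x $ i - \<zeta> $ i\<bar> \<Longrightarrow> cube_bump \<zeta> r x = 0"
  unfolding cube_bump_def by (rule prod_zero) (auto intro!: bexI[of _ i] bump_eq_0)

text \<open>The lower bound on the half-sized cube, uniform in centre and size, allows the cutoff to
  be divided out again on the piece it localizes to.\<close>

lemma cube_bump_lower:
  obtains h0 where "h0 > 0" "\<And>\<zeta> r (x :: real^'n). r > 0 \<Longrightarrow> (\<And>i. \<bar>x $ i - \<zeta> $ i\<bar> \<le> r / 2) \<Longrightarrow> h0 \<le> cube_bump \<zeta> r x"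
proof -
  have "\<exists>t0\<in>{-1/2..1/2}. \<forall>t\<in>{-1/2..1/2}. bump 0 t0 \<le> bump 0 t"
    by (rule continuous_attains_inf) (auto intro: continuous_on_subset[OF bump_continuous])
  then obtain t0 where t0: "t0 \<in> {-1/2..1/2}" "\<And>t. t \<in> {-1/2..1/2} \<Longrightarrow> bump 0 t0 \<le> bump 0 t" by blast
  have p: "bump 0 t0 > 0" using t0(1) by (intro bump_0_pos) auto
  show ?thesis
  proof (rule that[of "bump 0 t0 ^ CARD('n)"])
    fix \<zeta> :: "real^'n" and r :: real and x assume r: "r > 0" and x: "\<And>i. \<bar>x $ i - \<zeta> $ i\<bar> \<le> r / 2"
    have "(\<Prod>i\<in>(UNIV::'n set). bump 0 t0) \<le> cube_bump \<zeta> r x"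
      unfolding cube_bump_def
    proof (rule prod_mono)
      fix i :: 'n
      have "(x $ i - \<zeta> $ i) / r \<in> {-1/2..1/2}" using abs_le_D1[OF x[of i]] abs_le_D2[OF x[of i]] r by (auto simp: field_simps)
      then show "0 \<le> bump 0 t0 \<and> bump 0 t0 \<le> bump 0 ((x $ i - \<zeta> $ i) / r)" using t0(2) p by auto
    qed
    then show "bump 0 t0 ^ CARD('n) \<le> cube_bump \<zeta> r x" by simp
  qed (use p in simp)
qed

lemma cube_bump_dbounds:
  obtains C where "C \<ge> 0" "\<And>i \<zeta> r U. r > 0 \<Longrightarrow> dbounds (axis i 1 :: real^'n) (1 / r) U k C (\<lambda>x. complex_of_real (cube_bump \<zeta> r x))"
proof -
  obtain C where C: "C \<ge> 0" "\<And>l t. l \<le> k \<Longrightarrow> \<bar>bump l t\<bar> \<le> C" using bump_bounded[of k] by blast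
  show ?thesis
  proof (rule that[OF C(1)])
    fix i and \<zeta> :: "real^'n" and r :: real and U assume r: "r > 0"
    \<comment> \<open>The factors of the other coordinates do not change along axis i and lie
      between 0 and 1.\<close>
    define W where "W x = (\<Prod>j\<in>UNIV - {i}. bump 0 ((x $ j - \<zeta> $ j) / r))" for x :: "real^'n"
    have split: "cube_bump \<zeta> r x = bump 0 ((x $ i - \<zeta> $ i) / r) * W x" for x
      unfolding cube_bump_def W_def by (rule prod.remove) auto
    have W: "0 \<le> W x" "W x \<le> 1" for x
      unfolding W_def using bump_0_nonneg bump_0_le by (auto intro!: prod_nonneg prod_le_1)
    have Wi: "W (x + t *\<^sub>R axis i 1) = W x" for x t
      unfolding W_def by (rule prod.cong) (auto simp: axis_def)
    define f where "f l x = complex_of_real ((1 / r) ^ l * bump l ((x $ i - \<zeta> $ i) / r) * W x)" for l x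
    have "dbounds (axis i 1) (1 / r) U k C (f 0)"
    proof (rule dbounds_seq)
      fix l and x :: "real^'n" assume l: "l \<le> k"
      have "\<bar>bump l ((x $ i - \<zeta> $ i) / r) * W x\<bar> \<le> C * 1"
        unfolding abs_mult using C(2)[OF l] W[of x] C(1) by (intro mult_mono) auto
      then have "(1 / r) ^ l * \<bar>bump l ((x $ i - \<zeta> $ i) / r) * W x\<bar> \<le> (1 / r) ^ l * C"
        using r by (intro mult_left_mono) auto
      then show "norm (f l x) \<le> C * (1 / r) ^ l"
        using r unfolding f_def norm_of_real abs_mult by (simp add: mult_ac)
    next
      fix l and x :: "real^'n"
      have d: "((\<lambda>t. ((x + t *\<^sub>R axis i 1) $ i - \<zeta> $ i) / r) has_real_derivative 1 / r) (at 0)"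
        using r by (auto intro!: derivative_eq_intros)
      have "((\<lambda>t. bump l (((x + t *\<^sub>R axis i 1) $ i - \<zeta> $ i) / r)) has_real_derivative
          bump (Suc l) ((x $ i - \<zeta> $ i) / r) * (1 / r)) (at 0)"
        using DERIV_chain2[OF bump_has_derivative d, of l] by simp
      from DERIV_cmult_right[OF DERIV_cmult[OF this, of "(1 / r) ^ l"], of "W x"]
      have "((\<lambda>t. (1 / r) ^ l * bump l (((x + t *\<^sub>R axis i 1) $ i - \<zeta> $ i) / r) * W (x + t *\<^sub>R axis i 1)) has_real_derivative
          (1 / r) ^ Suc l * bump (Suc l) ((x $ i - \<zeta> $ i) / r) * W x) (at 0)"
        unfolding Wi by (simp add: mult_ac)
      then show "((\<lambda>t. f l (x + t *\<^sub>R axis i 1)) has_vector_derivative f (Suc l) x) (at 0)"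
        unfolding f_def by (rule has_vector_derivative_of_real)
    qed
    moreover have "f 0 = (\<lambda>x. complex_of_real (cube_bump \<zeta> r x))" by (rule ext) (simp add: f_def split)
    ultimately show "dbounds (axis i 1) (1 / r) U k C (\<lambda>x. complex_of_real (cube_bump \<zeta> r x))" by (simp only:)
  qed
qed

section \<open>Oscillatory integral operators\<close>

lemma borel_measurable_lebesgue_pair:
  fixes f :: "(real^'n) \<times> (real^'n) \<Rightarrow> 'b::topological_space"
  assumes "f \<in> borel_measurable borel"
  shows "f \<in> borel_measurable (lebesgue \<Otimes>\<^sub>M lborel)"
proof -
  have "(\<lambda>p. (fst p, snd p)) \<in> measurable ((lebesgue :: (real^'n) measure) \<Otimes>\<^sub>M (lborel :: (real^'n) measure)) (borel \<Otimes>\<^sub>M borel)"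
  proof (rule measurable_Pair)
    have "id \<in> measurable (lebesgue :: (real^'n) measure) borel" by (simp add: measurable_completion)
    from measurable_compose[OF measurable_fst this]
    show "fst \<in> measurable ((lebesgue :: (real^'n) measure) \<Otimes>\<^sub>M (lborel :: (real^'n) measure)) borel" by simp
    show "snd \<in> measurable ((lebesgue :: (real^'n) measure) \<Otimes>\<^sub>M (lborel :: (real^'n) measure)) borel" by simp
  qed
  then have "id \<in> measurable ((lebesgue :: (real^'n) measure) \<Otimes>\<^sub>M (lborel :: (real^'n) measure)) (borel :: ((real^'n) \<times> (real^'n)) measure)"
    by (simp add: borel_prod id_def)
  from measurable_comp[OF this assms] show ?thesis by simp
qed

text \<open>Three concentric cubes occur: half side r/2, where the cutoff is bounded below; r, which
  contains its support; and 2r, open, on which symbol and phase are controlled.\<close>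

abbreviation cube :: "real^'n \<Rightarrow> real \<Rightarrow> (real^'n) set" where
  "cube \<zeta> r \<equiv> {x. \<forall>i. \<bar>x $ i - \<zeta> $ i\<bar> < 2 * r}"

abbreviation closed_cube :: "real^'n \<Rightarrow> real \<Rightarrow> (real^'n) set" where
  "closed_cube \<zeta> r \<equiv> {x. \<forall>i. \<bar>x $ i - \<zeta> $ i\<bar> \<le> r / 2}"

abbreviation square_integrable :: "(real^'n \<Rightarrow> complex) \<Rightarrow> bool" where
  "square_integrable g \<equiv> g \<in> borel_measurable borel \<and> integrable lborel (\<lambda>x. (norm (g x))\<^sup>2)"

text \<open>C bounds the square of the operator norm. The output is measured in
  \<open>lebesgue\<close>, since symbols are only Lebesgue measurable in x, while the frequency side
  stays in \<open>lborel\<close>.\<close>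

definition piece_bound :: "(real^'n \<Rightarrow> real^'n \<Rightarrow> complex) \<Rightarrow> (real^'n) set \<Rightarrow> (real^'n \<Rightarrow> complex) \<Rightarrow> real \<Rightarrow> bool" where
  "piece_bound k Q g C \<longleftrightarrow> L2_mass lebesgue (\<lambda>x. LINT \<xi>|lborel. k x \<xi> * (indicator Q \<xi> * g \<xi>)) \<le> ennreal C * L2_mass lborel g"

text \<open>The phase difference of x and y moves with speed comparable to |x - y| in some
  coordinate direction. The direction may depend on x and y but not on the frequency in U.\<close>

abbreviation phase_separated :: "real \<Rightarrow> real \<Rightarrow> real \<Rightarrow> (real^'n) set \<Rightarrow> (real^'n \<Rightarrow> real^'n \<Rightarrow> real) \<Rightarrow> bool" where
  "phase_separated c A \<nu> U p \<equiv> \<forall>x y. x \<noteq> y \<longrightarrow> (\<exists>i q. q \<in> borel_measurable borel \<and> (\<forall>\<xi>\<in>U. c \<le> \<bar>q \<xi>\<bar>) \<and>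
     dbounds (axis i 1) \<nu> U (2 * CARD('n)) A (\<lambda>\<xi>. complex_of_real (q \<xi>)) \<and>
     (\<forall>\<xi>\<in>U. ((\<lambda>t. p x (\<xi> + t *\<^sub>R axis i 1) - p y (\<xi> + t *\<^sub>R axis i 1)) has_real_derivative norm (x - y) * q \<xi>) (at 0)))"

text \<open>The constant C is quantified outside all other data, so one constant serves all pieces
  of all shells; the dependence on the piece is carried by B, the measure of V and \<nu>.\<close>

abbreviation oscillatory_estimate :: "real \<Rightarrow> real \<Rightarrow> real \<Rightarrow> (real^'n \<Rightarrow> real^'n \<Rightarrow> real) \<Rightarrow> bool" where
  "oscillatory_estimate c A C p \<equiv> \<forall>b \<nu> B U V. 0 < \<nu> \<and> 0 < B \<and> open U \<and> compact V \<and> V \<subseteq> U \<and> 0 < measure lborel V \<and>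
     (\<lambda>(x, \<xi>). iexp (p x \<xi>) * b x \<xi>) \<in> borel_measurable (lebesgue \<Otimes>\<^sub>M lborel) \<and>
     (\<forall>x. p x \<in> borel_measurable borel \<and> b x \<in> borel_measurable borel) \<and>
     (\<forall>x i. dbounds (axis i 1) \<nu> U (2 * CARD('n)) B (b x)) \<and> (\<forall>x \<xi>. \<xi> \<notin> V \<longrightarrow> b x \<xi> = 0) \<and>
     phase_separated c A \<nu> U p \<longrightarrow>
     (\<forall>g. square_integrable g \<longrightarrow>
        L2_mass lebesgue (\<lambda>x. LINT \<xi>|lborel. iexp (p x \<xi>) * b x \<xi> * g \<xi>)
         \<le> ennreal (C * B\<^sup>2 * measure lborel V * \<nu> ^ CARD('n)) * L2_mass lborel g)"

text \<open>The form applied to pieces: the amplitude e needs no compact support, as the input is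
  restricted to a set Q in the small cube.\<close>

abbreviation cutoff_estimate :: "real \<Rightarrow> real \<Rightarrow> real \<Rightarrow> (real^'n \<Rightarrow> real^'n \<Rightarrow> real) \<Rightarrow> bool" where
  "cutoff_estimate c A C p \<equiv> \<forall>e \<nu> B \<zeta> r Q. 0 < \<nu> \<and> 0 < B \<and> 0 < r \<and> 1 / r \<le> \<nu> \<and>
     Q \<in> sets borel \<and> Q \<subseteq> closed_cube \<zeta> r \<and>
     (\<lambda>(x, \<xi>). iexp (p x \<xi>)) \<in> borel_measurable (lebesgue \<Otimes>\<^sub>M lborel) \<and>
     (\<lambda>(x, \<xi>). e x \<xi>) \<in> borel_measurable (lebesgue \<Otimes>\<^sub>M lborel) \<and>
     (\<forall>x. p x \<in> borel_measurable borel \<and> e x \<in> borel_measurable borel) \<and>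
     (\<forall>x i. dbounds (axis i 1) \<nu> (cube \<zeta> r) (2 * CARD('n)) B (e x)) \<and>
     phase_separated c A \<nu> (cube \<zeta> r) p \<longrightarrow>
     (\<forall>g. square_integrable g \<longrightarrow>
        piece_bound (\<lambda>x \<xi>. iexp (p x \<xi>) * e x \<xi>) Q g (C * B\<^sup>2 * r ^ CARD('n) * \<nu> ^ CARD('n)))"

text \<open>The kernel of T T* is an oscillatory integral with phase difference p x - p y.
  Non-stationary phase with D = |x - y| gives decay of order 2n, absolute values give a bound near
  the diagonal; together they stay below a multiple of the Schur weight of width \<nu>.\<close>

lemma oscillatory_operator_bound:
  fixes c A :: real
  assumes c: "c > 0" and A: "A \<ge> 0"
  shows "\<exists>C>0. \<forall>p :: real^'n \<Rightarrow> real^'n \<Rightarrow> real. oscillatory_estimate c A C p"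
proof -
  let ?K = "2 * CARD('n)"
  obtain R where R0: "R \<ge> 0" and R1: "\<forall>e \<nu> (U :: (real^'n) set) q. 0 \<le> \<nu> \<and> dbounds e \<nu> U ?K A q \<and> (\<forall>\<xi>\<in>U. c \<le> norm (q \<xi>)) \<longrightarrow>
    dbounds e \<nu> U ?K R (\<lambda>\<xi>. inverse (q \<xi>))"
    using dbounds_inverse[OF c A, of ?K] by (elim exE conjE) (rule that; assumption)
  obtain C1 where C10: "C1 \<ge> 0" and C1: "\<forall>(e :: real^'n) \<nu> D \<theta> q f U V B.
     nonstationary R ?K e \<nu> D \<theta> q f U V B \<longrightarrow>
     norm (LINT \<xi>|lborel. iexp (\<theta> \<xi>) * f \<xi>) \<le> C1 * measure lborel V * B * (\<nu> / D) ^ ?K"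
    using nonstationary_phase_reciprocal[OF R0, of ?K] by (elim exE conjE) (rule that; assumption)
  \<comment> \<open>The entry 1 serves the bound by absolute values; the other serves non-stationary
    phase, with 2^(2n) from the product of the two amplitudes.\<close>
  define C2 where "C2 = max 1 (C1 * 2 ^ ?K)"
  have C2: "C2 \<ge> 1" "C1 * 2 ^ ?K \<le> C2" by (auto simp: C2_def)
  show ?thesis
  proof (intro exI[of _ "C2 * (2 * pi) ^ CARD('n)"] conjI allI impI; (elim conjE)?)
    show "0 < C2 * (2 * pi) ^ CARD('n)" using C2 by (intro mult_pos_pos) auto
    fix p :: "real^'n \<Rightarrow> real^'n \<Rightarrow> real" and b \<nu> B U V and g :: "real^'n \<Rightarrow> complex"
    assume \<nu>: "0 < \<nu>" and B: "0 < B" and U: "open U" and V: "compact V" "V \<subseteq> U" "0 < measure lborel V"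
      and meas: "(\<lambda>(x, \<xi>). iexp (p x \<xi>) * b x \<xi>) \<in> borel_measurable (lebesgue \<Otimes>\<^sub>M lborel)"
      and meas1: "\<forall>x. p x \<in> borel_measurable borel \<and> b x \<in> borel_measurable borel"
      and bb: "\<forall>x i. dbounds (axis i 1) \<nu> U ?K B (b x)" and b0: "\<forall>x \<xi>. \<xi> \<notin> V \<longrightarrow> b x \<xi> = 0"
      and ph: "phase_separated c A \<nu> U p"
      and g: "g \<in> borel_measurable borel" "integrable lborel (\<lambda>\<xi>. (norm (g \<xi>))\<^sup>2)"
    note [measurable] = meas1[rule_format, THEN conjunct1] meas1[rule_format, THEN conjunct2]
    have Vm [measurable]: "V \<in> sets borel" using V by (auto intro: borel_compact)
    have fin: "emeasure lborel V < \<infinity>" using V emeasure_compact_finite by blast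
    define k where "k x \<xi> = iexp (p x \<xi>) * b x \<xi>" for x \<xi>
    define \<kappa> where "\<kappa> \<xi> = B * indicator V \<xi>" for \<xi> :: "real^'n"
    define a where "a = C2 * B\<^sup>2 * measure lborel V"
    have a: "a > 0" using C2 B V(3) by (simp add: a_def)
    define H where "H x y = a * schur_weight \<nu> (x - y)" for x y :: "real^'n"
    have bB: "norm (b x \<xi>) \<le> B * indicator V \<xi>" for x \<xi>
      using dbounds_norm[OF bb[rule_format, of undefined x], of \<xi>] b0 V(2) by (cases "\<xi> \<in> V") auto
    have ker: "norm (LINT \<xi>|lborel. k x \<xi> * cnj (k y \<xi>)) \<le> H x y" for x y
    proof -
      have eq: "k x \<xi> * cnj (k y \<xi>) = iexp (p x \<xi> - p y \<xi>) * (b x \<xi> * cnj (b y \<xi>))" for \<xi>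
        by (simp add: k_def exp_cnj exp_diff right_diff_distrib exp_minus divide_inverse mult_ac)
      have fB: "norm (b x \<xi> * cnj (b y \<xi>)) \<le> B\<^sup>2 * indicator V \<xi>" for \<xi>
        using mult_mono[OF bB[of x \<xi>] bB[of y \<xi>]] B by (cases "\<xi> \<in> V") (simp_all add: norm_mult power2_eq_square)
      have "norm (LINT \<xi>|lborel. k x \<xi> * cnj (k y \<xi>)) \<le> (LINT \<xi>|lborel. norm (k x \<xi> * cnj (k y \<xi>)))"
        by (rule integral_norm_bound)
      also have "\<dots> \<le> (LINT \<xi>|lborel. B\<^sup>2 * indicator V \<xi>)"
      proof (rule integral_mono')
        show "integrable lborel (\<lambda>\<xi>. B\<^sup>2 * indicator V \<xi>)"
          using fin by (intro integrable_mult_right integrable_real_indicator) auto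
        show "norm (k x \<xi> * cnj (k y \<xi>)) \<le> B\<^sup>2 * indicator V \<xi>" for \<xi>
          using fB[of \<xi>] unfolding eq by (simp add: norm_mult)
      qed (use B in auto)
      also have "\<dots> = 1 * (B\<^sup>2 * measure lborel V)" by simp
      also have "\<dots> \<le> C2 * (B\<^sup>2 * measure lborel V)" using C2 by (intro mult_right_mono) auto
      finally have 1: "norm (LINT \<xi>|lborel. k x \<xi> * cnj (k y \<xi>)) \<le> a" by (simp add: a_def mult.assoc)
      have 2: "norm (LINT \<xi>|lborel. k x \<xi> * cnj (k y \<xi>)) \<le> a * (\<nu> / norm (x - y)) ^ ?K" if "x - y \<noteq> 0"
      proof -
        from that ph[rule_format, of x y] obtain i q where q: "q \<in> borel_measurable borel" "\<forall>\<xi>\<in>U. c \<le> \<bar>q \<xi>\<bar>"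
          "dbounds (axis i 1) \<nu> U ?K A (\<lambda>\<xi>. complex_of_real (q \<xi>))"
          "\<forall>\<xi>\<in>U. ((\<lambda>t. p x (\<xi> + t *\<^sub>R axis i 1) - p y (\<xi> + t *\<^sub>R axis i 1)) has_real_derivative norm (x - y) * q \<xi>) (at 0)"
          by auto
        have r: "dbounds (axis i 1) \<nu> U ?K R (\<lambda>\<xi>. inverse (complex_of_real (q \<xi>)))"
          by (rule R1[THEN spec, THEN spec, THEN spec, THEN spec, THEN mp]) (use q \<nu> in auto)
        have f: "dbounds (axis i 1) \<nu> U ?K (2 ^ ?K * B * B) (\<lambda>\<xi>. b x \<xi> * cnj (b y \<xi>))"
          using bb \<nu> B by (intro dbounds_mult dbounds_cnj) auto
        have "\<forall>\<xi>\<in>U. \<bar>q \<xi>\<bar> \<le> A" using dbounds_norm[OF q(3)] by auto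
        then have Qx: "\<exists>Q. \<forall>\<xi>\<in>U. \<bar>q \<xi>\<bar> \<le> Q" by blast
        have "norm (LINT \<xi>|lborel. iexp (p x \<xi> - p y \<xi>) * (b x \<xi> * cnj (b y \<xi>))) \<le>
          C1 * measure lborel V * (2 ^ ?K * B * B) * (\<nu> / norm (x - y)) ^ ?K"
        proof (rule C1[THEN spec, THEN spec, THEN spec, THEN spec, THEN spec, THEN spec, THEN spec, THEN spec, THEN spec, THEN mp], intro conjI)
          show "\<forall>\<xi>\<in>U. q \<xi> \<noteq> 0" using q(2) c by fastforce
          show "\<forall>\<xi>. \<xi> \<notin> V \<longrightarrow> b x \<xi> * cnj (b y \<xi>) = 0" using b0 by simp
          show "(\<lambda>\<xi>. p x \<xi> - p y \<xi>) \<in> borel_measurable borel" by measurable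
          show "(\<lambda>\<xi>. b x \<xi> * cnj (b y \<xi>)) \<in> borel_measurable borel" by measurable
        qed (use \<nu> B U V q r f Qx that in auto)
        also have "\<dots> = (C1 * 2 ^ ?K) * (measure lborel V * B\<^sup>2 * (\<nu> / norm (x - y)) ^ ?K)"
          by (simp add: power2_eq_square)
        also have "\<dots> \<le> C2 * (measure lborel V * B\<^sup>2 * (\<nu> / norm (x - y)) ^ ?K)"
          using C2 \<nu> by (intro mult_right_mono mult_nonneg_nonneg) auto
        finally show ?thesis unfolding eq by (simp add: a_def mult_ac)
      qed
      show ?thesis unfolding H_def using \<nu> a 1 2 by (intro decay_le_schur_weight) auto
    qed
    have HB: "(\<integral>\<^sup>+y. ennreal (H x y) \<partial>lebesgue) \<le> ennreal (a * (2 * pi * \<nu>) ^ CARD('n))" for x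
    proof -
      have "(\<integral>\<^sup>+y. ennreal (H x y) \<partial>lebesgue) = (\<integral>\<^sup>+y. ennreal a * ennreal (schur_weight \<nu> (x - y)) \<partial>lborel)"
        using a by (simp add: nn_integral_completion H_def ennreal_mult' schur_weight_nonneg)
      also have "\<dots> = ennreal a * ennreal ((2 * pi * \<nu>) ^ CARD('n))"
        by (subst nn_integral_cmult) (auto simp: nn_integral_schur_weight[OF \<nu>])
      finally show ?thesis using a \<nu> by (simp add: ennreal_mult)
    qed
    have H_lebesgue: "case_prod H \<in> borel_measurable (lebesgue \<Otimes>\<^sub>M lebesgue)"
    proof -
      have "case_prod H \<in> borel_measurable (borel \<Otimes>\<^sub>M borel)"
        unfolding H_def by measurable
      note Hb = this
      have "id \<in> measurable (lebesgue :: (real^'n) measure) borel" by (simp add: measurable_completion)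
      then have "(\<lambda>p. (id (fst p), id (snd p))) \<in> measurable ((lebesgue :: (real^'n) measure) \<Otimes>\<^sub>M (lebesgue :: (real^'n) measure)) (borel \<Otimes>\<^sub>M borel)"
        by (intro measurable_Pair measurable_compose[OF measurable_fst] measurable_compose[OF measurable_snd])
      from measurable_compose[OF this Hb]
      show ?thesis by (simp add: case_prod_unfold)
    qed
    interpret schur_kernel lebesgue lborel k \<kappa> H "a * (2 * pi * \<nu>) ^ CARD('n)"
    proof (rule schur_kernel.intro)
      show "case_prod k \<in> borel_measurable (lebesgue \<Otimes>\<^sub>M lborel)" using meas by (simp add: k_def[abs_def])
      show "\<kappa> \<in> borel_measurable lborel" unfolding \<kappa>_def by measurable
      show "norm (k x \<xi>) \<le> \<kappa> \<xi>" for x \<xi> using bB[of x \<xi>] by (simp add: k_def \<kappa>_def norm_mult)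
      have "(\<kappa> \<xi>)\<^sup>2 = B\<^sup>2 * indicator V \<xi>" for \<xi> by (simp add: \<kappa>_def power_mult_distrib indicator_def)
      then show "integrable lborel (\<lambda>\<xi>. (\<kappa> \<xi>)\<^sup>2)"
        using fin by (simp only:) (intro integrable_mult_right integrable_real_indicator; auto)
      show "case_prod H \<in> borel_measurable (lebesgue \<Otimes>\<^sub>M lebesgue)" by (rule H_lebesgue)
      show "0 \<le> H x y" for x y using a by (simp add: H_def schur_weight_nonneg)
      show "H x y = H y x" for x y by (simp add: H_def schur_weight_minus)
      show "0 < a * (2 * pi * \<nu>) ^ CARD('n)" using a \<nu> by simp
      show "(\<integral>\<^sup>+y. ennreal (H x y) \<partial>lebesgue) \<le> ennreal (a * (2 * pi * \<nu>) ^ CARD('n))" for x by (rule HB)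
      show "norm (LINT \<xi>|lborel. k x \<xi> * cnj (k y \<xi>)) \<le> H x y" for x y by (rule ker)
      show "sigma_finite_measure (lebesgue :: (real^'n) measure)" by (rule sigma_finite_lebesgue)
      show "sigma_finite_measure (lborel :: (real^'n) measure)" by (rule lborel.sigma_finite_measure_axioms)
    qed
    have "a * (2 * pi * \<nu>) ^ CARD('n) = C2 * (2 * pi) ^ CARD('n) * B\<^sup>2 * measure lborel V * \<nu> ^ CARD('n)"
      by (simp add: a_def power_mult_distrib mult_ac)
    then show "L2_mass lebesgue (\<lambda>x. LINT \<xi>|lborel. iexp (p x \<xi>) * b x \<xi> * g \<xi>)
         \<le> ennreal (C2 * (2 * pi) ^ CARD('n) * B\<^sup>2 * measure lborel V * \<nu> ^ CARD('n)) * L2_mass lborel g"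
      using bound[of g] g by (simp add: k_def)
  qed
qed

lemma sup_cube_eq_box: "{x :: real^'n. \<forall>i. \<bar>x $ i - \<zeta> $ i\<bar> < s} = box (\<zeta> - (\<chi> i. s)) (\<zeta> + (\<chi> i. s))"
  by (auto simp: mem_box_cart abs_less_iff algebra_simps)

text \<open>The smooth cutoff is inserted into the amplitude, which then has compact support, and
  divided out of g on Q. Since the cutoff is at least h0 there, the division costs a fixed
  factor.\<close>

lemma cutoff_operator_bound:
  fixes c A :: real
  assumes c: "c > 0" and A: "A \<ge> 0"
  shows "\<exists>C>0. \<forall>p :: real^'n \<Rightarrow> real^'n \<Rightarrow> real. cutoff_estimate c A C p"
proof -
  let ?K = "2 * CARD('n)"
  obtain C1 where C10: "C1 > 0" and C1: "\<forall>p :: real^'n \<Rightarrow> real^'n \<Rightarrow> real. oscillatory_estimate c A C1 p"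
    using oscillatory_operator_bound[OF c A, where 'n='n] by (elim exE conjE) (rule that; assumption)
  obtain Cb where Cb: "Cb \<ge> 0" "\<And>i \<zeta> r U. r > 0 \<Longrightarrow> dbounds (axis i 1 :: real^'n) (1 / r) U ?K Cb (\<lambda>\<xi>. complex_of_real (cube_bump \<zeta> r \<xi>))"
    by (rule cube_bump_dbounds[of ?K], rule that, assumption+)
  obtain h0 where h0: "h0 > 0" "\<And>\<zeta> r (\<xi> :: real^'n). r > 0 \<Longrightarrow> (\<And>i. \<bar>\<xi> $ i - \<zeta> $ i\<bar> \<le> r / 2) \<Longrightarrow> h0 \<le> cube_bump \<zeta> r \<xi>"
    using cube_bump_lower[where 'n='n] by blast
  define D where "D = 2 ^ ?K * (Cb + 1)"
  have D: "D > 0" using Cb by (simp add: D_def)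
  show ?thesis
  proof (intro exI[of _ "C1 * D\<^sup>2 * 2 ^ CARD('n) * (1 / h0)\<^sup>2"] conjI allI impI; (elim conjE)?)
    show "0 < C1 * D\<^sup>2 * 2 ^ CARD('n) * (1 / h0)\<^sup>2" using C10 D h0 by simp
    fix p :: "real^'n \<Rightarrow> real^'n \<Rightarrow> real" and e \<nu> B and \<zeta> :: "real^'n" and r Q and g :: "real^'n \<Rightarrow> complex"
    define U where "U = (cube \<zeta> r)"
    define V where "V = cbox (\<zeta> - (\<chi> i. r)) (\<zeta> + (\<chi> i. r))"
    assume \<nu>: "0 < \<nu>" and B: "0 < B" and r: "0 < r" "1 / r \<le> \<nu>" and Q: "Q \<in> sets borel" "Q \<subseteq> closed_cube \<zeta> r"
      and meas: "(\<lambda>(x, \<xi>). iexp (p x \<xi>)) \<in> borel_measurable (lebesgue \<Otimes>\<^sub>M lborel)"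
        "(\<lambda>(x, \<xi>). e x \<xi>) \<in> borel_measurable (lebesgue \<Otimes>\<^sub>M lborel)"
      and meas1: "\<forall>x. p x \<in> borel_measurable borel \<and> e x \<in> borel_measurable borel"
      and eb: "\<forall>x i. dbounds (axis i 1) \<nu> (cube \<zeta> r) ?K B (e x)"
      and ph: "phase_separated c A \<nu> (cube \<zeta> r) p"
      and g: "g \<in> borel_measurable borel" "integrable lborel (\<lambda>\<xi>. (norm (g \<xi>))\<^sup>2)"
    note [measurable] = meas meas1[rule_format, THEN conjunct1] meas1[rule_format, THEN conjunct2] Q(1) g(1)
    define b where "b x \<xi> = e x \<xi> * complex_of_real (cube_bump \<zeta> r \<xi>)" for x \<xi>
    define g' where "g' \<xi> = indicator Q \<xi> * g \<xi> / complex_of_real (cube_bump \<zeta> r \<xi>)" for \<xi>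
    have [measurable]: "g' \<in> borel_measurable borel" unfolding g'_def by measurable
    have bg: "iexp (p x \<xi>) * b x \<xi> * g' \<xi> = iexp (p x \<xi>) * e x \<xi> * (indicator Q \<xi> * g \<xi>)" for x \<xi>
    proof (cases "\<xi> \<in> Q")
      case True
      then have "h0 \<le> cube_bump \<zeta> r \<xi>" using Q r by (intro h0(2)) auto
      then show ?thesis using h0(1) by (simp add: b_def g'_def)
    qed (simp add: g'_def)
    have g'_le: "norm (g' \<xi>) \<le> 1 / h0 * norm (g \<xi>)" for \<xi>
    proof (cases "\<xi> \<in> Q")
      case True
      then have "h0 \<le> cube_bump \<zeta> r \<xi>" using Q r by (intro h0(2)) auto
      then have "norm (g \<xi>) / cube_bump \<zeta> r \<xi> \<le> norm (g \<xi>) / h0" using h0(1) by (intro divide_left_mono) auto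
      then show ?thesis using True \<open>h0 \<le> _\<close> h0(1) by (simp add: g'_def norm_divide norm_mult)
    qed (use h0 in \<open>simp add: g'_def\<close>)
    have g'2: "(norm (g' \<xi>))\<^sup>2 \<le> (1 / h0)\<^sup>2 * (norm (g \<xi>))\<^sup>2" for \<xi>
      using power_mono[OF g'_le[of \<xi>], of 2] by (simp only: power_mult_distrib norm_ge_zero)
    have int: "integrable lborel (\<lambda>\<xi>. (norm (g' \<xi>))\<^sup>2)"
      by (rule Bochner_Integration.integrable_bound[OF integrable_mult_right[OF g(2), of "(1 / h0)\<^sup>2"]])
         (use g'2 in auto)
    have mV: "measure lborel V = (2 * r) ^ CARD('n)"
    proof -
      have "(\<zeta> - (\<chi> i. r)) \<bullet> i \<le> (\<zeta> + (\<chi> i. r)) \<bullet> i" if "i \<in> Basis" for i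
        using r that by (auto simp: Basis_vec_def inner_axis inner_diff_left inner_add_left)
      then have "\<forall>i\<in>Basis. (\<zeta> - (\<chi> i. r)) \<bullet> i \<le> (\<zeta> + (\<chi> i. r)) \<bullet> i" by blast
      then have "measure lborel V = (\<Prod>b\<in>Basis. (\<zeta> + (\<chi> i. r)) \<bullet> b - (\<zeta> - (\<chi> i. r)) \<bullet> b)"
        unfolding V_def by (rule content_cbox)
      also have "\<dots> = (\<Prod>b\<in>(Basis :: (real^'n) set). 2 * r)"
        by (intro prod.cong) (auto simp: Basis_vec_def inner_axis inner_diff_left inner_add_left)
      finally show ?thesis by simp
    qed
    have Vi: "\<xi> \<in> V \<longleftrightarrow> (\<forall>i. \<bar>\<xi> $ i - \<zeta> $ i\<bar> \<le> r)" for \<xi>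
      unfolding V_def mem_box_cart by (auto simp: abs_le_iff algebra_simps)
    have main: "L2_mass lebesgue (\<lambda>x. LINT \<xi>|lborel. iexp (p x \<xi>) * b x \<xi> * g' \<xi>)
         \<le> ennreal (C1 * (D * B)\<^sup>2 * measure lborel V * \<nu> ^ CARD('n)) * L2_mass lborel g'"
    proof (rule C1[THEN spec, THEN spec, THEN spec, THEN spec, THEN spec, THEN spec, THEN mp, THEN spec, THEN mp], intro conjI)
      show "open U" unfolding U_def sup_cube_eq_box by (rule open_box)
      show "compact V" by (simp add: V_def)
      show "V \<subseteq> U"
      proof
        fix \<xi> assume "\<xi> \<in> V"
        have "\<bar>\<xi> $ i - \<zeta> $ i\<bar> < 2 * r" for i :: 'n
        proof -
          have "\<bar>\<xi> $ i - \<zeta> $ i\<bar> \<le> r" using \<open>\<xi> \<in> V\<close> unfolding Vi by blast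
          also have "r < 2 * r" using r(1) by simp
          finally show ?thesis .
        qed
        then show "\<xi> \<in> U" by (simp add: U_def)
      qed
      show "0 < measure lborel V" using mV r by simp
      show "(\<lambda>(x, \<xi>). iexp (p x \<xi>) * b x \<xi>) \<in> borel_measurable (lebesgue \<Otimes>\<^sub>M lborel)"
        unfolding b_def by measurable
      show "\<forall>x. p x \<in> borel_measurable borel \<and> b x \<in> borel_measurable borel" unfolding b_def by measurable
      show "\<forall>x \<xi>. \<xi> \<notin> V \<longrightarrow> b x \<xi> = 0"
      proof (intro allI impI)
        fix x \<xi> assume "\<xi> \<notin> V"
        then obtain i where "r < \<bar>\<xi> $ i - \<zeta> $ i\<bar>" using Vi by (meson not_le)
        then have "cube_bump \<zeta> r \<xi> = 0" by (intro cube_bump_eq_0[OF r(1)] less_imp_le)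
        then show "b x \<xi> = 0" by (simp add: b_def)
      qed
      show "\<forall>x i. dbounds (axis i 1) \<nu> U ?K (D * B) (b x)"
      proof (intro allI)
        fix x i
        have 1: "dbounds (axis i 1) \<nu> U ?K (Cb + 1) (\<lambda>\<xi>. complex_of_real (cube_bump \<zeta> r \<xi>))"
          by (rule dbounds_mono[OF Cb(2)[OF r(1)]]) (use r Cb in auto)
        have "dbounds (axis i 1) \<nu> U ?K (2 ^ ?K * B * (Cb + 1)) (b x)"
          unfolding b_def using eb 1 \<nu> B Cb by (intro dbounds_mult) (auto simp: U_def)
        then show "dbounds (axis i 1) \<nu> U ?K (D * B) (b x)" by (simp add: D_def mult_ac)
      qed
      show "phase_separated c A \<nu> U p"
        using ph unfolding U_def .
    qed (use \<nu> B D int in auto)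
    have "L2_mass lborel g' \<le> (\<integral>\<^sup>+\<xi>. ennreal ((1 / h0)\<^sup>2) * ennreal ((norm (g \<xi>))\<^sup>2) \<partial>lborel)"
      using g'2 by (intro nn_integral_mono) (auto simp: ennreal_mult[symmetric] intro!: ennreal_leI)
    also have "\<dots> = ennreal ((1 / h0)\<^sup>2) * L2_mass lborel g"
      by (rule nn_integral_cmult) measurable
    finally have "ennreal (C1 * (D * B)\<^sup>2 * measure lborel V * \<nu> ^ CARD('n)) * L2_mass lborel g' \<le>
        ennreal (C1 * (D * B)\<^sup>2 * measure lborel V * \<nu> ^ CARD('n)) * (ennreal ((1 / h0)\<^sup>2) * L2_mass lborel g)"
      by (rule mult_left_mono) simp
    also have "\<dots> = ennreal (C1 * D\<^sup>2 * 2 ^ CARD('n) * (1 / h0)\<^sup>2 * B\<^sup>2 * r ^ CARD('n) * \<nu> ^ CARD('n)) * L2_mass lborel g"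
    proof -
      have e: "C1 * (D * B)\<^sup>2 * measure lborel V * \<nu> ^ CARD('n) * (1 / h0)\<^sup>2 = C1 * D\<^sup>2 * 2 ^ CARD('n) * (1 / h0)\<^sup>2 * B\<^sup>2 * r ^ CARD('n) * \<nu> ^ CARD('n)"
        unfolding mV by (simp add: power_mult_distrib mult_ac)
      have "ennreal (C1 * (D * B)\<^sup>2 * measure lborel V * \<nu> ^ CARD('n)) * ennreal ((1 / h0)\<^sup>2) =
          ennreal (C1 * (D * B)\<^sup>2 * measure lborel V * \<nu> ^ CARD('n) * (1 / h0)\<^sup>2)"
        by (rule ennreal_mult''[symmetric]) simp
      then show ?thesis unfolding e by (simp only: mult.assoc[symmetric])
    qed
    finally show "piece_bound (\<lambda>x \<xi>. iexp (p x \<xi>) * e x \<xi>) Q g (C1 * D\<^sup>2 * 2 ^ CARD('n) * (1 / h0)\<^sup>2 * B\<^sup>2 * r ^ CARD('n) * \<nu> ^ CARD('n))"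
      unfolding piece_bound_def using main unfolding bg by (rule order_trans[rotated])
  qed
qed

section \<open>Measurable selections\<close>

lemma dense_sequence:
  obtains d :: "nat \<Rightarrow> 'a::euclidean_space" where "\<And>x e. e > 0 \<Longrightarrow> \<exists>n. dist (d n) x < e"
proof -
  obtain D :: "'a set" where D: "countable D" "\<And>X. open X \<Longrightarrow> X \<noteq> {} \<Longrightarrow> \<exists>d\<in>D. d \<in> X"
    using countable_dense_exists[where 'a='a] by blast
  have "D \<noteq> {}" using D(2)[of UNIV] by auto
  show ?thesis
  proof (rule that[of "from_nat_into D"])
    fix x :: 'a and e :: real assume "e > 0"
    then obtain y where "y \<in> D" "y \<in> ball x e" using D(2)[of "ball x e"] by auto
    then show "\<exists>n. dist (from_nat_into D n) x < e"
      using from_nat_into_surj[OF D(1), of y] by (auto simp: dist_commute)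
  qed
qed

text \<open>The frequency is replaced by the first point of a dense sequence within 1/(N + 1) of it.
  Such an approximation takes countably many frequency values, and by continuity it
  converges.\<close>

lemma Caratheodory_measurable:
  fixes f :: "'a \<Rightarrow> 'b::euclidean_space \<Rightarrow> complex"
  assumes m: "\<And>\<xi>. (\<lambda>x. f x \<xi>) \<in> borel_measurable M" and c: "\<And>x. continuous_on UNIV (f x)"
  shows "(\<lambda>(x, \<xi>). f x \<xi>) \<in> borel_measurable (M \<Otimes>\<^sub>M lborel)"
proof -
  obtain d :: "nat \<Rightarrow> 'b" where d: "\<And>x e. e > 0 \<Longrightarrow> \<exists>n. dist (d n) x < e" using dense_sequence by blast
  define K where "K N \<xi> = (LEAST k. dist (d k) \<xi> < 1 / real (Suc N))" for N \<xi>
  have Km [measurable]: "(\<lambda>p. K N (snd p)) \<in> measurable (M \<Otimes>\<^sub>M lborel) (count_space UNIV)" for N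
    unfolding K_def by measurable
  have K: "dist (d (K N \<xi>)) \<xi> < 1 / real (Suc N)" for N \<xi>
  proof -
    have "\<exists>k. dist (d k) \<xi> < 1 / real (Suc N)" by (rule d) simp
    then show ?thesis unfolding K_def by (rule LeastI_ex)
  qed
  show ?thesis unfolding case_prod_unfold
  proof (rule borel_measurable_LIMSEQ_metric)
    show "(\<lambda>p. f (fst p) (d (K N (snd p)))) \<in> borel_measurable (M \<Otimes>\<^sub>M lborel)" for N
      by (rule measurable_compose_countable[OF _ Km, of "\<lambda>k p. f (fst p) (d k)"])
         (rule measurable_compose[OF measurable_fst m])
    fix p :: "'a \<times> 'b"
    have "(\<lambda>N. dist (d (K N (snd p))) (snd p)) \<longlonglongrightarrow> 0"
      by (rule tendsto_sandwich[OF _ _ tendsto_const LIMSEQ_Suc[OF lim_1_over_n]])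
         (auto intro!: always_eventually less_imp_le K simp del: of_nat_Suc)
    then have "(\<lambda>N. d (K N (snd p))) \<longlonglongrightarrow> snd p" by (rule tendsto_dist_iff[THEN iffD2])
    moreover have "isCont (f (fst p)) (snd p)" using c by (simp add: continuous_on_eq_continuous_at)
    ultimately show "(\<lambda>N. f (fst p) (d (K N (snd p)))) \<longlonglongrightarrow> f (fst p) (snd p)"
      by (rule isCont_tendsto_compose[rotated])
  qed
qed

text \<open>A finite net of the annulus by compactness. Taking the least admissible index makes the
  cells disjoint and measurable; by scaling the same net serves every dyadic shell.\<close>

lemma annulus_selection:
  assumes r: "r > 0"
  obtains z :: "nat \<Rightarrow> real^'n" and N :: nat and sel where
    "\<And>k. k < N \<Longrightarrow> 1 \<le> norm (z k) \<and> norm (z k) \<le> 2"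
    "sel \<in> measurable borel (count_space UNIV)"
    "\<And>\<eta>. 1 \<le> norm \<eta> \<Longrightarrow> norm \<eta> \<le> 2 \<Longrightarrow> sel \<eta> < N"
    "\<And>\<eta> i. 1 \<le> norm \<eta> \<Longrightarrow> norm \<eta> \<le> 2 \<Longrightarrow> \<bar>\<eta> $ i - z (sel \<eta>) $ i\<bar> \<le> r"
proof -
  let ?S = "{\<eta> :: real^'n. 1 \<le> norm \<eta> \<and> norm \<eta> \<le> 2}"
  have "?S = cball 0 2 - ball 0 1" by auto
  then have comp: "compact ?S" by (simp add: compact_diff)
  have cover: "?S \<subseteq> (\<Union>\<zeta>\<in>?S. ball \<zeta> r)" using r by auto
  obtain Z where Z: "Z \<subseteq> ?S" "finite Z" "?S \<subseteq> (\<Union>\<zeta>\<in>Z. ball \<zeta> r)"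
    by (rule compactE_image[OF comp _ cover]) auto
  obtain zs where zs: "set zs = Z" using finite_list[OF Z(2)] by blast
  define sel where "sel \<eta> = (LEAST k. k < length zs \<and> dist (zs ! k) \<eta> < r)" for \<eta>
  have sel: "sel \<eta> < length zs \<and> dist (zs ! sel \<eta>) \<eta> < r" if "\<eta> \<in> ?S" for \<eta>
  proof -
    from that Z(3) obtain \<zeta> where "\<zeta> \<in> Z" "dist \<zeta> \<eta> < r" by auto
    then obtain k where "k < length zs" "zs ! k = \<zeta>" using zs by (auto simp: in_set_conv_nth)
    then have "\<exists>k. k < length zs \<and> dist (zs ! k) \<eta> < r" using \<open>dist \<zeta> \<eta> < r\<close> by blast
    then show ?thesis unfolding sel_def by (rule LeastI_ex)
  qed
  show ?thesis
  proof (rule that[of "length zs" "\<lambda>k. zs ! k" sel])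
    show "1 \<le> norm (zs ! k) \<and> norm (zs ! k) \<le> 2" if "k < length zs" for k
      using Z(1) nth_mem[OF that] unfolding zs by blast
    show "sel \<in> measurable borel (count_space UNIV)" unfolding sel_def by measurable
    fix \<eta> :: "real^'n" assume \<eta>: "1 \<le> norm \<eta>" "norm \<eta> \<le> 2"
    show "sel \<eta> < length zs" using sel \<eta> by auto
    show "\<bar>\<eta> $ i - zs ! sel \<eta> $ i\<bar> \<le> r" for i
      using component_le_norm_cart[of "\<eta> - zs ! sel \<eta>" i] sel[of \<eta>] \<eta> by (simp add: dist_norm norm_minus_commute)
  qed
qed

section \<open>Estimates for the frequency-localized pieces\<close>

lemma dbounds_cong:
  assumes U: "open U" and eq: "\<And>x. x \<in> U \<Longrightarrow> f x = g x" and f: "dbounds e \<nu> U k B f"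
  shows "dbounds e \<nu> U k B g"
proof -
  have d: "((\<lambda>t. g (x + t *\<^sub>R e)) has_vector_derivative d) (at 0)"
    if "x \<in> U" "((\<lambda>t. f (x + t *\<^sub>R e)) has_vector_derivative d) (at 0)" for x d
  proof -
    have op: "open ((\<lambda>t. x + t *\<^sub>R e) -` U)" using U by (intro open_vimage) (auto intro!: continuous_intros)
    show ?thesis by (rule has_vector_derivative_transform_within_open[OF that(2) op]) (use that eq in auto)
  qed
  show ?thesis using f by (cases k) (auto simp: eq[symmetric] intro!: d)
qed

text \<open>The symbol bounds are assumed at every x, not only almost everywhere, in the form in
  which the kernel estimate consumes them: repeated derivatives in one direction up to order
  2n.\<close>

locale fio_setup = phase \<phi> for \<phi> :: "real^'n \<Rightarrow> real^'n \<Rightarrow> real" +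
  fixes a :: "real^'n \<Rightarrow> real^'n \<Rightarrow> complex" and m \<rho> Ca :: real
  assumes a_smooth: "\<And>x. smooth_on UNIV (a x)"
    and a_meas: "\<And>\<xi>. (\<lambda>x. a x \<xi>) \<in> borel_measurable lebesgue"
    and Ca: "Ca > 0"
    and a_bound: "\<And>x i l \<xi>. l \<le> 2 * CARD('n) \<Longrightarrow> norm ((pderiv_at i ^^ l) (a x) \<xi>) \<le> Ca * jbracket \<xi> powr (m - \<rho> * real l)"
    and \<rho>: "0 \<le> \<rho>" "\<rho> \<le> 1" and m: "m < real CARD('n) / 2 * (\<rho> - 1)"
begin

text \<open>The phase with the value 0 at frequency 0, where the given function is arbitrary and
  might spoil joint measurability.\<close>

definition p :: "real^'n \<Rightarrow> real^'n \<Rightarrow> real" where "p x \<xi> = (if \<xi> = 0 then 0 else \<phi> x \<xi>)"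

lemma m_le_0: "m \<le> 0"
proof -
  have "real CARD('n) / 2 * (\<rho> - 1) \<le> 0" using \<rho> by (intro mult_nonneg_nonpos) auto
  then show ?thesis using m by linarith
qed

lemma a_line: "((\<lambda>t. (pderiv_at i ^^ l) (a x) (\<xi> + t *\<^sub>R axis i 1)) has_vector_derivative (pderiv_at i ^^ Suc l) (a x) \<xi>) (at 0)"
proof -
  have "smooth_on UNIV (dirderivs (replicate l (axis i 1)) (a x))" by (rule smooth_on_dirderivs[OF a_smooth]) auto
  from smooth_on_has_derivative_line[OF this, of \<xi> 0 "axis i 1"] show ?thesis
    by (simp add: pderiv_at_funpow del: funpow.simps)
qed

lemma a_continuous: "continuous_on UNIV (a x)"
  using smooth_on_continuous_on[OF a_smooth] .

lemma a_measurable [measurable]: "a x \<in> borel_measurable borel"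
  by (rule borel_measurable_continuous_onI[OF a_continuous])

lemma a_joint: "(\<lambda>(x, \<xi>). a x \<xi>) \<in> borel_measurable (lebesgue \<Otimes>\<^sub>M lborel)"
  by (rule Caratheodory_measurable[OF a_meas a_continuous])

lemma p_joint: "(\<lambda>(x, \<xi>). p x \<xi>) \<in> borel_measurable (lebesgue \<Otimes>\<^sub>M lborel)"
proof -
  have "(\<lambda>q. indicator phdom q *\<^sub>R (case q of (x, \<xi>) \<Rightarrow> \<phi> x \<xi>)) \<in> borel_measurable borel"
    using smooth_on_continuous_on[OF smooth_\<Phi>] open_phdom by (intro borel_measurable_continuous_on_indicator) auto
  moreover have "(\<lambda>q. indicator phdom q *\<^sub>R (case q of (x, \<xi>) \<Rightarrow> \<phi> x \<xi>)) = (\<lambda>(x, \<xi>). p x \<xi>)"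
    by (auto simp: p_def fun_eq_iff indicator_def)
  ultimately show ?thesis using borel_measurable_lebesgue_pair by metis
qed

lemma p_measurable [measurable]: "p x \<in> borel_measurable borel"
proof -
  have "x \<in> space lebesgue" by simp
  from measurable_compose_Pair1[OF this p_joint] show ?thesis by simp
qed

lemma iexp_p_joint: "(\<lambda>(x, \<xi>). iexp (p x \<xi>)) \<in> borel_measurable (lebesgue \<Otimes>\<^sub>M lborel)"
  using p_joint unfolding case_prod_unfold by measurable

lemma P_measurable_\<xi> [measurable]: "set vs \<subseteq> Basis \<Longrightarrow> P vs x \<in> borel_measurable borel"
proof -
  assume vs: "set vs \<subseteq> Basis"
  have "continuous_on (- {0}) (P vs x)"
  proof (rule continuous_at_imp_continuous_on, intro ballI)
    fix \<xi> :: "real^'n" assume "\<xi> \<in> - {0}"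
    then have \<xi>: "\<xi> \<noteq> 0" by simp
    show "isCont (P vs x) \<xi>" by (rule P_has_derivative_\<xi>[OF vs \<xi>, of x]) (blast intro: has_derivative_continuous)
  qed
  then show ?thesis by (intro borel_measurable_continuous_countable_exceptions[of "{0}"]) auto
qed

lemma grad_measurable: "\<zeta> \<noteq> 0 \<Longrightarrow> (\<lambda>x. grad x \<zeta>) \<in> borel_measurable borel"
proof -
  assume \<zeta>: "\<zeta> \<noteq> 0"
  have "isCont (\<lambda>x. P [\<xi>dir i] x \<zeta>) x" for i x
    by (rule P_has_derivative_x[of "[\<xi>dir i]" \<zeta> x]) (use \<zeta> in \<open>simp, simp, blast intro: has_derivative_continuous\<close>)
  then have "continuous_on UNIV (\<lambda>x. grad x \<zeta>)"
    unfolding grad_def by (intro continuous_on_vec_lambda) (simp add: continuous_at_imp_continuous_on)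
  then show ?thesis by (rule borel_measurable_continuous_onI)
qed

lemma grad_inner_joint: "\<zeta> \<noteq> 0 \<Longrightarrow> (\<lambda>(x, \<xi>). grad x \<zeta> \<bullet> \<xi>) \<in> borel_measurable (lebesgue \<Otimes>\<^sub>M lborel)"
proof -
  assume "\<zeta> \<noteq> 0"
  note [measurable] = grad_measurable[OF this]
  have "(\<lambda>(x, \<xi>). grad x \<zeta> \<bullet> \<xi>) \<in> borel_measurable (borel \<Otimes>\<^sub>M borel)" by measurable
  then show ?thesis by (intro borel_measurable_lebesgue_pair) (simp add: borel_prod)
qed

lemma jbracket_ge: "norm x \<le> jbracket x" "1 \<le> jbracket x"
  unfolding jbracket_def by (auto intro!: real_le_rsqrt)

text \<open>The exponent m - \<rho> l is not positive, so the bracket may be replaced by the smaller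
  R/2; the powers of 2 that arise are absorbed using l at most 2n.\<close>

lemma a_dbounds_high:
  assumes R: "R \<ge> 1" and U: "\<And>\<xi>. \<xi> \<in> U \<Longrightarrow> R / 2 < norm \<xi>"
  shows "dbounds (axis i 1) (R powr (- \<rho>)) U (2 * CARD('n)) (Ca * 2 powr (real CARD('n) * 2 - m) * R powr m) (a x)"
proof -
  have "dbounds (axis i 1) (R powr (- \<rho>)) U (2 * CARD('n)) (Ca * 2 powr (real CARD('n) * 2 - m) * R powr m) ((pderiv_at i ^^ 0) (a x))"
  proof (rule dbounds_seq[where f="\<lambda>l. (pderiv_at i ^^ l) (a x)"])
    fix l \<xi> assume l: "l \<le> (2 * CARD('n))" and \<xi>: "\<xi> \<in> U"
    have "\<rho> * real l \<le> real CARD('n) * 2"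
    proof -
      have "\<rho> * real l \<le> 1 * real (2 * CARD('n))" using \<rho> l by (intro mult_mono) auto
      then show ?thesis by simp
    qed
    have neg: "m - \<rho> * real l \<le> 0" using m_le_0 \<rho> by (simp add: add_nonpos_nonpos diff_le_0_iff_le order_trans[of m 0])
    have "norm ((pderiv_at i ^^ l) (a x) \<xi>) \<le> Ca * jbracket \<xi> powr (m - \<rho> * real l)" by (rule a_bound[OF l])
    also have "\<dots> \<le> Ca * (R / 2) powr (m - \<rho> * real l)"
      using jbracket_ge(1)[of \<xi>] U[OF \<xi>] R neg Ca by (intro mult_left_mono powr_mono2') auto
    also have "(R / 2) powr (m - \<rho> * real l) = 2 powr (\<rho> * real l - m) * (R powr m * R powr (- \<rho> * real l))"
      using R by (simp add: powr_divide powr_diff powr_minus_divide)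
    also have "\<dots> \<le> 2 powr (real CARD('n) * 2 - m) * (R powr m * R powr (- \<rho> * real l))"
      using \<open>\<rho> * real l \<le> real CARD('n) * 2\<close> by (intro mult_right_mono powr_mono) auto
    also have "R powr (- \<rho> * real l) = (R powr (- \<rho>)) ^ l"
      using R by (simp add: powr_realpow[symmetric] powr_powr)
    finally show "norm ((pderiv_at i ^^ l) (a x) \<xi>) \<le> Ca * 2 powr (real CARD('n) * 2 - m) * R powr m * (R powr (- \<rho>)) ^ l"
      using Ca by (simp add: mult_ac)
  qed (rule a_line)
  then show ?thesis by simp
qed

lemma a_bound_0: "l \<le> (2 * CARD('n)) \<Longrightarrow> norm ((pderiv_at i ^^ l) (a x) \<xi>) \<le> Ca"
proof -
  assume l: "l \<le> (2 * CARD('n))"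
  have neg: "m - \<rho> * real l \<le> 0" using m_le_0 \<rho> by (simp add: add_nonpos_nonpos diff_le_0_iff_le order_trans[of m 0])
  have "Ca * jbracket \<xi> powr (m - \<rho> * real l) \<le> Ca * 1 powr (m - \<rho> * real l)"
    using jbracket_ge(2)[of \<xi>] neg Ca by (intro mult_left_mono powr_mono2') auto
  then show ?thesis using a_bound[OF l, of i x \<xi>] by simp
qed

text \<open>At low frequency the derivatives are bounded, which is stronger than scale 1/R for R at
  most 1. Subtracting the value at frequency 0 gains a factor R by the mean value theorem.\<close>

lemma a_dbounds_low:
  assumes R: "0 < R" "R \<le> 1"
  shows "dbounds (axis i 1) (1 / R) U (2 * CARD('n)) Ca (a x)"
    and "(\<And>\<xi>. \<xi> \<in> U \<Longrightarrow> norm \<xi> \<le> 4 * R) \<Longrightarrow> dbounds (axis i 1) (1 / R) U (2 * CARD('n)) (R * (4 * real CARD('n) * Ca)) (\<lambda>\<xi>. a x \<xi> - a x 0)"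
proof -
  have "dbounds (axis i 1) (1 / R) U (2 * CARD('n)) Ca ((pderiv_at i ^^ 0) (a x))"
  proof (rule dbounds_seq[where f="\<lambda>l. (pderiv_at i ^^ l) (a x)"])
    fix l \<xi> assume "l \<le> (2 * CARD('n))"
    have "Ca * 1 \<le> Ca * (1 / R) ^ l" using R Ca by (intro mult_left_mono one_le_power) auto
    then show "norm ((pderiv_at i ^^ l) (a x) \<xi>) \<le> Ca * (1 / R) ^ l" using a_bound_0[OF \<open>l \<le> (2 * CARD('n))\<close>, of i x \<xi>] by simp
  qed (rule a_line)
  then show "dbounds (axis i 1) (1 / R) U (2 * CARD('n)) Ca (a x)" by simp
  assume U: "\<And>\<xi>. \<xi> \<in> U \<Longrightarrow> norm \<xi> \<le> 4 * R"
  define f where "f l \<xi> = (if l = 0 then a x \<xi> - a x 0 else (pderiv_at i ^^ l) (a x) \<xi>)" for l \<xi>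
  have n1: "1 \<le> real CARD('n)" by (simp add: Suc_leI)
  have "dbounds (axis i 1) (1 / R) U (2 * CARD('n)) (R * (4 * real CARD('n) * Ca)) (f 0)"
  proof (rule dbounds_seq)
    fix l \<xi> assume l: "l \<le> (2 * CARD('n))" and \<xi>: "\<xi> \<in> U"
    show "norm (f l \<xi>) \<le> R * (4 * real CARD('n) * Ca) * (1 / R) ^ l"
    proof (cases "l = 0")
      case True
      have der: "(a x has_derivative frechet_derivative (a x) (at \<eta>)) (at \<eta>)" for \<eta>
        using smooth_on_differentiable[OF a_smooth] frechet_derivative_works by blast
      have "norm (a x \<xi> - a x 0) \<le> (real CARD('n) * Ca) * norm (\<xi> - 0)"
      proof (rule differentiable_bound[of UNIV])
        fix \<eta> :: "real^'n"
        show "(a x has_derivative frechet_derivative (a x) (at \<eta>)) (at \<eta> within UNIV)" using der by simp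
        show "onorm (frechet_derivative (a x) (at \<eta>)) \<le> real CARD('n) * Ca"
        proof (rule onorm_le)
          fix h :: "real^'n"
          have lin: "linear (frechet_derivative (a x) (at \<eta>))" using has_derivative_linear[OF der] .
          have "h = (\<Sum>j\<in>UNIV. h $ j *\<^sub>R axis j 1)" by (metis (no_types) basis_expansion scalar_mult_eq_scaleR)
          then have "frechet_derivative (a x) (at \<eta>) h = frechet_derivative (a x) (at \<eta>) (\<Sum>j\<in>UNIV. h $ j *\<^sub>R axis j 1)" by (rule arg_cong)
          also have "\<dots> = (\<Sum>j\<in>UNIV. h $ j *\<^sub>R pderiv_at j (a x) \<eta>)" using lin by (simp add: linear_sum linear_scale pderiv_at_def)
          also have "norm \<dots> \<le> (\<Sum>j\<in>(UNIV::'n set). norm (h $ j *\<^sub>R pderiv_at j (a x) \<eta>))" by (rule norm_sum)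
          also have "\<dots> \<le> (\<Sum>j\<in>(UNIV::'n set). norm h * Ca)"
          proof (rule sum_mono)
            fix j
            have "norm (pderiv_at j (a x) \<eta>) \<le> Ca" using a_bound_0[of 1 j x \<eta>] by (simp add: Suc_leI)
            then show "norm (h $ j *\<^sub>R pderiv_at j (a x) \<eta>) \<le> norm h * Ca"
              using component_le_norm_cart[of h j] by (simp add: mult_mono)
          qed
          finally show "norm (frechet_derivative (a x) (at \<eta>) h) \<le> real CARD('n) * Ca * norm h" by (simp add: mult_ac)
        qed
      qed auto
      also have "\<dots> \<le> (real CARD('n) * Ca) * (4 * R)" using U[OF \<xi>] Ca by (intro mult_left_mono) auto
      finally show ?thesis using True by (simp add: f_def mult_ac)
    next
      case False
      then obtain l' where l': "l = Suc l'" by (cases l) auto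
      have "norm (f l \<xi>) \<le> Ca" using a_bound_0[OF l] False by (simp add: f_def)
      also have "Ca \<le> (4 * real CARD('n) * Ca) * 1"
        proof -
          have "1 * Ca \<le> (4 * real CARD('n)) * Ca" by (rule mult_right_mono) (use n1 Ca in linarith)+
          then show ?thesis by (simp only: mult_1 mult_1_right)
        qed
        also have "\<dots> \<le> (4 * real CARD('n) * Ca) * (1 / R) ^ l'" using R Ca by (intro mult_left_mono one_le_power) auto
      finally show ?thesis using R l' by simp
    qed
  next
    fix l \<xi> assume "l < (2 * CARD('n))" "\<xi> \<in> U"
    show "((\<lambda>t. f l (\<xi> + t *\<^sub>R axis i 1)) has_vector_derivative f (Suc l) \<xi>) (at 0)"
    proof (cases "l = 0")
      case True
      have "((\<lambda>t. a x (\<xi> + t *\<^sub>R axis i 1) - a x 0) has_vector_derivative pderiv_at i (a x) \<xi> - 0) (at 0)"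
        using a_line[of 0 i x \<xi>] by (intro has_vector_derivative_diff has_vector_derivative_const) simp
      then show ?thesis using True by (simp add: f_def)
    qed (use a_line[of l i x \<xi>] in \<open>simp add: f_def\<close>)
  qed
  then show "dbounds (axis i 1) (1 / R) U (2 * CARD('n)) (R * (4 * real CARD('n) * Ca)) (\<lambda>\<xi>. a x \<xi> - a x 0)"
    by (simp add: f_def[abs_def])
qed

lemma open_cube: "open (cube \<zeta> r)" and convex_cube: "convex (cube \<zeta> r)"
  unfolding sup_cube_eq_box by (rule open_box, rule convex_box)

lemma cube_norm: "(x :: real^'n) \<in> cube \<zeta> r \<Longrightarrow> norm (x - \<zeta>) \<le> real CARD('n) * (2 * r)"
  by (rule norm_le_card_component) (auto intro: less_imp_le)

abbreviation high_estimate :: "real \<Rightarrow> real \<Rightarrow> bool" where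
  "high_estimate d0 C \<equiv> \<forall>R z Q g. 1 \<le> R \<and> 1 \<le> norm z \<and> Q \<in> sets borel \<and> Q \<subseteq> closed_cube (R *\<^sub>R z) (d0 * R) \<and>
       square_integrable g \<longrightarrow>
       piece_bound (\<lambda>x \<xi>. iexp (p x \<xi>) * a x \<xi>) Q g (C * R powr (2 * m + real CARD('n) - real CARD('n) * \<rho>))"

text \<open>The scale R^(-\<rho>) / d0 dominates all three scales that occur: R^(-\<rho>) of the
  symbol, 1/R of the phase and 1/(d0 R) of the cutoff, as R is at least 1 and \<rho> at most
  1.\<close>

lemma high_piece:
  obtains d0 where "0 < d0" "d0 \<le> 1" "d0 * real CARD('n) * 2 \<le> 1 / 4"
    "\<exists>C>0. high_estimate d0 C"
proof -
  obtain c \<delta> where c: "c > 0" and \<delta>: "0 < \<delta>" "\<delta> \<le> 1" and low: "\<And>x y R \<zeta> U. R > 0 \<Longrightarrow> convex U \<Longrightarrow> (\<And>\<xi>. \<xi> \<in> U \<Longrightarrow> R / 2 < norm \<xi> \<and> norm (\<xi> - \<zeta>) \<le> \<delta> * R) \<Longrightarrow> \<zeta> \<in> U \<Longrightarrow>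
      \<exists>i. \<forall>\<xi>\<in>U. c * norm (x - y) \<le> \<bar>P [\<xi>dir i] x \<xi> - P [\<xi>dir i] y \<xi>\<bar>"
    using phase_difference_lower by blast
  obtain A where A: "A \<ge> 0" and Ab: "\<And>i x y R U. R > 0 \<Longrightarrow> x \<noteq> y \<Longrightarrow> (\<And>\<xi>. \<xi> \<in> U \<Longrightarrow> R / 2 < norm \<xi>) \<Longrightarrow>
    dbounds (axis i 1) (1 / R) U (2 * CARD('n)) A (\<lambda>\<xi>. complex_of_real ((P [\<xi>dir i] x \<xi> - P [\<xi>dir i] y \<xi>) / norm (x - y)))"
    using phase_difference_dbounds[of "2 * CARD('n)"] by blast
  \<comment> \<open>The cube of half side 2 d0 R stays within \<open>min \<delta> (1/4) * R\<close>
    of its centre, whose norm is at least R. So norms in it exceed R/2 and the lower bound for phase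
    differences applies.\<close>
  define d0 where "d0 = min \<delta> (1/4) / (2 * real CARD('n))"
  have n1: "1 \<le> real CARD('n)" by (simp add: Suc_leI)
  have d0n: "real CARD('n) * (2 * d0) = min \<delta> (1/4)" using n1 by (simp add: d0_def)
  have d0: "0 < d0" using \<delta> n1 by (simp add: d0_def)
  have d01: "d0 \<le> 1"
  proof -
    have "1 * (2 * d0) \<le> real CARD('n) * (2 * d0)" using n1 d0 by (intro mult_right_mono) auto
    then show ?thesis using d0n by linarith
  qed
  obtain C1 where C10: "C1 > 0" and C1: "\<forall>p :: real^'n \<Rightarrow> real^'n \<Rightarrow> real. cutoff_estimate c A C1 p"
    using cutoff_operator_bound[OF c A, where 'n='n] by (elim exE conjE) (rule that; assumption)
  define B0 where "B0 = Ca * 2 powr (real CARD('n) * 2 - m)"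
  have B0: "B0 > 0" using Ca by (simp add: B0_def)
  have "high_estimate d0 (C1 * B0\<^sup>2)"
  proof (intro allI impI; elim conjE)
    fix R and z :: "real^'n" and Q and g :: "real^'n \<Rightarrow> complex"
    assume R: "1 \<le> R" and z: "1 \<le> norm z" and Q: "Q \<in> sets borel" "Q \<subseteq> closed_cube (R *\<^sub>R z) (d0 * R)"
      and g: "g \<in> borel_measurable borel" "integrable lborel (\<lambda>\<xi>. (norm (g \<xi>))\<^sup>2)"
    let ?r = "d0 * R" and ?\<zeta> = "R *\<^sub>R z" and ?\<nu> = "R powr (- \<rho>) / d0" and ?B = "B0 * R powr m"
    let ?U = "cube ?\<zeta> ?r"
    have R0: "R > 0" using R by simp
    have Un: "R / 2 < norm \<xi> \<and> norm (\<xi> - ?\<zeta>) \<le> \<delta> * R \<and> \<xi> \<noteq> 0" if "\<xi> \<in> ?U" for \<xi>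
    proof -
      have "norm (\<xi> - ?\<zeta>) \<le> (real CARD('n) * (2 * d0)) * R" using cube_norm[OF that] by (simp add: mult_ac)
      then have 1: "norm (\<xi> - ?\<zeta>) \<le> min \<delta> (1/4) * R" unfolding d0n .
      have 2: "min \<delta> (1/4) * R \<le> \<delta> * R" "min \<delta> (1/4) * R \<le> 1/4 * R" using R0 by (auto intro!: mult_right_mono)
      have 3: "R \<le> norm ?\<zeta>" using z R0 by simp
      have 4: "norm ?\<zeta> - norm \<xi> \<le> norm (\<xi> - ?\<zeta>)" by (metis norm_minus_commute norm_triangle_ineq2)
      have 5: "R / 2 < norm \<xi>" using 1 2 3 4 R0 by linarith
      then have "\<xi> \<noteq> 0" using R0 by auto
      moreover have "norm (\<xi> - ?\<zeta>) \<le> \<delta> * R" using 1 2 by linarith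
      ultimately show ?thesis using 5 by blast
    qed
    have \<zeta>U: "?\<zeta> \<in> ?U" using d0 R0 by simp
    have nu1: "R powr (- \<rho>) \<le> ?\<nu>"
    proof -
      have "R powr (- \<rho>) * 1 \<le> R powr (- \<rho>) * (1 / d0)" using d0 d01 by (intro mult_left_mono) auto
      then show ?thesis by simp
    qed
    have inv: "1 / R \<le> R powr (- \<rho>)"
    proof -
      have "R powr (- 1) \<le> R powr (- \<rho>)" using R \<rho> by (intro powr_mono) auto
      then show ?thesis using R0 by (simp add: powr_minus_divide)
    qed
    have "piece_bound (\<lambda>x \<xi>. iexp (p x \<xi>) * a x \<xi>) Q g (C1 * ?B\<^sup>2 * ?r ^ CARD('n) * ?\<nu> ^ CARD('n))"
    proof (rule C1[THEN spec, THEN spec, THEN spec, THEN spec, THEN spec, THEN spec, THEN spec, THEN mp, THEN spec, THEN mp], intro conjI)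
      show "0 < ?\<nu>" "0 < ?B" "0 < ?r" using d0 R0 B0 by auto
      show "1 / ?r \<le> ?\<nu>" using inv d0 R0 by (simp add: divide_right_mono field_simps)
      show "\<forall>x i. dbounds (axis i 1) ?\<nu> ?U (2 * CARD('n)) ?B (a x)"
      proof (intro allI)
        fix x i
        have "dbounds (axis i 1) (R powr (- \<rho>)) ?U (2 * CARD('n)) ?B (a x)"
          unfolding B0_def by (rule a_dbounds_high[OF R]) (use Un in blast)
        then show "dbounds (axis i 1) ?\<nu> ?U (2 * CARD('n)) ?B (a x)" by (rule dbounds_mono) (use nu1 B0 in auto)
      qed
      show "phase_separated c A ?\<nu> ?U p"
      proof (intro allI impI)
        fix x y :: "real^'n" assume xy: "x \<noteq> y"
        obtain i where i: "\<forall>\<xi>\<in>?U. c * norm (x - y) \<le> \<bar>P [\<xi>dir i] x \<xi> - P [\<xi>dir i] y \<xi>\<bar>"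
          using low[OF R0 convex_cube _ \<zeta>U] Un by blast
        define q where "q \<xi> = (P [\<xi>dir i] x \<xi> - P [\<xi>dir i] y \<xi>) / norm (x - y)" for \<xi>
        have [measurable]: "P [\<xi>dir i] z \<in> borel_measurable borel" for z by (rule P_measurable_\<xi>) simp
        have "q \<in> borel_measurable borel" unfolding q_def by measurable
        moreover have "\<forall>\<xi>\<in>?U. c \<le> \<bar>q \<xi>\<bar>" using i xy by (simp add: q_def pos_le_divide_eq)
        moreover have "dbounds (axis i 1) ?\<nu> ?U (2 * CARD('n)) A (\<lambda>\<xi>. complex_of_real (q \<xi>))"
          unfolding q_def by (rule dbounds_mono[OF Ab[OF R0 xy]]) (use Un inv nu1 A R0 in auto)
        moreover have "\<forall>\<xi>\<in>?U. ((\<lambda>t. p x (\<xi> + t *\<^sub>R axis i 1) - p y (\<xi> + t *\<^sub>R axis i 1)) has_real_derivative norm (x - y) * q \<xi>) (at 0)"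
        proof
          fix \<xi> assume \<xi>: "\<xi> \<in> ?U"
          then have nz: "\<xi> \<noteq> 0" using Un by blast
          have op: "open ((\<lambda>t. \<xi> + t *\<^sub>R axis i 1) -` ?U)" by (rule open_vimage[OF open_cube]) (intro continuous_intros)
          have "((\<lambda>t. \<phi> x (\<xi> + t *\<^sub>R axis i 1) - \<phi> y (\<xi> + t *\<^sub>R axis i 1)) has_real_derivative P [\<xi>dir i] x \<xi> - P [\<xi>dir i] y \<xi>) (at 0)"
            using P_line[of "[]" \<xi> _ i] nz by (intro DERIV_diff) (simp_all add: P_Nil)
          then have "((\<lambda>t. p x (\<xi> + t *\<^sub>R axis i 1) - p y (\<xi> + t *\<^sub>R axis i 1)) has_real_derivative P [\<xi>dir i] x \<xi> - P [\<xi>dir i] y \<xi>) (at 0)"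
            by (rule has_field_derivative_transform_within_open[OF _ op]) (use \<xi> Un in \<open>auto simp: p_def\<close>)
          then show "((\<lambda>t. p x (\<xi> + t *\<^sub>R axis i 1) - p y (\<xi> + t *\<^sub>R axis i 1)) has_real_derivative norm (x - y) * q \<xi>) (at 0)"
            using xy by (simp add: q_def)
        qed
        ultimately show "\<exists>i q. q \<in> borel_measurable borel \<and> (\<forall>\<xi>\<in>?U. c \<le> \<bar>q \<xi>\<bar>) \<and>
        dbounds (axis i 1) ?\<nu> ?U (2 * CARD('n)) A (\<lambda>\<xi>. complex_of_real (q \<xi>)) \<and>
        (\<forall>\<xi>\<in>?U. ((\<lambda>t. p x (\<xi> + t *\<^sub>R axis i 1) - p y (\<xi> + t *\<^sub>R axis i 1)) has_real_derivative norm (x - y) * q \<xi>) (at 0))"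
          by (intro exI[of _ i] exI[of _ q] conjI)
      qed
    qed (use Q g iexp_p_joint a_joint p_measurable a_measurable in auto)
    moreover have "C1 * ?B\<^sup>2 * ?r ^ CARD('n) * ?\<nu> ^ CARD('n) = C1 * B0\<^sup>2 * R powr (2 * m + real CARD('n) - real CARD('n) * \<rho>)"
    proof -
      \<comment> \<open>Volume of the cube times the integral of the Schur weight, up to constants;
        d0 cancels.\<close>
      have "?r ^ CARD('n) * ?\<nu> ^ CARD('n) = (R * R powr (- \<rho>)) ^ CARD('n)"
        using d0 by (simp add: power_mult_distrib[symmetric])
      also have "\<dots> = R powr (real CARD('n) - real CARD('n) * \<rho>)"
        using R0 by (simp add: powr_realpow[symmetric] powr_mult powr_powr powr_add[symmetric] mult.commute)
      finally have 1: "?r ^ CARD('n) * ?\<nu> ^ CARD('n) = R powr (real CARD('n) - real CARD('n) * \<rho>)" .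
      have 2: "?B\<^sup>2 = B0\<^sup>2 * R powr (2 * m)"
        using R0 by (simp add: power_mult_distrib powr_realpow[symmetric] powr_powr mult.commute)
      have "C1 * ?B\<^sup>2 * ?r ^ CARD('n) * ?\<nu> ^ CARD('n) = C1 * ?B\<^sup>2 * (?r ^ CARD('n) * ?\<nu> ^ CARD('n))" by (simp only: mult.assoc)
      also have "\<dots> = C1 * B0\<^sup>2 * (R powr (2 * m) * R powr (real CARD('n) - real CARD('n) * \<rho>))" unfolding 1 2 by (simp only: mult.assoc)
      finally show ?thesis by (simp add: powr_add[symmetric] add_diff_eq)
    qed
    ultimately show "piece_bound (\<lambda>x \<xi>. iexp (p x \<xi>) * a x \<xi>) Q g (C1 * B0\<^sup>2 * R powr (2 * m + real CARD('n) - real CARD('n) * \<rho>))"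
      by (simp only:)
  qed
  then show ?thesis using C10 B0 d0 d01 d0n by (intro that[of d0] exI[of _ "C1 * B0\<^sup>2"]) (auto simp: mult_ac)
qed

abbreviation linear_estimate :: "real \<Rightarrow> bool" where
  "linear_estimate C \<equiv> \<forall>z e \<nu> B \<zeta> r Q g. z \<noteq> 0 \<and> 0 < \<nu> \<and> 0 < B \<and> 0 < r \<and> 1 / r \<le> \<nu> \<and>
     Q \<in> sets borel \<and> Q \<subseteq> closed_cube \<zeta> r \<and>
     (\<lambda>(x, \<xi>). e x \<xi>) \<in> borel_measurable (lebesgue \<Otimes>\<^sub>M lborel) \<and>
     (\<forall>x. e x \<in> borel_measurable borel) \<and>
     (\<forall>x i. dbounds (axis i 1) \<nu> (cube \<zeta> r) (2 * CARD('n)) B (e x)) \<and>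
     square_integrable g \<longrightarrow>
     piece_bound (\<lambda>x \<xi>. iexp (grad x z \<bullet> \<xi>) * e x \<xi>) Q g (C * B\<^sup>2 * r ^ CARD('n) * \<nu> ^ CARD('n))"

text \<open>For a phase linear in \<xi> the derivative of the phase difference is a constant, a
  component of grad x z - grad y z. Hence cubes of any size and position are allowed, in particular
  around frequency 0.\<close>

lemma linear_piece:
  "\<exists>C>0. linear_estimate C"
proof -
  let ?n = "real CARD('n)"
  obtain c0 where c0: "c0 > 0" "\<And>x y \<xi>. \<xi> \<noteq> 0 \<Longrightarrow> c0 * norm (x - y) \<le> norm (grad x \<xi> - grad y \<xi>)"
    using grad_expansion by metis
  define c where "c = c0 / ?n"
  have c: "c > 0" using c0 by (simp add: c_def)
  obtain A where A: "A \<ge> 0" and Ab: "\<And>i x y R U. R > 0 \<Longrightarrow> x \<noteq> y \<Longrightarrow> (\<And>\<xi>. \<xi> \<in> U \<Longrightarrow> R / 2 < norm \<xi>) \<Longrightarrow>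
    dbounds (axis i 1) (1 / R) U 0 A (\<lambda>\<xi>. complex_of_real ((P [\<xi>dir i] x \<xi> - P [\<xi>dir i] y \<xi>) / norm (x - y)))"
    using phase_difference_dbounds[of 0] by blast
  \<comment> \<open>The order 0 bound for normalized phase differences, at the single frequency z
    with R = |z|: the gradient map is Lipschitz in x.\<close>
  have gA: "\<bar>(grad x z - grad y z) $ i\<bar> / norm (x - y) \<le> A" if "z \<noteq> 0" "x \<noteq> y" for x y z i
    using Ab[of "norm z" x y "{z}" i] that by (simp add: grad_def norm_divide del: of_real_diff)
  obtain C1 where C10: "C1 > 0" and C1: "\<forall>p :: real^'n \<Rightarrow> real^'n \<Rightarrow> real. cutoff_estimate c A C1 p"
    using cutoff_operator_bound[OF c A, where 'n='n] by (elim exE conjE) (rule that; assumption)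
  show ?thesis
  proof (intro exI[of _ C1] conjI C10 allI impI; elim conjE)
    fix z :: "real^'n" and e :: "real^'n \<Rightarrow> real^'n \<Rightarrow> complex" and \<nu> B and \<zeta> :: "real^'n" and r Q and g :: "real^'n \<Rightarrow> complex"
    assume z: "z \<noteq> 0" and h: "0 < \<nu>" "0 < B" "0 < r" "1 / r \<le> \<nu>"
      "Q \<in> sets borel" "Q \<subseteq> closed_cube \<zeta> r"
      "(\<lambda>(x, \<xi>). e x \<xi>) \<in> borel_measurable (lebesgue \<Otimes>\<^sub>M lborel)"
      "\<forall>x. e x \<in> borel_measurable borel"
      "\<forall>x i. dbounds (axis i 1) \<nu> (cube \<zeta> r) (2 * CARD('n)) B (e x)"
      "g \<in> borel_measurable borel" "integrable lborel (\<lambda>\<xi>. (norm (g \<xi>))\<^sup>2)"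
    show "piece_bound (\<lambda>x \<xi>. iexp (grad x z \<bullet> \<xi>) * e x \<xi>) Q g (C1 * B\<^sup>2 * r ^ CARD('n) * \<nu> ^ CARD('n))"
    proof (rule C1[THEN spec, THEN spec, THEN spec, THEN spec, THEN spec, THEN spec, THEN spec, THEN mp, THEN spec, THEN mp], intro conjI)
      show "(\<lambda>(x, \<xi>). iexp (grad x z \<bullet> \<xi>)) \<in> borel_measurable (lebesgue \<Otimes>\<^sub>M lborel)"
        using grad_inner_joint[OF z] unfolding case_prod_unfold by measurable
      show "\<forall>x. (\<lambda>\<xi>. grad x z \<bullet> \<xi>) \<in> borel_measurable borel \<and> e x \<in> borel_measurable borel"
        using h(8) by simp
      show "phase_separated c A \<nu> (cube \<zeta> r) (\<lambda>x \<xi>. grad x z \<bullet> \<xi>)"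
      proof (intro allI impI)
        fix x y :: "real^'n" assume xy: "x \<noteq> y"
        have "\<exists>i. c * norm (x - y) \<le> \<bar>(grad x z - grad y z) $ i\<bar>"
        proof (rule ccontr)
          assume "\<nexists>i. c * norm (x - y) \<le> \<bar>(grad x z - grad y z) $ i\<bar>"
          then have lt: "\<And>i. \<bar>(grad x z - grad y z) $ i\<bar> < c * norm (x - y)" by (meson not_le)
          have "norm (grad x z - grad y z) \<le> (\<Sum>i\<in>UNIV. \<bar>(grad x z - grad y z) $ i\<bar>)" by (rule norm_le_l1_cart)
          also have "\<dots> < (\<Sum>i\<in>(UNIV::'n set). c * norm (x - y))" using lt by (intro sum_strict_mono) auto
          also have "\<dots> = c0 * norm (x - y)" by (simp add: c_def)
          finally show False using c0(2)[OF z, of x y] by simp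
        qed
        then obtain i where i: "c * norm (x - y) \<le> \<bar>(grad x z - grad y z) $ i\<bar>" by blast
        let ?q = "(grad x z - grad y z) $ i / norm (x - y)"
        have "c \<le> \<bar>?q\<bar>" using i xy by (simp add: pos_le_divide_eq)
        moreover have "dbounds (axis i 1) \<nu> (cube \<zeta> r) (2 * CARD('n)) A (\<lambda>\<xi>. complex_of_real ?q)"
          using gA[OF z xy, of i] h(1) by (intro dbounds_const) (auto simp: norm_divide simp del: of_real_diff)
        moreover have "((\<lambda>t. grad x z \<bullet> (\<xi> + t *\<^sub>R axis i 1) - grad y z \<bullet> (\<xi> + t *\<^sub>R axis i 1)) has_real_derivative norm (x - y) * ?q) (at 0)" for \<xi>
          using xy by (auto intro!: derivative_eq_intros simp: inner_add_right inner_axis)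
        ultimately show "\<exists>i q. q \<in> borel_measurable borel \<and> (\<forall>\<xi>\<in>cube \<zeta> r. c \<le> \<bar>q \<xi>\<bar>) \<and>
        dbounds (axis i 1) \<nu> (cube \<zeta> r) (2 * CARD('n)) A (\<lambda>\<xi>. complex_of_real (q \<xi>)) \<and>
        (\<forall>\<xi>\<in>cube \<zeta> r. ((\<lambda>t. grad x z \<bullet> (\<xi> + t *\<^sub>R axis i 1) - grad y z \<bullet> (\<xi> + t *\<^sub>R axis i 1)) has_real_derivative norm (x - y) * q \<xi>) (at 0))"
          by (intro exI[of _ i] exI[of _ "\<lambda>\<xi>. ?q"] conjI) auto
      qed
    qed (use h in auto)
    
  qed
qed

text \<open>The linear exponential is factored out of the kernel and the symbol frozen at frequency
  0 is subtracted.\<close>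

definition remainder :: "real^'n \<Rightarrow> real^'n \<Rightarrow> real^'n \<Rightarrow> complex" where
  "remainder z x \<xi> = iexp (p x \<xi> - grad x z \<bullet> \<xi>) * a x \<xi> - a x 0"

lemma remainder_joint: "z \<noteq> 0 \<Longrightarrow> (\<lambda>(x, \<xi>). remainder z x \<xi>) \<in> borel_measurable (lebesgue \<Otimes>\<^sub>M lborel)"
proof -
  assume z: "z \<noteq> 0"
  note [measurable] = a_joint[unfolded case_prod_unfold] p_joint[unfolded case_prod_unfold] grad_inner_joint[OF z, unfolded case_prod_unfold]
  have [measurable]: "(\<lambda>q. a (fst q) 0) \<in> borel_measurable (lebesgue \<Otimes>\<^sub>M (lborel :: (real^'n) measure))"
    by (rule measurable_compose[OF measurable_fst a_meas])
  show ?thesis unfolding remainder_def case_prod_unfold by measurable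
qed

lemma remainder_measurable [measurable]: "remainder z x \<in> borel_measurable borel"
  unfolding remainder_def[abs_def] by measurable

abbreviation low_estimate :: "real \<Rightarrow> real \<Rightarrow> bool" where
  "low_estimate d0 C \<equiv> \<forall>R z Q g. 0 < R \<and> R \<le> 1 \<and> 1 \<le> norm z \<and> norm z \<le> 2 \<and> Q \<in> sets borel \<and> Q \<subseteq> closed_cube (R *\<^sub>R z) (d0 * R) \<and>
       square_integrable g \<longrightarrow>
       piece_bound (\<lambda>x \<xi>. iexp (grad x z \<bullet> \<xi>) * remainder z x \<xi>) Q g (C * R\<^sup>2)"

text \<open>Near frequency zero the phase is replaced by its linearization; the remainder is of the size
  of the frequency, which makes the dyadic sum converge.\<close>

lemma low_piece:
  assumes d0: "0 < d0" "d0 \<le> 1" "d0 * real CARD('n) * 2 \<le> 1 / 4"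
  shows "\<exists>C>0. low_estimate d0 C"
proof -
  let ?n = "real CARD('n)" and ?K = "2 * CARD('n)"
  obtain C1 where C10: "C1 > 0" and C1: "linear_estimate C1"
    using linear_piece by (elim exE conjE) (rule that; assumption)
  obtain A where A: "A \<ge> 0" and Ab: "\<And>i x \<zeta> R U. R > 0 \<Longrightarrow> convex U \<Longrightarrow> (\<And>\<xi>. \<xi> \<in> U \<Longrightarrow> R / 2 < norm \<xi> \<and> norm (\<xi> - \<zeta>) \<le> R) \<Longrightarrow> \<zeta> \<in> U \<Longrightarrow>
    dbounds (axis i 1) (1 / R) U ?K (R * A) (\<lambda>\<xi>. complex_of_real (\<phi> x \<xi> - grad x \<zeta> \<bullet> \<xi>))"
    using phase_linearization_dbounds[of ?K] by blast
  obtain E where E0: "E \<ge> 0" and E1: "\<forall>e \<nu> (U :: (real^'n) set) \<psi> s. 0 \<le> \<nu> \<and> 0 \<le> s \<and> s \<le> 1 \<and>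
      dbounds e \<nu> U ?K (s * A) (\<lambda>\<xi>. complex_of_real (\<psi> \<xi>)) \<longrightarrow>
    dbounds e \<nu> U ?K (s * E) (\<lambda>\<xi>. iexp (\<psi> \<xi>) - 1)"
    using dbounds_iexp_minus_one[OF A, of ?K] by (elim exE conjE) (rule that; assumption)
  \<comment> \<open>The first summand bounds (exp(i \<psi>) - 1) times the symbol, \<psi> being the
    linearization error; the second bounds the increment of the symbol from frequency 0. The common
    factor R is kept outside.\<close>
  define B0 where "B0 = 2 ^ ?K * E * Ca + 4 * ?n * Ca"
  have B0: "B0 > 0" using E0 Ca by (simp add: B0_def add_nonneg_pos)
  have "low_estimate d0 (C1 * B0\<^sup>2)"
  proof (intro allI impI; elim conjE)
    fix R and z :: "real^'n" and Q and g :: "real^'n \<Rightarrow> complex"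
    assume R: "0 < R" "R \<le> 1" and z: "1 \<le> norm z" "norm z \<le> 2" and Q: "Q \<in> sets borel" "Q \<subseteq> closed_cube (R *\<^sub>R z) (d0 * R)"
      and g: "g \<in> borel_measurable borel" "integrable lborel (\<lambda>\<xi>. (norm (g \<xi>))\<^sup>2)"
    let ?r = "d0 * R" and ?\<zeta> = "R *\<^sub>R z" and ?\<nu> = "1 / (d0 * R)" and ?B = "R * B0"
    let ?U = "cube ?\<zeta> ?r"
    have z0: "z \<noteq> 0" using z by auto
    have Un: "R / 2 < norm \<xi> \<and> norm (\<xi> - ?\<zeta>) \<le> R \<and> norm \<xi> \<le> 4 * R \<and> \<xi> \<noteq> 0" if "\<xi> \<in> ?U" for \<xi>
    proof -
      have "norm (\<xi> - ?\<zeta>) \<le> (d0 * ?n * 2) * R" using cube_norm[OF that] by (simp add: mult_ac)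
      also have "\<dots> \<le> 1 / 4 * R" using d0 R by (intro mult_right_mono) auto
      finally have 1: "norm (\<xi> - ?\<zeta>) \<le> 1 / 4 * R" .
      have 3: "R \<le> norm ?\<zeta>" "norm ?\<zeta> \<le> 2 * R" using z R by simp_all
      have 4: "norm ?\<zeta> - norm \<xi> \<le> norm (\<xi> - ?\<zeta>)" "norm \<xi> - norm ?\<zeta> \<le> norm (\<xi> - ?\<zeta>)"
        by (metis norm_minus_commute norm_triangle_ineq2, rule norm_triangle_ineq2)
      have 5: "R / 2 < norm \<xi>" "norm \<xi> \<le> 4 * R" "norm (\<xi> - ?\<zeta>) \<le> R" using 1 3 4 R by linarith+
      then have "\<xi> \<noteq> 0" using R by auto
      then show ?thesis using 5 by blast
    qed
    have \<zeta>U: "?\<zeta> \<in> ?U" using d0 R by simp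
    have nu: "1 / R \<le> ?\<nu>" using d0 R by (simp add: divide_left_mono mult_left_le_one_le)
    have "piece_bound (\<lambda>x \<xi>. iexp (grad x z \<bullet> \<xi>) * remainder z x \<xi>) Q g (C1 * ?B\<^sup>2 * ?r ^ CARD('n) * ?\<nu> ^ CARD('n))"
    proof (rule C1[THEN spec, THEN spec, THEN spec, THEN spec, THEN spec, THEN spec, THEN spec, THEN spec, THEN mp], intro conjI)
      show "\<forall>x i. dbounds (axis i 1) ?\<nu> ?U ?K ?B (remainder z x)"
      proof (intro allI)
        fix x i
        have gz: "grad x ?\<zeta> = grad x z" using grad_scale[OF z0 R(1)] .
        have "dbounds (axis i 1) (1 / R) ?U ?K (R * A) (\<lambda>\<xi>. complex_of_real (\<phi> x \<xi> - grad x z \<bullet> \<xi>))"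
          using Ab[OF R(1) convex_cube _ \<zeta>U, of i x] Un unfolding gz by blast
        then have "dbounds (axis i 1) (1 / R) ?U ?K (R * E) (\<lambda>\<xi>. iexp (\<phi> x \<xi> - grad x z \<bullet> \<xi>) - 1)"
          by (intro E1[THEN spec, THEN spec, THEN spec, THEN spec, THEN spec, THEN mp]) (use R in auto)
        then have 1: "dbounds (axis i 1) (1 / R) ?U ?K (2 ^ ?K * (R * E) * Ca) (\<lambda>\<xi>. (iexp (\<phi> x \<xi> - grad x z \<bullet> \<xi>) - 1) * a x \<xi>)"
          using a_dbounds_low(1)[OF R] R E0 Ca by (intro dbounds_mult) auto
        have 2: "dbounds (axis i 1) (1 / R) ?U ?K (R * (4 * ?n * Ca)) (\<lambda>\<xi>. a x \<xi> - a x 0)"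
          by (rule a_dbounds_low(2)[OF R]) (use Un in blast)
        have e: "2 ^ ?K * (R * E) * Ca + R * (4 * ?n * Ca) = ?B" by (simp add: B0_def algebra_simps)
        have "dbounds (axis i 1) (1 / R) ?U ?K ?B (\<lambda>\<xi>. (iexp (\<phi> x \<xi> - grad x z \<bullet> \<xi>) - 1) * a x \<xi> + (a x \<xi> - a x 0))"
          using dbounds_add[OF 1 2] unfolding e .
        then have "dbounds (axis i 1) (1 / R) ?U ?K ?B (remainder z x)"
          by (rule dbounds_cong[OF open_cube, rotated]) (use Un in \<open>auto simp: remainder_def p_def algebra_simps\<close>)
        then show "dbounds (axis i 1) ?\<nu> ?U ?K ?B (remainder z x)" by (rule dbounds_mono) (use nu R B0 in auto)
      qed
    qed (use z0 d0 R B0 Q g remainder_joint[OF z0] remainder_measurable in auto)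
    \<comment> \<open>Side of the cube and width of the Schur weight are inverse to each other, so
      the whole gain is the square of the factor R in the amplitude.\<close>
    moreover have "C1 * ?B\<^sup>2 * ?r ^ CARD('n) * ?\<nu> ^ CARD('n) = C1 * B0\<^sup>2 * R\<^sup>2"
      using d0 R by (simp add: power_mult_distrib[symmetric] mult_ac)
    ultimately show "piece_bound (\<lambda>x \<xi>. iexp (grad x z \<bullet> \<xi>) * remainder z x \<xi>) Q g (C1 * B0\<^sup>2 * R\<^sup>2)" by simp
  qed
  then show ?thesis using C10 B0 by (intro exI[of _ "C1 * B0\<^sup>2"]) (auto simp: mult_ac)
qed

abbreviation base_estimate :: "real \<Rightarrow> bool" where
  "base_estimate C \<equiv> \<forall>z Q g. z \<noteq> 0 \<and> Q \<in> sets borel \<and> Q \<subseteq> ball 0 1 \<and>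
       square_integrable g \<longrightarrow>
       piece_bound (\<lambda>x \<xi>. iexp (grad x z \<bullet> \<xi>) * a x 0) Q g C"

text \<open>The amplitude does not depend on the frequency, so the low frequencies form a single
  piece: the cube with r = 2 and \<nu> = 1 around 0 contains the unit ball.\<close>

lemma base_piece:
  "\<exists>C>0. base_estimate C"
proof -
  let ?n = "real CARD('n)" and ?K = "2 * CARD('n)"
  obtain C1 where C10: "C1 > 0" and C1: "linear_estimate C1"
    using linear_piece by (elim exE conjE) (rule that; assumption)
  have b: "Q \<subseteq> {\<xi>. \<forall>i. \<bar>\<xi> $ i - 0 $ i\<bar> \<le> 2 / 2}" if "Q \<subseteq> ball (0 :: real^'n) 1" for Q
  proof
    fix \<xi> assume "\<xi> \<in> Q"
    then have "norm \<xi> < 1" using that by auto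
    then have "\<bar>\<xi> $ i\<bar> \<le> 1" for i using component_le_norm_cart[of \<xi> i] by linarith
    then show "\<xi> \<in> {\<xi>. \<forall>i. \<bar>\<xi> $ i - 0 $ i\<bar> \<le> 2 / 2}" by simp
  qed
  have c: "norm (a x 0) \<le> Ca" for x using a_bound_0[of 0] by simp
  show ?thesis
  proof (intro exI[of _ "C1 * Ca\<^sup>2 * 2 ^ CARD('n) * 1 ^ CARD('n)"] conjI allI impI; (elim conjE)?)
    show "0 < C1 * Ca\<^sup>2 * 2 ^ CARD('n) * 1 ^ CARD('n)" using C10 Ca by simp
    fix z :: "real^'n" and Q :: "(real^'n) set" and g :: "real^'n \<Rightarrow> complex"
    assume h: "z \<noteq> 0" "Q \<in> sets borel" "Q \<subseteq> ball 0 1" "g \<in> borel_measurable borel" "integrable lborel (\<lambda>\<xi>. (norm (g \<xi>))\<^sup>2)"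
    have "(\<lambda>(x, \<xi>). a x 0) \<in> borel_measurable (lebesgue \<Otimes>\<^sub>M (lborel :: (real^'n) measure))"
      using measurable_compose[OF measurable_fst a_meas[of 0]] by (simp add: case_prod_unfold)
    then show "piece_bound (\<lambda>x \<xi>. iexp (grad x z \<bullet> \<xi>) * a x 0) Q g (C1 * Ca\<^sup>2 * 2 ^ CARD('n) * 1 ^ CARD('n))"
      by (intro C1[THEN spec[where x=z], THEN spec[where x="\<lambda>x \<xi>. a x 0"], THEN spec[where x=1], THEN spec[where x=Ca],
            THEN spec[where x=0], THEN spec[where x=2], THEN spec[where x=Q], THEN spec[where x=g], THEN mp] conjI b)
         (use h Ca c in \<open>auto intro: dbounds_const\<close>)
  qed
qed

end

section \<open>Boundedness below the critical order\<close>

text \<open>Squared form of the triangle inequality in L^2, by Cauchy-Schwarz with the weights w; it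
  avoids square roots of extended nonnegative integrals.\<close>

lemma nn_integral_weighted_sum:
  fixes f :: "'i \<Rightarrow> 'a \<Rightarrow> complex"
  assumes I: "finite I" and f: "\<And>i. i \<in> I \<Longrightarrow> f i \<in> borel_measurable M" and w: "\<And>i. i \<in> I \<Longrightarrow> 0 < w i" and C: "0 \<le> C"
    and b: "\<And>i. i \<in> I \<Longrightarrow> L2_mass M (f i) \<le> ennreal (C * (w i)\<^sup>2) * G"
  shows "L2_mass M (\<lambda>x. \<Sum>i\<in>I. f i x) \<le> ennreal (C * (\<Sum>i\<in>I. w i)\<^sup>2) * G"
proof -
  define W where "W = (\<Sum>i\<in>I. w i)"
  have W: "W \<ge> 0" unfolding W_def using w by (intro sum_nonneg) (auto intro: less_imp_le)
  have pt: "(norm (\<Sum>i\<in>I. f i x))\<^sup>2 \<le> (\<Sum>i\<in>I. W / w i * (norm (f i x))\<^sup>2)" for x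
  proof -
    have "norm (\<Sum>i\<in>I. f i x) \<le> (\<Sum>i\<in>I. norm (f i x))" by (rule norm_sum)
    also have "\<dots> = (\<Sum>i\<in>I. sqrt (w i) * (norm (f i x) / sqrt (w i)))" using w by (intro sum.cong) (auto simp: less_imp_neq[symmetric])
    finally have "(norm (\<Sum>i\<in>I. f i x))\<^sup>2 \<le> (\<Sum>i\<in>I. sqrt (w i) * (norm (f i x) / sqrt (w i)))\<^sup>2" by (intro power_mono) auto
    also have "\<dots> \<le> (\<Sum>i\<in>I. (sqrt (w i))\<^sup>2) * (\<Sum>i\<in>I. (norm (f i x) / sqrt (w i))\<^sup>2)" by (rule Cauchy_Schwarz_ineq_sum)
    also have "(\<Sum>i\<in>I. (sqrt (w i))\<^sup>2) = W" unfolding W_def using w by (intro sum.cong) (auto simp: less_imp_le)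
    also have "W * (\<Sum>i\<in>I. (norm (f i x) / sqrt (w i))\<^sup>2) = (\<Sum>i\<in>I. W / w i * (norm (f i x))\<^sup>2)"
      unfolding sum_distrib_left using w by (intro sum.cong) (auto simp: power_divide less_imp_le)
    finally show ?thesis .
  qed
  have "L2_mass M (\<lambda>x. \<Sum>i\<in>I. f i x) \<le> (\<integral>\<^sup>+x. (\<Sum>i\<in>I. ennreal (W / w i) * ennreal ((norm (f i x))\<^sup>2)) \<partial>M)"
  proof (intro nn_integral_mono)
    fix x
    have "ennreal ((norm (\<Sum>i\<in>I. f i x))\<^sup>2) \<le> ennreal (\<Sum>i\<in>I. W / w i * (norm (f i x))\<^sup>2)" by (rule ennreal_leI[OF pt])
    also have "\<dots> = (\<Sum>i\<in>I. ennreal (W / w i * (norm (f i x))\<^sup>2))"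
      by (rule sum_ennreal[symmetric]) (use W less_imp_le[OF w] in auto)
    also have "\<dots> = (\<Sum>i\<in>I. ennreal (W / w i) * ennreal ((norm (f i x))\<^sup>2))"
      using W less_imp_le[OF w] by (intro sum.cong refl ennreal_mult) auto
    finally show "ennreal ((norm (\<Sum>i\<in>I. f i x))\<^sup>2) \<le> (\<Sum>i\<in>I. ennreal (W / w i) * ennreal ((norm (f i x))\<^sup>2))" .
  qed
  also have "\<dots> = (\<Sum>i\<in>I. ennreal (W / w i) * L2_mass M (f i))"
    using f by (subst nn_integral_sum) (auto intro!: sum.cong nn_integral_cmult)
  also have "\<dots> \<le> (\<Sum>i\<in>I. ennreal (W / w i) * (ennreal (C * (w i)\<^sup>2) * G))"
    by (intro sum_mono mult_left_mono b) auto
  also have "\<dots> = (\<Sum>i\<in>I. ennreal (W * C * w i) * G)"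
  proof (intro sum.cong refl)
    fix i assume i: "i \<in> I"
    have "ennreal (W / w i) * ennreal (C * (w i)\<^sup>2) = ennreal (W / w i * (C * (w i)\<^sup>2))"
      using W w[OF i] C by (intro ennreal_mult[symmetric]) auto
    also have "W / w i * (C * (w i)\<^sup>2) = W * C * w i" using w[OF i] by (simp add: power2_eq_square)
    finally show "ennreal (W / w i) * (ennreal (C * (w i)\<^sup>2) * G) = ennreal (W * C * w i) * G" by (simp add: mult.assoc[symmetric])
  qed
  also have "\<dots> = ennreal (\<Sum>i\<in>I. W * C * w i) * G"
    unfolding sum_distrib_right[symmetric] using W less_imp_le[OF w] C by (subst sum_ennreal) auto
  also have "(\<Sum>i\<in>I. W * C * w i) = C * W\<^sup>2" by (simp add: sum_distrib_left[symmetric] W_def power2_eq_square)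
  finally show ?thesis by (simp only: W_def)
qed

lemma sum_power_le:
  fixes q :: real assumes "0 \<le> q" "q < 1" shows "(\<Sum>j<J. q ^ j) \<le> 1 / (1 - q)"
proof -
  have "(\<Sum>j<J. q ^ j) = (1 - q ^ J) / (1 - q)" using assms by (simp add: sum_gp_strict)
  also have "\<dots> \<le> 1 / (1 - q)" using assms by (intro divide_right_mono) auto
  finally show ?thesis .
qed

text \<open>The bound does not depend on J, so the number of shells may later tend to
  infinity.\<close>

lemma nn_integral_geometric_sum:
  fixes f :: "nat \<Rightarrow> 'a \<Rightarrow> complex"
  assumes f: "\<And>j. f j \<in> borel_measurable M" and q: "0 < q" "q < 1" and C: "0 \<le> C"
    and b: "\<And>j. L2_mass M (f j) \<le> ennreal (C * (q ^ j)\<^sup>2) * G"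
  shows "L2_mass M (\<lambda>x. \<Sum>j<J. f j x) \<le> ennreal (C * (1 / (1 - q))\<^sup>2) * G"
proof -
  have "L2_mass M (\<lambda>x. \<Sum>j<J. f j x) \<le> ennreal (C * (\<Sum>j<J. q ^ j)\<^sup>2) * G"
    using q by (intro nn_integral_weighted_sum f b C) auto
  also have "\<dots> \<le> ennreal (C * (1 / (1 - q))\<^sup>2) * G"
    using q C sum_power_le[of q J]
    by (intro mult_right_mono ennreal_leI mult_left_mono power_mono) (auto intro!: sum_nonneg)
  finally show ?thesis .
qed

text \<open>On a bounded set |g| is below 1 + |g|^2. Absolute integrability on cells is what permits
  splitting the kernel and the frequency domain.\<close>

lemma set_integrable_bounded_kernel:
  fixes g :: "real^'n \<Rightarrow> complex"
  assumes k: "k \<in> borel_measurable borel" "\<And>x. norm (k x) \<le> B" and g: "g \<in> borel_measurable borel" "integrable lborel (\<lambda>x. (norm (g x))\<^sup>2)"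
    and Q: "Q \<in> sets borel" "bounded Q"
  shows "set_integrable lborel Q (\<lambda>x. k x * g x :: complex)"
proof -
  have "emeasure lborel Q < \<infinity>" using Q(2) by (rule emeasure_bounded_finite)
  then have "integrable lborel (\<lambda>x. indicator Q x :: real)" using Q by (intro integrable_real_indicator) auto
  then have "integrable lborel (\<lambda>x. B * (indicator Q x + (norm (g x))\<^sup>2))" using g by auto
  then have "integrable lborel (\<lambda>x. indicator Q x *\<^sub>R (k x * g x))"
  proof (rule Bochner_Integration.integrable_bound)
    show "(\<lambda>x. indicator Q x *\<^sub>R (k x * g x)) \<in> borel_measurable lborel" using k g Q by auto
    have B: "0 \<le> B" using k(2)[of 0] norm_ge_zero order_trans by blast
    have "norm (indicator Q x *\<^sub>R (k x * g x)) \<le> norm (B * (indicator Q x + (norm (g x))\<^sup>2))" for x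
    proof (cases "x \<in> Q")
      case True
      have "2 * norm (g x) \<le> 1 + (norm (g x))\<^sup>2" using sum_squares_bound[of 1 "norm (g x)"] by simp
      then have "norm (g x) \<le> 1 + (norm (g x))\<^sup>2" using norm_ge_zero[of "g x"] by linarith
      then have "norm (k x) * norm (g x) \<le> B * (1 + (norm (g x))\<^sup>2)" using k(2) B by (intro mult_mono) auto
      then show ?thesis using True B by (simp add: norm_mult)
    qed (use B in simp)
    then show "AE x in lborel. norm (indicator Q x *\<^sub>R (k x * g x)) \<le> norm (B * (indicator Q x + (norm (g x))\<^sup>2))" by simp
  qed
  then show ?thesis by (simp add: set_integrable_def)
qed

lemma borel_measurable_kernel_integral:
  assumes "(\<lambda>(x, \<xi>). k x \<xi>) \<in> borel_measurable (lebesgue \<Otimes>\<^sub>M lborel)" "Q \<in> sets borel" "g \<in> borel_measurable borel"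
  shows "(\<lambda>x. LINT \<xi>:Q|lborel. k x \<xi> * g \<xi> :: complex) \<in> borel_measurable lebesgue"
proof -
  note [measurable] = assms assms(1)[unfolded case_prod_unfold]
  show ?thesis unfolding set_lebesgue_integral_def
    by (rule lborel.borel_measurable_lebesgue_integral) measurable
qed

text \<open>Cell k of the shell with norm between 2^i and 2^(i+1); the selection is applied to the
  frequency rescaled to the unit annulus.\<close>

definition dyadic :: "(real^'n \<Rightarrow> nat) \<Rightarrow> int \<Rightarrow> nat \<Rightarrow> (real^'n) set" where
  "dyadic sel i k = {x. x \<noteq> 0 \<and> \<lfloor>log 2 (norm x)\<rfloor> = i \<and> sel (x /\<^sub>R 2 powr i) = k}"

lemma dyadic_measurable:
  assumes "sel \<in> measurable borel (count_space UNIV)" shows "dyadic sel i k \<in> sets borel"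
proof -
  note [measurable] = assms
  have "{x \<in> space borel. x \<noteq> 0 \<and> \<lfloor>log 2 (norm x)\<rfloor> = i \<and> sel (x /\<^sub>R 2 powr i) = k} \<in> sets borel"
    by measurable
  then show ?thesis by (simp add: dyadic_def)
qed

lemma dyadic_norm:
  assumes "x \<noteq> 0" "\<lfloor>log 2 (norm x)\<rfloor> = i"
  shows "2 powr i \<le> norm x" "norm x < 2 * 2 powr i"
proof -
  have n: "0 < norm x" using assms by simp
  have "real_of_int i \<le> log 2 (norm x)" "log 2 (norm x) < real_of_int i + 1" using assms(2) by linarith+
  then show "2 powr i \<le> norm x" "norm x < 2 * 2 powr i"
    using n by (auto simp: le_log_iff log_less_iff powr_add)
qed

lemma dyadic_bounded: "bounded (dyadic sel i k)"
  by (rule boundedI[of _ "2 * 2 powr i"]) (auto simp: dyadic_def dest!: dyadic_norm intro: less_imp_le)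

context fio_setup
begin

lemma kernel_bounds:
  "norm (iexp (p x \<xi>) * a x \<xi>) \<le> Ca" "norm (iexp (grad x z \<bullet> \<xi>) * remainder z x \<xi>) \<le> 2 * Ca" "norm (iexp (grad x z \<bullet> \<xi>) * a x 0) \<le> Ca"
proof -
  have a: "norm (a x \<xi>) \<le> Ca" for \<xi> using a_bound_0[of 0] by simp
  show "norm (iexp (p x \<xi>) * a x \<xi>) \<le> Ca" "norm (iexp (grad x z \<bullet> \<xi>) * a x 0) \<le> Ca" using a by (simp_all add: norm_mult)
  have "norm (remainder z x \<xi>) \<le> norm (iexp (p x \<xi> - grad x z \<bullet> \<xi>) * a x \<xi>) + norm (a x 0)"
    unfolding remainder_def by (rule norm_triangle_ineq4)
  also have "\<dots> \<le> Ca + Ca" using a[of \<xi>] a[of 0] by (simp add: norm_mult del: of_real_diff)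
  finally show "norm (iexp (grad x z \<bullet> \<xi>) * remainder z x \<xi>) \<le> 2 * Ca" by (simp add: norm_mult)
qed

lemma kernel_split: "iexp (p x \<xi>) * a x \<xi> = iexp (grad x z \<bullet> \<xi>) * remainder z x \<xi> + iexp (grad x z \<bullet> \<xi>) * a x 0"
proof -
  have "iexp (grad x z \<bullet> \<xi>) * iexp (p x \<xi> - grad x z \<bullet> \<xi>) = iexp (p x \<xi>)" by (simp add: exp_add[symmetric] algebra_simps)
  then have "iexp (p x \<xi>) * a x \<xi> = iexp (grad x z \<bullet> \<xi>) * (iexp (p x \<xi> - grad x z \<bullet> \<xi>) * a x \<xi>)" by (simp only: mult.assoc[symmetric])
  then show ?thesis by (simp only: remainder_def) (simp add: algebra_simps del: of_real_diff)
qed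

lemma kernel_joint:
  "(\<lambda>(x, \<xi>). iexp (p x \<xi>) * a x \<xi>) \<in> borel_measurable (lebesgue \<Otimes>\<^sub>M lborel)"
  "z \<noteq> 0 \<Longrightarrow> (\<lambda>(x, \<xi>). iexp (grad x z \<bullet> \<xi>) * remainder z x \<xi>) \<in> borel_measurable (lebesgue \<Otimes>\<^sub>M lborel)"
  "z \<noteq> 0 \<Longrightarrow> (\<lambda>(x, \<xi>). iexp (grad x z \<bullet> \<xi>) * a x 0) \<in> borel_measurable (lebesgue \<Otimes>\<^sub>M lborel)"
proof -
  note [measurable] = a_joint[unfolded case_prod_unfold] p_joint[unfolded case_prod_unfold]
  show "(\<lambda>(x, \<xi>). iexp (p x \<xi>) * a x \<xi>) \<in> borel_measurable (lebesgue \<Otimes>\<^sub>M lborel)" unfolding case_prod_unfold by measurable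
  assume z: "z \<noteq> 0"
  note [measurable] = grad_inner_joint[OF z, unfolded case_prod_unfold] remainder_joint[OF z, unfolded case_prod_unfold]
  show "(\<lambda>(x, \<xi>). iexp (grad x z \<bullet> \<xi>) * remainder z x \<xi>) \<in> borel_measurable (lebesgue \<Otimes>\<^sub>M lborel)" unfolding case_prod_unfold by measurable
  have [measurable]: "(\<lambda>q. a (fst q) 0) \<in> borel_measurable (lebesgue \<Otimes>\<^sub>M (lborel :: (real^'n) measure))"
    by (rule measurable_compose[OF measurable_fst a_meas])
  show "(\<lambda>(x, \<xi>). iexp (grad x z \<bullet> \<xi>) * a x 0) \<in> borel_measurable (lebesgue \<Otimes>\<^sub>M lborel)" unfolding case_prod_unfold by measurable
qed

lemma piece_bound_set: "piece_bound k Q g C \<longleftrightarrow> L2_mass lebesgue (\<lambda>x. LINT \<xi>:Q|lborel. k x \<xi> * g \<xi>)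
     \<le> ennreal C * L2_mass lborel g"
proof -
  have "k x \<xi> * (indicator Q \<xi> * g \<xi>) = indicator Q \<xi> *\<^sub>R (k x \<xi> * g \<xi>)" for x \<xi> by (simp add: indicator_def)
  then show ?thesis by (simp add: piece_bound_def set_lebesgue_integral_def)
qed

lemma truncated_bound:
  "\<exists>C\<ge>0. \<forall>g. square_integrable g \<longrightarrow>
     (\<forall>J. piece_bound (\<lambda>x \<xi>. iexp (p x \<xi>) * a x \<xi>) {\<xi>. \<xi> \<noteq> 0 \<and> - int J \<le> \<lfloor>log 2 (norm \<xi>)\<rfloor> \<and> \<lfloor>log 2 (norm \<xi>)\<rfloor> < int J} g C)"
proof -
  obtain d0 where d0: "0 < d0" "d0 \<le> 1" "d0 * real CARD('n) * 2 \<le> 1 / 4"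
    and high0: "\<exists>C>0. high_estimate d0 C"
    by (rule high_piece)
  obtain C1 where C1: "C1 > 0" and high: "high_estimate d0 C1"
    using high0 by (elim exE conjE) (rule that; assumption)
  obtain C2 where C2: "C2 > 0" and low: "low_estimate d0 C2"
    using low_piece[OF d0] by (elim exE conjE) (rule that; assumption)
  obtain C3 where C3: "C3 > 0" and base: "base_estimate C3"
    using base_piece by (elim exE conjE) (rule that; assumption)
  have "d0 / 2 > 0" using d0 by simp
  then obtain z :: "nat \<Rightarrow> real^'n" and N :: nat and sel where
    z: "\<And>k. k < N \<Longrightarrow> 1 \<le> norm (z k) \<and> norm (z k) \<le> 2" and sel: "sel \<in> measurable borel (count_space UNIV)"
    and selN: "\<And>\<eta>. 1 \<le> norm \<eta> \<Longrightarrow> norm \<eta> \<le> 2 \<Longrightarrow> sel \<eta> < N"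
    and selz: "\<And>\<eta> i. 1 \<le> norm \<eta> \<Longrightarrow> norm \<eta> \<le> 2 \<Longrightarrow> \<bar>\<eta> $ i - z (sel \<eta>) $ i\<bar> \<le> d0 / 2"
    using annulus_selection[of "d0 / 2"] by metis
  define e where "e = 2 * m + real CARD('n) - real CARD('n) * \<rho>"
  have e: "e < 0" using m by (simp add: e_def field_simps)
  \<comment> \<open>The squared norm on a shell of radius R is of size R^e, with e < 0 exactly below
    the critical order; half of e governs the norm itself and hence the ratio of the geometric
    series.\<close>
  define q where "q = 2 powr (e / 2)"
  have q: "0 < q" "q < 1" using e by (auto simp: q_def powr_less_one)
  let ?D = "dyadic sel"
  have scaled: "1 \<le> norm (\<xi> /\<^sub>R 2 powr i)" "norm (\<xi> /\<^sub>R 2 powr i) \<le> 2" if "\<xi> \<noteq> 0" "\<lfloor>log 2 (norm \<xi>)\<rfloor> = i" for \<xi> i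
    using dyadic_norm[OF that] by (simp_all add: field_simps)
  have Dm: "?D i k \<in> sets borel" for i k by (rule dyadic_measurable[OF sel])
  have Dsub: "?D i k \<subseteq> closed_cube (2 powr i *\<^sub>R z k) (d0 * 2 powr i)" for i k
  proof (intro subsetI CollectI allI)
    fix \<xi> j assume "\<xi> \<in> ?D i k"
    then have \<xi>: "\<xi> \<noteq> 0" "\<lfloor>log 2 (norm \<xi>)\<rfloor> = i" "sel (\<xi> /\<^sub>R 2 powr i) = k" by (auto simp: dyadic_def)
    have "\<bar>(\<xi> /\<^sub>R 2 powr i) $ j - z k $ j\<bar> \<le> d0 / 2" using selz[OF scaled[OF \<xi>(1,2)], of j] \<xi>(3) by simp
    then have "2 powr i * \<bar>(\<xi> /\<^sub>R 2 powr i) $ j - z k $ j\<bar> \<le> 2 powr i * (d0 / 2)" by (intro mult_left_mono) auto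
    also have "2 powr i * \<bar>(\<xi> /\<^sub>R 2 powr i) $ j - z k $ j\<bar> = \<bar>2 powr i * ((\<xi> /\<^sub>R 2 powr i) $ j - z k $ j)\<bar>" by (simp add: abs_mult)
    also have "2 powr i * ((\<xi> /\<^sub>R 2 powr i) $ j - z k $ j) = \<xi> $ j - (2 powr i *\<^sub>R z k) $ j" by (simp add: field_simps)
    finally show "\<bar>\<xi> $ j - (2 powr i *\<^sub>R z k) $ j\<bar> \<le> d0 * 2 powr i / 2" by (simp add: mult_ac)
  qed
  define C0 where "C0 = C1 * (1 / (1 - q))\<^sup>2 + C2 * (1 / (1 - 1 / 2))\<^sup>2 + C3"
  have C0: "C0 > 0" unfolding C0_def using C1 C2 C3 by (intro add_nonneg_pos) auto
  have C0le: "C1 * (1 / (1 - q))\<^sup>2 \<le> C0" "C2 * (1 / (1 - 1 / 2))\<^sup>2 \<le> C0" "C3 \<le> C0" 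
    unfolding C0_def using C1 C2 C3 by (auto intro!: add_nonneg_nonneg)
  show ?thesis
  proof (intro exI[of _ "C0 * (real (3 * N))\<^sup>2"] conjI allI impI; (elim conjE)?)
    show "0 \<le> C0 * (real (3 * N))\<^sup>2" using C0 by simp
    fix g :: "real^'n \<Rightarrow> complex" and J :: nat
    assume g: "g \<in> borel_measurable borel" "integrable lborel (\<lambda>\<xi>. (norm (g \<xi>))\<^sup>2)"
    define G where "G = L2_mass lborel g"
    define K where "K x \<xi> = iexp (p x \<xi>) * a x \<xi>" for x \<xi>
    define Kr where "Kr k x \<xi> = iexp (grad x (z k) \<bullet> \<xi>) * remainder (z k) x \<xi>" for k x \<xi>
    define Kb where "Kb k x \<xi> = iexp (grad x (z k) \<bullet> \<xi>) * a x 0" for k x \<xi>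
    let ?op = "\<lambda>k Q x. LINT \<xi>:Q|lborel. k x \<xi> * g \<xi>"
    define L where "L k = (\<Union>j<J. ?D (- int j - 1) k)" for k
    define F where "F = (\<lambda>(s::nat, k) x. if s = 0 then \<Sum>j<J. ?op K (?D (int j) k) x
       else if s = 1 then \<Sum>j<J. ?op (Kr k) (?D (- int j - 1) k) x else ?op (Kb k) (L k) x)"
    have zk: "z k \<noteq> 0" if "k < N" for k using z[OF that] by auto
    have meas: "K x \<in> borel_measurable borel" "Kr k x \<in> borel_measurable borel" "Kb k x \<in> borel_measurable borel" for k x
      unfolding K_def Kr_def Kb_def by measurable
    have Lm: "L k \<in> sets borel" for k unfolding L_def using Dm by auto
    have Lball: "L k \<subseteq> ball 0 1" for k
    proof
      fix \<xi> assume "\<xi> \<in> L k"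
      then obtain j where "\<xi> \<noteq> 0" "\<lfloor>log 2 (norm \<xi>)\<rfloor> = - int j - 1" by (auto simp: L_def dyadic_def)
      from dyadic_norm(2)[OF this] have "norm \<xi> < 2 * 2 powr (- int j - 1)" by simp
      also have "2 * 2 powr (- int j - 1) = 2 powr (1 + (- real j - 1))" by (subst powr_add) simp
      also have "\<dots> \<le> 2 powr 0" by (intro powr_mono) auto
      finally show "\<xi> \<in> ball 0 1" by simp
    qed
    have opm: "?op K Q \<in> borel_measurable lebesgue" "k < N \<Longrightarrow> ?op (Kr k) Q \<in> borel_measurable lebesgue" "k < N \<Longrightarrow> ?op (Kb k) Q \<in> borel_measurable lebesgue"
      if "Q \<in> sets borel" for Q k
      unfolding K_def Kr_def Kb_def
      by (rule borel_measurable_kernel_integral[OF kernel_joint(1) that g(1)]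
               borel_measurable_kernel_integral[OF kernel_joint(2)[OF zk] that g(1)]
               borel_measurable_kernel_integral[OF kernel_joint(3)[OF zk] that g(1)]; assumption?)+
    have inted: "set_integrable lborel Q (\<lambda>\<xi>. K x \<xi> * g \<xi>)" "set_integrable lborel Q (\<lambda>\<xi>. Kr k x \<xi> * g \<xi>)" "set_integrable lborel Q (\<lambda>\<xi>. Kb k x \<xi> * g \<xi>)"
      if "Q \<in> sets borel" "bounded Q" for Q k x
      by (rule set_integrable_bounded_kernel[OF meas(1) _ g that, where B=Ca], simp only: K_def kernel_bounds)
         (rule set_integrable_bounded_kernel[OF meas(2) _ g that, where B="2 * Ca"], simp only: Kr_def kernel_bounds,
          rule set_integrable_bounded_kernel[OF meas(3) _ g that, where B=Ca], simp only: Kb_def kernel_bounds)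
    have Fm: "F s \<in> borel_measurable lebesgue" if "s \<in> {..<3} \<times> {..<N}" for s
      using that opm Dm Lm unfolding F_def by (auto intro!: borel_measurable_sum)
    have Fb: "L2_mass lebesgue (F s) \<le> ennreal (C0 * 1\<^sup>2) * G" if s: "s \<in> {..<3} \<times> {..<N}" for s
    proof -
      obtain t k where tk: "s = (t, k)" "t < 3" "k < N" using s by auto
      note zz = z[OF tk(3)]
      have up: "ennreal c * G \<le> ennreal (C0 * 1\<^sup>2) * G" if "c \<le> C0" for c using that by (intro mult_right_mono ennreal_leI) auto
      consider "t = 0" | "t = 1" | "t = 2" using tk(2) by linarith
      then show ?thesis
      proof cases
        case 1
        have "L2_mass lebesgue (\<lambda>x. \<Sum>j<J. ?op K (?D (int j) k) x) \<le> ennreal (C1 * (1 / (1 - q))\<^sup>2) * G"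
        proof (rule nn_integral_geometric_sum)
          fix j
          have "piece_bound K (?D (int j) k) g (C1 * (2 powr real_of_int (int j)) powr (2 * m + real CARD('n) - real CARD('n) * \<rho>))"
            unfolding K_def
            by (rule high[THEN spec, THEN spec, THEN spec, THEN spec, THEN mp]) (use zz Dm Dsub[of "int j" k] g in \<open>auto intro!: ge_one_powr_ge_zero\<close>)
          moreover have "(2 powr real_of_int (int j)) powr (2 * m + real CARD('n) - real CARD('n) * \<rho>) = (q ^ j)\<^sup>2"
          proof -
            have "(q ^ j)\<^sup>2 = q powr real (j * 2)" using q by (simp only: powr_realpow power_mult)
            also have "\<dots> = 2 powr (real j * e)" by (simp add: q_def powr_powr mult_ac)
            finally show ?thesis by (simp add: powr_powr e_def)
          qed
          ultimately show "L2_mass lebesgue (\<lambda>x. ?op K (?D (int j) k) x) \<le> ennreal (C1 * (q ^ j)\<^sup>2) * G"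
            by (simp only: piece_bound_set G_def)
        qed (use q C1 opm(1) Dm in auto)
        then show ?thesis using up[OF C0le(1)] by (simp add: F_def tk(1) 1) 
      next
        case 2
        have "L2_mass lebesgue (\<lambda>x. \<Sum>j<J. ?op (Kr k) (?D (- int j - 1) k) x) \<le> ennreal (C2 * (1 / (1 - 1 / 2))\<^sup>2) * G"
        proof (rule nn_integral_geometric_sum)
          fix j
          have R: "2 powr real_of_int (- int j - 1) = (1 / 2) ^ j / 2"
            by (simp add: powr_diff powr_minus powr_realpow field_simps)
          have h: "(1 / 2) ^ j / 2 \<le> (1 / 2 :: real) ^ j" "(1 / 2 :: real) ^ j \<le> 1" by (simp_all add: power_le_one)
          have "piece_bound (Kr k) (?D (- int j - 1) k) g (C2 * (2 powr real_of_int (- int j - 1))\<^sup>2)"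
            unfolding Kr_def
          proof (rule low[THEN spec, THEN spec, THEN spec, THEN spec, THEN mp], intro conjI)
            show "2 powr real_of_int (- int j - 1) \<le> 1" unfolding R using h by linarith
          qed (use zz Dm Dsub[of "- int j - 1" k] g in auto)
          then have "L2_mass lebesgue (\<lambda>x. ?op (Kr k) (?D (- int j - 1) k) x) \<le> ennreal (C2 * ((1 / 2) ^ j / 2)\<^sup>2) * G"
            unfolding R by (simp only: piece_bound_set G_def)
          also have "\<dots> \<le> ennreal (C2 * ((1 / 2) ^ j)\<^sup>2) * G"
            using C2 h by (intro mult_right_mono ennreal_leI mult_left_mono power_mono) auto
          finally show "L2_mass lebesgue (\<lambda>x. ?op (Kr k) (?D (- int j - 1) k) x) \<le> ennreal (C2 * ((1 / 2) ^ j)\<^sup>2) * G" .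
        qed (use C2 opm(2)[OF _ tk(3)] Dm in auto)
        from order_trans[OF this up[OF C0le(2)]] show ?thesis by (simp add: F_def tk(1) 2)
      next
        case 3
        have "piece_bound (Kb k) (L k) g C3" unfolding Kb_def
          by (rule base[THEN spec, THEN spec, THEN spec, THEN mp]) (use zk[OF tk(3)] Lm Lball g in auto)
        then have "L2_mass lebesgue (\<lambda>x. ?op (Kb k) (L k) x) \<le> ennreal C3 * G" by (simp only: piece_bound_set G_def)
        from order_trans[OF this up[OF C0le(3)]] show ?thesis by (simp add: F_def tk(1) 3)
      qed
    qed
    let ?E = "{\<xi> :: real^'n. \<xi> \<noteq> 0 \<and> - int J \<le> \<lfloor>log 2 (norm \<xi>)\<rfloor> \<and> \<lfloor>log 2 (norm \<xi>)\<rfloor> < int J}"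
    let ?I = "{- int J..<int J} \<times> {..<N}"
    have EI: "?E = (\<Union>s\<in>?I. ?D (fst s) (snd s))"
    proof (intro set_eqI iffI)
      fix \<xi> :: "real^'n" assume \<xi>: "\<xi> \<in> ?E"
      let ?s = "(\<lfloor>log 2 (norm \<xi>)\<rfloor>, sel (\<xi> /\<^sub>R 2 powr \<lfloor>log 2 (norm \<xi>)\<rfloor>))"
      have "sel (\<xi> /\<^sub>R 2 powr \<lfloor>log 2 (norm \<xi>)\<rfloor>) < N"
        by (rule selN[OF scaled(1)[OF _ refl] scaled(2)[OF _ refl]]) (use \<xi> in simp_all)
      then have "?s \<in> ?I" using \<xi> by simp
      moreover have "\<xi> \<in> ?D (fst ?s) (snd ?s)" using \<xi> by (simp add: dyadic_def)
      ultimately show "\<xi> \<in> (\<Union>s\<in>?I. ?D (fst s) (snd s))" by (rule UN_I)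
    qed (auto simp: dyadic_def)
    have disj: "disjoint_family_on (\<lambda>s. ?D (fst s) (snd s)) I" for I
      by (auto simp: disjoint_family_on_def dyadic_def)
    \<comment> \<open>Low shells are -1, -2, ..., so j = 0 stands for shell -1, and shell 0 belongs
      to the high ones.\<close>
    have ints: "{- int J..<int J} = int ` {..<J} \<union> (\<lambda>j. - int j - 1) ` {..<J}"
    proof (intro set_eqI iffI)
      fix i assume "i \<in> {- int J..<int J}"
      then show "i \<in> int ` {..<J} \<union> (\<lambda>j. - int j - 1) ` {..<J}"
      proof (cases "i \<ge> 0")
        case True
        then have "i \<in> int ` {..<J}" using \<open>i \<in> {- int J..<int J}\<close> by (intro image_eqI[of _ _ "nat i"]) auto
        then show ?thesis ..
      next
        case False
        then have "i \<in> (\<lambda>j. - int j - 1) ` {..<J}" using \<open>i \<in> {- int J..<int J}\<close> by (intro image_eqI[of _ _ "nat (- i - 1)"]) auto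
        then show ?thesis ..
      qed
    qed auto
    have sums: "(\<Sum>i\<in>{- int J..<int J}. h i) = (\<Sum>j<J. h (int j)) + (\<Sum>j<J. h (- int j - 1))" for h :: "int \<Rightarrow> complex"
      unfolding ints by (subst sum.union_disjoint) (auto simp: sum.reindex inj_on_def)
    have "?op K ?E x = (\<Sum>s\<in>{..<3} \<times> {..<N}. F s x)" for x
    proof -
      have "?op K ?E x = (\<Sum>s\<in>?I. ?op K (?D (fst s) (snd s)) x)" unfolding EI
        by (rule set_integral_finite_Union[OF _ disj]) (auto intro!: inted(1) Dm dyadic_bounded)
      also have "\<dots> = (\<Sum>i\<in>{- int J..<int J}. \<Sum>k<N. ?op K (?D i k) x)"
        by (subst sum.cartesian_product) (simp add: case_prod_unfold)
      also have "\<dots> = (\<Sum>k<N. \<Sum>i\<in>{- int J..<int J}. ?op K (?D i k) x)" by (rule sum.swap)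
      also have "\<dots> = (\<Sum>k<N. F (0, k) x + F (1, k) x + F (2, k) x)"
      proof (intro sum.cong refl)
        fix k
        have "(\<Sum>j<J. ?op K (?D (- int j - 1) k) x) = (\<Sum>j<J. ?op (Kr k) (?D (- int j - 1) k) x + ?op (Kb k) (?D (- int j - 1) k) x)"
        proof (intro sum.cong refl)
          fix j
          have "K x \<xi> * g \<xi> = Kr k x \<xi> * g \<xi> + Kb k x \<xi> * g \<xi>" for \<xi>
            using kernel_split[of x \<xi> "z k"] by (simp only: K_def Kr_def Kb_def distrib_right)
          then show "?op K (?D (- int j - 1) k) x = ?op (Kr k) (?D (- int j - 1) k) x + ?op (Kb k) (?D (- int j - 1) k) x"
            using set_integral_add(2)[OF inted(2,3)[OF Dm dyadic_bounded], of "- int j - 1" k k x k x] by simp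
        qed
        also have "\<dots> = (\<Sum>j<J. ?op (Kr k) (?D (- int j - 1) k) x) + ?op (Kb k) (L k) x"
        proof -
          have "?op (Kb k) (L k) x = (\<Sum>j<J. ?op (Kb k) (?D (- int j - 1) k) x)" unfolding L_def
            by (rule set_integral_finite_Union) (auto intro!: inted(3) Dm dyadic_bounded, auto simp: disjoint_family_on_def dyadic_def)
          then show ?thesis by (simp add: sum.distrib)
        qed
        finally show "(\<Sum>i\<in>{- int J..<int J}. ?op K (?D i k) x) = F (0, k) x + F (1, k) x + F (2, k) x"
          unfolding sums by (simp add: F_def)
      qed
      also have "\<dots> = (\<Sum>t\<in>{..<3}. \<Sum>k<N. F (t, k) x)" by (simp add: sum.distrib eval_nat_numeral)
      also have "\<dots> = (\<Sum>s\<in>{..<3} \<times> {..<N}. F s x)" by (subst sum.cartesian_product) (simp add: case_prod_unfold)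
      finally show ?thesis .
    qed
    moreover have "L2_mass lebesgue (\<lambda>x. \<Sum>s\<in>{..<3::nat} \<times> {..<N}. F s x) \<le> ennreal (C0 * (\<Sum>s\<in>{..<3::nat} \<times> {..<N}. 1)\<^sup>2) * G"
      by (rule nn_integral_weighted_sum) (use Fm Fb C0 in auto)
    ultimately show "piece_bound (\<lambda>x \<xi>. iexp (p x \<xi>) * a x \<xi>) ?E g (C0 * (real (3 * N))\<^sup>2)"
      by (simp add: piece_bound_set G_def K_def)
  qed
qed

text \<open>Fatou's lemma over growing unions of shells. Where the integrand is integrable the
  truncated integrals converge; elsewhere the full Bochner integral is 0 and the comparison is
  trivial.\<close>

lemma kernel_operator_bound:
  "\<exists>C\<ge>0. \<forall>g. square_integrable g \<longrightarrow>
     L2_mass lebesgue (\<lambda>x. LINT \<xi>|lborel. iexp (p x \<xi>) * a x \<xi> * g \<xi>)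
       \<le> ennreal C * L2_mass lborel g"
proof -
  define E where "E J = {\<xi> :: real^'n. \<xi> \<noteq> 0 \<and> - int J \<le> \<lfloor>log 2 (norm \<xi>)\<rfloor> \<and> \<lfloor>log 2 (norm \<xi>)\<rfloor> < int J}" for J
  obtain C where C: "C \<ge> 0" and tr: "\<forall>g. square_integrable g \<longrightarrow>
     (\<forall>J. piece_bound (\<lambda>x \<xi>. iexp (p x \<xi>) * a x \<xi>) (E J) g C)"
    using truncated_bound[folded E_def] by (elim exE conjE) (rule that; assumption)
  have Em: "E J \<in> sets borel" for J
  proof -
    have "{\<xi> \<in> space borel. \<xi> \<noteq> 0 \<and> - int J \<le> \<lfloor>log 2 (norm \<xi>)\<rfloor> \<and> \<lfloor>log 2 (norm \<xi>)\<rfloor> < int J} \<in> sets borel" by measurable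
    then show ?thesis by (simp add: E_def)
  qed
  have ev: "eventually (\<lambda>J. \<xi> \<in> E J) sequentially" if "\<xi> \<noteq> 0" for \<xi>
    unfolding eventually_sequentially
    by (intro exI[of _ "Suc (nat \<bar>\<lfloor>log 2 (norm \<xi>)\<rfloor>\<bar>)"]) (use that in \<open>auto simp: E_def\<close>)
  show ?thesis
  proof (intro exI[of _ C] conjI allI impI C; elim conjE)
    fix g :: "real^'n \<Rightarrow> complex"
    assume g: "g \<in> borel_measurable borel" "integrable lborel (\<lambda>\<xi>. (norm (g \<xi>))\<^sup>2)"
    note [measurable] = g(1) Em
    define f where "f x \<xi> = iexp (p x \<xi>) * a x \<xi> * g \<xi>" for x \<xi>
    have fm [measurable]: "f x \<in> borel_measurable borel" for x unfolding f_def by measurable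
    have lim: "(\<lambda>J. LINT \<xi>:E J|lborel. f x \<xi>) \<longlonglongrightarrow> (LINT \<xi>|lborel. f x \<xi>)" if "integrable lborel (f x)" for x
      unfolding set_lebesgue_integral_def
    proof (rule integral_dominated_convergence[where w="\<lambda>\<xi>. norm (f x \<xi>)"])
      have "AE \<xi> in lborel. \<xi> \<noteq> (0 :: real^'n)" by (rule AE_lborel_singleton)
      then show "AE \<xi> in lborel. (\<lambda>J. indicator (E J) \<xi> *\<^sub>R f x \<xi>) \<longlonglongrightarrow> f x \<xi>"
      proof (rule AE_mp, intro AE_I2 impI)
        fix \<xi> :: "real^'n" assume "\<xi> \<noteq> 0"
        from ev[OF this] show "(\<lambda>J. indicator (E J) \<xi> *\<^sub>R f x \<xi>) \<longlonglongrightarrow> f x \<xi>"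
          by (intro tendsto_eventually) (auto elim!: eventually_mono)
      qed
    qed (use that in \<open>auto simp: indicator_def intro!: borel_measurable_scaleR\<close>)
    have "L2_mass lebesgue (\<lambda>x. LINT \<xi>|lborel. f x \<xi>) \<le> (\<integral>\<^sup>+x. liminf (\<lambda>J. ennreal ((norm (LINT \<xi>:E J|lborel. f x \<xi>))\<^sup>2)) \<partial>lebesgue)"
    proof (intro nn_integral_mono)
      fix x
      show "ennreal ((norm (LINT \<xi>|lborel. f x \<xi>))\<^sup>2) \<le> liminf (\<lambda>J. ennreal ((norm (LINT \<xi>:E J|lborel. f x \<xi>))\<^sup>2))"
      proof (cases "integrable lborel (f x)")
        case True
        have "(\<lambda>J. ennreal ((norm (LINT \<xi>:E J|lborel. f x \<xi>))\<^sup>2)) \<longlonglongrightarrow> ennreal ((norm (LINT \<xi>|lborel. f x \<xi>))\<^sup>2)"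
          by (intro tendsto_ennrealI tendsto_power tendsto_norm lim True)
        then show ?thesis by (simp only: lim_imp_Liminf[OF sequentially_bot] order_refl)
      qed (simp add: not_integrable_integral_eq)
    qed
    also have "\<dots> \<le> liminf (\<lambda>J. \<integral>\<^sup>+x. ennreal ((norm (LINT \<xi>:E J|lborel. f x \<xi>))\<^sup>2) \<partial>lebesgue)"
    proof (rule nn_integral_liminf)
      fix J
      have [measurable]: "(\<lambda>x. LINT \<xi>:E J|lborel. f x \<xi>) \<in> borel_measurable lebesgue"
        unfolding f_def by (rule borel_measurable_kernel_integral[OF kernel_joint(1) Em g(1)])
      show "(\<lambda>x. ennreal ((norm (LINT \<xi>:E J|lborel. f x \<xi>))\<^sup>2)) \<in> borel_measurable lebesgue" by measurable
    qed
    also have "\<dots> \<le> ennreal C * L2_mass lborel g"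
    proof (rule Liminf_le[OF sequentially_bot], rule always_eventually, rule allI)
      fix J
      have "piece_bound (\<lambda>x \<xi>. iexp (p x \<xi>) * a x \<xi>) (E J) g C" by (rule tr[THEN spec, THEN mp, THEN spec]) (use g in auto)
      then show "L2_mass lebesgue (\<lambda>x. LINT \<xi>:E J|lborel. f x \<xi>) \<le> ennreal C * L2_mass lborel g"
        by (simp only: piece_bound_set f_def)
    qed
    finally show "L2_mass lebesgue (\<lambda>x. LINT \<xi>|lborel. iexp (p x \<xi>) * a x \<xi> * g \<xi>) \<le> ennreal C * L2_mass lborel g"
      by (simp only: f_def)
  qed
qed

end

section \<open>From essential bounds on the symbol to the operator on Schwartz functions\<close>

lemma in_L2_if_nn_integral_le:
  fixes F u :: "real^'n \<Rightarrow> complex"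
  assumes F: "F \<in> borel_measurable lebesgue" and u: "in_L2 u" and K: "0 \<le> K"
    and le: "L2_mass lebesgue F \<le> ennreal K * L2_mass lebesgue u"
  shows "in_L2 F \<and> L2_norm F \<le> sqrt K * L2_norm u"
proof -
  have eu: "L2_mass lebesgue u = ennreal (LINT x|lebesgue. (norm (u x))\<^sup>2)"
    using u unfolding in_L2_def by (intro nn_integral_eq_integral) auto
  have u0: "0 \<le> (LINT x|lebesgue. (norm (u x))\<^sup>2)" by simp
  have le': "L2_mass lebesgue F \<le> ennreal (K * (LINT x|lebesgue. (norm (u x))\<^sup>2))"
    using le unfolding eu by (subst ennreal_mult[OF K u0])
  have int: "integrable lebesgue (\<lambda>x. (norm (F x))\<^sup>2)"
    by (rule integrableI_bounded) (use F le' ennreal_less_top in \<open>auto intro: le_less_trans\<close>)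
  have "ennreal (LINT x|lebesgue. (norm (F x))\<^sup>2) \<le> ennreal (K * (LINT x|lebesgue. (norm (u x))\<^sup>2))"
    using le' nn_integral_eq_integral[OF int] by simp
  then have "(LINT x|lebesgue. (norm (F x))\<^sup>2) \<le> K * (LINT x|lebesgue. (norm (u x))\<^sup>2)"
    using K u0 by (simp add: ennreal_le_iff)
  then have "L2_norm F \<le> sqrt (K * (LINT x|lebesgue. (norm (u x))\<^sup>2))" unfolding L2_norm_def by (rule real_sqrt_le_mono)
  then show ?thesis using F int by (simp add: in_L2_def L2_norm_def real_sqrt_mult)
qed

lemma jbracket_pos: "0 < jbracket x"
  unfolding jbracket_def by (simp add: add_pos_nonneg)

lemma continuous_jbracket: "continuous_on S jbracket"
  unfolding jbracket_def[abs_def] by (intro continuous_intros)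

lemma continuous_funpow_pderiv:
  fixes f :: "real^'n \<Rightarrow> complex"
  shows "smooth_on UNIV f \<Longrightarrow> continuous_on UNIV ((pderiv_at i ^^ l) f)"
  unfolding pderiv_at_funpow by (rule smooth_on_continuous_on, rule smooth_on_dirderivs) auto

text \<open>The essential supremum is taken at fixed frequency, so its null set depends on \<xi> and
  on the order. A countable dense set of frequencies leaves one null set, and continuity in \<xi>
  extends the bounds to all frequencies.\<close>

lemma Linf_symbol_AE_bound:
  fixes a :: "real^'n \<Rightarrow> real^'n \<Rightarrow> complex"
  assumes a: "a \<in> Linf_symbol m \<rho>"
  shows "\<exists>C>0. AE x in lebesgue. \<forall>i l \<xi>. l \<le> K \<longrightarrow> norm ((pderiv_at i ^^ l) (a x) \<xi>) \<le> C * jbracket \<xi> powr (m - \<rho> * real l)"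
proof -
  have sm: "smooth_on UNIV (a x)" for x using a by (simp add: Linf_symbol_def)
  obtain d :: "nat \<Rightarrow> real^'n" where d: "\<And>x e. e > 0 \<Longrightarrow> \<exists>n. dist (d n) x < e" using dense_sequence by blast
  have "\<exists>c::nat. AE x in lebesgue. \<forall>\<xi>. jbracket \<xi> powr (- m + \<rho> * real l) * norm ((pderiv_at i ^^ l) (a x) \<xi>) \<le> real c" for i l
  proof -
    define S where "S = (SUP \<xi>. ereal (jbracket \<xi> powr (- m + \<rho> * real l)) * esssup lebesgue (\<lambda>x. ereal (norm ((pderiv_at i ^^ l) (a x) \<xi>))))"
    have "\<forall>\<alpha>. (SUP \<xi>. ereal (jbracket \<xi> powr (- m + \<rho> * real (mi_order \<alpha>))) *
                esssup lebesgue (\<lambda>x. ereal (norm (mderiv \<alpha> (a x) \<xi>)))) < \<infinity>" using a by (simp add: Linf_symbol_def)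
    then have "S < \<infinity>" unfolding S_def by (drule_tac spec[of _ "\<lambda>j. if j = i then l else 0"]) (simp only: mderiv_single mi_order_single)
    then obtain c :: nat where c: "S < ereal (real c)" using less_PInf_Ex_of_nat[of S] by auto
    have "AE x in lebesgue. jbracket (d n) powr (- m + \<rho> * real l) * norm ((pderiv_at i ^^ l) (a x) (d n)) \<le> real c" for n
      using esssup_AE[of "\<lambda>x. ereal (norm ((pderiv_at i ^^ l) (a x) (d n)))" lebesgue]
    proof eventually_elim
      case (elim x)
      have "ereal (jbracket (d n) powr (- m + \<rho> * real l)) * ereal (norm ((pderiv_at i ^^ l) (a x) (d n)))
        \<le> ereal (jbracket (d n) powr (- m + \<rho> * real l)) * esssup lebesgue (\<lambda>x. ereal (norm ((pderiv_at i ^^ l) (a x) (d n))))"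
        using elim by (rule ereal_mult_left_mono) simp
      also have "\<dots> \<le> S" unfolding S_def by (rule SUP_upper) simp
      also have "S \<le> ereal (real c)" using c by simp
      finally show ?case by simp
    qed
    then have "AE x in lebesgue. \<forall>n. jbracket (d n) powr (- m + \<rho> * real l) * norm ((pderiv_at i ^^ l) (a x) (d n)) \<le> real c"
      by (simp add: AE_all_countable)
    then have "AE x in lebesgue. \<forall>\<xi>. jbracket \<xi> powr (- m + \<rho> * real l) * norm ((pderiv_at i ^^ l) (a x) \<xi>) \<le> real c"
    proof eventually_elim
      case (elim x)
      let ?f = "\<lambda>\<xi>. jbracket \<xi> powr (- m + \<rho> * real l) * norm ((pderiv_at i ^^ l) (a x) \<xi>)"
      have "closed {\<xi>. ?f \<xi> \<le> real c}"
        by (intro closed_Collect_le continuous_intros continuous_jbracket continuous_funpow_pderiv sm) (simp add: less_imp_neq[OF jbracket_pos, symmetric])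
      moreover have "range d \<subseteq> {\<xi>. ?f \<xi> \<le> real c}" using elim by auto
      ultimately have "closure (range d) \<subseteq> {\<xi>. ?f \<xi> \<le> real c}" by (rule closure_minimal[rotated])
      moreover have "closure (range d) = UNIV" using d by (auto simp: closure_approachable)
      ultimately show ?case by auto
    qed
    then show ?thesis ..
  qed
  then have "\<forall>q. \<exists>c::nat. AE x in lebesgue. \<forall>\<xi>. jbracket \<xi> powr (- m + \<rho> * real (snd q)) * norm ((pderiv_at (fst q) ^^ (snd q)) (a x) \<xi>) \<le> real c" by blast
  then obtain c :: "'n \<times> nat \<Rightarrow> nat" where
    c: "\<forall>q. AE x in lebesgue. \<forall>\<xi>. jbracket \<xi> powr (- m + \<rho> * real (snd q)) * norm ((pderiv_at (fst q) ^^ (snd q)) (a x) \<xi>) \<le> real (c q)"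
    by (drule_tac choice) (elim exE, rule that)
  define C where "C = 1 + (\<Sum>q\<in>UNIV \<times> {..K}. real (c q))"
  have C: "C > 0" unfolding C_def by (intro add_pos_nonneg sum_nonneg) auto
  have cle: "real (c (i, l)) \<le> C" if "l \<le> K" for i l
  proof -
    have "real (c (i, l)) \<le> (\<Sum>q\<in>UNIV \<times> {..K}. real (c q))" using that by (intro member_le_sum) auto
    then show ?thesis by (simp add: C_def)
  qed
  have "AE x in lebesgue. \<forall>q. \<forall>\<xi>. jbracket \<xi> powr (- m + \<rho> * real (snd q)) * norm ((pderiv_at (fst q) ^^ (snd q)) (a x) \<xi>) \<le> real (c q)"
    using c by (simp add: AE_all_countable)
  then have "AE x in lebesgue. \<forall>i l \<xi>. l \<le> K \<longrightarrow> norm ((pderiv_at i ^^ l) (a x) \<xi>) \<le> C * jbracket \<xi> powr (m - \<rho> * real l)"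
  proof eventually_elim
    case (elim x)
    show ?case
    proof (intro allI impI)
      fix i l \<xi> assume l: "l \<le> K"
      have "jbracket \<xi> powr (- m + \<rho> * real l) * norm ((pderiv_at i ^^ l) (a x) \<xi>) \<le> C"
        using elim[rule_format, of \<xi> "(i, l)"] cle[OF l, of i] by simp
      then have "jbracket \<xi> powr (m - \<rho> * real l) * (jbracket \<xi> powr (- m + \<rho> * real l) * norm ((pderiv_at i ^^ l) (a x) \<xi>)) \<le> jbracket \<xi> powr (m - \<rho> * real l) * C"
        by (intro mult_left_mono) auto
      moreover have "jbracket \<xi> powr (m - \<rho> * real l) * jbracket \<xi> powr (- m + \<rho> * real l) = 1"
        using jbracket_pos[of \<xi>] unfolding powr_add[symmetric] by simp
      ultimately show "norm ((pderiv_at i ^^ l) (a x) \<xi>) \<le> C * jbracket \<xi> powr (m - \<rho> * real l)"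
        by (simp only: mult.assoc[symmetric] mult_1 mult.commute[of C])
    qed
  qed
  then show ?thesis using C by blast
qed

lemma pderiv_funpow_zero: "(pderiv_at i ^^ l) (\<lambda>_. 0 :: complex) = (\<lambda>_::real^'n. 0)"
  by (induction l) (simp_all add: pderiv_at_def[abs_def])

lemma smooth_on_zero: "smooth_on S (\<lambda>_. 0 :: 'b::real_normed_vector)"
proof -
  have "Ck_on k S (\<lambda>_. 0 :: 'b)" for k by (induction k) auto
  then show ?thesis by (simp add: smooth_on_def)
qed

lemma schwartz_bounded: "u \<in> schwartz \<Longrightarrow> \<exists>B. \<forall>x. norm (u x :: complex) \<le> B"
proof -
  assume "u \<in> schwartz"
  then have "\<forall>\<alpha> \<beta>. bdd_above (range (\<lambda>x. \<bar>mpower x \<alpha>\<bar> * norm (mderiv \<beta> u x)))" by (simp add: schwartz_def)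
  then have "bdd_above (range (\<lambda>x. \<bar>mpower x (\<lambda>_. 0)\<bar> * norm (mderiv (\<lambda>_. 0) u x)))" by (elim allE)
  moreover have "mderiv (\<lambda>_. 0) u = u" 
  proof -
    have "mi_list (\<lambda>_::'a. 0) = []" by (simp add: mi_list_def)
    then show ?thesis by (simp add: mderiv_dirderivs)
  qed
  ultimately show ?thesis by (auto simp: mpower_def bdd_above_def)
qed

lemma fourier_transform_lborel:
  assumes "u \<in> borel_measurable borel"
  shows "fourier_transform u \<xi> = (LINT x|lborel. u x * iexp (-1 * (x \<bullet> \<xi>)))"
proof -
  note [measurable] = assms
  have "fourier_transform u \<xi> = (LINT x|lborel. exp (- \<i> * complex_of_real (x \<bullet> \<xi>)) * u x)"
    unfolding fourier_transform_def by (rule integral_completion) measurable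
  then show ?thesis by (simp add: mult.commute)
qed

theorem L2_bounded_FIO:
  fixes a :: "real^'n \<Rightarrow> real^'n \<Rightarrow> complex"
  assumes \<rho>: "0 \<le> \<rho>" "\<rho> \<le> 1" and a: "a \<in> Linf_symbol m \<rho>" and \<phi>: "\<phi> \<in> phase_class 2" "strongly_nondegenerate \<phi>"
    and m: "m < real CARD('n) / 2 * (\<rho> - 1)"
  shows "L2_bounded (FIO a \<phi>)"
proof -
  have sm: "smooth_on UNIV (a x)" and am: "(\<lambda>x. a x \<xi>) \<in> borel_measurable lebesgue" for x \<xi>
    using a by (simp_all add: Linf_symbol_def)
  obtain Ca where Ca: "Ca > 0" and AE: "AE x in lebesgue. \<forall>i l \<xi>. l \<le> 2 * CARD('n) \<longrightarrow> norm ((pderiv_at i ^^ l) (a x) \<xi>) \<le> Ca * jbracket \<xi> powr (m - \<rho> * real l)"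
    using Linf_symbol_AE_bound[OF a] by blast
  obtain N where N: "N \<in> null_sets lebesgue" and Nb: "\<And>x. x \<notin> N \<Longrightarrow> \<forall>i l \<xi>. l \<le> 2 * CARD('n) \<longrightarrow> norm ((pderiv_at i ^^ l) (a x) \<xi>) \<le> Ca * jbracket \<xi> powr (m - \<rho> * real l)"
    using AE by (rule AE_E3) (rule that, auto)
  \<comment> \<open>Setting the symbol to 0 on the exceptional null set makes its bounds hold at
    every x and changes the operator only on that set.\<close>
  define b where "b x \<xi> = (if x \<in> N then 0 else a x \<xi>)" for x \<xi>
  have bx: "b x = (if x \<in> N then (\<lambda>_. 0) else a x)" for x by (auto simp: b_def)
  interpret fio_setup \<phi> b m \<rho> Ca
  proof (intro fio_setup.intro phase.intro fio_setup_axioms.intro)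
    show "smooth_on UNIV (b x)" for x by (simp add: bx sm smooth_on_zero)
    have "N \<in> sets lebesgue" using N by auto
    then show "(\<lambda>x. b x \<xi>) \<in> borel_measurable lebesgue" for \<xi> unfolding b_def using am
      by (intro measurable_If) auto
    show "norm ((pderiv_at i ^^ l) (b x) \<xi>) \<le> Ca * jbracket \<xi> powr (m - \<rho> * real l)" if "l \<le> 2 * CARD('n)" for x i l \<xi>
      using Nb[of x] that Ca by (auto simp: bx pderiv_funpow_zero)
  qed (use Ca \<rho> m \<phi> in auto)
  obtain C where C: "C \<ge> 0" and bound: "\<forall>g. square_integrable g \<longrightarrow>
     L2_mass lebesgue (\<lambda>x. LINT \<xi>|lborel. iexp (p x \<xi>) * b x \<xi> * g \<xi>)
       \<le> ennreal C * L2_mass lborel g"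
    using kernel_operator_bound by (elim exE conjE) (rule that; assumption)
  define c0 where "c0 = 1 / (2 * pi) ^ CARD('n)"
  have c0: "c0 \<ge> 0" by (simp add: c0_def)
  \<comment> \<open>Square of the normalizing factor, squared norm of the kernel operator, and
    Plancherel's constant.\<close>
  define K where "K = c0\<^sup>2 * C * (2 * pi) ^ CARD('n)"
  have K: "K \<ge> 0" using C by (simp add: K_def)
  have "in_L2 (FIO a \<phi> u) \<and> L2_norm (FIO a \<phi> u) \<le> sqrt K * L2_norm u" if u: "u \<in> schwartz" for u
  proof -
    define U where "U = fourier_transform u"
    have um [measurable]: "u \<in> borel_measurable borel"
      using u by (intro borel_measurable_continuous_onI smooth_on_continuous_on) (simp add: schwartz_def)
    have U: "U = (\<lambda>\<xi>. LINT x|lborel. u x * iexp (-1 * (x \<bullet> \<xi>)))"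
      unfolding U_def by (rule ext) (rule fourier_transform_lborel[OF um])
    show ?thesis
    proof (cases "integrable lborel u")
      \<comment> \<open>Instead of deriving integrability from Schwartz decay, the other case is
        dismissed: every Fourier integral of u would then be 0 by convention, and so would its
        image.\<close>
      case False
      have "\<not> integrable lborel (\<lambda>x. u x * iexp (-1 * (x \<bullet> \<xi>)))" for \<xi>
      proof
        assume "integrable lborel (\<lambda>x. u x * iexp (-1 * (x \<bullet> \<xi>)))"
        then have "integrable lborel u"
          by (rule Bochner_Integration.integrable_bound) (auto simp: norm_mult)
        with False show False by simp
      qed
      then have "U = (\<lambda>_. 0)" unfolding U by (simp add: not_integrable_integral_eq del: of_real_mult)
      then have "FIO a \<phi> u = (\<lambda>_. 0)" by (simp add: FIO_def[abs_def] U_def)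
      then show ?thesis using K by (simp add: in_L2_def L2_norm_def)
    next
      case True
      obtain B where B: "\<And>x. norm (u x) \<le> B" using schwartz_bounded[OF u] by blast
      have u2: "integrable lborel (\<lambda>x. (norm (u x))\<^sup>2)"
      proof (rule Bochner_Integration.integrable_bound[where f="\<lambda>x. B * norm (u x)"])
        show "AE x in lborel. norm ((norm (u x))\<^sup>2) \<le> norm (B * norm (u x))"
          using B by (intro AE_I2) (auto simp: power2_eq_square abs_mult intro!: mult_right_mono order_trans[OF B])
      qed (use True in auto)
      have uL2: "in_L2 u" unfolding in_L2_def using measurable_completion[of u lborel borel] um u2 by (auto intro: integrable_completion[THEN iffD2])
      have "U \<in> borel_measurable lborel" unfolding U
        by (rule lborel.borel_measurable_lebesgue_integral) measurable
      then have Um [measurable]: "U \<in> borel_measurable borel" by simp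
      have Upl: "L2_mass lborel U \<le> ennreal ((2 * pi) ^ CARD('n)) * L2_mass lborel u"
        unfolding U by (rule plancherel_le[OF True]) simp
      also have "\<dots> < \<infinity>" using u2 by (simp add: nn_integral_eq_integral ennreal_mult_less_top)
      finally have U2: "integrable lborel (\<lambda>\<xi>. (norm (U \<xi>))\<^sup>2)" by (intro integrableI_bounded) auto
      have F: "FIO a \<phi> u x = complex_of_real c0 * (LINT \<xi>|lborel. iexp (p x \<xi>) * a x \<xi> * U \<xi>)" for x
      proof -
        have [measurable]: "a x \<in> borel_measurable borel" by (rule borel_measurable_continuous_onI[OF smooth_on_continuous_on[OF sm]])
        have "\<phi> x = (\<lambda>\<xi>. if \<xi> = 0 then \<phi> x 0 else p x \<xi>)" by (auto simp: p_def)
        moreover have "(\<lambda>\<xi>. if \<xi> = 0 then \<phi> x 0 else p x \<xi>) \<in> borel_measurable borel" by measurable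
        ultimately have [measurable]: "\<phi> x \<in> borel_measurable borel" by simp
        have "(LINT \<xi>|lebesgue. a x \<xi> * exp (\<i> * complex_of_real (\<phi> x \<xi>)) * U \<xi>) = (LINT \<xi>|lborel. a x \<xi> * exp (\<i> * complex_of_real (\<phi> x \<xi>)) * U \<xi>)"
          by (rule integral_completion) measurable
        also have "\<dots> = (LINT \<xi>|lborel. iexp (p x \<xi>) * a x \<xi> * U \<xi>)"
        proof (rule integral_cong_AE)
          have "AE \<xi> in lborel. \<xi> \<noteq> (0 :: real^'n)" by (rule AE_lborel_singleton)
          then show "AE \<xi> in lborel. a x \<xi> * exp (\<i> * complex_of_real (\<phi> x \<xi>)) * U \<xi> = iexp (p x \<xi>) * a x \<xi> * U \<xi>"
            by eventually_elim (simp add: p_def)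
        qed measurable
        finally show ?thesis by (simp add: FIO_def U_def c0_def)
      qed
      have Tm: "FIO a \<phi> u \<in> borel_measurable lebesgue"
      proof -
        note [measurable] = Caratheodory_measurable[OF am smooth_on_continuous_on[OF sm], unfolded case_prod_unfold] p_joint[unfolded case_prod_unfold]
        have "(\<lambda>x. LINT \<xi>|lborel. iexp (p x \<xi>) * a x \<xi> * U \<xi>) \<in> borel_measurable lebesgue"
          by (rule lborel.borel_measurable_lebesgue_integral) (unfold case_prod_unfold, measurable)
        then show ?thesis unfolding F[abs_def] by measurable
      qed
      have "AE x in lebesgue. x \<notin> N" using N by (rule AE_not_in)
      then have "L2_mass lebesgue (FIO a \<phi> u)
        = (\<integral>\<^sup>+x. ennreal (c0\<^sup>2) * ennreal ((norm (LINT \<xi>|lborel. iexp (p x \<xi>) * b x \<xi> * U \<xi>))\<^sup>2) \<partial>lebesgue)"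
        by (intro nn_integral_cong_AE, eventually_elim) (simp add: F b_def norm_mult power_mult_distrib ennreal_mult)
      also have "\<dots> = ennreal (c0\<^sup>2) * L2_mass lebesgue (\<lambda>x. LINT \<xi>|lborel. iexp (p x \<xi>) * b x \<xi> * U \<xi>)"
      proof (rule nn_integral_cmult)
        note [measurable] = kernel_joint(1)[unfolded case_prod_unfold]
        have [measurable]: "(\<lambda>x. LINT \<xi>|lborel. iexp (p x \<xi>) * b x \<xi> * U \<xi>) \<in> borel_measurable lebesgue"
          by (rule lborel.borel_measurable_lebesgue_integral) (unfold case_prod_unfold, measurable)
        show "(\<lambda>x. ennreal ((norm (LINT \<xi>|lborel. iexp (p x \<xi>) * b x \<xi> * U \<xi>))\<^sup>2)) \<in> borel_measurable lebesgue" by measurable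
      qed
      also have "\<dots> \<le> ennreal (c0\<^sup>2) * (ennreal C * (ennreal ((2 * pi) ^ CARD('n)) * L2_mass lborel u))"
        by (intro mult_left_mono order_trans[OF bound[THEN spec, THEN mp] mult_left_mono[OF Upl]]) (use Um U2 in auto)
      also have "\<dots> = ennreal K * L2_mass lebesgue u"
      proof -
        have "L2_mass lebesgue u = L2_mass lborel u" by (rule nn_integral_completion)
        then show ?thesis using C by (simp add: K_def ennreal_mult mult.assoc)
      qed
      finally show ?thesis by (intro in_L2_if_nn_integral_le Tm uL2 K)
    qed
  qed
  then show ?thesis unfolding L2_bounded_def by blast
qed

section \<open>The phase of the Fourier inversion formula\<close>

lemma frechet_derivative_eq: "(f has_derivative f') (at x) \<Longrightarrow> frechet_derivative f (at x) = f'"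
  by (rule frechet_derivative_at[symmetric])

lemma Ck_on_const: "Ck_on k S (\<lambda>_. c)"
  by (induction k arbitrary: c) (simp_all add: frechet_derivative_eq[OF has_derivative_const])

lemma Ck_on_bounded_linear:
  assumes f: "bounded_linear f" shows "Ck_on k S f"
proof (cases k)
  case (Suc k')
  have d: "(f has_derivative f) (at x)" for x by (rule bounded_linear_imp_has_derivative[OF f])
  then show ?thesis by (auto simp: Suc differentiable_def frechet_derivative_eq[OF d] Ck_on_const)
qed (simp add: linear_continuous_on[OF f])

lemma smooth_on_inner: "smooth_on S (\<lambda>(x, \<xi>). x \<bullet> (\<xi> :: real^'n))"
proof -
  have d: "((\<lambda>(x, \<xi>). x \<bullet> (\<xi> :: real^'n)) has_derivative (\<lambda>h. fst q \<bullet> snd h + fst h \<bullet> snd q)) (at q)" for q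
    unfolding case_prod_unfold by (auto intro!: derivative_eq_intros)
  have "Ck_on k S (\<lambda>(x, \<xi>). x \<bullet> (\<xi> :: real^'n))" for k
  proof (cases k)
    case 0
    then show ?thesis by (auto simp: case_prod_unfold intro!: continuous_intros)
  next
    case (Suc k')
    have "Ck_on k' S (\<lambda>q. fst q \<bullet> snd b + fst b \<bullet> snd (q :: (real^'n) \<times> (real^'n)))" for b
      by (intro Ck_on_bounded_linear bounded_linear_add)
        (auto intro: bounded_linear_compose[OF bounded_linear_inner_left bounded_linear_fst] bounded_linear_compose[OF bounded_linear_inner_right bounded_linear_snd])
    then show ?thesis by (auto simp: Suc frechet_derivative_eq[OF d] intro: differentiableI[OF d])
  qed
  then show ?thesis by (simp add: smooth_on_def)
qed

lemma dirderivs_bounded_linear: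
  assumes f: "bounded_linear f"
  shows "dirderivs (v # vs) f = (\<lambda>_. if vs = [] then f v else 0)"
proof (induction vs arbitrary: v)
  case Nil
  show ?case by (simp add: frechet_derivative_eq[OF bounded_linear_imp_has_derivative[OF f]])
next
  case (Cons w ws)
  have "dirderivs (v # w # ws) f = (\<lambda>x. frechet_derivative (dirderivs (w # ws) f) (at x) v)" by simp
  then show ?case unfolding Cons by (simp add: frechet_derivative_eq[OF has_derivative_const])
qed

text \<open>By bilinearity a derivative of order at least two vanishes unless it takes one
  derivative in each variable; then it is 0 or 1, with weight |\<xi>|^0. So the bound 1 serves all
  orders.\<close>

lemma inner_mem_phase_class: "(\<lambda>x \<xi> :: real^'n. x \<bullet> \<xi>) \<in> phase_class 2"
  unfolding phase_class_def mem_Collect_eq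
proof (intro conjI allI impI)
  show "smooth_on (UNIV \<times> - {0}) (\<lambda>(x, \<xi> :: real^'n). x \<bullet> \<xi>)" by (rule smooth_on_inner)
  fix \<alpha> \<beta> :: "'n multi_index" assume ab: "2 \<le> mi_order \<alpha> + mi_order \<beta>"
  let ?ax = "\<lambda>i. axis i 1 :: real^'n"
  have zero: "dirderivs vs (\<lambda>_ :: real^'n. 0 :: real) = (\<lambda>_. 0)" for vs
    by (cases vs) (simp_all add: dirderivs_bounded_linear[OF bounded_linear_zero] del: dirderivs.simps(2))
  have len: "2 \<le> length (mi_list \<alpha>) + length (mi_list \<beta>)" using ab by (simp add: length_mi_list)
  have "norm \<xi> powr (- 1 + real (mi_order \<alpha>)) * \<bar>mderiv \<alpha> (\<lambda>\<eta>. mderiv \<beta> (\<lambda>y. y \<bullet> \<eta>) x) \<xi>\<bar> \<le> 1" if \<xi>: "\<xi> \<noteq> 0" for x \<xi> :: "real^'n"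
  proof (cases "mi_list \<beta>")
    case Nil
    then obtain i cs where cs: "mi_list \<alpha> = i # cs" "cs \<noteq> []"
      using len by (cases "mi_list \<alpha>") (auto simp: Suc_le_length_iff)
    have "mderiv \<beta> (\<lambda>y. y \<bullet> \<eta>) x = x \<bullet> \<eta>" for \<eta> using Nil by (simp add: mderiv_dirderivs)
    then show ?thesis using cs
      by (simp add: mderiv_dirderivs dirderivs_bounded_linear[OF bounded_linear_inner_right] del: dirderivs.simps(2))
  next
    case (Cons i cs)
    have d: "mderiv \<beta> (\<lambda>y. y \<bullet> \<eta>) x = (if cs = [] then ?ax i \<bullet> \<eta> else 0)" for \<eta>
      using Cons by (simp add: mderiv_dirderivs dirderivs_bounded_linear[OF bounded_linear_inner_left] del: dirderivs.simps(2))
    show ?thesis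
    proof (cases "cs = []")
      case True
      then obtain j js where js: "mi_list \<alpha> = j # js" using len Cons by (cases "mi_list \<alpha>") auto
      have o: "mi_order \<alpha> = Suc (length js)" by (simp add: length_mi_list[symmetric] js)
      show ?thesis unfolding d using True js o \<xi>
        by (simp add: mderiv_dirderivs dirderivs_bounded_linear[OF bounded_linear_inner_right] inner_axis_axis del: dirderivs.simps(2))
    next
      case False
      then show ?thesis unfolding d by (simp add: mderiv_dirderivs zero)
    qed
  qed
  then show "bdd_above ((\<lambda>(x, \<xi>). norm \<xi> powr (- 1 + real (mi_order \<alpha>)) *
      \<bar>mderiv \<alpha> (\<lambda>\<eta>. mderiv \<beta> (\<lambda>y. y \<bullet> \<eta>) x) \<xi>\<bar>) ` (UNIV \<times> - {0 :: real^'n}))"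
    by (intro bdd_aboveI[of _ 1]) auto
qed simp

lemma inner_strongly_nondegenerate: "strongly_nondegenerate (\<lambda>x \<xi> :: real^'n. x \<bullet> \<xi>)"
proof -
  have "mixed_hessian (\<lambda>x \<xi> :: real^'n. x \<bullet> \<xi>) x \<xi> = mat 1" for x \<xi>
    unfolding mixed_hessian_def pderiv_at_def
      frechet_derivative_eq[OF bounded_linear_imp_has_derivative[OF bounded_linear_inner_right]]
      frechet_derivative_eq[OF bounded_linear_imp_has_derivative[OF bounded_linear_inner_left]]
    by (auto simp: mat_def inner_axis_axis vec_eq_iff)
  then show ?thesis unfolding strongly_nondegenerate_def by (intro exI[of _ 1]) simp
qed

section \<open>Sums of tensor products\<close>

text \<open>A family graded by order and closed under partial derivatives consists of smooth
  functions, and its multi-index derivatives stay in it. The only computation left to applications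
  is the closure step; the parameter x is carried along so that one formula holds for all x.\<close>

lemma graded_derivatives:
  fixes C :: "nat \<Rightarrow> ('p \<Rightarrow> real^'n \<Rightarrow> 'b::real_normed_vector) set"
  assumes step: "\<And>l h. h \<in> C l \<Longrightarrow> \<exists>d. (\<forall>i. d i \<in> C (Suc l)) \<and>
      (\<forall>x \<xi>. (h x has_derivative (\<lambda>v. \<Sum>i\<in>UNIV. v $ i *\<^sub>R d i x \<xi>)) (at \<xi>))"
    and h: "h \<in> C l"
  shows "smooth_on UNIV (h x)" "(\<lambda>x. mderiv \<alpha> (h x)) \<in> C (l + mi_order \<alpha>)"
proof -
  have step': "\<exists>d. (\<forall>i. d i \<in> C (Suc l)) \<and> (\<forall>i x \<xi>. h x differentiable (at \<xi>) \<and> frechet_derivative (h x) (at \<xi>) (axis i 1) = d i x \<xi>)"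
    if h: "h \<in> C l" for h l
  proof -
    obtain d where d: "\<And>i. d i \<in> C (Suc l)" "\<And>x \<xi>. (h x has_derivative (\<lambda>v. \<Sum>i\<in>UNIV. v $ i *\<^sub>R d i x \<xi>)) (at \<xi>)"
      using step[OF h] by blast
    have "(\<Sum>i\<in>UNIV. axis j 1 $ i *\<^sub>R d i x \<xi>) = d j x \<xi>" for j x \<xi>
    proof -
      have "(\<Sum>i\<in>UNIV. axis j 1 $ i *\<^sub>R d i x \<xi>) = (\<Sum>i\<in>UNIV. if i = j then d i x \<xi> else 0)"
        by (intro sum.cong) (auto simp: axis_def)
      then show ?thesis by simp
    qed
    then show ?thesis using d by (intro exI[of _ d]) (auto simp: frechet_derivative_eq[OF d(2)] intro: differentiableI[OF d(2)])
  qed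
  have "Ck_on k UNIV (h x)" for k
    using h
  proof (induction k arbitrary: h l)
    case 0
    then show ?case using step'[OF 0]
      by (auto intro!: continuous_at_imp_continuous_on differentiable_imp_continuous_within)
  next
    case (Suc k)
    obtain d where d: "\<And>i. d i \<in> C (Suc l)" "\<And>i x \<xi>. h x differentiable (at \<xi>) \<and> frechet_derivative (h x) (at \<xi>) (axis i 1) = d i x \<xi>"
      using step'[OF Suc.prems] by blast
    have "Ck_on k UNIV (\<lambda>\<xi>. frechet_derivative (h x) (at \<xi>) b)" if b: "b \<in> Basis" for b
    proof -
      obtain i where "b = axis i 1" using b by (auto simp: Basis_vec_def)
      then show ?thesis using Suc.IH[OF d(1)[of i]] d(2) by simp
    qed
    then show ?case using d(2) by simp
  qed
  then show "smooth_on UNIV (h x)" by (simp add: smooth_on_def)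
  have "(\<lambda>x. dirderivs (map (\<lambda>i. axis i 1) cs) (h x)) \<in> C (l + length cs)" for cs
  proof (induction cs)
    case (Cons i cs)
    obtain d where d: "\<And>i. d i \<in> C (Suc (l + length cs))" "\<And>i x \<xi>. frechet_derivative (dirderivs (map (\<lambda>i. axis i 1) cs) (h x)) (at \<xi>) (axis i 1) = d i x \<xi>"
      using step'[OF Cons] by blast
    show ?case using d(1)[of i] by (simp add: d(2))
  qed (simp add: h)
  then show "(\<lambda>x. mderiv \<alpha> (h x)) \<in> C (l + mi_order \<alpha>)"
    unfolding mderiv_dirderivs length_mi_list[symmetric] .
qed

text \<open>Finite sums of products of functions of one coordinate: a partial derivative replaces
  just one factor, which keeps the class stable.\<close>

definition tensor_sum :: "'k set \<Rightarrow> ('k \<Rightarrow> complex) \<Rightarrow> ('k \<Rightarrow> 'n \<Rightarrow> real \<Rightarrow> complex) \<Rightarrow> real^'n \<Rightarrow> complex" where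
  "tensor_sum F c f x = (\<Sum>k\<in>F. c k * (\<Prod>i\<in>UNIV. f k i (x $ i)))"

lemma has_derivative_tensor_sum:
  fixes x :: "real^'n" and f :: "'k \<Rightarrow> 'n \<Rightarrow> real \<Rightarrow> complex"
  assumes f: "\<And>k i t. k \<in> F \<Longrightarrow> (f k i has_vector_derivative f' k i t) (at t)"
  shows "(tensor_sum F c f has_derivative (\<lambda>v. \<Sum>i\<in>UNIV. v $ i *\<^sub>R tensor_sum F c (\<lambda>k. (f k)(i := f' k i)) x)) (at x)"
proof -
  have 1: "((\<lambda>x. \<Prod>i\<in>UNIV. f k i (x $ i)) has_derivative (\<lambda>v. \<Sum>i\<in>UNIV. (v $ i *\<^sub>R f' k i (x $ i)) * (\<Prod>j\<in>UNIV - {i}. f k j (x $ j)))) (at x)"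
    if k: "k \<in> F" for k
  proof (rule has_derivative_prod)
    fix i
    have "((\<lambda>x::real^'n. x $ i) has_derivative (\<lambda>v. v $ i)) (at x)" by (rule bounded_linear_imp_has_derivative) (rule bounded_linear_vec_nth)
    from has_derivative_compose[OF this f[OF k, of i "x $ i", unfolded has_vector_derivative_def]]
    show "((\<lambda>x. f k i (x $ i)) has_derivative (\<lambda>v. v $ i *\<^sub>R f' k i (x $ i))) (at x)" .
  qed
  have "(tensor_sum F c f has_derivative (\<lambda>v. \<Sum>k\<in>F. c k * (\<Sum>i\<in>UNIV. (v $ i *\<^sub>R f' k i (x $ i)) * (\<Prod>j\<in>UNIV - {i}. f k j (x $ j))))) (at x)"
    unfolding tensor_sum_def[abs_def] by (intro has_derivative_sum has_derivative_mult_right 1)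
  also have "(\<lambda>v. \<Sum>k\<in>F. c k * (\<Sum>i\<in>UNIV. (v $ i *\<^sub>R f' k i (x $ i)) * (\<Prod>j\<in>UNIV - {i}. f k j (x $ j))))
    = (\<lambda>v. \<Sum>i\<in>UNIV. v $ i *\<^sub>R tensor_sum F c (\<lambda>k. (f k)(i := f' k i)) x)"
  proof
    fix v :: "real^'n"
    have p: "(\<Prod>j\<in>UNIV. ((f k)(i := f' k i)) j (x $ j)) = f' k i (x $ i) * (\<Prod>j\<in>UNIV - {i}. f k j (x $ j))" for k i
      by (subst prod.remove[of _ i]) (auto intro!: prod.cong)
    have "(\<Sum>k\<in>F. c k * (\<Sum>i\<in>UNIV. (v $ i *\<^sub>R f' k i (x $ i)) * (\<Prod>j\<in>UNIV - {i}. f k j (x $ j))))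
       = (\<Sum>k\<in>F. \<Sum>i\<in>UNIV. v $ i *\<^sub>R (c k * (\<Prod>j\<in>UNIV. ((f k)(i := f' k i)) j (x $ j))))"
      unfolding p by (simp add: sum_distrib_left)
    also have "\<dots> = (\<Sum>i\<in>UNIV. v $ i *\<^sub>R tensor_sum F c (\<lambda>k. (f k)(i := f' k i)) x)"
      unfolding tensor_sum_def scaleR_sum_right by (rule sum.swap)
    finally show "(\<Sum>k\<in>F. c k * (\<Sum>i\<in>UNIV. (v $ i *\<^sub>R f' k i (x $ i)) * (\<Prod>j\<in>UNIV - {i}. f k j (x $ j))))
       = (\<Sum>i\<in>UNIV. v $ i *\<^sub>R tensor_sum F c (\<lambda>k. (f k)(i := f' k i)) x)" .
  qed
  finally show ?thesis .
qed

section \<open>Modulated Gaussians\<close>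

lemma power_times_gaussian_bounded:
  assumes s: "s > 0" shows "\<exists>B. \<forall>t::real. \<bar>t\<bar> ^ k * exp (- s * t\<^sup>2 / 2) \<le> B"
proof (cases "k = 0")
  case True
  then show ?thesis using s by (intro exI[of _ 1]) simp
next
  case False
  \<comment> \<open>Chosen so that 1 + t^2 is at most c (1 + s t^2 / (2k)), hence at most c exp(s
    t^2 / (2k)); the k-th power then has exactly the exponent to be cancelled.\<close>
  define c where "c = 1 + 2 * real k / s"
  have c: "c \<ge> 1" using s by (simp add: c_def)
  have "\<bar>t\<bar> ^ k * exp (- s * t\<^sup>2 / 2) \<le> c ^ k" for t
  proof -
    have "\<bar>t\<bar> \<le> 1 + t\<^sup>2" using sum_squares_bound[of 1 "\<bar>t\<bar>"] by simp
    also have "\<dots> \<le> c * (1 + s * t\<^sup>2 / (2 * real k))" using s False by (simp add: c_def field_simps)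
    also have "\<dots> \<le> c * exp (s * t\<^sup>2 / (2 * real k))" using c by (intro mult_left_mono exp_ge_add_one_self) auto
    finally have "\<bar>t\<bar> ^ k \<le> (c * exp (s * t\<^sup>2 / (2 * real k))) ^ k" by (intro power_mono) auto
    also have "\<dots> = c ^ k * exp (s * t\<^sup>2 / 2)"
      using False by (simp add: power_mult_distrib exp_of_nat_mult[symmetric])
    finally have "\<bar>t\<bar> ^ k * exp (- s * t\<^sup>2 / 2) \<le> c ^ k * exp (s * t\<^sup>2 / 2) * exp (- s * t\<^sup>2 / 2)"
      by (intro mult_right_mono) auto
    then show ?thesis by (simp add: mult.assoc exp_add[symmetric])
  qed
  then show ?thesis by blast
qed

lemma poly_times_gaussian_bounded:
  assumes s: "s > 0"
  shows "\<exists>B. \<forall>t::real. \<bar>t\<bar> ^ k * (norm (poly q (complex_of_real t)) * exp (- s * t\<^sup>2 / 2)) \<le> B"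
proof (induction q arbitrary: k)
  case 0
  show ?case by (intro exI[of _ 0]) simp
next
  case (pCons a q)
  obtain B1 where B1: "\<And>t. \<bar>t\<bar> ^ k * exp (- s * t\<^sup>2 / 2) \<le> B1" using power_times_gaussian_bounded[OF s] by blast
  obtain B2 where B2: "\<And>t. \<bar>t\<bar> ^ Suc k * (norm (poly q (complex_of_real t)) * exp (- s * t\<^sup>2 / 2)) \<le> B2" using pCons.IH by blast
  have "\<bar>t\<bar> ^ k * (norm (poly (pCons a q) (complex_of_real t)) * exp (- s * t\<^sup>2 / 2)) \<le> norm a * B1 + B2" for t
  proof -
    have "norm (poly (pCons a q) (complex_of_real t)) \<le> norm a + \<bar>t\<bar> * norm (poly q (complex_of_real t))"
      using norm_triangle_ineq[of a "of_real t * poly q (of_real t)"] by (simp add: norm_mult)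
    then have "\<bar>t\<bar> ^ k * (norm (poly (pCons a q) (complex_of_real t)) * exp (- s * t\<^sup>2 / 2))
       \<le> \<bar>t\<bar> ^ k * ((norm a + \<bar>t\<bar> * norm (poly q (complex_of_real t))) * exp (- s * t\<^sup>2 / 2))"
      by (intro mult_left_mono mult_right_mono) auto
    also have "\<dots> = norm a * (\<bar>t\<bar> ^ k * exp (- s * t\<^sup>2 / 2)) + \<bar>t\<bar> ^ Suc k * (norm (poly q (complex_of_real t)) * exp (- s * t\<^sup>2 / 2))"
      by (simp add: algebra_simps)
    also have "\<dots> \<le> norm a * B1 + B2" by (intro add_mono mult_left_mono B1 B2) auto
    finally show ?thesis .
  qed
  then show ?case by blast
qed

text \<open>Every derivative is again a tensor sum of polynomials times modulated Gaussians, the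
  polynomials being the parameter q, and each one-dimensional factor beats any power of its
  coordinate. The grading is constant in the order here.\<close>

lemma gaussian_sum_schwartz:
  fixes b :: "'k \<Rightarrow> real^'n"
  assumes s: "s > 0"
  shows "(\<lambda>x. \<Sum>k\<in>F. c k * (iexp (b k \<bullet> x) * complex_of_real (exp (- s * (norm x)\<^sup>2 / 2)))) \<in> schwartz"
proof -
  define H where "H = (\<lambda>q k i t. poly (q k i) (complex_of_real t) * exp (\<i> * of_real (b k $ i) * of_real t - of_real s * (of_real t)\<^sup>2 / 2))"
  define C where "C = (\<lambda>l::nat. range (\<lambda>q (u::unit). tensor_sum F c (H q)))"
  have step: "\<exists>d. (\<forall>i. d i \<in> C (Suc l)) \<and> (\<forall>x \<xi>. (h x has_derivative (\<lambda>v. \<Sum>i\<in>UNIV. v $ i *\<^sub>R d i x \<xi>)) (at \<xi>))"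
    if h: "h \<in> C l" for h l
  proof -
    obtain q where q: "h = (\<lambda>_. tensor_sum F c (H q))" using h by (auto simp: C_def)
    \<comment> \<open>Differentiating a polynomial times exp(i b t - s t^2 / 2) adds to its
      derivative the polynomial times i b - s t.\<close>
    define q' where "q' = (\<lambda>k i. pderiv (q k i) + q k i * [:\<i> * of_real (b k $ i), - of_real s:])"
    have d: "(H q k i has_vector_derivative H q' k i t) (at t)" for k i t
    proof -
      have "((\<lambda>z. poly (q k i) z * exp (\<i> * of_real (b k $ i) * z - of_real s * z\<^sup>2 / 2)) has_field_derivative
        poly (pderiv (q k i)) (of_real t) * exp (\<i> * of_real (b k $ i) * of_real t - of_real s * (of_real t)\<^sup>2 / 2)
        + poly (q k i) (of_real t) * (exp (\<i> * of_real (b k $ i) * of_real t - of_real s * (of_real t)\<^sup>2 / 2) * (\<i> * of_real (b k $ i) - of_real s * of_real t))) (at (of_real t))"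
        by (auto intro!: derivative_eq_intros poly_DERIV) (simp add: algebra_simps)?
      from has_vector_derivative_real_field[OF this] show ?thesis
        unfolding H_def q'_def by (simp add: algebra_simps)
    qed
    have "(\<lambda>_. tensor_sum F c (\<lambda>k. (H q k)(i := H q' k i))) \<in> C (Suc l)" for i
    proof -
      have "(\<lambda>k. (H q k)(i := H q' k i)) = H (\<lambda>k. (q k)(i := q' k i))" by (auto simp: H_def fun_eq_iff)
      then show ?thesis by (simp add: C_def)
    qed
    then show ?thesis
      by (intro exI[of _ "\<lambda>i _. tensor_sum F c (\<lambda>k. (H q k)(i := H q' k i))"] conjI allI)
        (auto simp: q intro!: has_derivative_tensor_sum d)
  qed
  define h where "h = (\<lambda>u::unit. tensor_sum F c (H (\<lambda>_ _. 1)))"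
  have hC: "h \<in> C 0" by (auto simp: C_def h_def)
  have "h () = (\<lambda>x. \<Sum>k\<in>F. c k * (iexp (b k \<bullet> x) * complex_of_real (exp (- s * (norm x)\<^sup>2 / 2))))"
  proof
    fix x :: "real^'n"
    have "(\<Prod>i\<in>UNIV. H (\<lambda>_ _. 1) k i (x $ i)) = iexp (b k \<bullet> x) * complex_of_real (exp (- s * (norm x)\<^sup>2 / 2))" for k
    proof -
      have "(\<Prod>i\<in>UNIV. H (\<lambda>_ _. 1) k i (x $ i)) = exp (\<Sum>i\<in>UNIV. \<i> * of_real (b k $ i) * of_real (x $ i) - of_real s * (of_real (x $ i))\<^sup>2 / 2)"
        by (simp add: H_def exp_sum)
      also have "(\<Sum>i\<in>UNIV. \<i> * of_real (b k $ i) * of_real (x $ i) - of_real s * (of_real (x $ i))\<^sup>2 / 2)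
         = \<i> * of_real (b k \<bullet> x) + of_real (- s * (norm x)\<^sup>2 / 2)"
        by (simp add: inner_vec_def norm_vec_power2 sum_subtractf sum_distrib_left sum_divide_distrib mult.assoc sum_negf)
      finally show ?thesis by (simp only: exp_add exp_of_real[symmetric])
    qed
    then show "h () x = (\<Sum>k\<in>F. c k * (iexp (b k \<bullet> x) * complex_of_real (exp (- s * (norm x)\<^sup>2 / 2))))"
      by (simp add: h_def tensor_sum_def)
  qed
  moreover have "h () \<in> schwartz" unfolding schwartz_def mem_Collect_eq
  proof (intro conjI allI)
    show "smooth_on UNIV (h ())" by (rule graded_derivatives(1)[OF step hC])
    fix \<alpha> \<beta> :: "'n multi_index"
    have "(\<lambda>x. mderiv \<beta> (h x)) \<in> C (0 + mi_order \<beta>)" by (rule graded_derivatives(2)[OF step hC])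
    then obtain q where "(\<lambda>x. mderiv \<beta> (h x)) = (\<lambda>_. tensor_sum F c (H q))" by (auto simp: C_def)
    then have q: "mderiv \<beta> (h ()) = tensor_sum F c (H q)" by (rule fun_cong)
    have "\<forall>r. \<exists>B. \<forall>t. \<bar>t\<bar> ^ \<alpha> (snd r) * norm (H q (fst r) (snd r) t) \<le> B"
      using poly_times_gaussian_bounded[OF s] by (simp add: H_def norm_mult norm_exp_eq_Re)
    then obtain B where B: "\<forall>r. \<forall>t. \<bar>t\<bar> ^ \<alpha> (snd r) * norm (H q (fst r) (snd r) t) \<le> B r"
      by (drule_tac choice) (elim exE, rule that)
    have "\<bar>mpower x \<alpha>\<bar> * norm (mderiv \<beta> (h ()) x) \<le> (\<Sum>k\<in>F. norm (c k) * (\<Prod>i\<in>UNIV. B (k, i)))" for x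
    proof -
      have "\<bar>mpower x \<alpha>\<bar> * norm (mderiv \<beta> (h ()) x) \<le> \<bar>mpower x \<alpha>\<bar> * (\<Sum>k\<in>F. norm (c k * (\<Prod>i\<in>UNIV. H q k i (x $ i))))"
        unfolding q tensor_sum_def by (intro mult_left_mono norm_sum) auto
      also have "\<dots> = (\<Sum>k\<in>F. norm (c k) * (\<Prod>i\<in>UNIV. \<bar>x $ i\<bar> ^ \<alpha> i * norm (H q k i (x $ i))))"
        by (simp add: mpower_def abs_prod sum_distrib_left norm_mult prod_norm power_abs prod.distrib mult_ac)
      also have "\<dots> \<le> (\<Sum>k\<in>F. norm (c k) * (\<Prod>i\<in>UNIV. B (k, i)))"
      proof (intro sum_mono mult_left_mono prod_mono)
        fix k i show "0 \<le> \<bar>x $ i\<bar> ^ \<alpha> i * norm (H q k i (x $ i)) \<and> \<bar>x $ i\<bar> ^ \<alpha> i * norm (H q k i (x $ i)) \<le> B (k, i)"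
          using B[rule_format, of "x $ i" "(k, i)"] by simp
      qed simp
      finally show ?thesis .
    qed
    then show "bdd_above (range (\<lambda>x. \<bar>mpower x \<alpha>\<bar> * norm (mderiv \<beta> (h ()) x)))" by (intro bdd_aboveI) auto
  qed
  ultimately show ?thesis by simp
qed

section \<open>A symbol of critical order\<close>

text \<open>R^\<rho> for R = 4^j. Powers of 4 keep the shells apart: coordinates of points in the
  support of shell j lie between 3R/4 and 2R, and the next shell starts at 3R.\<close>

definition spacing :: "real \<Rightarrow> nat \<Rightarrow> real" where
  "spacing \<rho> j = (4 ^ j) powr \<rho>"

text \<open>The number of lattice points per axis, so that every coordinate of a point runs from R
  up to less than 2R.\<close>

definition mesh :: "real \<Rightarrow> nat \<Rightarrow> nat" where
  "mesh \<rho> j = nat \<lfloor>4 ^ j / spacing \<rho> j\<rfloor>"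

definition lattice_index :: "real \<Rightarrow> nat \<Rightarrow> (nat \<times> ('n \<Rightarrow> nat)) set" where
  "lattice_index \<rho> N = (SIGMA j:{..<N}. {l. \<forall>i. l i < mesh \<rho> j})"

definition lattice_point :: "real \<Rightarrow> nat \<times> ('n \<Rightarrow> nat) \<Rightarrow> real^'n" where
  "lattice_point \<rho> k = (\<chi> i. 4 ^ fst k + spacing \<rho> (fst k) * real (snd k i))"

definition lattice_weight :: "real \<Rightarrow> nat \<times> ('n::finite \<Rightarrow> nat) \<Rightarrow> real" where
  "lattice_weight \<rho> k = (4 ^ fst k) powr (real CARD('n) / 2 * (\<rho> - 1))"

text \<open>The open cube of half side a quarter of the spacing, outside which the bump of k
  vanishes.\<close>

definition near_lattice_point :: "real \<Rightarrow> nat \<times> ('n::finite \<Rightarrow> nat) \<Rightarrow> real^'n \<Rightarrow> bool" where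
  "near_lattice_point \<rho> k x \<longleftrightarrow> (\<forall>i. \<bar>4 * (x $ i - lattice_point \<rho> k $ i) / spacing \<rho> (fst k)\<bar> < 1)"

text \<open>The parameter \<open>c\<close> counts how often each factor has been differentiated in the frequency.\<close>

definition lattice_coeff :: "('n \<Rightarrow> nat) \<Rightarrow> real \<Rightarrow> real^'n \<Rightarrow> nat \<times> ('n::finite \<Rightarrow> nat) \<Rightarrow> complex" where
  "lattice_coeff c \<rho> x k = of_real (lattice_weight \<rho> k * (4 / spacing \<rho> (fst k)) ^ (\<Sum>i\<in>UNIV. c i)) * iexp (- (x \<bullet> lattice_point \<rho> k))"

definition lattice_bump :: "('n \<Rightarrow> nat) \<Rightarrow> real \<Rightarrow> nat \<times> ('n::finite \<Rightarrow> nat) \<Rightarrow> 'n \<Rightarrow> real \<Rightarrow> complex" where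
  "lattice_bump c \<rho> k i t = of_real (bump (c i) (4 * (t - lattice_point \<rho> k $ i) / spacing \<rho> (fst k)))"

text \<open>An infinite sum over shells, cut at an index depending on \<xi> so that it is a finite
  sum; no omitted bump reaches \<xi>, because shell j lives at norms above j.\<close>

definition lattice_symbol :: "('n \<Rightarrow> nat) \<Rightarrow> real \<Rightarrow> real^'n \<Rightarrow> real^'n \<Rightarrow> complex" where
  "lattice_symbol c \<rho> x \<xi> =
     tensor_sum (lattice_index \<rho> (Suc (nat \<lceil>norm \<xi>\<rceil>))) (lattice_coeff c \<rho> x) (lattice_bump c \<rho>) \<xi>"

lemma finite_lattice_index [simp]: "finite (lattice_index \<rho> N :: (nat \<times> ('n::finite \<Rightarrow> nat)) set)"
proof -
  have "{l :: 'n \<Rightarrow> nat. \<forall>i. l i < mesh \<rho> j} = PiE UNIV (\<lambda>_. {..<mesh \<rho> j})" for j by (auto simp: PiE_UNIV_domain)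
  then show ?thesis unfolding lattice_index_def by (auto intro!: finite_PiE)
qed

lemma lattice_weight_pos: "0 < lattice_weight \<rho> k"
  by (simp add: lattice_weight_def)

lemma spacing_pos: "0 < spacing \<rho> j"
  by (simp add: spacing_def)

lemma near_lattice_point_iff:
  "near_lattice_point \<rho> k x \<longleftrightarrow> (\<forall>i. \<bar>x $ i - lattice_point \<rho> k $ i\<bar> < spacing \<rho> (fst k) / 4)"
proof -
  have "\<bar>4 * d / r\<bar> < 1 \<longleftrightarrow> \<bar>d\<bar> < r / 4" if "r > 0" for d r :: real using that by (simp add: abs_mult field_simps)
  from this[OF spacing_pos] show ?thesis by (simp only: near_lattice_point_def)
qed

lemma near_lattice_point_self: "near_lattice_point \<rho> k (lattice_point \<rho> k)"
  by (simp add: near_lattice_point_def)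

lemma open_near_lattice_point: "open {x. near_lattice_point \<rho> k x}"
proof -
  have "{x. near_lattice_point \<rho> k x} = (\<Inter>i. {x. \<bar>4 * (x $ i - lattice_point \<rho> k $ i) / spacing \<rho> (fst k)\<bar> < 1})"
    by (auto simp: near_lattice_point_def)
  moreover have "open \<dots>" by (intro open_INT finite ballI open_Collect_less continuous_intros) (auto simp: spacing_pos less_imp_neq[OF spacing_pos, symmetric])
  ultimately show ?thesis by simp
qed

lemma lattice_bump_prod_eq_0:
  assumes "\<not> near_lattice_point \<rho> k x" shows "(\<Prod>i\<in>UNIV. lattice_bump c \<rho> k i (x $ i)) = 0"
proof -
  obtain i where "1 \<le> \<bar>4 * (x $ i - lattice_point \<rho> k $ i) / spacing \<rho> (fst k)\<bar>"
    using assms by (auto simp: near_lattice_point_def not_less)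
  then have "lattice_bump c \<rho> k i (x $ i) = 0" by (simp add: lattice_bump_def bump_eq_0)
  then show ?thesis by (intro prod_zero) auto
qed

abbreviation critical_symbol :: "real \<Rightarrow> real^'n \<Rightarrow> real^'n \<Rightarrow> complex" where
  "critical_symbol \<rho> \<equiv> lattice_symbol (\<lambda>_. 0) \<rho>"

context
  fixes \<rho> :: real assumes \<rho>: "0 \<le> \<rho>" "\<rho> \<le> 1"
begin

lemma spacing_bounds: "1 \<le> spacing \<rho> j" "spacing \<rho> j \<le> 4 ^ j"
  using \<rho> powr_mono[of \<rho> 1 "4 ^ j :: real"] by (auto simp: spacing_def ge_one_powr_ge_zero)

lemma mesh_spacing: "real (mesh \<rho> j) * spacing \<rho> j \<le> 4 ^ j"
proof -
  have "real (mesh \<rho> j) \<le> 4 ^ j / spacing \<rho> j" unfolding mesh_def using spacing_pos[of \<rho> j] by simp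
  then show ?thesis using spacing_pos[of \<rho> j] by (simp add: field_simps)
qed

lemma near_lattice_point_shell:
  assumes k: "k \<in> lattice_index \<rho> N" and near: "near_lattice_point \<rho> k x"
  shows "3 / 4 * 4 ^ fst k < x $ i" "x $ i < 2 * 4 ^ fst k"
proof -
  let ?r = "spacing \<rho> (fst k)"
  have d: "\<bar>x $ i - (4 ^ fst k + ?r * real (snd k i))\<bar> < ?r / 4"
    using near unfolding near_lattice_point_iff by (simp add: lattice_point_def)
  have "Suc (snd k i) \<le> mesh \<rho> (fst k)" using k by (auto simp: lattice_index_def Suc_leI)
  then have "real (Suc (snd k i)) \<le> real (mesh \<rho> (fst k))" by (simp only: of_nat_le_iff)
  then have "real (snd k i) + 1 \<le> real (mesh \<rho> (fst k))" by simp
  then have "?r * (real (snd k i) + 1) \<le> ?r * real (mesh \<rho> (fst k))" using spacing_pos[of \<rho> "fst k"] by (intro mult_left_mono) auto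
  then have "?r * real (snd k i) + ?r \<le> 4 ^ fst k" using mesh_spacing[of "fst k"] by (simp add: algebra_simps)
  moreover have "0 \<le> ?r * real (snd k i)" "?r \<le> 4 ^ fst k" "0 < ?r" using spacing_bounds[of "fst k"] spacing_pos[of \<rho> "fst k"] by auto
  ultimately show "3 / 4 * 4 ^ fst k < x $ i" "x $ i < 2 * 4 ^ fst k" using d unfolding abs_less_iff by linarith+
qed

text \<open>The crude bound j below |x|, where the true size is about 4^j, already justifies the
  truncation of the sum.\<close>

lemma near_lattice_point_norm:
  assumes k: "k \<in> lattice_index \<rho> N" and near: "near_lattice_point \<rho> k x" shows "real (fst k) < norm x"
proof -
  have "real j \<le> 3 / 4 * 4 ^ j" for j
  proof (induction j)
    case (Suc j)
    moreover have "(1 :: real) \<le> 4 ^ j" by simp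
    ultimately show ?case unfolding power_Suc of_nat_Suc by linarith
  qed simp
  also have "3 / 4 * 4 ^ fst k < x $ i" for i by (rule near_lattice_point_shell[OF k near])
  also have "x $ i \<le> norm x" for i using component_le_norm_cart[of x i] by linarith
  finally show ?thesis .
qed

text \<open>Different shells are separated by the factor 4; within a shell the points are a full
  spacing apart and the supports reach only a quarter of it. So at most one bump is active at a
  frequency.\<close>

lemma near_lattice_point_unique:
  fixes k k' :: "nat \<times> ('n::finite \<Rightarrow> nat)"
  assumes k: "k \<in> lattice_index \<rho> N" "near_lattice_point \<rho> k x" and k': "k' \<in> lattice_index \<rho> N'" "near_lattice_point \<rho> k' x"
  shows "k = k'"
proof -
  have le: "fst k1 \<le> fst k2" if "k1 \<in> lattice_index \<rho> N1" "near_lattice_point \<rho> k1 x" "k2 \<in> lattice_index \<rho> N2" "near_lattice_point \<rho> k2 x"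
    for k1 k2 :: "nat \<times> ('n \<Rightarrow> nat)" and N1 N2
  proof (rule ccontr)
    assume "\<not> fst k1 \<le> fst k2"
    then have "(4 :: real) ^ Suc (fst k2) \<le> 4 ^ fst k1" by (intro power_increasing) auto
    moreover have "3 / 4 * 4 ^ fst k1 < (2 :: real) * 4 ^ fst k2"
      using near_lattice_point_shell(1)[OF that(1,2)] near_lattice_point_shell(2)[OF that(3,4)] order_less_trans by blast
    moreover have "(0 :: real) < 4 ^ fst k2" by simp
    ultimately show False unfolding power_Suc by linarith
  qed
  have j: "fst k = fst k'" using le[OF k k'] le[OF k' k] by simp
  have "snd k i = snd k' i" for i
  proof -
    let ?r = "spacing \<rho> (fst k)"
    have "\<bar>x $ i - (4 ^ fst k + ?r * real (snd k i))\<bar> < ?r / 4" "\<bar>x $ i - (4 ^ fst k + ?r * real (snd k' i))\<bar> < ?r / 4"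
      using k(2) k'(2) unfolding near_lattice_point_iff by (simp_all add: lattice_point_def j)
    moreover have "0 < ?r" by (rule spacing_pos)
    ultimately have "\<bar>?r * real (snd k i) - ?r * real (snd k' i)\<bar> < ?r" by linarith
    then have "?r * \<bar>real (snd k i) - real (snd k' i)\<bar> < ?r * 1" using spacing_pos[of \<rho> "fst k"]
      by (simp add: right_diff_distrib[symmetric] abs_mult)
    then have "\<bar>real (snd k i) - real (snd k' i)\<bar> < 1" using spacing_pos[of \<rho> "fst k"] by (simp only: mult_less_cancel_left_pos)
    then show ?thesis by linarith
  qed
  then show ?thesis using j by (intro prod_eqI) auto
qed

lemma tensor_sum_lattice_near:
  assumes k: "k \<in> lattice_index \<rho> N" "near_lattice_point \<rho> k x"
  shows "tensor_sum (lattice_index \<rho> N) C (lattice_bump c \<rho>) x = C k * (\<Prod>i\<in>UNIV. lattice_bump c \<rho> k i (x $ i))"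
proof -
  have "tensor_sum (lattice_index \<rho> N) C (lattice_bump c \<rho>) x = (\<Sum>k'\<in>{k}. C k' * (\<Prod>i\<in>UNIV. lattice_bump c \<rho> k' i (x $ i)))"
    unfolding tensor_sum_def
  proof (rule sum.mono_neutral_right)
    show "\<forall>k'\<in>lattice_index \<rho> N - {k}. C k' * (\<Prod>i\<in>UNIV. lattice_bump c \<rho> k' i (x $ i)) = 0"
    proof
      fix k' assume "k' \<in> lattice_index \<rho> N - {k}"
      then have "\<not> near_lattice_point \<rho> k' x" using near_lattice_point_unique[OF k] by blast
      then show "C k' * (\<Prod>i\<in>UNIV. lattice_bump c \<rho> k' i (x $ i)) = 0" by (simp only: lattice_bump_prod_eq_0[OF \<open>\<not> near_lattice_point \<rho> k' x\<close>] mult_zero_right)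
    qed
  qed (use k in auto)
  then show ?thesis by simp
qed

lemma tensor_sum_lattice_far:
  assumes "\<And>k. k \<in> lattice_index \<rho> N \<Longrightarrow> \<not> near_lattice_point \<rho> k x"
  shows "tensor_sum (lattice_index \<rho> N) C (lattice_bump c \<rho>) x = 0"
  unfolding tensor_sum_def by (intro sum.neutral ballI) (simp only: lattice_bump_prod_eq_0[OF assms] mult_zero_right)

lemma lattice_symbol_near:
  assumes k: "k \<in> lattice_index \<rho> N" "near_lattice_point \<rho> k \<xi>"
  shows "lattice_symbol c \<rho> x \<xi> = lattice_coeff c \<rho> x k * (\<Prod>i\<in>UNIV. lattice_bump c \<rho> k i (\<xi> $ i))"
proof -
  have "fst k < Suc (nat \<lceil>norm \<xi>\<rceil>)" using near_lattice_point_norm[OF k] by linarith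
  then have "k \<in> lattice_index \<rho> (Suc (nat \<lceil>norm \<xi>\<rceil>))" using k(1) by (auto simp: lattice_index_def)
  then show ?thesis unfolding lattice_symbol_def using k(2) by (rule tensor_sum_lattice_near)
qed

lemma lattice_symbol_far:
  assumes "\<And>N k. k \<in> lattice_index \<rho> N \<Longrightarrow> \<not> near_lattice_point \<rho> k \<xi>"
  shows "lattice_symbol c \<rho> x \<xi> = 0"
  unfolding lattice_symbol_def by (rule tensor_sum_lattice_far[OF assms])

text \<open>On a whole ball the symbol equals one fixed finite sum, although its definition cuts the
  sum at an index that jumps with \<xi>. This makes it differentiable.\<close>

lemma lattice_symbol_eq:
  assumes "norm \<xi> < real N"
  shows "lattice_symbol c \<rho> x \<xi> = tensor_sum (lattice_index \<rho> N) (lattice_coeff c \<rho> x) (lattice_bump c \<rho>) \<xi>"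
proof (cases "\<exists>N' k. k \<in> lattice_index \<rho> N' \<and> near_lattice_point \<rho> k \<xi>")
  case True
  then obtain N' k where k: "k \<in> lattice_index \<rho> N'" "near_lattice_point \<rho> k \<xi>" by blast
  have "fst k < N" using near_lattice_point_norm[OF k] assms by linarith
  then have "k \<in> lattice_index \<rho> N" using k(1) by (auto simp: lattice_index_def)
  then show ?thesis using tensor_sum_lattice_near[OF _ k(2)] by (simp only: lattice_symbol_near[OF k])
next
  case False
  then show ?thesis by (subst lattice_symbol_far, blast, subst tensor_sum_lattice_far) auto
qed

text \<open>A partial derivative raises one entry of c by 1; the inner derivative 4 / spacing of the
  bump is absorbed into the coefficient, which depends on the total order only.\<close>

lemma lattice_symbol_has_derivative:
  fixes \<xi> :: "real^'n"
  shows "(lattice_symbol c \<rho> x has_derivative (\<lambda>v. \<Sum>i\<in>UNIV. v $ i *\<^sub>R lattice_symbol (c(i := Suc (c i))) \<rho> x \<xi>)) (at \<xi>)"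
proof -
  obtain N where N: "norm \<xi> < real N" using reals_Archimedean2 by blast
  let ?F = "lattice_index \<rho> N :: (nat \<times> ('n \<Rightarrow> nat)) set"
  define f' where "f' = (\<lambda>(k :: nat \<times> ('n \<Rightarrow> nat)) i t. of_real (4 / spacing \<rho> (fst k)) * lattice_bump (c(i := Suc (c i))) \<rho> k i t)"
  have d: "(lattice_bump c \<rho> k i has_vector_derivative f' k i t) (at t)" for k i t
  proof -
    have "((\<lambda>t. bump (c i) (4 * (t - lattice_point \<rho> k $ i) / spacing \<rho> (fst k))) has_real_derivative
       bump (Suc (c i)) (4 * (t - lattice_point \<rho> k $ i) / spacing \<rho> (fst k)) * (4 / spacing \<rho> (fst k))) (at t)"
      by (rule DERIV_chain2[OF bump_has_derivative]) (auto intro!: derivative_eq_intros simp: less_imp_neq[OF spacing_pos, symmetric])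
    from has_vector_derivative_of_real[OF this, where ?'a=complex] show ?thesis
      unfolding lattice_bump_def[abs_def] f'_def by (simp add: mult.commute)
  qed
  have e: "tensor_sum ?F (lattice_coeff c \<rho> x) (\<lambda>k. (lattice_bump c \<rho> k)(i := f' k i)) \<xi> = lattice_symbol (c(i := Suc (c i))) \<rho> x \<xi>" for i
    unfolding lattice_symbol_eq[OF N] tensor_sum_def
  proof (intro sum.cong refl)
    fix k :: "nat \<times> ('n \<Rightarrow> nat)"
    let ?c = "c(i := Suc (c i))"
    have "(\<Prod>j\<in>UNIV. ((lattice_bump c \<rho> k)(i := f' k i)) j (\<xi> $ j)) = f' k i (\<xi> $ i) * (\<Prod>j\<in>UNIV - {i}. lattice_bump c \<rho> k j (\<xi> $ j))"
      by (subst prod.remove[of _ i]) (auto intro!: prod.cong)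
    also have "(\<Prod>j\<in>UNIV - {i}. lattice_bump c \<rho> k j (\<xi> $ j)) = (\<Prod>j\<in>UNIV - {i}. lattice_bump ?c \<rho> k j (\<xi> $ j))"
      by (intro prod.cong) (auto simp: lattice_bump_def)
    also have "f' k i (\<xi> $ i) * \<dots> = of_real (4 / spacing \<rho> (fst k)) * (\<Prod>j\<in>UNIV. lattice_bump ?c \<rho> k j (\<xi> $ j))"
      unfolding f'_def by (simp only: prod.remove[of UNIV i "\<lambda>j. lattice_bump ?c \<rho> k j (\<xi> $ j)", OF finite UNIV_I] mult.assoc)
    finally have p: "(\<Prod>j\<in>UNIV. ((lattice_bump c \<rho> k)(i := f' k i)) j (\<xi> $ j)) = of_real (4 / spacing \<rho> (fst k)) * (\<Prod>j\<in>UNIV. lattice_bump ?c \<rho> k j (\<xi> $ j))" .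
    have "(\<Sum>j\<in>UNIV. ?c j) = Suc (\<Sum>j\<in>UNIV. c j)"
      by (simp add: sum.remove[of UNIV i])
    then have "lattice_coeff ?c \<rho> x k = lattice_coeff c \<rho> x k * of_real (4 / spacing \<rho> (fst k))"
      by (simp add: lattice_coeff_def mult_ac)
    then show "lattice_coeff c \<rho> x k * (\<Prod>j\<in>UNIV. ((lattice_bump c \<rho> k)(i := f' k i)) j (\<xi> $ j)) = lattice_coeff ?c \<rho> x k * (\<Prod>j\<in>UNIV. lattice_bump ?c \<rho> k j (\<xi> $ j))"
      unfolding p by (simp only: mult.assoc)
  qed
  have "(tensor_sum ?F (lattice_coeff c \<rho> x) (lattice_bump c \<rho>) has_derivative (\<lambda>v. \<Sum>i\<in>UNIV. v $ i *\<^sub>R lattice_symbol (c(i := Suc (c i))) \<rho> x \<xi>)) (at \<xi>)"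
    using has_derivative_tensor_sum[where f="lattice_bump c \<rho>" and f'=f', OF d, where F="?F" and c="lattice_coeff c \<rho> x" and x=\<xi>] unfolding e .
  then show ?thesis
    by (rule has_derivative_transform_within_open[of _ _ _ _ "ball 0 (real N)"]) (use N in \<open>auto simp: lattice_symbol_eq[of _ N]\<close>)
qed

lemma continuous_lattice_symbol_x: "continuous_on UNIV (\<lambda>x. lattice_symbol c \<rho> x \<xi>)"
  unfolding lattice_symbol_def tensor_sum_def lattice_coeff_def by (intro continuous_intros)

text \<open>With a single active bump of shell R the symbol is of size R^m R^(-\<rho> L). The weight
  has a nonnegative exponent, so the upper bound (1 + 2n) R for the bracket suffices, and all powers
  of R cancel.\<close>

lemma lattice_symbol_bound:
  "\<exists>K. \<forall>c (x :: real^'n) \<xi>. (\<Sum>i\<in>UNIV. c i) = L \<longrightarrow>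
     jbracket \<xi> powr (- (real CARD('n) / 2 * (\<rho> - 1)) + \<rho> * real L) * norm (lattice_symbol c \<rho> x \<xi>) \<le> K"
proof -
  let ?m = "real CARD('n) / 2 * (\<rho> - 1)"
  obtain B where B: "B \<ge> 0" "\<And>l t. l \<le> L \<Longrightarrow> \<bar>bump l t\<bar> \<le> B" using bump_bounded[of L] by blast
  let ?e = "- ?m + \<rho> * real L" and ?D = "1 + 2 * real CARD('n)"
  have "?m \<le> 0" using \<rho> by (intro mult_nonneg_nonpos) auto
  moreover have "0 \<le> \<rho> * real L" using \<rho> by simp
  ultimately have e: "?e \<ge> 0" by linarith
  have K0: "0 \<le> ?D powr ?e * (4 ^ L * B ^ CARD('n))" using B by simp
  have "jbracket \<xi> powr ?e * norm (lattice_symbol c \<rho> x \<xi>) \<le> ?D powr ?e * (4 ^ L * B ^ CARD('n))"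
    if c: "(\<Sum>i\<in>UNIV. c i) = L" for c and x \<xi> :: "real^'n"
  proof (cases "\<exists>N k. k \<in> lattice_index \<rho> N \<and> near_lattice_point \<rho> k \<xi>")
    case False
    then have "lattice_symbol c \<rho> x \<xi> = 0" by (intro lattice_symbol_far) blast
    then show ?thesis using K0 by simp
  next
    case True
    then obtain N k where k: "k \<in> lattice_index \<rho> N" "near_lattice_point \<rho> k \<xi>" by blast
    define R where "R = (4 :: real) ^ fst k"
    have R: "R \<ge> 1" by (simp add: R_def)
    have "norm \<xi> \<le> real CARD('n) * (2 * R)"
    proof (rule norm_le_card_component)
      fix i
      have "0 < 3 / 4 * (4 :: real) ^ fst k" by simp
      then show "\<bar>\<xi> $ i\<bar> \<le> 2 * R" using near_lattice_point_shell[OF k, of i] unfolding R_def by linarith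
    qed
    moreover have "jbracket \<xi> \<le> 1 + norm \<xi>"
      unfolding jbracket_def by (rule real_le_lsqrt) (auto simp: power2_eq_square algebra_simps)
    ultimately have "jbracket \<xi> \<le> ?D * R" using R by (simp add: algebra_simps)
    then have 1: "jbracket \<xi> powr ?e \<le> (?D * R) powr ?e"
      using e jbracket_pos[of \<xi>] by (intro powr_mono2) auto
    have "norm (\<Prod>i\<in>UNIV. lattice_bump c \<rho> k i (\<xi> $ i)) \<le> (\<Prod>i\<in>(UNIV::'n set). B)"
      unfolding prod_norm[symmetric]
    proof (intro prod_mono conjI norm_ge_zero)
      fix i
      have "c i \<le> L" unfolding c[symmetric] by (rule member_le_sum) auto
      then show "norm (lattice_bump c \<rho> k i (\<xi> $ i)) \<le> B" using B(2) by (simp add: lattice_bump_def)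
    qed
    moreover have "norm (lattice_coeff c \<rho> x k) = R powr ?m * (4 / R powr \<rho>) ^ L"
    proof -
      have "norm (iexp (- (x \<bullet> lattice_point \<rho> k))) = 1" by simp
      then have "norm (lattice_coeff c \<rho> x k) = \<bar>lattice_weight \<rho> k * (4 / spacing \<rho> (fst k)) ^ L\<bar>"
        unfolding lattice_coeff_def norm_mult norm_of_real c by simp
      also have "\<dots> = lattice_weight \<rho> k * (4 / spacing \<rho> (fst k)) ^ L"
        using lattice_weight_pos[of \<rho> k] spacing_pos[of \<rho> "fst k"] by (intro abs_of_nonneg) simp
      finally show ?thesis by (simp only: lattice_weight_def spacing_def R_def)
    qed
    ultimately have 2: "norm (lattice_symbol c \<rho> x \<xi>) \<le> R powr ?m * (4 / R powr \<rho>) ^ L * B ^ CARD('n)"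
      unfolding lattice_symbol_near[OF k] norm_mult by (simp add: mult_left_mono)
    have "jbracket \<xi> powr ?e * norm (lattice_symbol c \<rho> x \<xi>) \<le> (?D * R) powr ?e * (R powr ?m * (4 / R powr \<rho>) ^ L * B ^ CARD('n))"
      by (intro mult_mono 1 2) auto
    also have "(4 / R powr \<rho>) ^ L = 4 ^ L * R powr (- (\<rho> * real L))"
      using R by (simp add: power_divide powr_minus_divide powr_powr powr_power mult.commute)
    also have "(?D * R) powr ?e * (R powr ?m * (4 ^ L * R powr (- (\<rho> * real L))) * B ^ CARD('n))
       = ?D powr ?e * (4 ^ L * B ^ CARD('n)) * (R powr ?e * R powr ?m * R powr (- (\<rho> * real L)))"
      using R by (simp only: powr_mult) (simp add: mult_ac)
    also have "R powr ?e * R powr ?m * R powr (- (\<rho> * real L)) = 1"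
      using R by (simp only: powr_add[symmetric]) simp
    finally show ?thesis by (simp only: mult_1_right)
  qed
  then show ?thesis by blast
qed

text \<open>Grade l consists of the symbols whose counts c sum to l; it is closed under
  differentiation, so the class condition reduces to the uniform bound for each total order.\<close>

lemma lattice_symbol_mem:
  "critical_symbol \<rho> \<in> (Linf_symbol (real CARD('n) / 2 * (\<rho> - 1)) \<rho> :: (real^'n \<Rightarrow> real^'n \<Rightarrow> complex) set)"
proof -
  define C where "C = (\<lambda>l. {h. \<exists>c :: 'n \<Rightarrow> nat. (\<Sum>i\<in>UNIV. c i) = l \<and> h = lattice_symbol c \<rho>})"
  have step: "\<exists>d. (\<forall>i. d i \<in> C (Suc l)) \<and> (\<forall>x \<xi>. (h x has_derivative (\<lambda>v. \<Sum>i\<in>UNIV. v $ i *\<^sub>R d i x \<xi>)) (at \<xi>))"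
    if h: "h \<in> C l" for h l
  proof -
    obtain c where c: "(\<Sum>i\<in>UNIV. c i) = l" "h = lattice_symbol c \<rho>" using h by (auto simp: C_def)
    have "lattice_symbol (c(i := Suc (c i))) \<rho> \<in> C (Suc l)" for i
    proof -
      have "(\<Sum>j\<in>UNIV. (c(i := Suc (c i))) j) = Suc l"
        unfolding c(1)[symmetric] by (simp add: sum.remove[of UNIV i])
      then show ?thesis unfolding C_def mem_Collect_eq by (intro exI[of _ "c(i := Suc (c i))"] conjI refl)
    qed
    then show ?thesis using lattice_symbol_has_derivative[of c]
      by (intro exI[of _ "\<lambda>i. lattice_symbol (c(i := Suc (c i))) \<rho>"]) (simp only: c(2), blast)
  qed
  have a0: "critical_symbol \<rho> \<in> C 0" by (auto simp: C_def intro!: exI[of _ "\<lambda>_. 0"])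
  have meas: "(\<lambda>x :: real^'n. lattice_symbol c \<rho> x \<xi>) \<in> borel_measurable lebesgue" for c \<xi>
    by (intro measurable_completion) (use borel_measurable_continuous_onI[OF continuous_lattice_symbol_x] in simp)
  let ?m = "real CARD('n) / 2 * (\<rho> - 1)"
  show ?thesis unfolding Linf_symbol_def mem_Collect_eq
  proof (intro conjI allI meas)
    show "smooth_on UNIV (critical_symbol \<rho> x)" for x :: "real^'n" by (rule graded_derivatives(1)[OF step a0])
    fix \<alpha> :: "'n multi_index"
    have "(\<lambda>x. mderiv \<alpha> (critical_symbol \<rho> x)) \<in> C (0 + mi_order \<alpha>)" by (rule graded_derivatives(2)[OF step a0])
    then obtain c where c: "(\<Sum>i\<in>UNIV. c i) = mi_order \<alpha>" "(\<lambda>x. mderiv \<alpha> (critical_symbol \<rho> x)) = lattice_symbol c \<rho>"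
      by (auto simp: C_def)
    have md: "mderiv \<alpha> (critical_symbol \<rho> x) = lattice_symbol c \<rho> x" for x using c(2) by (rule fun_cong)
    obtain K where K: "\<forall>c (x :: real^'n) \<xi>. (\<Sum>i\<in>UNIV. c i) = mi_order \<alpha> \<longrightarrow>
      jbracket \<xi> powr (- ?m + \<rho> * real (mi_order \<alpha>)) * norm (lattice_symbol c \<rho> x \<xi>) \<le> K"
      using lattice_symbol_bound[where 'n='n and L="mi_order \<alpha>"] by (elim exE) (rule that; assumption)
    have "(SUP \<xi>. ereal (jbracket \<xi> powr (- ?m + \<rho> * real (mi_order \<alpha>))) *
        esssup lebesgue (\<lambda>x :: real^'n. ereal (norm (lattice_symbol c \<rho> x \<xi>)))) \<le> ereal K"
    proof (rule SUP_least)
      fix \<xi> :: "real^'n"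
      let ?J = "jbracket \<xi> powr (- ?m + \<rho> * real (mi_order \<alpha>))"
      have J: "?J > 0" using jbracket_pos[of \<xi>] by simp
      have "esssup lebesgue (\<lambda>x :: real^'n. ereal (norm (lattice_symbol c \<rho> x \<xi>))) \<le> ereal (K / ?J)"
      proof (rule esssup_I)
        show "(\<lambda>x :: real^'n. ereal (norm (lattice_symbol c \<rho> x \<xi>))) \<in> borel_measurable lebesgue" using meas by measurable
        have "norm (lattice_symbol c \<rho> x \<xi>) \<le> K / ?J" for x
          using K[rule_format, OF c(1), of \<xi> x] J by (simp add: pos_le_divide_eq mult.commute)
        then show "AE x in lebesgue. ereal (norm (lattice_symbol c \<rho> x \<xi>)) \<le> ereal (K / ?J)" by simp
      qed
      then have "ereal ?J * esssup lebesgue (\<lambda>x :: real^'n. ereal (norm (lattice_symbol c \<rho> x \<xi>))) \<le> ereal ?J * ereal (K / ?J)"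
        by (rule ereal_mult_left_mono) (use J in simp)
      also have "\<dots> = ereal K" using J by simp
      finally show "ereal ?J * esssup lebesgue (\<lambda>x :: real^'n. ereal (norm (lattice_symbol c \<rho> x \<xi>))) \<le> ereal K" .
    qed
    also have "\<dots> < \<infinity>" by simp
    finally show "(SUP \<xi>. ereal (jbracket \<xi> powr (- ?m + \<rho> * real (mi_order \<alpha>))) *
        esssup lebesgue (\<lambda>x :: real^'n. ereal (norm (mderiv \<alpha> (critical_symbol \<rho> x) \<xi>)))) < \<infinity>" by (simp only: md)
  qed
qed

text \<open>Put t = R^(1 - \<rho>), at least 1. Its integer part is at least t/2, so a shell has at
  least (t/2)^n points, each with squared weight t^(-n): every shell contributes at least
  2^(-n).\<close>

lemma lattice_weights_sum:
  "real N / 2 ^ CARD('n) \<le> (\<Sum>k\<in>(lattice_index \<rho> N :: (nat \<times> ('n::finite \<Rightarrow> nat)) set). (lattice_weight \<rho> k)\<^sup>2)"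
proof -
  let ?n = "real CARD('n)"
  have fin: "finite {l :: 'n \<Rightarrow> nat. \<forall>i. l i < mesh \<rho> j}" and card: "card {l :: 'n \<Rightarrow> nat. \<forall>i. l i < mesh \<rho> j} = mesh \<rho> j ^ CARD('n)" for j
  proof -
    have "{l :: 'n \<Rightarrow> nat. \<forall>i. l i < mesh \<rho> j} = PiE UNIV (\<lambda>_. {..<mesh \<rho> j})" by (auto simp: PiE_UNIV_domain)
    then show "finite {l :: 'n \<Rightarrow> nat. \<forall>i. l i < mesh \<rho> j}" "card {l :: 'n \<Rightarrow> nat. \<forall>i. l i < mesh \<rho> j} = mesh \<rho> j ^ CARD('n)"
      by (simp_all add: finite_PiE card_PiE)
  qed
  have "(\<Sum>k\<in>(lattice_index \<rho> N :: (nat \<times> ('n \<Rightarrow> nat)) set). (lattice_weight \<rho> k)\<^sup>2)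
    = (\<Sum>j<N. \<Sum>l\<in>{l :: 'n \<Rightarrow> nat. \<forall>i. l i < mesh \<rho> j}. (lattice_weight \<rho> (j, l))\<^sup>2)"
    unfolding lattice_index_def by (subst sum.Sigma) (use fin in \<open>auto simp: case_prod_unfold\<close>)
  also have "\<dots> = (\<Sum>j<N. real (mesh \<rho> j) ^ CARD('n) * ((4 ^ j) powr (?n / 2 * (\<rho> - 1)))\<^sup>2)"
    by (simp add: lattice_weight_def card)
  also have "\<dots> \<ge> (\<Sum>j<N. (1 / 2) ^ CARD('n))"
  proof (rule sum_mono)
    fix j
    define R where "R = (4 :: real) ^ j"
    have R: "R \<ge> 1" by (simp add: R_def)
    define t where "t = R powr (1 - \<rho>)"
    have t: "t \<ge> 1" using R \<rho> by (simp add: t_def ge_one_powr_ge_zero)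
    have "R / spacing \<rho> j = t" using R by (simp add: t_def spacing_def R_def powr_diff)
    then have "real (mesh \<rho> j) = real_of_int \<lfloor>t\<rfloor>" using t by (simp add: mesh_def R_def[symmetric])
    moreover have "1 \<le> \<lfloor>t\<rfloor>" "t < real_of_int \<lfloor>t\<rfloor> + 1" using t by auto
    ultimately have "real (mesh \<rho> j) \<ge> t / 2" by linarith
    then have "(t / 2) ^ CARD('n) * R powr (?n * (\<rho> - 1)) \<le> real (mesh \<rho> j) ^ CARD('n) * R powr (?n * (\<rho> - 1))"
      using t by (intro mult_right_mono power_mono) auto
    moreover have "t ^ CARD('n) * R powr (?n * (\<rho> - 1)) = 1"
    proof -
      have "t ^ CARD('n) = R powr ((1 - \<rho>) * ?n)" using R by (simp add: t_def powr_power mult.commute)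
      moreover have "(1 - \<rho>) * ?n + ?n * (\<rho> - 1) = 0" by (simp add: algebra_simps)
      ultimately show ?thesis using R by (simp only: powr_add[symmetric]) simp
    qed
    then have "(t / 2) ^ CARD('n) * R powr (?n * (\<rho> - 1)) = (1 / 2) ^ CARD('n)" by (simp add: power_divide)
    moreover have "(R powr (?n / 2 * (\<rho> - 1)))\<^sup>2 = R powr (?n * (\<rho> - 1))" using R by (simp add: powr_power)
    ultimately show "(1 / 2) ^ CARD('n) \<le> real (mesh \<rho> j) ^ CARD('n) * ((4 ^ j) powr (?n / 2 * (\<rho> - 1)))\<^sup>2"
      unfolding R_def by simp
  qed
  finally show ?thesis by (simp add: power_divide)
qed

end

section \<open>Unboundedness at the critical order\<close>

lemma lborel_affine_vec:
  fixes t :: "real^'n"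
  shows "c \<noteq> 0 \<Longrightarrow> lborel = density (distr lborel borel (\<lambda>x. t + c *\<^sub>R x)) (\<lambda>_. ennreal (\<bar>c\<bar> ^ CARD('n)))"
  using lborel_affine[of c t] by (simp add: ennreal_power)

lemma lborel_integral_affine:
  fixes f :: "real^'n \<Rightarrow> 'b::{banach, second_countable_topology}"
  assumes f: "f \<in> borel_measurable borel" and c: "c \<noteq> 0"
  shows "(LINT x|lborel. f x) = \<bar>c\<bar> ^ CARD('n) *\<^sub>R (LINT x|lborel. f (t + c *\<^sub>R x))"
  using f by (subst lborel_affine_vec[OF c, of t]) (simp add: integral_density integral_distr)

lemma lborel_nn_integral_scale:
  fixes f :: "real^'n \<Rightarrow> ennreal"
  assumes f: "f \<in> borel_measurable borel" and c: "c > 0"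
  shows "(\<integral>\<^sup>+x. f (c *\<^sub>R x) \<partial>lborel) = ennreal (1 / c ^ CARD('n)) * (\<integral>\<^sup>+x. f x \<partial>lborel)"
proof -
  have "(\<integral>\<^sup>+x. f x \<partial>lborel) = ennreal (c ^ CARD('n)) * (\<integral>\<^sup>+x. f (c *\<^sub>R x) \<partial>lborel)"
    using f c by (subst lborel_affine_vec[of c 0]) (simp_all add: nn_integral_density nn_integral_distr nn_integral_cmult)
  then have "ennreal (1 / c ^ CARD('n)) * (\<integral>\<^sup>+x. f x \<partial>lborel) = ennreal (1 / c ^ CARD('n) * c ^ CARD('n)) * (\<integral>\<^sup>+x. f (c *\<^sub>R x) \<partial>lborel)"
    using c by (subst ennreal_mult) (simp_all add: mult.assoc)
  then show ?thesis using c by simp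
qed

lemma integrable_gaussian:
  assumes "s > 0" shows "integrable lborel (\<lambda>x :: real^'n. exp (- s * (norm x)\<^sup>2 / 2))"
    "(LINT x|lborel. exp (- s * (norm (x :: real^'n))\<^sup>2 / 2)) = sqrt (2 * pi / s) ^ CARD('n)"
proof -
  have i: "integrable lborel (\<lambda>x :: real^'n. complex_of_real (exp (- s * (norm x)\<^sup>2 / 2)))" using gaussian_fourier(1)[OF assms, of 0] by simp
  then show "integrable lborel (\<lambda>x :: real^'n. exp (- s * (norm x)\<^sup>2 / 2))" using integrable_Re[OF i] by simp
  have "complex_of_real (LINT x|lborel. exp (- s * (norm (x :: real^'n))\<^sup>2 / 2)) = (LINT x|lborel. complex_of_real (exp (- s * (norm (x :: real^'n))\<^sup>2 / 2)))"
    by (rule integral_complex_of_real[symmetric])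
  also have "\<dots> = complex_of_real (sqrt (2 * pi / s) ^ CARD('n))"
    using gaussian_fourier(2)[OF assms, of "0 :: real^'n"] by simp
  finally have "complex_of_real (LINT x|lborel. exp (- s * (norm (x :: real^'n))\<^sup>2 / 2)) = complex_of_real (sqrt (2 * pi / s) ^ CARD('n))" .
  then show "(LINT x|lborel. exp (- s * (norm (x :: real^'n))\<^sup>2 / 2)) = sqrt (2 * pi / s) ^ CARD('n)" by (simp only: of_real_eq_iff)
qed

text \<open>Test functions concentrate at the lattice points in frequency as the scale \<open>\<tau>\<close> grows.\<close>

definition test_function :: "real \<Rightarrow> nat \<Rightarrow> real \<Rightarrow> real^'n \<Rightarrow> complex" where
  "test_function \<rho> N \<tau> x = (\<Sum>k\<in>lattice_index \<rho> N. of_real (lattice_weight \<rho> k) *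
     (iexp (lattice_point \<rho> k \<bullet> x) * complex_of_real (exp (- (1 / \<tau>\<^sup>2) * (norm x)\<^sup>2 / 2))))"

lemma test_function_schwartz: "\<tau> > 0 \<Longrightarrow> test_function \<rho> N \<tau> \<in> schwartz"
  unfolding test_function_def[abs_def] by (rule gaussian_sum_schwartz) simp

lemma test_function_measurable [measurable]: "test_function \<rho> N \<tau> \<in> borel_measurable borel"
  unfolding test_function_def[abs_def] by measurable

lemma test_function_fourier:
  fixes \<xi> :: "real^'n"
  assumes \<tau>: "\<tau> > 0"
  shows "fourier_transform (test_function \<rho> N \<tau>) \<xi> = (\<Sum>k\<in>lattice_index \<rho> N. of_real (lattice_weight \<rho> k) *
     complex_of_real ((sqrt (2 * pi) * \<tau>) ^ CARD('n) * exp (- \<tau>\<^sup>2 * (norm (lattice_point \<rho> k - \<xi>))\<^sup>2 / 2)))"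
proof -
  have s: "1 / \<tau>\<^sup>2 > 0" using \<tau> by simp
  let ?g = "\<lambda>k x. iexp ((lattice_point \<rho> k - \<xi>) \<bullet> x) * complex_of_real (exp (- (1 / \<tau>\<^sup>2) * (norm x)\<^sup>2 / 2))"
  have e: "iexp (P \<bullet> x) * iexp (-1 * (x \<bullet> \<xi>)) = iexp ((P - \<xi>) \<bullet> x)" for P x :: "real^'n"
    by (simp add: exp_add[symmetric] inner_diff_left inner_commute algebra_simps)
  have "test_function \<rho> N \<tau> x * iexp (-1 * (x \<bullet> \<xi>)) = (\<Sum>k\<in>lattice_index \<rho> N. of_real (lattice_weight \<rho> k) * ?g k x)" for x
    unfolding test_function_def sum_distrib_right e[symmetric] by (intro sum.cong refl) (simp only: mult_ac)
  then have "fourier_transform (test_function \<rho> N \<tau>) \<xi> = (LINT x|lborel. (\<Sum>k\<in>lattice_index \<rho> N. of_real (lattice_weight \<rho> k) * ?g k x))"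
    by (simp only: fourier_transform_lborel[OF test_function_measurable])
  also have "\<dots> = (\<Sum>k\<in>lattice_index \<rho> N. of_real (lattice_weight \<rho> k) * (LINT x|lborel. ?g k x))"
    by (subst Bochner_Integration.integral_sum, rule integrable_mult_right, rule gaussian_fourier(1)[OF s], simp only: integral_mult_right_zero)
  also have "\<dots> = (\<Sum>k\<in>lattice_index \<rho> N. of_real (lattice_weight \<rho> k) *
     complex_of_real (sqrt (2 * pi / (1 / \<tau>\<^sup>2)) ^ CARD('n) * exp (- (norm (lattice_point \<rho> k - \<xi>))\<^sup>2 / (2 * (1 / \<tau>\<^sup>2)))))"
    by (simp only: gaussian_fourier(2)[OF s])
  also have "sqrt (2 * pi / (1 / \<tau>\<^sup>2)) = sqrt (2 * pi) * \<tau>" using \<tau> by (simp add: real_sqrt_mult)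
  finally show ?thesis by (simp add: mult.commute)
qed

context
  fixes \<rho> :: real assumes \<rho>: "0 \<le> \<rho>" "\<rho> \<le> 1"
begin

text \<open>The critical order is not positive. The bound supplies the integrable majorants for the
  Gaussian integrals below.\<close>

lemma lattice_symbol_bounded:
  obtains B where "\<And>x \<xi> :: real^'n. norm (critical_symbol \<rho> x \<xi>) \<le> B"
proof -
  let ?m = "real CARD('n) / 2 * (\<rho> - 1)"
  have m: "?m \<le> 0" using \<rho> by (intro mult_nonneg_nonpos) auto
  obtain K where K: "\<forall>c (x :: real^'n) \<xi>. (\<Sum>i\<in>UNIV. c i) = 0 \<longrightarrow>
      jbracket \<xi> powr (- ?m + \<rho> * real 0) * norm (lattice_symbol c \<rho> x \<xi>) \<le> K"
    using lattice_symbol_bound[OF \<rho>, where 'n='n and L=0] by (elim exE) (rule that; assumption)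
  have "norm (critical_symbol \<rho> x \<xi>) \<le> K" for x \<xi> :: "real^'n"
  proof -
    have "1 \<le> jbracket \<xi>" by (simp add: jbracket_def)
    then have "1 \<le> jbracket \<xi> powr (- ?m + \<rho> * real 0)" using m by (intro ge_one_powr_ge_zero) auto
    then have "1 * norm (critical_symbol \<rho> x \<xi>) \<le> jbracket \<xi> powr (- ?m + \<rho> * real 0) * norm (critical_symbol \<rho> x \<xi>)"
      by (rule mult_right_mono) simp
    also have "\<dots> \<le> K" using K[rule_format, of "\<lambda>_. 0" \<xi> x] by simp
    finally show ?thesis by simp
  qed
  then show ?thesis by (rule that)
qed

lemma continuous_lattice_symbol: "continuous_on UNIV (lattice_symbol c \<rho> (x :: real^'n))"
  using lattice_symbol_has_derivative[OF \<rho>] has_derivative_continuous by (intro continuous_at_imp_continuous_on) blast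

lemma lattice_symbol_joint:
  "(\<lambda>(x :: real^'n, \<xi>). lattice_symbol c \<rho> x \<xi>) \<in> borel_measurable (lborel \<Otimes>\<^sub>M lborel)"
  by (rule Caratheodory_measurable[OF _ continuous_lattice_symbol])
    (use borel_measurable_continuous_onI[OF continuous_lattice_symbol_x[OF \<rho>]] in simp)

text \<open>Around each lattice point the frequency is rescaled by 1/\<tau>, which makes the
  Gaussian independent of \<tau> and moves \<tau> into the symbol and the phase, where the limit can
  be taken.\<close>

lemma FIO_test_function:
  fixes x :: "real^'n"
  assumes \<tau>: "\<tau> > 0"
  shows "FIO (critical_symbol \<rho>) (\<bullet>) (test_function \<rho> N \<tau>) x = complex_of_real (sqrt (2 * pi) ^ CARD('n) / (2 * pi) ^ CARD('n)) *
     (\<Sum>k\<in>lattice_index \<rho> N. of_real (lattice_weight \<rho> k) * (LINT \<eta>|lborel.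
        critical_symbol \<rho> x (lattice_point \<rho> k + (1 / \<tau>) *\<^sub>R \<eta>) * iexp (x \<bullet> (lattice_point \<rho> k + (1 / \<tau>) *\<^sub>R \<eta>)) *
        complex_of_real (exp (- (norm \<eta>)\<^sup>2 / 2))))"
proof -
  let ?a = "critical_symbol \<rho> x"
  have am [measurable]: "?a \<in> borel_measurable borel" by (rule borel_measurable_continuous_onI[OF continuous_lattice_symbol])
  obtain B where B: "\<And>x \<xi> :: real^'n. norm (critical_symbol \<rho> x \<xi>) \<le> B" using lattice_symbol_bounded by blast
  define T where "T = complex_of_real ((sqrt (2 * pi) * \<tau>) ^ CARD('n))"
  define f where "f k \<xi> = ?a \<xi> * iexp (x \<bullet> \<xi>) * complex_of_real (exp (- \<tau>\<^sup>2 * (norm (lattice_point \<rho> k - \<xi>))\<^sup>2 / 2))" for k \<xi>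
  have fm [measurable]: "f k \<in> borel_measurable borel" for k unfolding f_def by measurable
  have fint: "integrable lborel (f k)" for k
  proof -
    have "integrable lborel (\<lambda>\<xi>. B * exp (- \<tau>\<^sup>2 * (norm (lattice_point \<rho> k - \<xi>))\<^sup>2 / 2))"
    proof -
      have "integrable lborel (\<lambda>x :: real^'n. exp (- \<tau>\<^sup>2 * (norm x)\<^sup>2 / 2))" using \<tau> by (intro integrable_gaussian) simp
      then have "integrable (density (distr lborel borel (\<lambda>\<xi>. lattice_point \<rho> k + (-1) *\<^sub>R \<xi>)) (\<lambda>_. ennreal (\<bar>-1\<bar> ^ CARD('n)))) (\<lambda>x :: real^'n. exp (- \<tau>\<^sup>2 * (norm x)\<^sup>2 / 2))"
        by (subst lborel_affine_vec[symmetric]) simp_all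
      then have "integrable lborel (\<lambda>\<xi>. exp (- \<tau>\<^sup>2 * (norm (lattice_point \<rho> k - \<xi>))\<^sup>2 / 2))"
        by (simp add: density_1 integrable_distr_eq)
      then show ?thesis by simp
    qed
    then show ?thesis
    proof (rule Bochner_Integration.integrable_bound)
      show "AE \<xi> in lborel. norm (f k \<xi>) \<le> norm (B * exp (- \<tau>\<^sup>2 * (norm (lattice_point \<rho> k - \<xi>))\<^sup>2 / 2))"
        using B[of x] order_trans[OF norm_ge_zero B[of x]] by (intro AE_I2) (simp add: f_def norm_mult mult_right_mono)
    qed simp
  qed
  have "FIO (critical_symbol \<rho>) (\<bullet>) (test_function \<rho> N \<tau>) x = complex_of_real (1 / (2 * pi) ^ CARD('n)) *
     (LINT \<xi>|lborel. ?a \<xi> * iexp (x \<bullet> \<xi>) * fourier_transform (test_function \<rho> N \<tau>) \<xi>)"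
    unfolding FIO_def test_function_fourier[OF \<tau>] by (subst integral_completion) measurable
  also have "(LINT \<xi>|lborel. ?a \<xi> * iexp (x \<bullet> \<xi>) * fourier_transform (test_function \<rho> N \<tau>) \<xi>)
     = (LINT \<xi>|lborel. (\<Sum>k\<in>lattice_index \<rho> N. T * of_real (lattice_weight \<rho> k) * f k \<xi>))"
    unfolding test_function_fourier[OF \<tau>] sum_distrib_left
    by (intro Bochner_Integration.integral_cong sum.cong refl) (simp only: f_def T_def of_real_mult mult_ac)
  also have "\<dots> = (\<Sum>k\<in>lattice_index \<rho> N. T * of_real (lattice_weight \<rho> k) * (LINT \<xi>|lborel. f k \<xi>))"
    by (subst Bochner_Integration.integral_sum) (auto intro!: integrable_mult_right fint)
  also have "\<dots> = (\<Sum>k\<in>lattice_index \<rho> N. complex_of_real (sqrt (2 * pi) ^ CARD('n)) * (of_real (lattice_weight \<rho> k) * (LINT \<eta>|lborel.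
        ?a (lattice_point \<rho> k + (1 / \<tau>) *\<^sub>R \<eta>) * iexp (x \<bullet> (lattice_point \<rho> k + (1 / \<tau>) *\<^sub>R \<eta>)) * complex_of_real (exp (- (norm \<eta>)\<^sup>2 / 2)))))"
  proof (intro sum.cong refl)
    fix k
    have "(LINT \<xi>|lborel. f k \<xi>) = \<bar>1 / \<tau>\<bar> ^ CARD('n) *\<^sub>R (LINT \<eta>|lborel. f k (lattice_point \<rho> k + (1 / \<tau>) *\<^sub>R \<eta>))"
      using \<tau> by (intro lborel_integral_affine fm) simp
    moreover have "f k (lattice_point \<rho> k + (1 / \<tau>) *\<^sub>R \<eta>) = ?a (lattice_point \<rho> k + (1 / \<tau>) *\<^sub>R \<eta>) * iexp (x \<bullet> (lattice_point \<rho> k + (1 / \<tau>) *\<^sub>R \<eta>)) * complex_of_real (exp (- (norm \<eta>)\<^sup>2 / 2))" for \<eta>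
    proof -
      have "- \<tau>\<^sup>2 * (norm (lattice_point \<rho> k - (lattice_point \<rho> k + (1 / \<tau>) *\<^sub>R \<eta>)))\<^sup>2 / 2 = - (norm \<eta>)\<^sup>2 / 2"
        using \<tau> by (simp add: power_divide)
      then show ?thesis by (simp only: f_def)
    qed
    \<comment> \<open>The Jacobian \<tau>^(-n) cancels the \<tau>^n in the Fourier transform of the
      wide Gaussian.\<close>
    moreover have "T * of_real w * (\<bar>1 / \<tau>\<bar> ^ CARD('n) *\<^sub>R I) = complex_of_real (sqrt (2 * pi) ^ CARD('n)) * (of_real w * I)" for w :: real and I :: complex
      using \<tau> by (simp add: T_def power_mult_distrib power_divide scaleR_conv_of_real)
    ultimately show "T * of_real (lattice_weight \<rho> k) * (LINT \<xi>|lborel. f k \<xi>) = complex_of_real (sqrt (2 * pi) ^ CARD('n)) * (of_real (lattice_weight \<rho> k) * (LINT \<eta>|lborel.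
        ?a (lattice_point \<rho> k + (1 / \<tau>) *\<^sub>R \<eta>) * iexp (x \<bullet> (lattice_point \<rho> k + (1 / \<tau>) *\<^sub>R \<eta>)) * complex_of_real (exp (- (norm \<eta>)\<^sup>2 / 2))))"
      by (simp only:)
  qed
  finally show ?thesis unfolding sum_distrib_left[symmetric] by (simp only: mult.assoc[symmetric] of_real_mult[symmetric]) simp
qed

lemma FIO_test_function_measurable:
  assumes \<tau>: "\<tau> > 0"
  shows "FIO (critical_symbol \<rho>) (\<bullet>) (test_function \<rho> N \<tau> :: real^'n \<Rightarrow> complex) \<in> borel_measurable borel"
proof -
  have [measurable]: "(\<lambda>q. critical_symbol \<rho> (fst q) (snd q)) \<in> borel_measurable ((lborel :: (real^'n) measure) \<Otimes>\<^sub>M lborel)"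
    using lattice_symbol_joint by (simp add: case_prod_unfold)
  have [measurable]: "critical_symbol \<rho> (x :: real^'n) \<in> borel_measurable borel" for x by (rule borel_measurable_continuous_onI[OF continuous_lattice_symbol])
  let ?U = "fourier_transform (test_function \<rho> N \<tau>)"
  have [measurable]: "?U \<in> borel_measurable (borel :: (real^'n) measure)"
    unfolding test_function_fourier[OF \<tau>, abs_def] by measurable
  have "FIO (critical_symbol \<rho>) (\<bullet>) (test_function \<rho> N \<tau>) = (\<lambda>x :: real^'n. complex_of_real (1 / (2 * pi) ^ CARD('n)) *
     (LINT \<xi>|lborel. critical_symbol \<rho> x \<xi> * iexp (x \<bullet> \<xi>) * ?U \<xi>))"
    unfolding FIO_def[abs_def] by (subst integral_completion) measurable
  moreover have "(\<lambda>x :: real^'n. LINT \<xi>|lborel. critical_symbol \<rho> x \<xi> * iexp (x \<bullet> \<xi>) * ?U \<xi>) \<in> borel_measurable lborel"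
    by (rule lborel.borel_measurable_lebesgue_integral) (unfold case_prod_unfold, measurable)
  ultimately show ?thesis by simp
qed

text \<open>At the point \<tau> y the symbol cancels the oscillation belonging to each lattice point
  and leaves exp(i y . \<eta>), which integrates to the same Gaussian in y for all of them. One
  factor of the squared weight comes from the test function, the other from the symbol.\<close>

lemma FIO_test_function_tendsto:
  fixes y :: "real^'n"
  shows "(\<lambda>t. FIO (critical_symbol \<rho>) (\<bullet>) (test_function \<rho> N (real (Suc t))) (real (Suc t) *\<^sub>R y))
    \<longlonglongrightarrow> complex_of_real ((\<Sum>k\<in>(lattice_index \<rho> N :: (nat \<times> ('n \<Rightarrow> nat)) set). (lattice_weight \<rho> k)\<^sup>2) * bump 0 0 ^ CARD('n) * exp (- (norm y)\<^sup>2 / 2))"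
proof -
  let ?a = "critical_symbol \<rho>"
  let ?\<tau> = "\<lambda>t. real (Suc t)"
  let ?b = "bump 0 0 ^ CARD('n)"
  have [measurable]: "?a (x :: real^'n) \<in> borel_measurable borel" for x by (rule borel_measurable_continuous_onI[OF continuous_lattice_symbol])
  obtain B where B: "\<And>x \<xi> :: real^'n. norm (?a x \<xi>) \<le> B" using lattice_symbol_bounded by blast
  have lim0: "(\<lambda>t. (1 / ?\<tau> t) *\<^sub>R \<eta>) \<longlonglongrightarrow> 0" for \<eta> :: "real^'n"
    using tendsto_scaleR[OF LIMSEQ_inverse_real_of_nat tendsto_const, of \<eta>] by (simp add: inverse_eq_divide)
  define h where "h k t \<eta> = ?a (?\<tau> t *\<^sub>R y) (lattice_point \<rho> k + (1 / ?\<tau> t) *\<^sub>R \<eta>) * iexp (?\<tau> t *\<^sub>R y \<bullet> (lattice_point \<rho> k + (1 / ?\<tau> t) *\<^sub>R \<eta>)) *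
        complex_of_real (exp (- (norm \<eta>)\<^sup>2 / 2))" for k t \<eta>
  have "(\<lambda>t. LINT \<eta>|lborel. h k t \<eta>) \<longlonglongrightarrow> (LINT \<eta>|lborel. complex_of_real (lattice_weight \<rho> k * ?b) * (iexp (y \<bullet> \<eta>) * complex_of_real (exp (- 1 * (norm \<eta>)\<^sup>2 / 2))))"
    if k: "k \<in> lattice_index \<rho> N" for k :: "nat \<times> ('n \<Rightarrow> nat)"
  proof (rule integral_dominated_convergence[where w="\<lambda>\<eta>. B * exp (- 1 * (norm \<eta>)\<^sup>2 / 2)"])
    show "integrable lborel (\<lambda>\<eta> :: real^'n. B * exp (- 1 * (norm \<eta>)\<^sup>2 / 2))"
      by (intro integrable_mult_right integrable_gaussian) simp
    show "AE \<eta> in lborel. norm (h k t \<eta>) \<le> B * exp (- 1 * (norm \<eta>)\<^sup>2 / 2)" for t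
      using B by (intro AE_I2) (simp add: h_def norm_mult mult_right_mono)
    show "AE \<eta> in lborel. (\<lambda>t. h k t \<eta>) \<longlonglongrightarrow> complex_of_real (lattice_weight \<rho> k * ?b) * (iexp (y \<bullet> \<eta>) * complex_of_real (exp (- 1 * (norm \<eta>)\<^sup>2 / 2)))"
    proof (rule AE_I2)
      fix \<eta> :: "real^'n"
      let ?p = "\<lambda>t. lattice_point \<rho> k + (1 / ?\<tau> t) *\<^sub>R \<eta>"
      have pl: "?p \<longlonglongrightarrow> lattice_point \<rho> k" using tendsto_add[OF tendsto_const lim0[of \<eta>], of "lattice_point \<rho> k"] by simp
      have "eventually (\<lambda>t. ?p t \<in> {\<xi>. near_lattice_point \<rho> k \<xi>}) sequentially"
        using topological_tendstoD[OF pl open_near_lattice_point] near_lattice_point_self by blast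
      then have ev: "eventually (\<lambda>t. complex_of_real (lattice_weight \<rho> k) * (\<Prod>i\<in>UNIV. lattice_bump (\<lambda>_. 0) \<rho> k i (?p t $ i)) *
          (iexp (y \<bullet> \<eta>) * complex_of_real (exp (- 1 * (norm \<eta>)\<^sup>2 / 2))) = h k t \<eta>) sequentially"
      proof eventually_elim
        case (elim t)
        have near: "near_lattice_point \<rho> k (?p t)" using elim by simp
        have 1: "?a (?\<tau> t *\<^sub>R y) (?p t) = complex_of_real (lattice_weight \<rho> k) * iexp (- (?\<tau> t *\<^sub>R y \<bullet> lattice_point \<rho> k)) * (\<Prod>i\<in>UNIV. lattice_bump (\<lambda>_. 0) \<rho> k i (?p t $ i))"
          unfolding lattice_symbol_near[OF \<rho> k near] lattice_coeff_def by simp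
        \<comment> \<open>The factor \<tau> of the space variable and the 1/\<tau> of the frequency
          shift cancel, so the remaining phase does not depend on \<tau>.\<close>
        have "- (?\<tau> t *\<^sub>R y \<bullet> lattice_point \<rho> k) + ?\<tau> t *\<^sub>R y \<bullet> ?p t = y \<bullet> \<eta>" by (simp add: inner_add_right field_simps del: of_nat_Suc)
        then have "iexp (- (?\<tau> t *\<^sub>R y \<bullet> lattice_point \<rho> k)) * iexp (?\<tau> t *\<^sub>R y \<bullet> ?p t) = iexp (y \<bullet> \<eta>)"
          by (simp only: exp_add[symmetric] distrib_left[symmetric] of_real_add[symmetric])
        then show ?case unfolding h_def 1 by (simp add: mult_ac)
      qed
      have "(\<lambda>t. \<Prod>i\<in>UNIV. lattice_bump (\<lambda>_. 0) \<rho> k i (?p t $ i)) \<longlonglongrightarrow> (\<Prod>i\<in>(UNIV::'n set). complex_of_real (bump 0 0))"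
      proof (rule tendsto_prod)
        fix i
        have l: "(\<lambda>t. 4 * (?p t $ i - lattice_point \<rho> k $ i) / spacing \<rho> (fst k)) \<longlonglongrightarrow> 4 * (lattice_point \<rho> k $ i - lattice_point \<rho> k $ i) / spacing \<rho> (fst k)"
          by (intro tendsto_intros tendsto_vec_nth[OF pl]) (simp add: less_imp_neq[OF spacing_pos, symmetric])
        have "isCont (bump 0) s" for s using bump_continuous by (simp add: continuous_on_eq_continuous_at)
        from isCont_tendsto_compose[OF this l]
        have "(\<lambda>t. bump 0 (4 * (?p t $ i - lattice_point \<rho> k $ i) / spacing \<rho> (fst k))) \<longlonglongrightarrow> bump 0 0"
          by (simp only: diff_self mult_zero_right div_0)
        then show "(\<lambda>t. lattice_bump (\<lambda>_. 0) \<rho> k i (?p t $ i)) \<longlonglongrightarrow> complex_of_real (bump 0 0)"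
          unfolding lattice_bump_def by (rule tendsto_of_real)
      qed
      then have "(\<lambda>t. complex_of_real (lattice_weight \<rho> k) * (\<Prod>i\<in>UNIV. lattice_bump (\<lambda>_. 0) \<rho> k i (?p t $ i)) *
          (iexp (y \<bullet> \<eta>) * complex_of_real (exp (- 1 * (norm \<eta>)\<^sup>2 / 2)))) \<longlonglongrightarrow> complex_of_real (lattice_weight \<rho> k) * (\<Prod>i\<in>(UNIV::'n set). complex_of_real (bump 0 0)) *
          (iexp (y \<bullet> \<eta>) * complex_of_real (exp (- 1 * (norm \<eta>)\<^sup>2 / 2)))"
        by (intro tendsto_mult tendsto_const)
      then have "(\<lambda>t. h k t \<eta>) \<longlonglongrightarrow> complex_of_real (lattice_weight \<rho> k) * (\<Prod>i\<in>(UNIV::'n set). complex_of_real (bump 0 0)) *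
          (iexp (y \<bullet> \<eta>) * complex_of_real (exp (- 1 * (norm \<eta>)\<^sup>2 / 2)))" by (rule Lim_transform_eventually[OF _ ev])
      then show "(\<lambda>t. h k t \<eta>) \<longlonglongrightarrow> complex_of_real (lattice_weight \<rho> k * ?b) * (iexp (y \<bullet> \<eta>) * complex_of_real (exp (- 1 * (norm \<eta>)\<^sup>2 / 2)))"
        by simp
    qed
  qed (unfold h_def, measurable)
  then have lim: "(\<lambda>t. LINT \<eta>|lborel. h k t \<eta>) \<longlonglongrightarrow> complex_of_real (lattice_weight \<rho> k * ?b * (sqrt (2 * pi) ^ CARD('n) * exp (- (norm y)\<^sup>2 / 2)))"
    if "k \<in> lattice_index \<rho> N" for k
    using that gaussian_fourier(2)[of 1 y] by (simp add: mult.assoc)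
  have "(\<lambda>t. complex_of_real (sqrt (2 * pi) ^ CARD('n) / (2 * pi) ^ CARD('n)) *
     (\<Sum>k\<in>lattice_index \<rho> N. of_real (lattice_weight \<rho> k) * (LINT \<eta>|lborel. h k t \<eta>)))
    \<longlonglongrightarrow> complex_of_real (sqrt (2 * pi) ^ CARD('n) / (2 * pi) ^ CARD('n)) *
     (\<Sum>k\<in>(lattice_index \<rho> N :: (nat \<times> ('n \<Rightarrow> nat)) set). of_real (lattice_weight \<rho> k) * complex_of_real (lattice_weight \<rho> k * ?b * (sqrt (2 * pi) ^ CARD('n) * exp (- (norm y)\<^sup>2 / 2))))"
    by (intro tendsto_mult tendsto_const tendsto_sum lim)
  also have "complex_of_real (sqrt (2 * pi) ^ CARD('n) / (2 * pi) ^ CARD('n)) *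
     (\<Sum>k\<in>(lattice_index \<rho> N :: (nat \<times> ('n \<Rightarrow> nat)) set). of_real (lattice_weight \<rho> k) * complex_of_real (lattice_weight \<rho> k * ?b * (sqrt (2 * pi) ^ CARD('n) * exp (- (norm y)\<^sup>2 / 2))))
    = complex_of_real ((\<Sum>k\<in>(lattice_index \<rho> N :: (nat \<times> ('n \<Rightarrow> nat)) set). (lattice_weight \<rho> k)\<^sup>2) * ?b * exp (- (norm y)\<^sup>2 / 2))"
  proof -
    define Q where "Q = sqrt (2 * pi) ^ CARD('n)"
    define E where "E = exp (- (norm y)\<^sup>2 / 2)"
    let ?F = "lattice_index \<rho> N :: (nat \<times> ('n \<Rightarrow> nat)) set" and ?w = "lattice_weight \<rho> :: nat \<times> ('n \<Rightarrow> nat) \<Rightarrow> real"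
    \<comment> \<open>One power of sqrt (2 pi)^n comes from the transform of the test function, one
      from the integral over \<eta>; together they cancel the normalization of the operator.\<close>
    have "sqrt (2 * pi) * sqrt (2 * pi) = 2 * pi" by simp
    then have "Q * Q = (2 * pi) ^ CARD('n)" unfolding Q_def by (simp only: power_mult_distrib[symmetric])
    then have q: "Q / (2 * pi) ^ CARD('n) * (Q * X) = X" for X by (simp only: times_divide_eq_left mult.assoc[symmetric]) simp
    have "(\<Sum>k\<in>?F. ?w k * (?w k * ?b * (Q * E))) = Q * ((\<Sum>k\<in>?F. (?w k)\<^sup>2) * ?b * E)"
      by (simp add: sum_distrib_left sum_distrib_right power2_eq_square mult_ac)
    then have "Q / (2 * pi) ^ CARD('n) * (\<Sum>k\<in>?F. ?w k * (?w k * ?b * (Q * E))) = (\<Sum>k\<in>?F. (?w k)\<^sup>2) * ?b * E"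
      by (simp only: q)
    from arg_cong[OF this, of complex_of_real] show ?thesis
      unfolding Q_def[symmetric] E_def[symmetric] by (simp only: of_real_mult of_real_sum)
  qed
  finally show ?thesis by (simp only: FIO_test_function of_nat_0_less_iff zero_less_Suc h_def)
qed

text \<open>In the rescaled variable the cross terms are Gaussian integrals at frequency \<tau>
  times the difference of two distinct lattice points, which tend to 0; the diagonal terms do not
  depend on \<tau>.\<close>

lemma test_function_L2:
  "integrable lborel (\<lambda>y :: real^'n. (norm (test_function \<rho> N (real (Suc t)) (real (Suc t) *\<^sub>R y)))\<^sup>2)"
  "(\<lambda>t. LINT y|lborel. (norm (test_function \<rho> N (real (Suc t)) (real (Suc t) *\<^sub>R (y :: real^'n))))\<^sup>2)
    \<longlonglongrightarrow> (\<Sum>k\<in>(lattice_index \<rho> N :: (nat \<times> ('n \<Rightarrow> nat)) set). (lattice_weight \<rho> k)\<^sup>2) * sqrt pi ^ CARD('n)"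
proof -
  let ?F = "lattice_index \<rho> N :: (nat \<times> ('n \<Rightarrow> nat)) set" and ?w = "lattice_weight \<rho> :: nat \<times> ('n \<Rightarrow> nat) \<Rightarrow> real" and ?P = "lattice_point \<rho>"
  let ?\<tau> = "\<lambda>t. real (Suc t)"
  let ?g = "\<lambda>t k l (y :: real^'n). iexp ((?\<tau> t *\<^sub>R (?P k - ?P l)) \<bullet> y) * complex_of_real (exp (- 2 * (norm y)\<^sup>2 / 2))"
  have pt: "complex_of_real ((norm (test_function \<rho> N (?\<tau> t) (?\<tau> t *\<^sub>R y)))\<^sup>2) = (\<Sum>k\<in>?F. \<Sum>l\<in>?F. of_real (?w k * ?w l) * ?g t k l y)" for t y
  proof -
    have e: "exp (- (1 / (?\<tau> t)\<^sup>2) * (norm (?\<tau> t *\<^sub>R y))\<^sup>2 / 2) = exp (- (norm y)\<^sup>2 / 2)" by (simp add: power_mult_distrib)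
    let ?c = "\<lambda>k. iexp (?P k \<bullet> (?\<tau> t *\<^sub>R y)) * complex_of_real (exp (- (norm y)\<^sup>2 / 2))"
    have u: "test_function \<rho> N (?\<tau> t) (?\<tau> t *\<^sub>R y) = (\<Sum>k\<in>?F. of_real (?w k) * ?c k)"
      unfolding test_function_def e ..
    have E: "complex_of_real (exp (- (norm y)\<^sup>2 / 2)) * complex_of_real (exp (- (norm y)\<^sup>2 / 2)) = complex_of_real (exp (- 2 * (norm y)\<^sup>2 / 2))"
      by (simp only: of_real_mult[symmetric] exp_add[symmetric]) simp
    have A: "iexp (?P k \<bullet> (?\<tau> t *\<^sub>R y)) * cnj (iexp (?P l \<bullet> (?\<tau> t *\<^sub>R y))) = iexp ((?\<tau> t *\<^sub>R (?P k - ?P l)) \<bullet> y)" for k l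
      by (simp add: exp_cnj exp_add[symmetric] inner_diff_left algebra_simps)
    have c: "?c k * cnj (?c l) = ?g t k l y" for k l
    proof -
      have "?c k * cnj (?c l) = (iexp (?P k \<bullet> (?\<tau> t *\<^sub>R y)) * cnj (iexp (?P l \<bullet> (?\<tau> t *\<^sub>R y)))) *
          (complex_of_real (exp (- (norm y)\<^sup>2 / 2)) * complex_of_real (exp (- (norm y)\<^sup>2 / 2)))"
        by (simp only: complex_cnj_mult complex_cnj_complex_of_real mult_ac)
      then show ?thesis by (simp only: A E)
    qed
    have "complex_of_real ((norm (test_function \<rho> N (?\<tau> t) (?\<tau> t *\<^sub>R y)))\<^sup>2) = (\<Sum>k\<in>?F. of_real (?w k) * ?c k) * cnj (\<Sum>l\<in>?F. of_real (?w l) * ?c l)"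
      unfolding complex_norm_square u ..
    also have "\<dots> = (\<Sum>k\<in>?F. \<Sum>l\<in>?F. (of_real (?w k) * ?c k) * (of_real (?w l) * cnj (?c l)))"
      unfolding cnj_sum sum_product by (simp only: complex_cnj_mult complex_cnj_complex_of_real)
    also have "\<dots> = (\<Sum>k\<in>?F. \<Sum>l\<in>?F. of_real (?w k * ?w l) * (?c k * cnj (?c l)))"
      by (intro sum.cong refl) (simp only: of_real_mult mult_ac)
    finally show ?thesis unfolding c .
  qed
  have gi: "integrable lborel (?g t k l)" for t k l by (rule gaussian_fourier(1)) simp
  have ci: "integrable lborel (\<lambda>y :: real^'n. complex_of_real ((norm (test_function \<rho> N (?\<tau> t) (?\<tau> t *\<^sub>R y)))\<^sup>2))" for t
    unfolding pt by (intro Bochner_Integration.integrable_sum integrable_mult_right gi)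
  show "integrable lborel (\<lambda>y :: real^'n. (norm (test_function \<rho> N (real (Suc t)) (real (Suc t) *\<^sub>R y)))\<^sup>2)"
    using integrable_Re[OF ci] by simp
  have val: "(LINT y|lborel. (norm (test_function \<rho> N (?\<tau> t) (?\<tau> t *\<^sub>R (y :: real^'n))))\<^sup>2)
    = (\<Sum>k\<in>?F. \<Sum>l\<in>?F. ?w k * ?w l * (sqrt pi ^ CARD('n) * exp (- ((?\<tau> t)\<^sup>2 * (norm (?P k - ?P l))\<^sup>2) / 4)))" for t
  proof -
    have "complex_of_real (LINT y|lborel. (norm (test_function \<rho> N (?\<tau> t) (?\<tau> t *\<^sub>R (y :: real^'n))))\<^sup>2)
      = (LINT y|lborel. (\<Sum>k\<in>?F. \<Sum>l\<in>?F. of_real (?w k * ?w l) * ?g t k l y))"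
      unfolding pt[symmetric] by (rule integral_complex_of_real[symmetric])
    also have "\<dots> = (\<Sum>k\<in>?F. \<Sum>l\<in>?F. of_real (?w k * ?w l) * (LINT y|lborel. ?g t k l y))"
      using gi by (simp add: Bochner_Integration.integral_sum Bochner_Integration.integrable_sum integrable_mult_right del: of_real_mult)
    also have "\<dots> = (\<Sum>k\<in>?F. \<Sum>l\<in>?F. of_real (?w k * ?w l) * complex_of_real (sqrt (2 * pi / 2) ^ CARD('n) * exp (- (norm (?\<tau> t *\<^sub>R (?P k - ?P l)))\<^sup>2 / (2 * 2))))"
      by (subst gaussian_fourier(2)) simp_all
    finally show ?thesis
      by (simp only: of_real_mult[symmetric] of_real_sum[symmetric] of_real_eq_iff) (simp add: power_mult_distrib)
  qed
  have "(\<lambda>t. \<Sum>k\<in>?F. \<Sum>l\<in>?F. ?w k * ?w l * (sqrt pi ^ CARD('n) * exp (- ((?\<tau> t)\<^sup>2 * (norm (?P k - ?P l))\<^sup>2) / 4)))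
    \<longlonglongrightarrow> (\<Sum>k\<in>?F. \<Sum>l\<in>?F. ?w k * ?w l * (sqrt pi ^ CARD('n) * (if k = l then 1 else 0)))"
  proof (intro tendsto_sum tendsto_mult tendsto_const)
    fix k l assume kl: "k \<in> ?F" "l \<in> ?F"
    show "(\<lambda>t. exp (- ((?\<tau> t)\<^sup>2 * (norm (?P k - ?P l))\<^sup>2) / 4)) \<longlonglongrightarrow> (if k = l then 1 else 0)"
    proof (cases "k = l")
      case False
      have "?P k \<noteq> ?P l"
        using near_lattice_point_unique[OF \<rho> kl(1) _ kl(2), of "?P k"] near_lattice_point_self[of \<rho> k] near_lattice_point_self[of \<rho> l] False by metis
      define c where "c = (norm (?P k - ?P l))\<^sup>2 / 4"
      have c: "c > 0" using \<open>?P k \<noteq> ?P l\<close> by (simp add: c_def)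
      have "(\<lambda>t. exp (- ((?\<tau> t)\<^sup>2 * (norm (?P k - ?P l))\<^sup>2) / 4)) \<longlonglongrightarrow> 0"
      proof (rule tendsto_sandwich[OF _ _ tendsto_const])
        have "exp (- ((?\<tau> t)\<^sup>2 * (norm (?P k - ?P l))\<^sup>2) / 4) \<le> 1 / c * inverse (?\<tau> t)" for t
        proof -
          have "?\<tau> t * 1 \<le> ?\<tau> t * ?\<tau> t" by (intro mult_left_mono) auto
          then have "?\<tau> t * c \<le> (?\<tau> t)\<^sup>2 * c" using c by (intro mult_right_mono) (auto simp: power2_eq_square)
          also have "\<dots> \<le> exp ((?\<tau> t)\<^sup>2 * c)" using exp_ge_add_one_self[of "(?\<tau> t)\<^sup>2 * c"] by linarith
          finally have "inverse (exp ((?\<tau> t)\<^sup>2 * c)) \<le> inverse (?\<tau> t * c)" using c by (intro le_imp_inverse_le) auto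
          moreover have "- ((?\<tau> t)\<^sup>2 * (norm (?P k - ?P l))\<^sup>2) / 4 = - ((?\<tau> t)\<^sup>2 * c)" by (simp add: c_def)
          moreover have "inverse (?\<tau> t * c) = 1 / c * inverse (?\<tau> t)" by (simp add: divide_inverse)
          ultimately show ?thesis by (simp only: exp_minus)
        qed
        then show "\<forall>\<^sub>F t in sequentially. exp (- ((?\<tau> t)\<^sup>2 * (norm (?P k - ?P l))\<^sup>2) / 4) \<le> 1 / c * inverse (?\<tau> t)" by simp
        show "(\<lambda>t. 1 / c * inverse (?\<tau> t)) \<longlonglongrightarrow> 0"
          using tendsto_mult[OF tendsto_const LIMSEQ_inverse_real_of_nat, of "1 / c"] by simp
      qed simp
      then show ?thesis using False by simp
    qed simp
  qed
  moreover have "(\<Sum>k\<in>?F. \<Sum>l\<in>?F. ?w k * ?w l * (sqrt pi ^ CARD('n) * (if k = l then 1 else 0))) = (\<Sum>k\<in>?F. (?w k)\<^sup>2) * sqrt pi ^ CARD('n)"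
  proof -
    have "(\<Sum>l\<in>?F. ?w k * ?w l * (sqrt pi ^ CARD('n) * (if k = l then 1 else 0))) = (\<Sum>l\<in>?F. if k = l then (?w k)\<^sup>2 * sqrt pi ^ CARD('n) else 0)" for k
      by (intro sum.cong) (auto simp: power2_eq_square)
    then show ?thesis by (simp add: sum_distrib_right)
  qed
  ultimately show "(\<lambda>t. LINT y|lborel. (norm (test_function \<rho> N (?\<tau> t) (?\<tau> t *\<^sub>R (y :: real^'n))))\<^sup>2)
    \<longlonglongrightarrow> (\<Sum>k\<in>?F. (?w k)\<^sup>2) * sqrt pi ^ CARD('n)" unfolding val by simp
qed

text \<open>With S the sum of squared weights, the squared norm of the test function tends to a
  multiple of S and that of its image is at least a multiple of S^2 in the limit. Both sides are
  rescaled by the same power of \<tau>, so dividing by S bounds S by the operator norm.\<close>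

lemma lattice_weights_bounded:
  assumes C: "\<And>u. u \<in> schwartz \<Longrightarrow> in_L2 (FIO (critical_symbol \<rho>) (\<bullet>) u) \<and>
      L2_norm (FIO (critical_symbol \<rho>) (\<bullet>) u) \<le> C * L2_norm (u :: real^'n \<Rightarrow> complex)"
  shows "(\<Sum>k\<in>(lattice_index \<rho> N :: (nat \<times> ('n \<Rightarrow> nat)) set). (lattice_weight \<rho> k)\<^sup>2) * (bump 0 0 ^ CARD('n))\<^sup>2 \<le> C\<^sup>2"
proof -
  let ?\<tau> = "\<lambda>t. real (Suc t)"
  let ?T = "\<lambda>u :: real^'n \<Rightarrow> complex. FIO (critical_symbol \<rho>) (\<bullet>) u"
  define S where "S = (\<Sum>k\<in>(lattice_index \<rho> N :: (nat \<times> ('n \<Rightarrow> nat)) set). (lattice_weight \<rho> k)\<^sup>2)"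
  define b where "b = bump 0 0 ^ CARD('n)"
  define u where "u t = (test_function \<rho> N (?\<tau> t) :: real^'n \<Rightarrow> complex)" for t
  define I where "I t = (LINT y|lborel. (norm (u t (?\<tau> t *\<^sub>R y)))\<^sup>2)" for t
  have S0: "0 \<le> S" by (simp add: S_def sum_nonneg)
  have um [measurable]: "u t \<in> borel_measurable borel" for t by (simp add: u_def)
  have Tm [measurable]: "?T (u t) \<in> borel_measurable borel" for t unfolding u_def by (rule FIO_test_function_measurable) simp
  have um2: "(\<lambda>x. (norm (u t x))\<^sup>2) \<in> borel_measurable borel" and Tm2: "(\<lambda>x. ennreal ((norm (?T (u t) x))\<^sup>2)) \<in> borel_measurable borel" for t
    by measurable
  have I: "I \<longlonglongrightarrow> S * sqrt pi ^ CARD('n)" unfolding I_def u_def S_def by (rule test_function_L2(2))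
  have bound: "L2_mass lborel (\<lambda>y. ?T (u t) (?\<tau> t *\<^sub>R y)) \<le> ennreal (C\<^sup>2 * I t)" for t
  proof -
    have us: "u t \<in> schwartz" unfolding u_def by (rule test_function_schwartz) simp
    note Ct = C[OF us]
    have "L2_norm (?T (u t)) \<ge> 0" by (simp add: L2_norm_def)
    then have "(L2_norm (?T (u t)))\<^sup>2 \<le> (C * L2_norm (u t))\<^sup>2" using Ct by (intro power_mono) auto
    then have 1: "(LINT x|lebesgue. (norm (?T (u t) x))\<^sup>2) \<le> C\<^sup>2 * (LINT x|lebesgue. (norm (u t x))\<^sup>2)"
      by (simp add: L2_norm_def power_mult_distrib)
    have 2: "(LINT x|lebesgue. (norm (u t x))\<^sup>2) = ?\<tau> t ^ CARD('n) * I t"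
    proof -
      have "(LINT x|lebesgue. (norm (u t x))\<^sup>2) = (LINT x|lborel. (norm (u t x))\<^sup>2)" by (rule integral_completion) measurable
      also have "\<dots> = \<bar>?\<tau> t\<bar> ^ CARD('n) *\<^sub>R (LINT y|lborel. (norm (u t (0 + ?\<tau> t *\<^sub>R y)))\<^sup>2)"
        by (rule lborel_integral_affine[OF um2]) simp
      finally show ?thesis by (simp add: I_def)
    qed
    have "L2_mass lborel (\<lambda>y. ?T (u t) (?\<tau> t *\<^sub>R y)) = ennreal (1 / ?\<tau> t ^ CARD('n)) * L2_mass lborel (?T (u t))"
      by (rule lborel_nn_integral_scale[OF Tm2]) simp
    also have "L2_mass lborel (?T (u t)) = L2_mass lebesgue (?T (u t))"
      by (rule nn_integral_completion[symmetric])
    also have "\<dots> = ennreal (LINT x|lebesgue. (norm (?T (u t) x))\<^sup>2)"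
      using Ct by (intro nn_integral_eq_integral) (auto simp: in_L2_def)
    also have "\<dots> \<le> ennreal (C\<^sup>2 * (?\<tau> t ^ CARD('n) * I t))" using 1 unfolding 2 by (rule ennreal_leI)
    finally have "L2_mass lborel (\<lambda>y. ?T (u t) (?\<tau> t *\<^sub>R y)) \<le> ennreal (1 / ?\<tau> t ^ CARD('n)) * ennreal (C\<^sup>2 * (?\<tau> t ^ CARD('n) * I t))"
      by (simp add: mult_left_mono)
    also have "\<dots> = ennreal (1 / ?\<tau> t ^ CARD('n) * (C\<^sup>2 * (?\<tau> t ^ CARD('n) * I t)))"
      by (rule ennreal_mult[symmetric]) (auto simp: I_def)
    also have "1 / ?\<tau> t ^ CARD('n) * (C\<^sup>2 * (?\<tau> t ^ CARD('n) * I t)) = C\<^sup>2 * I t"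
    proof -
      have "?\<tau> t ^ CARD('n) \<noteq> 0" by simp
      then show ?thesis by (simp only: times_divide_eq_left mult_1_left) (simp del: of_nat_Suc)
    qed
    finally show ?thesis .
  qed
  have g: "(\<integral>\<^sup>+y. ennreal ((S * b)\<^sup>2 * exp (- 2 * (norm (y :: real^'n))\<^sup>2 / 2)) \<partial>lborel) = ennreal ((S * b)\<^sup>2 * sqrt pi ^ CARD('n))"
    using integrable_gaussian[of 2, where 'n='n] by (subst nn_integral_eq_integral) auto
  \<comment> \<open>Pointwise convergence of the rescaled images and Fatou's lemma give the required
    lower bound for their mass.\<close>
  have "ennreal ((S * b)\<^sup>2 * sqrt pi ^ CARD('n)) \<le> (\<integral>\<^sup>+y. liminf (\<lambda>t. ennreal ((norm (?T (u t) (?\<tau> t *\<^sub>R y)))\<^sup>2)) \<partial>lborel)"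
    unfolding g[symmetric]
  proof (intro nn_integral_mono)
    fix y :: "real^'n"
    have "(\<lambda>t. ennreal ((norm (?T (u t) (?\<tau> t *\<^sub>R y)))\<^sup>2)) \<longlonglongrightarrow> ennreal ((norm (complex_of_real (S * b * exp (- (norm y)\<^sup>2 / 2))))\<^sup>2)"
      unfolding u_def S_def b_def by (intro tendsto_ennrealI tendsto_power tendsto_norm FIO_test_function_tendsto)
    moreover have "(norm (complex_of_real (S * b * exp (- (norm y)\<^sup>2 / 2))))\<^sup>2 = (S * b)\<^sup>2 * exp (- 2 * (norm y)\<^sup>2 / 2)"
    proof -
      have "(exp (- (norm y)\<^sup>2 / 2))\<^sup>2 = exp (- 2 * (norm y)\<^sup>2 / 2)" by (simp add: power2_eq_square exp_add[symmetric])
      then show ?thesis by (simp only: norm_of_real power2_abs power_mult_distrib)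
    qed
    ultimately show "ennreal ((S * b)\<^sup>2 * exp (- 2 * (norm y)\<^sup>2 / 2)) \<le> liminf (\<lambda>t. ennreal ((norm (?T (u t) (?\<tau> t *\<^sub>R y)))\<^sup>2))"
      by (simp only: lim_imp_Liminf[OF sequentially_bot] order_refl)
  qed
  also have "\<dots> \<le> liminf (\<lambda>t. \<integral>\<^sup>+y. ennreal ((norm (?T (u t) (?\<tau> t *\<^sub>R y)))\<^sup>2) \<partial>lborel)"
    by (rule nn_integral_liminf) measurable
  also have "\<dots> \<le> liminf (\<lambda>t. ennreal (C\<^sup>2 * I t))" by (intro Liminf_mono always_eventually allI bound)
  also have "\<dots> = ennreal (C\<^sup>2 * (S * sqrt pi ^ CARD('n)))"
    by (rule lim_imp_Liminf[OF sequentially_bot]) (intro tendsto_ennrealI tendsto_mult tendsto_const I)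
  finally have "(S * b)\<^sup>2 * sqrt pi ^ CARD('n) \<le> C\<^sup>2 * (S * sqrt pi ^ CARD('n))" using S0 by (simp add: ennreal_le_iff)
  then have "(S * b)\<^sup>2 * sqrt pi ^ CARD('n) \<le> (C\<^sup>2 * S) * sqrt pi ^ CARD('n)" by (simp only: mult.assoc)
  then have "(S * b)\<^sup>2 \<le> C\<^sup>2 * S" by (rule mult_right_le_imp_le) simp
  then have le: "S * (S * b\<^sup>2) \<le> S * C\<^sup>2" by (simp add: power2_eq_square mult_ac)
  have "S * b\<^sup>2 \<le> C\<^sup>2"
  proof (cases "S = 0")
    case False
    then have "S > 0" using S0 by simp
    then show ?thesis using le by (simp only: mult_le_cancel_left_pos)
  qed simp
  then show ?thesis by (simp only: S_def b_def)
qed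

text \<open>The sum of squared weights grows at least linearly in the number of shells, whereas
  boundedness would cap it; the cap is finite because the bump is positive at its centre.\<close>

lemma lattice_FIO_unbounded:
  "\<not> L2_bounded (FIO (critical_symbol \<rho>) (\<lambda>x \<xi> :: real^'n. x \<bullet> \<xi>))"
proof
  assume "L2_bounded (FIO (critical_symbol \<rho>) (\<lambda>x \<xi> :: real^'n. x \<bullet> \<xi>))"
  then obtain C where C: "\<And>u. u \<in> schwartz \<Longrightarrow> in_L2 (FIO (critical_symbol \<rho>) (\<bullet>) u) \<and>
      L2_norm (FIO (critical_symbol \<rho>) (\<bullet>) u) \<le> C * L2_norm (u :: real^'n \<Rightarrow> complex)"
    unfolding L2_bounded_def by blast
  define b where "b = bump 0 0 ^ CARD('n)"
  have b: "b > 0" using bump_0_pos[of 0] by (simp add: b_def)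
  obtain N where N: "2 ^ CARD('n) * C\<^sup>2 / b\<^sup>2 < real N" using reals_Archimedean2 by blast
  have "real N / 2 ^ CARD('n) * b\<^sup>2 \<le> C\<^sup>2"
    by (rule order_trans[OF mult_right_mono[OF lattice_weights_sum[OF \<rho>]] lattice_weights_bounded[OF C, folded b_def]]) simp
  then show False using N b by (simp add: field_simps)
qed

end

theorem theorem2p2p1:
  shows "(\<forall>(\<rho>::real) (m::real) (a :: real^'n \<Rightarrow> real^'n \<Rightarrow> complex) (\<phi> :: real^'n \<Rightarrow> real^'n \<Rightarrow> real).
            0 \<le> \<rho> \<and> \<rho> \<le> 1 \<and> a \<in> Linf_symbol m \<rho> \<and>
            \<phi> \<in> phase_class 2 \<and> strongly_nondegenerate \<phi> \<and>
            m < real CARD('n) / 2 * (\<rho> - 1)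
            \<longrightarrow> L2_bounded (FIO a \<phi>)) \<and>
         (\<forall>\<rho>\<in>{0..1::real}. \<exists>(a :: real^'n \<Rightarrow> real^'n \<Rightarrow> complex) (\<phi> :: real^'n \<Rightarrow> real^'n \<Rightarrow> real).
            a \<in> Linf_symbol (real CARD('n) / 2 * (\<rho> - 1)) \<rho> \<and>
            \<phi> \<in> phase_class 2 \<and> strongly_nondegenerate \<phi> \<and>
            \<not> L2_bounded (FIO a \<phi>))"
proof (intro conjI allI impI ballI)
  fix \<rho> m :: real and a :: "real^'n \<Rightarrow> real^'n \<Rightarrow> complex" and \<phi> :: "real^'n \<Rightarrow> real^'n \<Rightarrow> real"
  assume "0 \<le> \<rho> \<and> \<rho> \<le> 1 \<and> a \<in> Linf_symbol m \<rho> \<and> \<phi> \<in> phase_class 2 \<and> strongly_nondegenerate \<phi> \<and>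
    m < real CARD('n) / 2 * (\<rho> - 1)"
  then show "L2_bounded (FIO a \<phi>)" by (elim conjE) (rule L2_bounded_FIO)
next
  fix \<rho> :: real assume "\<rho> \<in> {0..1}"
  then have \<rho>: "0 \<le> \<rho>" "\<rho> \<le> 1" by auto
  show "\<exists>(a :: real^'n \<Rightarrow> real^'n \<Rightarrow> complex) (\<phi> :: real^'n \<Rightarrow> real^'n \<Rightarrow> real).
            a \<in> Linf_symbol (real CARD('n) / 2 * (\<rho> - 1)) \<rho> \<and>
            \<phi> \<in> phase_class 2 \<and> strongly_nondegenerate \<phi> \<and> \<not> L2_bounded (FIO a \<phi>)"
    by (intro exI conjI) (rule lattice_symbol_mem[OF \<rho>] inner_mem_phase_class inner_strongly_nondegenerate lattice_FIO_unbounded[OF \<rho>])+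
qed

end
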